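(* Let $\sigma\colon S\curvearrowright A$ and $\tau\colon T\curvearrowright B$ be algebraic actions satisfying the standing assumptions, with globalizations $\tilde\sigma\colon\mathscr S\curvearrowright\mathscr A$ and $\tilde\tau\colon\mathscr T\curvearrowright\mathscr B$, and suppose that $\mathscr A$ and $\mathscr B$ are torsion-free. (i) If condition (I$_s$) holds and the groupoids $(\mathscr A\rtimes\mathscr S)\ltimes\overline A$ and $(\mathscr B\rtimes\mathscr T)\ltimes\overline B$ are isomorphic as topological groupoids, then $\dot\sigma\colon\mathscr S\curvearrowright\mathbb Q\otimes\mathscr A$ embeds into $\dot\tau\colon\mathscr T\curvearrowright\mathbb Q\otimes\mathscr B$ and $\dot\tau$ embeds into $\dot\sigma$. (ii) If condition ($*_s$) holds and $(S^{-1}A\rtimes S^{-1}S)\ltimes\overline A\cong(T^{-1}B\rtimes T^{-1}T)\ltimes\overline B$ as topological groupoids, then $\tilde\sigma\colon S^{-1}S\curvearrowright S^{-1}A$ embeds into $\tilde\tau\colon T^{-1}T\curvearrowright T^{-1}B$ and vice versa. If in addition $\mathscr A$ and $\mathscr B$ have finite rank, then in (i) both embeddings can be chosen full, and in (ii) both embeddings can be chosen of finite index. If in addition $\mathscr A$ and $\mathscr B$ have finite rank and both $\tilde\sigma$ and $\tilde\tau$ satisfy (SF), then in (i) there is a full and strict embedding of $\dot\sigma\colon\mathscr S\curvearrowright\mathbb Q\otimes\mathscr A$ into $\dot\tau\colon\mathscr T\curvearrowright\mathbb Q\otimes\mathscr B$ (i.e. the actions are isomorphic over $\mathbb Q$),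 and in (ii) there are strict finite index embeddings of $\tilde\sigma\colon S^{-1}S\curvearrowright S^{-1}A$ into $\tilde\tau\colon T^{-1}T\curvearrowright T^{-1}B$ and of $\tilde\tau$ into $\tilde\sigma$.
   Context: An algebraic action $\sigma\colon S\curvearrowright A$ consists of a left cancellative monoid $S$, an abelian group $A$ and a monoid homomorphism $s\mapsto\sigma_s$ from $S$ to the injective group endomorphisms of $A$. For $X\subseteq A$ put $\sigma_s^{-1}X=\{a\in A:\sigma_s(a)\in X\}$. The family $\mathcal C$ of constructible subgroups is the smallest family of subgroups of $A$ containing $A$ and closed under $C\mapsto\sigma_s(C)$ and $C\mapsto\sigma_s^{-1}(C)$ ($s\in S$). Standing assumptions: $\sigma$ is faithful ($s\mapsto\sigma_s$ injective), non-automorphic unless $S$ is a group (some $\sigma_s$ not surjective), satisfies (FI): $A/\sigma_s(A)$ is finite for all $s\in S$ (then each $C\in\mathcal C$ has finite index and $\overline A:=\varprojlim_{C\in\mathcal C}A/C$ is a compact group); and $\sigma$ has a globalization: a group $\mathscr S\supseteq S$ generated by $S$, an abelian group $\mathscr A\supseteq A$ generated by $\bigcup_{g\in\mathscr S}\tilde\sigma_g(A)$, and an action $\tilde\sigma$ of $\mathscr S$ on $\mathscr A$ by automorphisms with $\tilde\sigma_s|_A=\sigma_s$ ($s\in S$), satisfying (JF): if $C\in\mathcal C$, $g\in\mathscr S$ and $\tilde\sigma_g$ fixes $C$ pointwise, then $g=1$. The group $\mathscr A\rtimes\mathscr S$ acts on $\mathscr A$ by $(z,\gamma).x=z+\tilde\sigma_\gamma(x)$;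 restricting to $A$ gives a partial action on $A$ ($g$ acts by $A\cap g^{-1}.A\to g.A\cap A$), which under the standing assumptions extends uniquely to a partial action of $\mathscr A\rtimes\mathscr S$ on $\overline A$ by homeomorphisms between open sets; $(\mathscr A\rtimes\mathscr S)\ltimes\overline A$ denotes the associated partial transformation groupoid $\{(g,x):x\in\text{domain of }g\}$ (with $\mathscr A\rtimes\mathscr S$ discrete). The same notation ($T,B,\mathcal C_\tau,\overline B,\mathscr T,\mathscr B,\tilde\tau$) is used for $\tau$. Let $\dot\sigma_g={\rm id}_{\mathbb Q}\otimes\tilde\sigma_g$ on $\mathbb Q\otimes\mathscr A$, similarly $\dot\tau$. A group has finite rank if $\mathbb Q\otimes$ it is finite-dimensional. Embeddings: for actions $\rho\colon G\curvearrowright X$, $\rho'\colon H\curvearrowright Y$ of groups by automorphisms of abelian groups, an embedding of $\rho$ into $\rho'$ is a pair of injective homomorphisms $\mathfrak t\colon G\to H$, $\mathfrak b\colon X\to Y$ with $\mathfrak b(\rho_g(x))=\rho'_{\mathfrak t(g)}(\mathfrak b(x))$; it is of finite index if $\mathfrak b(X)$ has finite index in $Y$, full if $\mathfrak b$ is surjective, strict if $\mathfrak t$ is bijective. (SF) for $\tilde\sigma$ (with $\mathscr A$ torsion-free of finite rank): for $s,t\in\mathscr S$ and $\rho\in{\rm Aut}(\mathbb Q\otimes\mathscr A)$, $\dot\sigma_s=\rho\dot\sigma_t\rho^{-1}$ implies $s=t$. Condition (F) for $\tilde\tau$: ${\rm id}-\tilde\tau_t$ is injective on $\mathscr B$ for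 every $1\neq t\in\mathscr T$. Conditions for $\sigma$ relative to $\tau$, for a finite rank subgroup $\mathcal A'\subseteq A$: (i$_1$) there is $s\in S$ with $\sigma_s(\mathcal A')\subseteq\mathcal A'$, ${\rm id}-\sigma_s$ injective on $\mathcal A'$, and every subgroup of $\mathscr T$ generated by two elements is free or abelian; (i$_2$) there is $s\in S$ with $\sigma_s=\kappa\,{\rm id}_A$ for some $\kappa\in\mathbb Z\setminus\{0,1\}$, and every $\alpha\in\mathscr T$ conjugate in $\mathscr T$ to $\alpha^\kappa$ has finite order; (ii$_1$) for every integer $l>1$ that is the order of some torsion element of $\mathscr T$ there are $1\neq s_l\in S$ and coprime positive integers $\mu,\nu$ with $\sigma_{s_l}(\mathcal A')\subseteq\mathcal A'$, $\mu\det(z-{\rm id}_{\mathbb Q}\otimes\sigma_{s_l}|_{\mathcal A'})=\mu z^\delta-\nu$ for some $\delta$, and $\gcd(l,\mu)>1$ or $\gcd(l,\nu)>1$; (ii$_2$) condition (F) holds for $\tilde\tau$. (I): $A=\bigcup_n\mathcal A_n$ for an increasing sequence of finite rank subgroups, and either (i$_1$) holds for every $\mathcal A_n$ or (i$_2$) holds. (II): (ii$_1$) holds for every $\mathcal A_n$, or (ii$_2$) holds and $A$ is torsion-free. (III): there is $s\in S$ with $\sigma_s=\kappa\,{\rm id}_A$, $\kappa\in\mathbb Z\setminus\{0,1\}$, $\mathscr B$ has finite rank, and (F) holds for $\tilde\tau$. ($*$): $A=\bigcup_n\mathcal A_n$ for increasing finite rank subgroups, and ((I) and (II)) or (III) holds;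 moreover there is an increasing sequence of finitely generated subgroups $\mathfrak A_k$ with $A=\bigcup_k\mathfrak A_k$ and $\sigma_s(\mathfrak A_k)\subseteq\mathfrak A_k$ for all $s,k$; $S$ and $T$ are right reversible ($Ss\cap St\neq\emptyset$ for all $s,t$, and likewise for $T$); $\mathscr S=S^{-1}S$, $\mathscr A=S^{-1}A=\bigcup_{s\in S}\tilde\sigma_s^{-1}(A)$, $\mathscr T=T^{-1}T$, $\mathscr B=T^{-1}B$; and $\sigma$ satisfies (PC): for every $C\in\mathcal C$ there is $s\in S$ with $\sigma_s(A)\subseteq C$. The symmetrized conditions (I$_s$), ($*_s$) mean that the condition holds for $\sigma$ relative to $\tau$ and also with the roles of $\sigma$ and $\tau$ exchanged. *)

theory Defs
  imports "HOL-Algebra.Coset" "HOL-Algebra.Generated_Groups"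
    "HOL-Analysis.Product_Topology" "Jordan_Normal_Form.Char_Poly"
begin

text \<open>An algebraic action S acting on A together with its globalization
 (G = script S, M = script A, sig = tilde sigma) is given by the data
 (M, G, S, A, sig); the action sigma of S on A is the restriction of sig.\<close>

inductive_set constr :: "'g set \<Rightarrow> 'a set \<Rightarrow> ('g \<Rightarrow> 'a \<Rightarrow> 'a) \<Rightarrow> 'a set set"
  for S A sig where
  constr_top: "A \<in> constr S A sig"
| constr_img: "C \<in> constr S A sig \<Longrightarrow> s \<in> S \<Longrightarrow> sig s ` C \<in> constr S A sig"
| constr_pre: "C \<in> constr S A sig \<Longrightarrow> s \<in> S \<Longrightarrow> {a \<in> A. sig s a \<in> C} \<in> constr S A sig"

definition standing :: "'a monoid \<Rightarrow> 'g monoid \<Rightarrow> 'g set \<Rightarrow> 'a set \<Rightarrow> ('g \<Rightarrow> 'a \<Rightarrow> 'a) \<Rightarrow> bool" where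
  "standing M G S A sig \<longleftrightarrow>
     group G \<and> comm_group M \<and>
     \<comment> \<open>S is a submonoid of the group G\<close>
     S \<subseteq> carrier G \<and> \<one>\<^bsub>G\<^esub> \<in> S \<and> (\<forall>s\<in>S. \<forall>t\<in>S. s \<otimes>\<^bsub>G\<^esub> t \<in> S) \<and>
     \<comment> \<open>A is a subgroup of the abelian group M\<close>
     subgroup A M \<and>
     \<comment> \<open>sig is an action of G on M by automorphisms\<close>
     (\<forall>g\<in>carrier G. sig g \<in> iso M M) \<and>
     (\<forall>x\<in>carrier M. sig \<one>\<^bsub>G\<^esub> x = x) \<and>
     (\<forall>g\<in>carrier G. \<forall>h\<in>carrier G. \<forall>x\<in>carrier M. sig (g \<otimes>\<^bsub>G\<^esub> h) x = sig g (sig h x)) \<and>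
     \<comment> \<open>restriction to S gives (injective) endomorphisms of A\<close>
     (\<forall>s\<in>S. sig s ` A \<subseteq> A) \<and>
     \<comment> \<open>globalization: generation conditions\<close>
     generate G S = carrier G \<and>
     generate M (\<Union>g\<in>carrier G. sig g ` A) = carrier M \<and>
     \<comment> \<open>faithful\<close>
     inj_on (\<lambda>s. restrict (sig s) A) S \<and>
     \<comment> \<open>non-automorphic unless S is a group\<close>
     ((\<forall>s\<in>S. inv\<^bsub>G\<^esub> s \<in> S) \<or> (\<exists>s\<in>S. sig s ` A \<noteq> A)) \<and>
     \<comment> \<open>(FI)\<close>
     (\<forall>s\<in>S. finite (rcosets\<^bsub>M\<lparr>carrier := A\<rparr>\<^esub> (sig s ` A))) \<and>
     \<comment> \<open>(JF)\<close>
     (\<forall>C\<in>constr S A sig. \<forall>g\<in>carrier G. (\<forall>c\<in>C. sig g c = c) \<longrightarrow> g = \<one>\<^bsub>G\<^esub>)"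

text \<open>Abar = inverse limit of A/C over constructible C: compatible families of cosets.\<close>

definition Abar :: "'a monoid \<Rightarrow> 'g set \<Rightarrow> 'a set \<Rightarrow> ('g \<Rightarrow> 'a \<Rightarrow> 'a) \<Rightarrow> ('a set \<Rightarrow> 'a set) set" where
  "Abar M S A sig = {x. (\<forall>C\<in>constr S A sig. \<exists>a\<in>A. x C = a <#\<^bsub>M\<^esub> C) \<and>
      (\<forall>C\<in>constr S A sig. \<forall>D\<in>constr S A sig. D \<subseteq> C \<longrightarrow> x D \<subseteq> x C) \<and>
      (\<forall>C. C \<notin> constr S A sig \<longrightarrow> x C = {})}"

text \<open>Inverse limit topology (each A/C discrete).\<close>
definition Abar_top :: "'a monoid \<Rightarrow> 'g set \<Rightarrow> 'a set \<Rightarrow> ('g \<Rightarrow> 'a \<Rightarrow> 'a) \<Rightarrow> ('a set \<Rightarrow> 'a set) topology" where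
  "Abar_top M S A sig = topology_generated_by
     {{x \<in> Abar M S A sig. x C = c} | C c. C \<in> constr S A sig}"

definition iota :: "'a monoid \<Rightarrow> 'g set \<Rightarrow> 'a set \<Rightarrow> ('g \<Rightarrow> 'a \<Rightarrow> 'a) \<Rightarrow> 'a \<Rightarrow> ('a set \<Rightarrow> 'a set)" where
  "iota M S A sig a = (\<lambda>C. if C \<in> constr S A sig then a <#\<^bsub>M\<^esub> C else {})"

definition sd_carrier :: "'a monoid \<Rightarrow> 'g monoid \<Rightarrow> ('a \<times> 'g) set" where
  "sd_carrier M G = carrier M \<times> carrier G"

definition sd_mult :: "'a monoid \<Rightarrow> 'g monoid \<Rightarrow> ('g \<Rightarrow> 'a \<Rightarrow> 'a) \<Rightarrow> 'a \<times> 'g \<Rightarrow> 'a \<times> 'g \<Rightarrow> 'a \<times> 'g" where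
  "sd_mult M G sig p q = (fst p \<otimes>\<^bsub>M\<^esub> sig (snd p) (fst q), snd p \<otimes>\<^bsub>G\<^esub> snd q)"

definition pact :: "'a monoid \<Rightarrow> ('g \<Rightarrow> 'a \<Rightarrow> 'a) \<Rightarrow> 'a \<times> 'g \<Rightarrow> 'a \<Rightarrow> 'a" where
  "pact M sig p x = fst p \<otimes>\<^bsub>M\<^esub> sig (snd p) x"

definition pdom :: "'a monoid \<Rightarrow> 'a set \<Rightarrow> ('g \<Rightarrow> 'a \<Rightarrow> 'a) \<Rightarrow> 'a \<times> 'g \<Rightarrow> 'a set" where
  "pdom M A sig p = {x \<in> A. pact M sig p x \<in> A}"

text \<open>Extended partial action on Abar: domain is the closure of the image of the
 domain in A, the map is the (unique) continuous extension.\<close>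
definition Udom :: "'a monoid \<Rightarrow> 'g set \<Rightarrow> 'a set \<Rightarrow> ('g \<Rightarrow> 'a \<Rightarrow> 'a) \<Rightarrow> 'a \<times> 'g \<Rightarrow> ('a set \<Rightarrow> 'a set) set" where
  "Udom M S A sig p = (Abar_top M S A sig) closure_of (iota M S A sig ` pdom M A sig p)"

definition theta :: "'a monoid \<Rightarrow> 'g set \<Rightarrow> 'a set \<Rightarrow> ('g \<Rightarrow> 'a \<Rightarrow> 'a) \<Rightarrow> 'a \<times> 'g
     \<Rightarrow> ('a set \<Rightarrow> 'a set) \<Rightarrow> ('a set \<Rightarrow> 'a set)" where
  "theta M S A sig p = (THE f.
      continuous_map (subtopology (Abar_top M S A sig) (Udom M S A sig p)) (Abar_top M S A sig) f \<and>
      (\<forall>a\<in>pdom M A sig p. f (iota M S A sig a) = iota M S A sig (pact M sig p a)) \<and>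
      (\<forall>x. x \<notin> Udom M S A sig p \<longrightarrow> f x = undefined))"

definition gpd_arr :: "'a monoid \<Rightarrow> 'g monoid \<Rightarrow> 'g set \<Rightarrow> 'a set \<Rightarrow> ('g \<Rightarrow> 'a \<Rightarrow> 'a)
     \<Rightarrow> (('a \<times> 'g) \<times> ('a set \<Rightarrow> 'a set)) set" where
  "gpd_arr M G S A sig = {(p, x). p \<in> sd_carrier M G \<and> x \<in> Udom M S A sig p}"

definition gpd_top :: "'a monoid \<Rightarrow> 'g monoid \<Rightarrow> 'g set \<Rightarrow> 'a set \<Rightarrow> ('g \<Rightarrow> 'a \<Rightarrow> 'a)
     \<Rightarrow> (('a \<times> 'g) \<times> ('a set \<Rightarrow> 'a set)) topology" where
  "gpd_top M G S A sig = subtopology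
     (prod_topology (discrete_topology (sd_carrier M G)) (Abar_top M S A sig)) (gpd_arr M G S A sig)"

definition gpd_src :: "('a \<times> 'g) \<times> ('a set \<Rightarrow> 'a set) \<Rightarrow> ('a set \<Rightarrow> 'a set)" where
  "gpd_src e = snd e"

definition gpd_rng :: "'a monoid \<Rightarrow> 'g set \<Rightarrow> 'a set \<Rightarrow> ('g \<Rightarrow> 'a \<Rightarrow> 'a)
     \<Rightarrow> ('a \<times> 'g) \<times> ('a set \<Rightarrow> 'a set) \<Rightarrow> ('a set \<Rightarrow> 'a set)" where
  "gpd_rng M S A sig e = theta M S A sig (fst e) (snd e)"

text \<open>Product (p, theta q y)(q, y) = (pq, y), defined when composable.\<close>
definition gpd_mul :: "'a monoid \<Rightarrow> 'g monoid \<Rightarrow> ('g \<Rightarrow> 'a \<Rightarrow> 'a)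
     \<Rightarrow> ('a \<times> 'g) \<times> ('a set \<Rightarrow> 'a set) \<Rightarrow> ('a \<times> 'g) \<times> ('a set \<Rightarrow> 'a set) \<Rightarrow> ('a \<times> 'g) \<times> ('a set \<Rightarrow> 'a set)" where
  "gpd_mul M G sig e f = (sd_mult M G sig (fst e) (fst f), snd f)"

definition gpd_isomorphic ::
  "'a monoid \<Rightarrow> 'g monoid \<Rightarrow> 'g set \<Rightarrow> 'a set \<Rightarrow> ('g \<Rightarrow> 'a \<Rightarrow> 'a) \<Rightarrow>
   'b monoid \<Rightarrow> 'h monoid \<Rightarrow> 'h set \<Rightarrow> 'b set \<Rightarrow> ('h \<Rightarrow> 'b \<Rightarrow> 'b) \<Rightarrow> bool" where
  "gpd_isomorphic M G S A sig N H T B tau \<longleftrightarrow>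
    (\<exists>\<Phi>. homeomorphic_map (gpd_top M G S A sig) (gpd_top N H T B tau) \<Phi> \<and>
      (\<forall>e\<in>gpd_arr M G S A sig. \<forall>f\<in>gpd_arr M G S A sig.
         (gpd_src e = gpd_rng M S A sig f \<longleftrightarrow> gpd_src (\<Phi> e) = gpd_rng N T B tau (\<Phi> f)) \<and>
         (gpd_src e = gpd_rng M S A sig f \<longrightarrow>
            \<Phi> (gpd_mul M G sig e f) = gpd_mul N H tau (\<Phi> e) (\<Phi> f))))"

text \<open>Q \<otimes> X realized as the localization of X at the positive integers:
 classes of pairs (a, n) (standing for (1/n) \<otimes> a) with (a,n) ~ (b,m) iff
 k m a = k n b for some k > 0 (written multiplicatively).\<close>

definition qrel :: "'a monoid \<Rightarrow> 'a set \<Rightarrow> (('a \<times> nat) \<times> ('a \<times> nat)) set" where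
  "qrel M X = {((a, n), (b, m)). a \<in> X \<and> b \<in> X \<and> 0 < n \<and> 0 < m \<and>
      (\<exists>k::nat. 0 < k \<and> a [^]\<^bsub>M\<^esub> (m * k) = b [^]\<^bsub>M\<^esub> (n * k))}"

definition QT :: "'a monoid \<Rightarrow> 'a set \<Rightarrow> ('a \<times> nat) set set" where
  "QT M X = (X \<times> {n. 0 < n}) // qrel M X"

definition qrep :: "('a \<times> nat) set \<Rightarrow> 'a \<times> nat" where
  "qrep v = (SOME p. p \<in> v)"

definition qadd :: "'a monoid \<Rightarrow> 'a set \<Rightarrow> ('a \<times> nat) set \<Rightarrow> ('a \<times> nat) set \<Rightarrow> ('a \<times> nat) set" where
  "qadd M X v w = qrel M X `` {(fst (qrep v) [^]\<^bsub>M\<^esub> snd (qrep w) \<otimes>\<^bsub>M\<^esub> fst (qrep w) [^]\<^bsub>M\<^esub> snd (qrep v),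
                               snd (qrep v) * snd (qrep w))}"

definition qzero :: "'a monoid \<Rightarrow> 'a set \<Rightarrow> ('a \<times> nat) set" where
  "qzero M X = qrel M X `` {(\<one>\<^bsub>M\<^esub>, 1)}"

definition QTg :: "'a monoid \<Rightarrow> 'a set \<Rightarrow> ('a \<times> nat) set monoid" where
  "QTg M X = \<lparr>carrier = QT M X, monoid.mult = qadd M X, monoid.one = qzero M X\<rparr>"

definition qsmult :: "'a monoid \<Rightarrow> 'a set \<Rightarrow> rat \<Rightarrow> ('a \<times> nat) set \<Rightarrow> ('a \<times> nat) set" where
  "qsmult M X r v = qrel M X `` {(fst (qrep v) [^]\<^bsub>M\<^esub> fst (quotient_of r),
                                   snd (qrep v) * nat (snd (quotient_of r)))}"

definition qlift :: "'a monoid \<Rightarrow> 'a set \<Rightarrow> ('a \<Rightarrow> 'a) \<Rightarrow> ('a \<times> nat) set \<Rightarrow> ('a \<times> nat) set" where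
  "qlift M X f v = qrel M X `` {(f (fst (qrep v)), snd (qrep v))}"

definition qt_act :: "'a monoid \<Rightarrow> ('g \<Rightarrow> 'a \<Rightarrow> 'a) \<Rightarrow> 'g \<Rightarrow> ('a \<times> nat) set \<Rightarrow> ('a \<times> nat) set" where
  "qt_act M sig g = qlift M (carrier M) (sig g)"

definition qlincomb :: "'a monoid \<Rightarrow> 'a set \<Rightarrow> rat list \<Rightarrow> ('a \<times> nat) set list \<Rightarrow> ('a \<times> nat) set" where
  "qlincomb M X cs vs = foldr (\<lambda>(c, v) acc. qadd M X (qsmult M X c v) acc) (zip cs vs) (qzero M X)"

definition qspans :: "'a monoid \<Rightarrow> 'a set \<Rightarrow> ('a \<times> nat) set list \<Rightarrow> bool" where
  "qspans M X vs \<longleftrightarrow> set vs \<subseteq> QT M X \<and>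
     (\<forall>v\<in>QT M X. \<exists>cs. length cs = length vs \<and> v = qlincomb M X cs vs)"

definition qindep :: "'a monoid \<Rightarrow> 'a set \<Rightarrow> ('a \<times> nat) set list \<Rightarrow> bool" where
  "qindep M X vs \<longleftrightarrow> set vs \<subseteq> QT M X \<and>
     (\<forall>cs. length cs = length vs \<and> qlincomb M X cs vs = qzero M X \<longrightarrow> (\<forall>c\<in>set cs. c = 0))"

definition finite_rank :: "'a monoid \<Rightarrow> 'a set \<Rightarrow> bool" where
  "finite_rank M X \<longleftrightarrow> (\<exists>vs. qspans M X vs)"

definition qcharpoly :: "'a monoid \<Rightarrow> 'a set \<Rightarrow> (('a \<times> nat) set \<Rightarrow> ('a \<times> nat) set) \<Rightarrow> rat poly \<Rightarrow> bool" where
  "qcharpoly M X phi p \<longleftrightarrow> (\<exists>vs Mt. qspans M X vs \<and> qindep M X vs \<and>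
      Mt \<in> carrier_mat (length vs) (length vs) \<and>
      (\<forall>j<length vs. phi (vs ! j) = qlincomb M X (list_of_vec (col Mt j)) vs) \<and>
      char_poly Mt = p)"

definition torsion_free :: "'a monoid \<Rightarrow> 'a set \<Rightarrow> bool" where
  "torsion_free M X \<longleftrightarrow> (\<forall>a\<in>X. \<forall>n::nat. 0 < n \<and> a [^]\<^bsub>M\<^esub> n = \<one>\<^bsub>M\<^esub> \<longrightarrow> a = \<one>\<^bsub>M\<^esub>)"

definition act_emb :: "'g monoid \<Rightarrow> 'x monoid \<Rightarrow> ('g \<Rightarrow> 'x \<Rightarrow> 'x) \<Rightarrow>
    'h monoid \<Rightarrow> 'y monoid \<Rightarrow> ('h \<Rightarrow> 'y \<Rightarrow> 'y) \<Rightarrow> ('g \<Rightarrow> 'h) \<Rightarrow> ('x \<Rightarrow> 'y) \<Rightarrow> bool" where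
  "act_emb G X rho H Y rho' t b \<longleftrightarrow>
     t \<in> hom G H \<and> inj_on t (carrier G) \<and> b \<in> hom X Y \<and> inj_on b (carrier X) \<and>
     (\<forall>g\<in>carrier G. \<forall>x\<in>carrier X. b (rho g x) = rho' (t g) (b x))"

definition emb_finite_index :: "'x monoid \<Rightarrow> 'y monoid \<Rightarrow> ('x \<Rightarrow> 'y) \<Rightarrow> bool" where
  "emb_finite_index X Y b \<longleftrightarrow> finite (rcosets\<^bsub>Y\<^esub> (b ` carrier X))"

definition emb_full :: "'x monoid \<Rightarrow> 'y monoid \<Rightarrow> ('x \<Rightarrow> 'y) \<Rightarrow> bool" where
  "emb_full X Y b \<longleftrightarrow> b ` carrier X = carrier Y"

definition emb_strict :: "'g monoid \<Rightarrow> 'h monoid \<Rightarrow> ('g \<Rightarrow> 'h) \<Rightarrow> bool" where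
  "emb_strict G H t \<longleftrightarrow> t ` carrier G = carrier H"

definition word_eval :: "'h monoid \<Rightarrow> (bool \<times> 'h) list \<Rightarrow> 'h" where
  "word_eval H w = foldr (\<lambda>(e, x) acc. (if e then x else inv\<^bsub>H\<^esub> x) \<otimes>\<^bsub>H\<^esub> acc) w \<one>\<^bsub>H\<^esub>"

definition reduced_word :: "'h set \<Rightarrow> (bool \<times> 'h) list \<Rightarrow> bool" where
  "reduced_word X w \<longleftrightarrow> (\<forall>l\<in>set w. snd l \<in> X) \<and>
     (\<forall>i. Suc i < length w \<longrightarrow> \<not> (snd (w ! i) = snd (w ! Suc i) \<and> fst (w ! i) \<noteq> fst (w ! Suc i)))"

definition free_subgroup :: "'h monoid \<Rightarrow> 'h set \<Rightarrow> bool" where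
  "free_subgroup H K \<longleftrightarrow> (\<exists>X \<subseteq> K. generate H X = K \<and>
     (\<forall>w. w \<noteq> [] \<and> reduced_word X w \<longrightarrow> word_eval H w \<noteq> \<one>\<^bsub>H\<^esub>))"

definition two_gen_free_or_abelian :: "'h monoid \<Rightarrow> bool" where
  "two_gen_free_or_abelian H \<longleftrightarrow> (\<forall>a\<in>carrier H. \<forall>b\<in>carrier H.
     free_subgroup H (generate H {a, b}) \<or>
     (\<forall>x\<in>generate H {a, b}. \<forall>y\<in>generate H {a, b}. x \<otimes>\<^bsub>H\<^esub> y = y \<otimes>\<^bsub>H\<^esub> x))"

definition scalar_elt :: "'a monoid \<Rightarrow> 'g set \<Rightarrow> 'a set \<Rightarrow> ('g \<Rightarrow> 'a \<Rightarrow> 'a) \<Rightarrow> 'g \<Rightarrow> int \<Rightarrow> bool" where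
  "scalar_elt M S A sig s \<kappa> \<longleftrightarrow> s \<in> S \<and> \<kappa> \<noteq> 0 \<and> \<kappa> \<noteq> 1 \<and> (\<forall>a\<in>A. sig s a = a [^]\<^bsub>M\<^esub> \<kappa>)"

definition cond_i1 :: "'a monoid \<Rightarrow> 'g set \<Rightarrow> ('g \<Rightarrow> 'a \<Rightarrow> 'a) \<Rightarrow> 'h monoid \<Rightarrow> 'a set \<Rightarrow> bool" where
  "cond_i1 M S sig H X \<longleftrightarrow>
     (\<exists>s\<in>S. sig s ` X \<subseteq> X \<and> inj_on (\<lambda>a. a \<otimes>\<^bsub>M\<^esub> inv\<^bsub>M\<^esub> (sig s a)) X) \<and>
     two_gen_free_or_abelian H"

definition cond_i2 :: "'a monoid \<Rightarrow> 'g set \<Rightarrow> 'a set \<Rightarrow> ('g \<Rightarrow> 'a \<Rightarrow> 'a) \<Rightarrow> 'h monoid \<Rightarrow> bool" where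
  "cond_i2 M S A sig H \<longleftrightarrow> (\<exists>s \<kappa>. scalar_elt M S A sig s \<kappa> \<and>
     (\<forall>\<alpha>\<in>carrier H. (\<exists>\<beta>\<in>carrier H. \<beta> \<otimes>\<^bsub>H\<^esub> \<alpha> \<otimes>\<^bsub>H\<^esub> inv\<^bsub>H\<^esub> \<beta> = \<alpha> [^]\<^bsub>H\<^esub> \<kappa>) \<longrightarrow>
        (\<exists>n::nat. 0 < n \<and> \<alpha> [^]\<^bsub>H\<^esub> n = \<one>\<^bsub>H\<^esub>)))"

definition is_torsion_order :: "'h monoid \<Rightarrow> nat \<Rightarrow> bool" where
  "is_torsion_order H l \<longleftrightarrow> 0 < l \<and> (\<exists>\<alpha>\<in>carrier H. \<alpha> [^]\<^bsub>H\<^esub> l = \<one>\<^bsub>H\<^esub> \<and>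
      (\<forall>k. 0 < k \<and> k < l \<longrightarrow> \<alpha> [^]\<^bsub>H\<^esub> k \<noteq> \<one>\<^bsub>H\<^esub>))"

definition cond_ii1 :: "'a monoid \<Rightarrow> 'g monoid \<Rightarrow> 'g set \<Rightarrow> ('g \<Rightarrow> 'a \<Rightarrow> 'a) \<Rightarrow> 'h monoid \<Rightarrow> 'a set \<Rightarrow> bool" where
  "cond_ii1 M G S sig H X \<longleftrightarrow> (\<forall>l::nat. 1 < l \<and> is_torsion_order H l \<longrightarrow>
     (\<exists>s\<in>S. s \<noteq> \<one>\<^bsub>G\<^esub> \<and> (\<exists>\<mu> \<nu> :: nat. 0 < \<mu> \<and> 0 < \<nu> \<and> coprime \<mu> \<nu> \<and>
        sig s ` X \<subseteq> X \<and>
        (\<exists>\<delta> p. qcharpoly M X (qlift M X (sig s)) p \<and>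
             Polynomial.smult (of_nat \<mu>) p = monom (of_nat \<mu>) \<delta> - [:of_nat \<nu>:]) \<and>
        (1 < gcd l \<mu> \<or> 1 < gcd l \<nu>))))"

definition cond_F :: "'b monoid \<Rightarrow> 'h monoid \<Rightarrow> ('h \<Rightarrow> 'b \<Rightarrow> 'b) \<Rightarrow> bool" where
  "cond_F N H tau \<longleftrightarrow> (\<forall>t\<in>carrier H. t \<noteq> \<one>\<^bsub>H\<^esub> \<longrightarrow>
      inj_on (\<lambda>b. b \<otimes>\<^bsub>N\<^esub> inv\<^bsub>N\<^esub> (tau t b)) (carrier N))"

definition incr_fr_seq :: "'a monoid \<Rightarrow> 'a set \<Rightarrow> (nat \<Rightarrow> 'a set) \<Rightarrow> bool" where
  "incr_fr_seq M A An \<longleftrightarrow> (\<forall>n. subgroup (An n) M \<and> finite_rank M (An n) \<and> An n \<subseteq> An (Suc n)) \<and>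
     (\<Union>n. An n) = A"

definition cond_I_seq :: "'a monoid \<Rightarrow> 'g set \<Rightarrow> 'a set \<Rightarrow> ('g \<Rightarrow> 'a \<Rightarrow> 'a) \<Rightarrow> 'h monoid \<Rightarrow> (nat \<Rightarrow> 'a set) \<Rightarrow> bool" where
  "cond_I_seq M S A sig H An \<longleftrightarrow> (\<forall>n. cond_i1 M S sig H (An n)) \<or> cond_i2 M S A sig H"

definition cond_II_seq :: "'a monoid \<Rightarrow> 'g monoid \<Rightarrow> 'g set \<Rightarrow> 'a set \<Rightarrow> ('g \<Rightarrow> 'a \<Rightarrow> 'a) \<Rightarrow>
    'b monoid \<Rightarrow> 'h monoid \<Rightarrow> ('h \<Rightarrow> 'b \<Rightarrow> 'b) \<Rightarrow> (nat \<Rightarrow> 'a set) \<Rightarrow> bool" where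
  "cond_II_seq M G S A sig N H tau An \<longleftrightarrow>
     (\<forall>n. cond_ii1 M G S sig H (An n)) \<or> (cond_F N H tau \<and> torsion_free M A)"

definition cond_III :: "'a monoid \<Rightarrow> 'g set \<Rightarrow> 'a set \<Rightarrow> ('g \<Rightarrow> 'a \<Rightarrow> 'a) \<Rightarrow>
    'b monoid \<Rightarrow> 'h monoid \<Rightarrow> ('h \<Rightarrow> 'b \<Rightarrow> 'b) \<Rightarrow> bool" where
  "cond_III M S A sig N H tau \<longleftrightarrow> (\<exists>s \<kappa>. scalar_elt M S A sig s \<kappa>) \<and>
     finite_rank N (carrier N) \<and> cond_F N H tau"

definition cond_I :: "'a monoid \<Rightarrow> 'g set \<Rightarrow> 'a set \<Rightarrow> ('g \<Rightarrow> 'a \<Rightarrow> 'a) \<Rightarrow> 'h monoid \<Rightarrow> bool" where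
  "cond_I M S A sig H \<longleftrightarrow> (\<exists>An. incr_fr_seq M A An \<and> cond_I_seq M S A sig H An)"

definition right_reversible :: "'g monoid \<Rightarrow> 'g set \<Rightarrow> bool" where
  "right_reversible G S \<longleftrightarrow> (\<forall>s\<in>S. \<forall>t\<in>S. \<exists>u\<in>S. \<exists>v\<in>S. u \<otimes>\<^bsub>G\<^esub> s = v \<otimes>\<^bsub>G\<^esub> t)"

definition cond_PC :: "'g set \<Rightarrow> 'a set \<Rightarrow> ('g \<Rightarrow> 'a \<Rightarrow> 'a) \<Rightarrow> bool" where
  "cond_PC S A sig \<longleftrightarrow> (\<forall>C\<in>constr S A sig. \<exists>s\<in>S. sig s ` A \<subseteq> C)"

definition localized :: "'a monoid \<Rightarrow> 'g monoid \<Rightarrow> 'g set \<Rightarrow> 'a set \<Rightarrow> ('g \<Rightarrow> 'a \<Rightarrow> 'a) \<Rightarrow> bool" where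
  "localized M G S A sig \<longleftrightarrow>
     carrier G = {inv\<^bsub>G\<^esub> s \<otimes>\<^bsub>G\<^esub> t | s t. s \<in> S \<and> t \<in> S} \<and>
     carrier M = (\<Union>s\<in>S. {x \<in> carrier M. sig s x \<in> A})"

definition cond_star :: "'a monoid \<Rightarrow> 'g monoid \<Rightarrow> 'g set \<Rightarrow> 'a set \<Rightarrow> ('g \<Rightarrow> 'a \<Rightarrow> 'a) \<Rightarrow>
    'b monoid \<Rightarrow> 'h monoid \<Rightarrow> 'h set \<Rightarrow> 'b set \<Rightarrow> ('h \<Rightarrow> 'b \<Rightarrow> 'b) \<Rightarrow> bool" where
  "cond_star M G S A sig N H T B tau \<longleftrightarrow>
     (\<exists>An. incr_fr_seq M A An \<and>
        ((cond_I_seq M S A sig H An \<and> cond_II_seq M G S A sig N H tau An) \<or>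
         cond_III M S A sig N H tau)) \<and>
     (\<exists>Ak. (\<forall>k. Ak k \<subseteq> Ak (Suc k) \<and> (\<exists>F. finite F \<and> F \<subseteq> A \<and> Ak k = generate M F) \<and>
              (\<forall>s\<in>S. sig s ` Ak k \<subseteq> Ak k)) \<and> (\<Union>k. Ak k) = A) \<and>
     right_reversible G S \<and> right_reversible H T \<and>
     localized M G S A sig \<and> localized N H T B tau \<and>
     cond_PC S A sig"

definition cond_SF :: "'a monoid \<Rightarrow> 'g monoid \<Rightarrow> ('g \<Rightarrow> 'a \<Rightarrow> 'a) \<Rightarrow> bool" where
  "cond_SF M G sig \<longleftrightarrow> (\<forall>s\<in>carrier G. \<forall>t\<in>carrier G. \<forall>\<rho>.
     \<rho> \<in> iso (QTg M (carrier M)) (QTg M (carrier M)) \<and>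
     (\<forall>v\<in>QT M (carrier M). qt_act M sig s (\<rho> v) = \<rho> (qt_act M sig t v)) \<longrightarrow> s = t)"

end

theory Submission
  imports Defs "HOL-Computational_Algebra.Fundamental_Theorem_Algebra"
    "HOL-Analysis.Abstract_Topological_Spaces"
begin

text \<open>An isomorphism of the groupoids, followed by the projection to the group of the target, is a
  cocycle with values in the semidirect product of \<open>N\<close> and \<open>H\<close>. Since the completion of \<open>A\<close> is compact
  and the cocycle is locally constant, on a finitely generated subgroup of \<open>A\<close> it only depends on
  the base point modulo some constructible subgroup \<open>C\<close>; on the elements lying in \<open>C\<close> it is therefore
  an injective homomorphism \<open>e\<close>, evaluated at the base point \<open>0\<close>. The isotropy at \<open>0\<close> gives a
  homomorphism \<open>K\<close> on \<open>G\<close>, and \<open>e\<close> intertwines the action of \<open>s\<close> with conjugation by \<open>K s\<close> close to \<open>0\<close>.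
  The conditions (I) and (III) force the \<open>H\<close>-component of \<open>e\<close> to be torsion (in a free group, \<open>u\<close> commutes with
  \<open>t u t\<inverse>\<close> only if it commutes with \<open>t\<close>; over the complex numbers, a spectrum that is closed under
  \<open>\<kappa>\<close>-th powers contains a root of unity), so that multiples
  of elements of \<open>A\<close> are sent to translations; dividing by these multiples yields the equivariant
  embedding over the rationals. Under the stronger condition on \<open>\<sigma>\<close> and \<open>\<tau>\<close> in part (ii) the \<open>H\<close>-component even vanishes on
  \<open>C' \<inter> \<AA>\<close> for the invariant finitely generated subgroups \<open>\<AA>\<close>, and translating into \<open>C'\<close>
  by (PC) shows that the rational embedding is integral. For finite rank, an injective endomorphism has
  cokernel of bounded exponent, which compares the two embeddings.\<close>

section \<open>Commuting conjugates in free groups\<close>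

text \<open>The comments write abelian groups additively: \<open>a [^] n\<close> is the multiple n
  a, and the unit of \<open>M\<close> or \<open>N\<close> is 0. The obstacle throughout is that the
  constructible subgroup on which \<open>e\<close> is additive depends on the finitely many elements
  at hand; no single one is known to serve all of \<open>A\<close>. (FI) gives the remedy: each
  constructible subgroup contains a fixed positive multiple of \<open>A\<close>, so one exponent
  moves any finite set into \<open>Dom C\<close>, and over the rationals it can be divided out
  again. Integrality has no such freedom, so part (ii) needs the linear part to vanish on elements,
  not just on multiples: under (F) because a nontrivial linear part cannot fix a nonzero
  translation, under (ii_1) because a relation mu sigma^delta = nu forbids each of the finitely many
  possible orders near 0. Finite rank is expressed by integer relations (\<open>rat_spanned\<close>)
  and endomorphisms act through integer polynomials, so the same lemmas cover groups, subgroups and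
  rationalizations. The rational and the integral embedding share the group map \<open>tmap\<close>;
  this is how (SF), a condition over the rationals, yields strictness in (ii).\<close>

definition inv_letter :: "bool \<times> 'h \<Rightarrow> bool \<times> 'h" where
  "inv_letter l = (\<not> fst l, snd l)"

definition inv_word :: "(bool \<times> 'h) list \<Rightarrow> (bool \<times> 'h) list" where
  "inv_word w = rev (map inv_letter w)"

lemma inv_letter_simps [simp]:
  "inv_letter (inv_letter l) = l" "inv_letter l \<noteq> l" "l \<noteq> inv_letter l" "snd (inv_letter l) = snd l"
  "inv_letter a = inv_letter b \<longleftrightarrow> a = b"
  by (auto simp: inv_letter_def prod_eq_iff)

lemma inv_word_simps [simp]:
  "inv_word [] = []" "inv_word (l # w) = inv_word w @ [inv_letter l]"
  "length (inv_word w) = length w" "inv_word w = [] \<longleftrightarrow> w = []"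
  by (auto simp: inv_word_def)

text \<open>The index form of the definition is awkward for \<open>@\<close>;
  \<open>successively\<close> has an append rule that only looks at the two letters at the
  seam.\<close>

lemma reduced_word_iff_successively:
  "reduced_word X w \<longleftrightarrow> snd ` set w \<subseteq> X \<and> successively (\<lambda>a b. b \<noteq> inv_letter a) w"
  unfolding reduced_word_def successively_conv_nth by (auto simp: inv_letter_def prod_eq_iff)

lemma reduced_word_append_iff:
  "reduced_word X (u @ v) \<longleftrightarrow> reduced_word X u \<and> reduced_word X v \<and>
     (u \<noteq> [] \<longrightarrow> v \<noteq> [] \<longrightarrow> hd v \<noteq> inv_letter (last u))"
  by (auto simp: reduced_word_iff_successively successively_append_iff)

lemma reduced_word_Cons_iff:
  "reduced_word X (l # v) \<longleftrightarrow> snd l \<in> X \<and> reduced_word X v \<and> (v \<noteq> [] \<longrightarrow> hd v \<noteq> inv_letter l)"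
  using reduced_word_append_iff[of X "[l]" v] by (auto simp: reduced_word_iff_successively)

lemma reduced_word_Nil [simp]: "reduced_word X []"
  by (simp add: reduced_word_iff_successively)

lemma hd_inv_word: "w \<noteq> [] \<Longrightarrow> hd (inv_word w) = inv_letter (last w)"
  by (simp add: inv_word_def hd_rev last_map)

lemma last_inv_word: "w \<noteq> [] \<Longrightarrow> last (inv_word w) = inv_letter (hd w)"
  by (simp add: inv_word_def last_rev hd_map)

lemma reduced_word_inv_word: "reduced_word X w \<Longrightarrow> reduced_word X (inv_word w)"
proof (induction w)
  case (Cons l w)
  then show ?case
    by (auto simp: reduced_word_append_iff reduced_word_Cons_iff last_inv_word)
qed simp

context group
begin

lemma mult_inv_cancel:
  assumes "x \<in> carrier G" "y \<in> carrier G"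
  shows "x \<otimes> (inv x \<otimes> y) = y" "inv x \<otimes> (x \<otimes> y) = y"
  using assms by (simp_all add: m_assoc[symmetric])

lemma inv_commute:
  assumes "x \<in> carrier G" "y \<in> carrier G" "x \<otimes> y = y \<otimes> x"
  shows "inv x \<otimes> y = y \<otimes> inv x"
proof -
  have "inv x \<otimes> y = inv x \<otimes> (y \<otimes> x) \<otimes> inv x" using assms by (simp add: m_assoc)
  also have "\<dots> = y \<otimes> inv x" using assms by (simp add: assms(3)[symmetric] mult_inv_cancel)
  finally show ?thesis .
qed

lemma conj_eq_one:
  assumes "p \<in> carrier G" "x \<in> carrier G" "p \<otimes> x \<otimes> inv p = \<one>"
  shows "x = \<one>"
proof -
  have "x = inv p \<otimes> (p \<otimes> x \<otimes> inv p) \<otimes> p" using assms(1,2) by (simp add: m_assoc mult_inv_cancel)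
  then show ?thesis using assms by simp
qed

lemma conj_int_pow:
  assumes "t \<in> carrier G" "x \<in> carrier G"
  shows "t \<otimes> x [^] (k::int) \<otimes> inv t = (t \<otimes> x \<otimes> inv t) [^] k"
proof -
  have "(\<lambda>y. t \<otimes> y \<otimes> inv t) \<in> hom G G"
    using assms by (auto simp: hom_def m_assoc mult_inv_cancel)
  then show ?thesis using assms hom_int_pow[of "\<lambda>y. t \<otimes> y \<otimes> inv t" G G x k] is_group by simp
qed

end

text \<open>Freeness is the absence of nontrivial relations, as in \<open>free_subgroup\<close>; the
  ambient group may be larger than the subgroup generated by \<open>X\<close>.\<close>

locale free_gens = group H for H :: "'h monoid" (structure) +
  fixes X :: "'h set"
  assumes gens_in: "X \<subseteq> carrier H"
    and free: "w \<noteq> [] \<Longrightarrow> reduced_word X w \<Longrightarrow> word_eval H w \<noteq> \<one>"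
begin

abbreviation "ev \<equiv> word_eval H"

definition letter_eval :: "bool \<times> 'h \<Rightarrow> 'h" where
  "letter_eval l = (if fst l then snd l else inv snd l)"

lemma ev_Nil [simp]: "ev [] = \<one>"
  by (simp add: word_eval_def)

lemma ev_Cons: "ev (l # w) = letter_eval l \<otimes> ev w"
  by (simp add: word_eval_def letter_eval_def split: prod.split)

lemma letter_eval_closed: "snd l \<in> X \<Longrightarrow> letter_eval l \<in> carrier H"
  using gens_in by (auto simp: letter_eval_def)

lemma ev_closed: "snd ` set w \<subseteq> X \<Longrightarrow> ev w \<in> carrier H"
proof (induction w)
  case (Cons l w)
  have "snd l \<in> X" "snd ` set w \<subseteq> X" using Cons.prems by auto
  then show ?case using Cons.IH letter_eval_closed[of l] by (simp add: ev_Cons)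
qed simp

lemma ev_append:
  "snd ` set u \<subseteq> X \<Longrightarrow> snd ` set v \<subseteq> X \<Longrightarrow> ev (u @ v) = ev u \<otimes> ev v"
proof (induction u)
  case (Cons l u)
  have "snd l \<in> X" "snd ` set u \<subseteq> X" using Cons.prems by auto
  then show ?case using Cons letter_eval_closed[of l] ev_closed[of u] ev_closed[of v]
    by (simp add: ev_Cons m_assoc)
qed (simp add: ev_closed)

lemma letter_eval_inv: "snd l \<in> X \<Longrightarrow> letter_eval (inv_letter l) = inv (letter_eval l)"
  using gens_in by (auto simp: inv_letter_def letter_eval_def)

lemma ev_inv_word: "snd ` set w \<subseteq> X \<Longrightarrow> ev (inv_word w) = inv (ev w)"
proof (induction w)
  case (Cons l w)
  have l: "snd l \<in> X" "snd ` set w \<subseteq> X" using Cons.prems by auto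
  then have "snd ` set (inv_word w) \<subseteq> X" by (auto simp: inv_word_def)
  then have "ev (inv_word (l # w)) = inv (ev w) \<otimes> inv (letter_eval l)"
    using Cons l letter_eval_closed[of l]
    by (simp add: ev_append ev_Cons letter_eval_inv)
  also have "\<dots> = inv (ev (l # w))"
    using l letter_eval_closed[of l] ev_closed[of w] by (simp add: ev_Cons inv_mult_group)
  finally show ?case .
qed simp

lemma reduced_letters: "reduced_word X w \<Longrightarrow> snd ` set w \<subseteq> X"
  by (simp add: reduced_word_iff_successively)

text \<open>The tail is reduced first; the new letter then either stays or cancels the head of the
  reduced tail. The length bound is what later turns a cancellation into a contradiction.\<close>

lemma reduce_word:
  assumes "snd ` set w \<subseteq> X"
  shows "\<exists>w'. reduced_word X w' \<and> ev w' = ev w \<and> length w' \<le> length w"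
  using assms
proof (induction w)
  case Nil
  show ?case by (intro exI[of _ "[]"]) simp
next
  case (Cons l w)
  have l: "snd l \<in> X" and w: "snd ` set w \<subseteq> X" using Cons.prems by auto
  obtain w' where w': "reduced_word X w'" "ev w' = ev w" "length w' \<le> length w"
    using Cons.IH[OF w] by blast
  show ?case
  proof (cases "w' \<noteq> [] \<and> hd w' = inv_letter l")
    case False
    then have "reduced_word X (l # w')" using w' l by (auto simp: reduced_word_Cons_iff)
    then show ?thesis using w' by (intro exI[of _ "l # w'"]) (simp add: ev_Cons)
  next
    case True
    then obtain v where v: "w' = inv_letter l # v" by (cases w') auto
    have rv: "reduced_word X v" using w'(1) v by (simp add: reduced_word_Cons_iff)
    have "ev (l # w) = letter_eval l \<otimes> (inv (letter_eval l) \<otimes> ev v)"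
      using w' v letter_eval_inv[OF l] by (simp add: ev_Cons)
    also have "\<dots> = ev v"
      using letter_eval_closed[OF l] ev_closed[OF reduced_letters[OF rv]]
      by (simp add: m_assoc[symmetric])
    finally show ?thesis using rv w'(3) v by (intro exI[of _ v]) simp
  qed
qed

text \<open>Common first letters are stripped. Once the first letters differ, the inverse of one
  word followed by the other is reduced and nonempty but evaluates to one, against freeness.\<close>

lemma reduced_word_unique:
  "reduced_word X u \<Longrightarrow> reduced_word X v \<Longrightarrow> ev u = ev v \<Longrightarrow> u = v"
proof (induction u arbitrary: v)
  case Nil
  then show ?case using free[of v] by auto
next
  case (Cons l u)
  show ?case
  proof (cases "v \<noteq> [] \<and> hd v = l")
    case True
    then obtain v' where v: "v = l # v'" by (cases v) auto
    have r: "reduced_word X u" "reduced_word X v'" "snd l \<in> X"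
      using Cons.prems v by (auto simp: reduced_word_Cons_iff)
    have "ev u = ev v'" using Cons.prems(3) v r letter_eval_closed[of l]
        ev_closed[OF reduced_letters[OF r(1)]] ev_closed[OF reduced_letters[OF r(2)]]
      by (simp add: ev_Cons)
    then show ?thesis using Cons.IH r v by simp
  next
    case False
    have "reduced_word X (inv_word (l # u) @ v)"
      using Cons.prems False reduced_word_inv_word[OF Cons.prems(1)] last_inv_word[of "l # u"]
      by (auto simp: reduced_word_append_iff[of X "inv_word (l # u)"] simp del: inv_word_simps(2))
    moreover have "ev (inv_word (l # u) @ v) = \<one>"
    proof -
      have 1: "snd ` set (l # u) \<subseteq> X" using Cons.prems(1) reduced_letters by blast
      have 2: "snd ` set (inv_word (l # u)) \<subseteq> X"
        using reduced_letters[OF reduced_word_inv_word[OF Cons.prems(1)]] .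
      show ?thesis
        using Cons.prems(3) ev_inv_word[OF 1] ev_append[OF 2 reduced_letters[OF Cons.prems(2)]]
          ev_closed[OF 1] by (metis l_inv)
    qed
    ultimately show ?thesis using free by fastforce
  qed
qed

lemma generate_imp_word:
  assumes "g \<in> generate H X"
  shows "\<exists>w. reduced_word X w \<and> ev w = g"
proof -
  have "\<exists>w. snd ` set w \<subseteq> X \<and> ev w = g"
    using assms
  proof (induction rule: generate.induct)
    case one
    show ?case by (intro exI[of _ "[]"]) simp
  next
    case (incl h)
    then show ?case using gens_in by (intro exI[of _ "[(True, h)]"]) (auto simp: ev_Cons letter_eval_def)
  next
    case (inv h)
    then show ?case using gens_in by (intro exI[of _ "[(False, h)]"]) (auto simp: ev_Cons letter_eval_def)
  next
    case (eng h1 h2)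
    then obtain w1 w2 where "snd ` set w1 \<subseteq> X" "ev w1 = h1" "snd ` set w2 \<subseteq> X" "ev w2 = h2"
      by blast
    then show ?case by (intro exI[of _ "w1 @ w2"]) (auto simp: ev_append)
  qed
  then show ?thesis using reduce_word by metis
qed

abbreviation "K \<equiv> generate H X"

lemma K_closed: "g \<in> K \<Longrightarrow> g \<in> carrier H"
  using generate_in_carrier[OF gens_in] by blast

lemma K_subgroup: "subgroup K H"
  using generate_is_subgroup[OF gens_in] .

lemma ev_in_K: "snd ` set w \<subseteq> X \<Longrightarrow> ev w \<in> K"
proof (induction w)
  case (Cons l w)
  have "snd l \<in> X" "snd ` set w \<subseteq> X" using Cons.prems by auto
  then show ?case using Cons.IH
    by (auto simp: ev_Cons letter_eval_def intro!: generate.eng intro: generate.incl generate.inv)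
qed (simp add: generate.one)

section \<open>Word length and cyclically reduced words\<close>

definition len :: "'h \<Rightarrow> nat" where
  "len g = length (SOME w. reduced_word X w \<and> ev w = g)"

lemma len_ev: "reduced_word X w \<Longrightarrow> len (ev w) = length w"
  unfolding len_def by (metis (mono_tags, lifting) someI_ex reduced_word_unique)

lemma len_mult:
  assumes "g \<in> K" "h \<in> K" shows "len (g \<otimes> h) \<le> len g + len h"
proof -
  obtain u v where u: "reduced_word X u" "ev u = g" and v: "reduced_word X v" "ev v = h"
    using assms generate_imp_word by metis
  have "snd ` set (u @ v) \<subseteq> X" using u v reduced_letters by fastforce
  from reduce_word[OF this] obtain w where "reduced_word X w" "ev w = g \<otimes> h"
    "length w \<le> length u + length v"
    using ev_append[OF reduced_letters[OF u(1)] reduced_letters[OF v(1)]] u v by auto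
  then show ?thesis using len_ev u v by metis
qed

lemma len_inv: "g \<in> K \<Longrightarrow> len (inv g) = len g"
  using generate_imp_word[of g] len_ev reduced_word_inv_word ev_inv_word reduced_letters
  by (metis inv_word_simps(3))

text \<open>Exactly the nonempty reduced words whose powers show no cancellation, so that the length
  of a power is linear in the exponent.\<close>

definition cyc_reduced :: "(bool \<times> 'h) list \<Rightarrow> bool" where
  "cyc_reduced u \<longleftrightarrow> u \<noteq> [] \<and> reduced_word X u \<and> hd u \<noteq> inv_letter (last u)"

lemma cyc_reduced_inv: "cyc_reduced u \<Longrightarrow> cyc_reduced (inv_word u)"
  unfolding cyc_reduced_def using reduced_word_inv_word
  by (auto simp: hd_inv_word last_inv_word)

lemma cyc_reduced_power:
  assumes "cyc_reduced z"
  shows "reduced_word X (concat (replicate n z)) \<and>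
    (n > 0 \<longrightarrow> concat (replicate n z) \<noteq> [] \<and> hd (concat (replicate n z)) = hd z)"
proof (induction n)
  case (Suc n)
  then show ?case using assms
    by (cases n) (auto simp: cyc_reduced_def reduced_word_append_iff hd_append)
qed simp

lemma ev_concat_replicate:
  "snd ` set z \<subseteq> X \<Longrightarrow> ev (concat (replicate n z)) = ev z [^] (n::nat)"
proof (induction n)
  case (Suc n)
  have "snd ` set (concat (replicate n z)) \<subseteq> X" using Suc.prems by (cases n) (auto simp: image_subset_iff)
  then show ?case using Suc nat_pow_Suc2[OF ev_closed[OF Suc.prems], of n]
    by (simp add: ev_append del: set_concat)
qed simp

lemma len_power:
  assumes "cyc_reduced z"
  shows "len (ev z [^] (k::int)) = nat \<bar>k\<bar> * length z"
proof -
  have z: "reduced_word X z" using assms by (simp add: cyc_reduced_def)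
  have nat: "len (ev z [^] (n::nat)) = n * length z" for n
    using len_ev[of "concat (replicate n z)"] cyc_reduced_power[OF assms, of n]
      ev_concat_replicate[OF reduced_letters[OF z], of n] by (simp add: length_concat sum_list_replicate)
  have K: "ev z [^] (n::nat) \<in> K" for n
    using ev_in_K[OF reduced_letters[OF z]]
    by (induction n) (auto intro: generate.one generate.eng)
  have c: "ev z \<in> carrier H" using ev_closed[OF reduced_letters[OF z]] .
  show ?thesis
  proof (cases k rule: int_cases2)
    case (nonneg n)
    then show ?thesis using nat[of n] by (simp add: int_pow_int)
  next
    case (nonpos n)
    then have "ev z [^] k = inv (ev z [^] n)" using c by (simp add: int_pow_neg_int)
    then show ?thesis using nat[of n] len_inv[OF K[of n]] nonpos by simp
  qed
qed

text \<open>As long as the first and the last letter cancel, both are moved into the conjugator, and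
  the word gets shorter by two.\<close>

lemma conj_cyc_reduced_word:
  "reduced_word X w \<Longrightarrow> w \<noteq> [] \<Longrightarrow> \<exists>p u. p \<in> K \<and> cyc_reduced u \<and> ev w = p \<otimes> ev u \<otimes> inv p"
proof (induction w rule: length_induct)
  case (1 w)
  show ?case
  proof (cases "cyc_reduced w")
    case True
    then show ?thesis using ev_closed[OF reduced_letters[OF 1(2)]]
      by (intro exI[of _ \<one>] exI[of _ w]) (simp add: generate.one)
  next
    case False
    then have h: "hd w = inv_letter (last w)" using 1 by (simp add: cyc_reduced_def)
    obtain l w1 where w1: "w = l # w1" using 1(3) by (cases w) auto
    then have "w1 \<noteq> []" using h by auto
    then obtain v m where w: "w = l # v @ [m]" using w1 by (metis append_butlast_last_id)
    then have m: "m = inv_letter l" using h by simp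
    have rv: "reduced_word X v" and lX: "snd l \<in> X" and "v \<noteq> []"
      using 1(2) w m by (auto simp: reduced_word_Cons_iff reduced_word_append_iff)
    moreover have "length v < length w" using w by simp
    ultimately obtain p u where p: "p \<in> K" "cyc_reduced u" "ev v = p \<otimes> ev u \<otimes> inv p"
      using 1(1) by blast
    have l: "letter_eval l \<in> K" using lX by (auto simp: letter_eval_def intro: generate.incl generate.inv)
    have "ev w = letter_eval l \<otimes> (ev v \<otimes> inv (letter_eval l))"
    proof -
      have "ev [m] = inv (letter_eval l)" using m lX letter_eval_inv[OF lX] letter_eval_closed[OF lX]
        by (simp add: ev_Cons)
      moreover have "snd ` set [m] \<subseteq> X" using m lX by simp
      ultimately show ?thesis
        unfolding w using ev_append[OF reduced_letters[OF rv], of "[m]"] ev_Cons[of l "v @ [m]"] by argo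
    qed
    also have "\<dots> = (letter_eval l \<otimes> p) \<otimes> ev u \<otimes> inv (letter_eval l \<otimes> p)"
      using p l K_closed ev_closed[OF reduced_letters, of u]
      by (simp add: cyc_reduced_def m_assoc inv_mult_group)
    finally show ?thesis using p l by (meson generate.eng)
  qed
qed

lemma conj_cyc_reduced:
  assumes "g \<in> K" "g \<noteq> \<one>"
  shows "\<exists>p u. p \<in> K \<and> cyc_reduced u \<and> g = p \<otimes> ev u \<otimes> inv p"
  using generate_imp_word[OF assms(1)] assms(2) conj_cyc_reduced_word by force

text \<open>The assumption on \<open>hd u\<close> makes \<open>v @ u\<close> reduced, so the common
  product has length |u| + |v|. Then \<open>u @ v\<close> cannot cancel either, the two words
  coincide letter by letter, and words that commute under concatenation are powers of one
  word.\<close>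

lemma commuting_words:
  assumes u: "cyc_reduced u" and v: "reduced_word X v" "v \<noteq> []"
    and comm: "ev u \<otimes> ev v = ev v \<otimes> ev u" and nc: "hd u \<noteq> inv_letter (last v)"
  shows "\<exists>z m n. cyc_reduced z \<and> ev u = ev z [^] (m::int) \<and> ev v = ev z [^] (n::int)"
proof -
  have ru: "reduced_word X u" "u \<noteq> []" using u by (auto simp: cyc_reduced_def)
  have L: "snd ` set u \<subseteq> X" "snd ` set v \<subseteq> X" using ru v reduced_letters by auto
  have vu: "reduced_word X (v @ u)" using ru v nc by (simp add: reduced_word_append_iff)
  have e: "ev (v @ u) = ev (u @ v)" using comm L by (simp add: ev_append)
  have "reduced_word X (u @ v)"
  proof (rule ccontr)
    assume "\<not> reduced_word X (u @ v)"
    then have h: "hd v = inv_letter (last u)" using ru v by (simp add: reduced_word_append_iff)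
    define u' where "u' = butlast u"
    define v' where "v' = tl v"
    have uu: "u = u' @ [last u]" "v = [inv_letter (last u)] @ v'"
      using ru v h by (auto simp: u'_def v'_def) (metis h hd_Cons_tl)
    have L': "snd ` set u' \<subseteq> X" "snd ` set v' \<subseteq> X" "snd (last u) \<in> X"
    proof -
      have "set u' \<subseteq> set u" "set v' \<subseteq> set v" "last u \<in> set u"
        using ru v by (auto simp: u'_def v'_def dest: in_set_butlastD list.set_sel(2))
      then show "snd ` set u' \<subseteq> X" "snd ` set v' \<subseteq> X" "snd (last u) \<in> X"
        using L by (meson image_mono order_trans, meson image_mono order_trans, blast)
    qed
    have c: "letter_eval (last u) \<in> carrier H" using L' letter_eval_closed by blast
    have 1: "ev [last u] = letter_eval (last u)" using c by (simp add: ev_Cons)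
    have 2: "ev [inv_letter (last u)] = inv (letter_eval (last u))"
      using c letter_eval_inv[OF L'(3)] by (simp add: ev_Cons)
    have "ev u = ev u' \<otimes> ev [last u]" by (subst uu(1), rule ev_append) (use L' in auto)
    moreover have "ev v = ev [inv_letter (last u)] \<otimes> ev v'"
      by (subst uu(2), rule ev_append) (use L' in auto)
    ultimately have "ev (u @ v) = (ev u' \<otimes> letter_eval (last u)) \<otimes> (inv (letter_eval (last u)) \<otimes> ev v')"
      using ev_append[OF L] 1 2 by simp
    also have "\<dots> = ev u' \<otimes> ev v'"
      using c ev_closed[OF L'(1)] ev_closed[OF L'(2)] by (simp add: m_assoc mult_inv_cancel)
    also have "\<dots> = ev (u' @ v')" using L' by (simp add: ev_append)
    finally have "ev (u @ v) = ev (u' @ v')" .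
    moreover have "snd ` set (u' @ v') \<subseteq> X" using L' by auto
    ultimately obtain w where "reduced_word X w" "ev w = ev (u @ v)" "length w \<le> length (u' @ v')"
      using reduce_word by metis
    then have "length (v @ u) \<le> length (u' @ v')" using reduced_word_unique[OF _ vu] e by metis
    moreover have "length u' < length u" "length v' \<le> length v" using ru v by (auto simp: u'_def v'_def)
    ultimately show False by simp
  qed
  then have "u @ v = v @ u" using reduced_word_unique vu e by metis
  then obtain m n z where z: "concat (replicate m z) = u" "concat (replicate n z) = v"
    using comm_append_are_replicate by blast
  have m: "m > 0" "z \<noteq> []" using z ru by (auto intro: gr0I)
  have "hd u = hd z" "last u = last z"
  proof -
    obtain m' where m': "m = Suc m'" using m by (cases m) auto
    show "hd u = hd z" using z(1) m m' by auto
    have "replicate m z = replicate m' z @ [z]" using m' by (simp add: replicate_append_same)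
    then show "last u = last z" using z(1) m by auto
  qed
  moreover have "reduced_word X z"
    using z(1) m ru(1) by (cases m) (auto simp: reduced_word_append_iff)
  ultimately have "cyc_reduced z" using u m by (simp add: cyc_reduced_def)
  moreover have "ev u = ev z [^] int m" "ev v = ev z [^] int n"
    using z ev_concat_replicate \<open>reduced_word X z\<close> reduced_letters by (auto simp: int_pow_int)
  ultimately show ?thesis by blast
qed

text \<open>Since \<open>u\<close> is cyclically reduced, \<open>last v\<close> cannot cancel both
  against the head of \<open>u\<close> and against the head of its inverse; the previous lemma
  applies to one of the two.\<close>

lemma commuting_common_root:
  assumes u: "cyc_reduced u" and h: "h \<in> K" and comm: "ev u \<otimes> h = h \<otimes> ev u"
  shows "\<exists>z m n. cyc_reduced z \<and> ev u = ev z [^] (m::int) \<and> h = ev z [^] (n::int)"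
proof -
  obtain v where v: "reduced_word X v" "ev v = h" using generate_imp_word[OF h] by blast
  have ru: "reduced_word X u" "u \<noteq> []" using u by (auto simp: cyc_reduced_def)
  have cu: "ev u \<in> carrier H" using ev_closed[OF reduced_letters[OF ru(1)]] .
  show ?thesis
  proof (cases "v = []")
    case True
    then show ?thesis using u v cu
      by (intro exI[of _ u] exI[of _ 1] exI[of _ 0]) auto
  next
    case False
    show ?thesis
    proof (cases "hd u = inv_letter (last v)")
      case False
      then show ?thesis using commuting_words[OF u v(1) \<open>v \<noteq> []\<close>] comm v by auto
    next
      case True
      have iu: "ev (inv_word u) = inv (ev u)" using ev_inv_word reduced_letters ru by blast
      have "hd (inv_word u) \<noteq> inv_letter (last v)"
        using True u by (auto simp: cyc_reduced_def hd_inv_word)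
      moreover have "ev (inv_word u) \<otimes> ev v = ev v \<otimes> ev (inv_word u)"
        using inv_commute[OF cu K_closed[OF h] comm] v iu by simp
      ultimately obtain z m n where z: "cyc_reduced z" "inv (ev u) = ev z [^] (m::int)"
        "ev v = ev z [^] (n::int)"
        using commuting_words[OF cyc_reduced_inv[OF u] v(1) False] iu by auto
      have "ev z \<in> carrier H" using z(1) ev_closed reduced_letters by (auto simp: cyc_reduced_def)
      then have "ev u = ev z [^] (- m)" using z(2) cu by (metis int_pow_neg inv_inv)
      then show ?thesis using z v by blast
    qed
  qed
qed

lemma square_eq_one:
  assumes "g \<in> K" "g \<otimes> g = \<one>" shows "g = \<one>"
proof (rule ccontr)
  assume "g \<noteq> \<one>"
  then obtain p u where p: "p \<in> K" "cyc_reduced u" "g = p \<otimes> ev u \<otimes> inv p"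
    using conj_cyc_reduced assms by blast
  have c: "p \<in> carrier H" "ev u \<in> carrier H"
    using p K_closed ev_closed reduced_letters by (auto simp: cyc_reduced_def)
  have "g \<otimes> g = p \<otimes> (ev u \<otimes> ev u) \<otimes> inv p"
    using c p(3) by (simp add: m_assoc mult_inv_cancel)
  then have "p \<otimes> (ev u \<otimes> ev u) \<otimes> inv p = \<one>" using assms by simp
  then have "ev u \<otimes> ev u = \<one>"
    using conj_eq_one[of p "ev u \<otimes> ev u"] c by simp
  then have "ev u [^] (2::int) = \<one>" using c
    using int_pow_int[of H "ev u" 2] by (simp add: numeral_2_eq_2)
  then have "len (ev u [^] (2::int)) = 0" using len_ev[of "[]"] by simp
  then show False using len_power[OF p(2), of 2] p(2) by (simp add: cyc_reduced_def)
qed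

text \<open>Conjugation by \<open>t\<close> adds at most 2 \<open>len t\<close> to the length, a
  bound independent of the exponent, while the powers of \<open>z\<close> grow linearly; comparing
  j-th powers for large j gives the inequality.\<close>

lemma conj_power_bound:
  assumes z: "cyc_reduced z" and t: "t \<in> K"
    and eq: "t \<otimes> ev z [^] (m::int) \<otimes> inv t = ev z [^] (n::int)"
  shows "\<bar>n\<bar> \<le> \<bar>m\<bar>"
proof (rule ccontr)
  assume "\<not> \<bar>n\<bar> \<le> \<bar>m\<bar>"
  then have lt: "nat \<bar>m\<bar> + 1 \<le> nat \<bar>n\<bar>" by linarith
  have rz: "reduced_word X z" using z by (simp add: cyc_reduced_def)
  have zK: "ev z \<in> K" using ev_in_K[OF reduced_letters[OF rz]] .
  have c: "ev z \<in> carrier H" "t \<in> carrier H" using K_closed zK t by auto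
  have pK: "ev z [^] (k::int) \<in> K" for k
    using zK subgroup_int_pow_closed[OF K_subgroup] by blast
  have bound: "nat \<bar>n * int j\<bar> * length z \<le> 2 * len t + nat \<bar>m * int j\<bar> * length z" for j
  proof -
    have "ev z [^] (n * int j) = t \<otimes> ev z [^] (m * int j) \<otimes> inv t"
      using c by (simp add: int_pow_pow[symmetric] conj_int_pow eq[symmetric])
    then have "len (ev z [^] (n * int j)) \<le> len t + len (ev z [^] (m * int j)) + len (inv t)"
      using len_mult[of "t \<otimes> ev z [^] (m * int j)" "inv t"] len_mult[OF t pK[of "m * int j"]]
        generate.eng[OF t pK[of "m * int j"]] subgroup.m_inv_closed[OF K_subgroup t] by simp
    then show ?thesis using len_power[OF z] len_inv[OF t] by simp
  qed
  \<comment> \<open>Any value beyond 2 \<open>len t\<close> works: if |n| exceeds |m| by at least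
    one, the two lengths differ by at least j |z|, hence by at least j.\<close>
  define j where "j = 2 * len t + 1"
  have "nat \<bar>n * int j\<bar> = nat \<bar>n\<bar> * j" "nat \<bar>m * int j\<bar> = nat \<bar>m\<bar> * j"
    by (simp_all add: abs_mult nat_mult_distrib)
  then have "nat \<bar>n\<bar> * (j * length z) \<le> 2 * len t + nat \<bar>m\<bar> * (j * length z)"
    using bound[of j] by (simp add: mult.assoc)
  moreover have "(nat \<bar>m\<bar> + 1) * (j * length z) \<le> nat \<bar>n\<bar> * (j * length z)"
    using lt by (rule mult_le_mono1)
  ultimately have "j * length z \<le> 2 * len t" by simp
  moreover have "j \<le> j * length z" using z by (cases z) (auto simp: cyc_reduced_def)
  ultimately show False by (simp add: j_def)
qed

text \<open>\<open>u\<close> and its conjugate are powers m and n of one \<open>z\<close>, and the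
  bound for \<open>t\<close> and for its inverse gives |n| = |m|. If n = m, the conjugate equals
  \<open>u\<close>. If n = -m, conjugation by \<open>t\<close> inverts \<open>u\<close>; then t^2
  commutes with \<open>u\<close>, and comparing powers of a common root forces t = 1.\<close>

lemma commute_with_conj_cyc_reduced:
  assumes u: "cyc_reduced u" and t: "t \<in> K"
    and comm: "ev u \<otimes> (t \<otimes> ev u \<otimes> inv t) = (t \<otimes> ev u \<otimes> inv t) \<otimes> ev u"
  shows "ev u \<otimes> t = t \<otimes> ev u"
proof -
  define g where "g = ev u"
  have ru: "reduced_word X u" using u by (simp add: cyc_reduced_def)
  have gK: "g \<in> K" unfolding g_def using ev_in_K[OF reduced_letters[OF ru]] .
  have itK: "inv t \<in> K" using subgroup.m_inv_closed[OF K_subgroup t] .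
  have c: "g \<in> carrier H" "t \<in> carrier H" using K_closed gK t by auto
  obtain z m n where z: "cyc_reduced z" "g = ev z [^] (m::int)" "t \<otimes> g \<otimes> inv t = ev z [^] (n::int)"
    using commuting_common_root[OF u _ comm] generate.eng[OF generate.eng[OF t gK] itK]
    unfolding g_def by blast
  have cz: "ev z \<in> carrier H" using z(1) ev_closed reduced_letters by (auto simp: cyc_reduced_def)
  have eq: "t \<otimes> ev z [^] m \<otimes> inv t = ev z [^] n" using z by simp
  have eq': "inv t \<otimes> ev z [^] n \<otimes> inv (inv t) = ev z [^] m"
    using c cz by (simp add: eq[symmetric] m_assoc mult_inv_cancel)
  have "\<bar>n\<bar> = \<bar>m\<bar>"
    using conj_power_bound[OF z(1) t eq] conj_power_bound[OF z(1) itK eq'] by simp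
  then consider "n = m" | "n = - m" by linarith
  then have "g \<otimes> t = t \<otimes> g"
  proof cases
    case 1
    then have "t \<otimes> g \<otimes> inv t = g" using z by simp
    then have "t \<otimes> g \<otimes> inv t \<otimes> t = g \<otimes> t" by simp
    then show ?thesis using c by (simp add: m_assoc)
  next
    case 2
    then have i: "t \<otimes> g \<otimes> inv t = inv g" using z cz by (simp add: int_pow_neg)
    then have tg: "t \<otimes> g = inv g \<otimes> t" using c by (metis inv_closed inv_solve_right' m_closed)
    have "g \<otimes> (t \<otimes> t) = (t \<otimes> t) \<otimes> g"
    proof -
      have "(t \<otimes> t) \<otimes> g = t \<otimes> (inv g \<otimes> t)" using c tg by (simp add: m_assoc)
      also have "\<dots> = t \<otimes> inv g \<otimes> inv t \<otimes> t \<otimes> t" using c by (simp add: m_assoc mult_inv_cancel)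
      also have "t \<otimes> inv g \<otimes> inv t = inv (t \<otimes> g \<otimes> inv t)" using c by (simp add: inv_mult_group m_assoc)
      finally show ?thesis using c i by (simp add: m_assoc)
    qed
    then obtain y k l where y: "cyc_reduced y" "g = ev y [^] (k::int)" "t \<otimes> t = ev y [^] (l::int)"
      using commuting_common_root[OF u, of "t \<otimes> t"] t by (auto simp: g_def intro: generate.eng)
    have cy: "ev y \<in> carrier H" using y(1) ev_closed reduced_letters by (auto simp: cyc_reduced_def)
    \<comment> \<open>Both sides are the power k l of \<open>ev y\<close>. The right side is a power
      of t^2 and commutes with \<open>t\<close>, while \<open>t\<close> inverts the left side; so
      this element equals its own inverse.\<close>
    have gl: "g [^] l = (t \<otimes> t) [^] k" using y cy by (simp add: int_pow_pow mult.commute)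
    have "t \<otimes> (t \<otimes> t) \<otimes> inv t = t \<otimes> t" using c by (simp add: m_assoc)
    then have "t \<otimes> g [^] l \<otimes> inv t = g [^] l"
      using gl conj_int_pow[of t "t \<otimes> t" k] c by simp
    moreover have "t \<otimes> g [^] l \<otimes> inv t = inv (g [^] l)"
      using conj_int_pow[of t g l] c i by (simp add: int_pow_inv)
    ultimately have "g [^] l \<otimes> g [^] l = \<one>" using c by (metis int_pow_closed r_inv)
    then have "g [^] l = \<one>" using square_eq_one subgroup_int_pow_closed[OF K_subgroup gK] by blast
    then have "ev y [^] (k * l) = \<one>" using y cy by (simp add: int_pow_pow)
    then have "len (ev y [^] (k * l)) = 0" using len_ev[of "[]"] by simp
    then have "k * l = 0" using len_power[OF y(1), of "k * l"] y(1) by (auto simp: cyc_reduced_def)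
    moreover have "k \<noteq> 0"
    proof
      assume "k = 0"
      then have "len g = 0" using y len_ev[of "[]"] by simp
      then show False using len_ev[OF ru] u by (simp add: g_def cyc_reduced_def)
    qed
    ultimately have "t \<otimes> t = \<one>" using y by simp
    then have "t = \<one>" using square_eq_one t by blast
    then show ?thesis using c by simp
  qed
  then show ?thesis by (simp add: g_def)
qed

text \<open>The statement is invariant under conjugating \<open>g\<close> and \<open>t\<close>
  simultaneously, so \<open>g\<close> may be taken cyclically reduced.\<close>

theorem commute_with_conj:
  assumes "g \<in> K" "t \<in> K"
    and comm: "g \<otimes> (t \<otimes> g \<otimes> inv t) = (t \<otimes> g \<otimes> inv t) \<otimes> g"
  shows "g \<otimes> t = t \<otimes> g"
proof (cases "g = \<one>")
  case True
  then show ?thesis using assms K_closed by simp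
next
  case False
  then obtain p u where p: "p \<in> K" "cyc_reduced u" "g = p \<otimes> ev u \<otimes> inv p"
    using conj_cyc_reduced assms by blast
  define t' where "t' = inv p \<otimes> t \<otimes> p"
  have t'K: "t' \<in> K"
    unfolding t'_def using p assms subgroup.m_inv_closed[OF K_subgroup p(1)] by (auto intro: generate.eng)
  have c: "p \<in> carrier H" "ev u \<in> carrier H" "t \<in> carrier H" "t' \<in> carrier H"
    using p assms t'K K_closed ev_closed reduced_letters by (auto simp: cyc_reduced_def)
  have t: "t = p \<otimes> t' \<otimes> inv p" using c by (simp add: t'_def m_assoc mult_inv_cancel)
  have "p \<otimes> (ev u \<otimes> (t' \<otimes> ev u \<otimes> inv t')) \<otimes> inv p = g \<otimes> (t \<otimes> g \<otimes> inv t)"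
    unfolding p(3) t using c by (simp add: m_assoc mult_inv_cancel inv_mult_group)
  also have "\<dots> = p \<otimes> ((t' \<otimes> ev u \<otimes> inv t') \<otimes> ev u) \<otimes> inv p"
    unfolding comm unfolding p(3) t using c by (simp add: m_assoc mult_inv_cancel inv_mult_group)
  finally have "ev u \<otimes> (t' \<otimes> ev u \<otimes> inv t') = (t' \<otimes> ev u \<otimes> inv t') \<otimes> ev u"
    using c by simp
  then have "ev u \<otimes> t' = t' \<otimes> ev u" using commute_with_conj_cyc_reduced p t'K by blast
  then have "p \<otimes> (ev u \<otimes> t') \<otimes> inv p = p \<otimes> (t' \<otimes> ev u) \<otimes> inv p" by simp
  then show ?thesis unfolding p(3) t using c by (simp add: m_assoc mult_inv_cancel)
qed

end

lemma commute_with_conj_two_gen: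
  fixes G :: "'g monoid" (structure)
  assumes G: "group G" and two: "two_gen_free_or_abelian G" and g: "g \<in> carrier G" and t: "t \<in> carrier G"
    and comm: "g \<otimes> (t \<otimes> g \<otimes> inv t) = (t \<otimes> g \<otimes> inv t) \<otimes> g"
  shows "g \<otimes> t = t \<otimes> g"
proof -
  interpret group G by fact
  have in_gen: "g \<in> generate G {g, t}" "t \<in> generate G {g, t}" by (auto intro: generate.incl)
  consider "free_subgroup G (generate G {g, t})" | "g \<otimes> t = t \<otimes> g"
    using two g t in_gen unfolding two_gen_free_or_abelian_def by blast
  then show ?thesis
  proof cases
    case 1
    then obtain X where X: "X \<subseteq> generate G {g, t}" "generate G X = generate G {g, t}"
      "\<forall>w. w \<noteq> [] \<and> reduced_word X w \<longrightarrow> word_eval G w \<noteq> \<one>"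
      unfolding free_subgroup_def by blast
    have "X \<subseteq> carrier G" using X(1) generate_incl[of "{g, t}"] g t by blast
    then interpret free_gens G X using X(3) by unfold_locales auto
    show ?thesis using commute_with_conj comm in_gen X(2) by blast
  qed
qed

section \<open>Torsion-free abelian groups of finite rank\<close>

fun lincomb_upto :: "('a, 'c) monoid_scheme \<Rightarrow> (nat \<Rightarrow> 'a) \<Rightarrow> (nat \<Rightarrow> int) \<Rightarrow> nat \<Rightarrow> 'a" where
  "lincomb_upto G e k 0 = \<one>\<^bsub>G\<^esub>"
| "lincomb_upto G e k (Suc n) = lincomb_upto G e k n \<otimes>\<^bsub>G\<^esub> e n [^]\<^bsub>G\<^esub> k n"

text \<open>Spanning over the rationals with the denominators cleared; \<open>d\<close> bounds the
  rank from above and need not equal it.\<close>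

definition rat_spanned :: "('a, 'c) monoid_scheme \<Rightarrow> nat \<Rightarrow> (nat \<Rightarrow> 'a) \<Rightarrow> bool" where
  "rat_spanned G d e \<longleftrightarrow> (\<forall>j<d. e j \<in> carrier G) \<and>
     (\<forall>a\<in>carrier G. \<exists>N::nat. 0 < N \<and> (\<exists>k. a [^]\<^bsub>G\<^esub> N = lincomb_upto G e k d))"

text \<open>Fraction-free elimination: a row \<open>r\<close> with nonzero entry at
  \<open>j0\<close> clears that column from the other rows by cross-multiplication, leaving one
  equation and one unknown less.\<close>

lemma int_kernel_nontrivial:
  fixes K :: "'i \<Rightarrow> 'j \<Rightarrow> int"
  assumes "finite J" "finite I" "card J < card I"
  shows "\<exists>c. (\<exists>i\<in>I. c i \<noteq> 0) \<and> (\<forall>j\<in>J. (\<Sum>i\<in>I. c i * K i j) = 0)"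
  using assms
proof (induction J arbitrary: I K rule: finite_induct)
  case empty
  then have "I \<noteq> {}" by auto
  then show ?case by (intro exI[of _ "\<lambda>_. 1"]) auto
next
  case (insert j0 J)
  show ?case
  proof (cases "\<forall>i\<in>I. K i j0 = 0")
    case True
    have "card J < card I" using insert by simp
    then obtain c where c: "\<exists>i\<in>I. c i \<noteq> 0" "\<forall>j\<in>J. (\<Sum>i\<in>I. c i * K i j) = 0"
      using insert.IH insert.prems by blast
    then show ?thesis using True by (intro exI[of _ c]) auto
  next
    case False
    then obtain r where r: "r \<in> I" "K r j0 \<noteq> 0" by blast
    define I' where "I' = I - {r}"
    have I': "finite I'" "card J < card I'" "I = insert r I'" "r \<notin> I'"
      using insert r by (auto simp: I'_def)
    define K' where "K' i j = K r j0 * K i j - K i j0 * K r j" for i j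
    obtain c where c: "\<exists>i\<in>I'. c i \<noteq> 0" "\<forall>j\<in>J. (\<Sum>i\<in>I'. c i * K' i j) = 0"
      using insert.IH[of I' K'] I' by blast
    \<comment> \<open>The entry at \<open>r\<close> is chosen to solve the equation
      \<open>j0\<close>; scaling the others by the nonzero pivot keeps them integral and nonzero
      wherever \<open>c\<close> is.\<close>
    define c' where "c' i = (if i = r then - (\<Sum>i\<in>I'. c i * K i j0) else K r j0 * c i)" for i
    have sum: "(\<Sum>i\<in>I. c' i * K i j) = (\<Sum>i\<in>I'. c i * K' i j)" for j
    proof -
      have "(\<Sum>i\<in>I. c' i * K i j) = c' r * K r j + (\<Sum>i\<in>I'. c' i * K i j)"
        using I' by simp
      also have "(\<Sum>i\<in>I'. c' i * K i j) = (\<Sum>i\<in>I'. K r j0 * c i * K i j)"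
        using I' by (intro sum.cong) (auto simp: c'_def)
      also have "c' r * K r j = - (\<Sum>i\<in>I'. c i * K i j0 * K r j)"
        by (simp add: c'_def sum_distrib_right)
      finally show ?thesis
        by (simp add: K'_def algebra_simps sum_subtractf sum.distrib)
    qed
    have "\<forall>j\<in>insert j0 J. (\<Sum>i\<in>I. c' i * K i j) = 0"
      using c(2) by (auto simp: sum) (simp add: K'_def)
    moreover have "\<exists>i\<in>I. c' i \<noteq> 0"
      using c(1) r I' by (auto simp: c'_def)
    ultimately show ?thesis by blast
  qed
qed

locale abelian_grp = comm_group G for G :: "'a monoid" (structure)
begin

lemma lincomb_closed: "\<forall>j<d. e j \<in> carrier G \<Longrightarrow> lincomb_upto G e k d \<in> carrier G"
  by (induction d) auto

lemma lincomb_add: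
  "\<forall>j<d. e j \<in> carrier G \<Longrightarrow>
    lincomb_upto G e (\<lambda>j. k j + l j) d = lincomb_upto G e k d \<otimes> lincomb_upto G e l d"
proof (induction d)
  case (Suc d)
  then have "e d \<in> carrier G" "\<forall>j<d. e j \<in> carrier G" by auto
  then show ?case using Suc.IH lincomb_closed[of d e] by (simp add: int_pow_mult m_ac)
qed simp

lemma lincomb_smult:
  "\<forall>j<d. e j \<in> carrier G \<Longrightarrow>
    lincomb_upto G e (\<lambda>j. c * k j) d = lincomb_upto G e k d [^] (c::int)"
proof (induction d)
  case (Suc d)
  then have "e d \<in> carrier G" "\<forall>j<d. e j \<in> carrier G" by auto
  then show ?case using Suc.IH lincomb_closed[of d e]
    by (simp add: int_pow_distrib int_pow_pow mult.commute)
qed simp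

lemma lincomb_zero: "\<forall>j<d. k j = 0 \<Longrightarrow> lincomb_upto G e k d = \<one>"
  by (induction d) auto

lemma lincomb_cong: "\<forall>j<d. k j = l j \<Longrightarrow> \<forall>j<d. e j = f j \<Longrightarrow> lincomb_upto G e k d = lincomb_upto G f l d"
  by (induction d) auto

lemma lincomb_lincomb:
  assumes e: "\<forall>j<d. e j \<in> carrier G" and y: "\<forall>i<n. y i \<in> carrier G"
    and N: "\<forall>i<n. y i [^] (N i :: nat) = lincomb_upto G e (K i) d"
  shows "lincomb_upto G y (\<lambda>i. c i * int (N i)) n = lincomb_upto G e (\<lambda>j. \<Sum>i<n. c i * K i j) d"
  using y N
proof (induction n)
  case 0
  then show ?case using lincomb_zero by simp
next
  case (Suc n)
  have "y n [^] (c n * int (N n)) = (y n [^] int (N n)) [^] c n"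
    using Suc.prems by (simp add: int_pow_pow mult.commute)
  also have "\<dots> = lincomb_upto G e (\<lambda>j. c n * K n j) d"
    using Suc.prems e by (simp add: int_pow_int lincomb_smult)
  finally show ?case using Suc e by (simp add: lincomb_add)
qed

lemma int_pow_eq_one_torsion_free:
  assumes "torsion_free G (carrier G)" "a \<in> carrier G" "a [^] (c::int) = \<one>" "c \<noteq> 0"
  shows "a = \<one>"
proof (cases c rule: int_cases2)
  case (nonneg n)
  then show ?thesis using assms by (auto simp: torsion_free_def int_pow_int)
next
  case (nonpos n)
  then have "inv (a [^] n) = \<one>" using assms by (simp add: int_pow_neg_int)
  then have "a [^] n = \<one>" using assms by (metis inv_inv inv_one nat_pow_closed)
  then show ?thesis using assms nonpos by (auto simp: torsion_free_def)
qed

text \<open>After clearing denominators each \<open>y i\<close> has integer coordinates in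
  \<open>e\<close>; with more vectors than coordinates the coordinate matrix has an integral kernel
  vector.\<close>

lemma rat_spanned_dependent:
  assumes sp: "rat_spanned G d e" and y: "\<forall>i<n. y i \<in> carrier G" and n: "d < n"
  shows "\<exists>c. (\<exists>i<n. c i \<noteq> 0) \<and> lincomb_upto G y c n = \<one>"
proof -
  have e: "\<forall>j<d. e j \<in> carrier G" using sp by (simp add: rat_spanned_def)
  have "\<forall>i. \<exists>N K. i < n \<longrightarrow> 0 < N \<and> y i [^] (N::nat) = lincomb_upto G e K d"
    using sp y unfolding rat_spanned_def by blast
  then obtain N K where NK: "\<And>i. i < n \<Longrightarrow> 0 < N i \<and> y i [^] (N i::nat) = lincomb_upto G e (K i) d"
    by metis
  obtain c where c: "\<exists>i\<in>{..<n}. c i \<noteq> 0" "\<forall>j\<in>{..<d}. (\<Sum>i\<in>{..<n}. c i * K i j) = 0"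
    using int_kernel_nontrivial[of "{..<d}" "{..<n}" K] n by auto
  have "lincomb_upto G y (\<lambda>i. c i * int (N i)) n = lincomb_upto G e (\<lambda>j. \<Sum>i<n. c i * K i j) d"
    using lincomb_lincomb e y NK by blast
  also have "\<dots> = \<one>" using c(2) by (intro lincomb_zero) auto
  finally show ?thesis using c(1) NK by (intro exI[of _ "\<lambda>i. c i * int (N i)"]) fastforce
qed

end

section \<open>Endomorphisms of finite rank groups and integer polynomials\<close>

locale group_endo = abelian_grp G for G :: "'a monoid" (structure) +
  fixes \<phi> :: "'a \<Rightarrow> 'a"
  assumes endo: "\<phi> \<in> hom G G"
begin

text \<open>The module structure over the integer polynomial ring in which the variable acts as \<open>\<phi>\<close>.\<close>

definition poly_app :: "int poly \<Rightarrow> 'a \<Rightarrow> 'a" where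
  "poly_app P x = fold_coeffs (\<lambda>c acc. x [^] c \<otimes> \<phi> acc) P \<one>"

lemma phi_closed [simp]: "x \<in> carrier G \<Longrightarrow> \<phi> x \<in> carrier G"
  using endo by (auto simp: hom_def)

lemma phi_mult: "x \<in> carrier G \<Longrightarrow> y \<in> carrier G \<Longrightarrow> \<phi> (x \<otimes> y) = \<phi> x \<otimes> \<phi> y"
  using endo by (auto simp: hom_def)

lemma phi_one [simp]: "\<phi> \<one> = \<one>"
  using hom_one[OF endo is_group is_group] .

lemma phi_int_pow: "x \<in> carrier G \<Longrightarrow> \<phi> (x [^] (c::int)) = \<phi> x [^] c"
  using hom_int_pow[OF endo _ is_group is_group] by simp

lemma poly_app_0 [simp]: "poly_app 0 x = \<one>"
  by (simp add: poly_app_def)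

lemma poly_app_pCons: "poly_app (pCons c P) x = x [^] c \<otimes> \<phi> (poly_app P x)"
  by (cases "c = 0 \<and> P = 0") (auto simp: poly_app_def)

lemma poly_app_closed [simp]: "x \<in> carrier G \<Longrightarrow> poly_app P x \<in> carrier G"
  by (induction P) (auto simp: poly_app_pCons)

lemma poly_app_add: "x \<in> carrier G \<Longrightarrow> poly_app (P + Q) x = poly_app P x \<otimes> poly_app Q x"
  by (induction P Q rule: poly_induct2) (simp_all add: poly_app_pCons phi_mult int_pow_mult m_ac)

lemma poly_app_smult: "x \<in> carrier G \<Longrightarrow> poly_app (Polynomial.smult c P) x = poly_app P x [^] c"
  by (induction P) (simp_all add: poly_app_pCons phi_int_pow int_pow_distrib int_pow_pow mult.commute)

lemma poly_app_mult_arg: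
  "x \<in> carrier G \<Longrightarrow> y \<in> carrier G \<Longrightarrow> poly_app P (x \<otimes> y) = poly_app P x \<otimes> poly_app P y"
  by (induction P) (simp_all add: poly_app_pCons phi_mult int_pow_distrib m_ac)

lemma poly_app_hom: "poly_app P \<in> hom G G"
  using poly_app_mult_arg by (auto simp: hom_def)

lemma poly_app_mult: "x \<in> carrier G \<Longrightarrow> poly_app (P * Q) x = poly_app P (poly_app Q x)"
  by (induction P) (simp_all add: poly_app_pCons poly_app_add poly_app_smult)

lemma poly_app_const: "x \<in> carrier G \<Longrightarrow> poly_app [:c:] x = x [^] c"
  by (simp add: poly_app_pCons)

lemma poly_app_monom: "x \<in> carrier G \<Longrightarrow> poly_app (monom c n) x = (\<phi> ^^ n) x [^] c"
proof (induction n)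
  case 0
  then show ?case by (simp add: monom_0 poly_app_const)
next
  case (Suc n)
  have "(\<phi> ^^ n) x \<in> carrier G" using Suc.prems by (induction n) auto
  then show ?case using Suc by (simp add: monom_Suc poly_app_pCons phi_int_pow)
qed

lemma funpow_phi_closed [simp]: "x \<in> carrier G \<Longrightarrow> (\<phi> ^^ n) x \<in> carrier G"
  by (induction n) auto

lemma funpow_phi_hom: "\<phi> ^^ n \<in> hom G G"
  by (induction n) (auto simp: hom_def phi_mult)

text \<open>For one element, the orbit under \<open>\<phi>\<close> becomes dependent after
  \<open>d\<close> steps. Annihilators for the \<open>e j\<close> are multiplied up, each new factor
  being chosen to kill the image of the next \<open>e n\<close>; torsion-freeness passes from the
  span to elements with a multiple in it.\<close>

lemma rat_spanned_annihilator:
  assumes tf: "torsion_free G (carrier G)" and sp: "rat_spanned G d e"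
  shows "\<exists>P. P \<noteq> 0 \<and> (\<forall>x\<in>carrier G. poly_app P x = \<one>)"
proof -
  have e: "\<forall>j<d. e j \<in> carrier G" using sp by (simp add: rat_spanned_def)
  have single: "\<exists>P. P \<noteq> 0 \<and> poly_app P x = \<one>" if x: "x \<in> carrier G" for x
  proof -
    obtain c where c: "\<exists>i<Suc d. c i \<noteq> 0" "lincomb_upto G (\<lambda>i. (\<phi> ^^ i) x) c (Suc d) = \<one>"
      using rat_spanned_dependent[OF sp, of "Suc d" "\<lambda>i. (\<phi> ^^ i) x"] x by auto
    define P where "P n = (\<Sum>i<n. monom (c i) i)" for n
    have "poly_app (P n) x = lincomb_upto G (\<lambda>i. (\<phi> ^^ i) x) c n" for n
      using x by (induction n) (simp_all add: P_def poly_app_add poly_app_monom)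
    moreover have "P (Suc d) \<noteq> 0"
    proof -
      obtain i where i: "i < Suc d" "c i \<noteq> 0" using c by blast
      have "coeff (P (Suc d)) i = (\<Sum>j<Suc d. if j = i then c j else 0)"
        unfolding P_def coeff_sum by (intro sum.cong) auto
      also have "\<dots> = c i" using i by (subst sum.delta) auto
      finally show ?thesis using i by auto
    qed
    ultimately show ?thesis using c by metis
  qed
  have "\<exists>P. P \<noteq> 0 \<and> (\<forall>j<n. poly_app P (e j) = \<one>)" if "n \<le> d" for n
    using that
  proof (induction n)
    case 0
    show ?case by (intro exI[of _ 1]) auto
  next
    case (Suc n)
    then obtain P where P: "P \<noteq> 0" "\<forall>j<n. poly_app P (e j) = \<one>" by auto
    obtain Q where Q: "Q \<noteq> 0" "poly_app Q (poly_app P (e n)) = \<one>"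
      using single[of "poly_app P (e n)"] e Suc.prems by auto
    have Q1: "poly_app Q \<one> = \<one>" using hom_one[OF poly_app_hom is_group is_group] .
    show ?case
      using P Q Q1 e Suc.prems
      by (intro exI[of _ "Q * P"]) (auto simp: poly_app_mult less_Suc_eq)
  qed
  then obtain P where P: "P \<noteq> 0" "\<forall>j<d. poly_app P (e j) = \<one>" by blast
  have lc: "poly_app P (lincomb_upto G e k n) = \<one>" if "n \<le> d" for n k
    using that
  proof (induction n)
    case 0
    then show ?case using hom_one[OF poly_app_hom is_group is_group] by simp
  next
    case (Suc n)
    have "poly_app P (e n [^] k n) = poly_app P (e n) [^] k n"
      using hom_int_pow[OF poly_app_hom _ is_group is_group] e Suc.prems by simp
    then show ?case using Suc P e by (simp add: poly_app_mult_arg lincomb_closed)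
  qed
  have "poly_app P x = \<one>" if x: "x \<in> carrier G" for x
  proof -
    obtain N k where N: "0 < N" "x [^] (N::nat) = lincomb_upto G e k d"
      using sp x unfolding rat_spanned_def by blast
    then have "poly_app P x [^] N = \<one>"
      using hom_nat_pow[OF poly_app_hom[of P] x is_group is_group, of N] lc[of d k] by simp
    then show ?thesis using tf x N unfolding torsion_free_def by (meson poly_app_closed)
  qed
  then show ?thesis using P by blast
qed

text \<open>Take an annihilating polynomial and let m be its lowest nonzero coefficient. Injectivity
  cancels the powers of \<open>\<phi>\<close> in front of it, and the remaining equation exhibits m
  x as a value of \<open>\<phi>\<close>.\<close>

lemma inj_cokernel_bounded:
  assumes tf: "torsion_free G (carrier G)" and sp: "rat_spanned G d e"
    and inj: "inj_on \<phi> (carrier G)"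
  shows "\<exists>m::int. m \<noteq> 0 \<and> (\<forall>x\<in>carrier G. \<exists>y\<in>carrier G. x [^] m = \<phi> y)"
proof -
  have step: "\<exists>m::int. m \<noteq> 0 \<and> (\<forall>x\<in>carrier G. \<exists>y\<in>carrier G. x [^] m = \<phi> y)"
    if "P \<noteq> 0" "\<forall>x\<in>carrier G. poly_app P x = \<one>" for P
    using that
  proof (induction P)
    case (pCons c P)
    have eq: "x [^] c \<otimes> \<phi> (poly_app P x) = \<one>" if "x \<in> carrier G" for x
      using pCons.prems that by (simp add: poly_app_pCons)
    show ?case
    proof (cases "c = 0")
      case True
      have "poly_app P x = \<one>" if x: "x \<in> carrier G" for x
      proof -
        have "\<phi> (poly_app P x) = \<phi> \<one>" using eq[OF x] x True by simp
        then show ?thesis using inj_onD[OF inj] x by simp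
      qed
      then show ?thesis using pCons True by auto
    next
      case False
      have "x [^] c = \<phi> (inv (poly_app P x))" if x: "x \<in> carrier G" for x
      proof -
        have "\<phi> (inv (poly_app P x)) = inv (\<phi> (poly_app P x))"
          using phi_int_pow[of "poly_app P x" "-1"] x by (simp add: int_pow_neg)
        then show ?thesis using eq[OF x] x by (metis int_pow_closed inv_equality inv_inv phi_closed poly_app_closed)
      qed
      then show ?thesis using False by (intro exI[of _ c]) (metis inv_closed poly_app_closed)
    qed
  qed simp
  obtain P where "P \<noteq> 0" "\<forall>x\<in>carrier G. poly_app P x = \<one>"
    using rat_spanned_annihilator[OF tf sp] by blast
  then show ?thesis by (rule step)
qed

lemma poly_app_intertwine:
  assumes "group_endo G \<psi>" and t: "t \<in> hom G G" and eq: "\<And>x. x \<in> carrier G \<Longrightarrow> t (\<phi> x) = \<psi> (t x)"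
    and x: "x \<in> carrier G"
  shows "t (poly_app P x) = group_endo.poly_app G \<psi> P (t x)"
proof -
  interpret psi: group_endo G \<psi> by fact
  interpret T: group_endo G t by unfold_locales (rule t)
  show ?thesis using x
    by (induction P) (simp_all add: poly_app_pCons psi.poly_app_pCons T.phi_mult T.phi_int_pow eq)
qed

text \<open>Substituting X^k for the variable replaces \<open>\<phi>\<close> by its k-th iterate; in
  this form an annihilator returns after conjugation by \<open>t\<close>.\<close>

lemma poly_app_pcompose_monom:
  assumes x: "x \<in> carrier G"
  shows "poly_app (P \<circ>\<^sub>p monom 1 k) x = group_endo.poly_app G (\<phi> ^^ k) P x"
proof -
  interpret K: group_endo G "\<phi> ^^ k" by unfold_locales (rule funpow_phi_hom)
  show ?thesis using x
    by (induction P) (simp_all add: pcompose_pCons K.poly_app_pCons poly_app_add poly_app_mult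
        poly_app_const poly_app_monom)
qed

end

lemma ex_min_degree:
  assumes "A P" "P \<noteq> 0"
  shows "\<exists>R::int poly. R \<noteq> 0 \<and> A R \<and> (\<forall>Q. Q \<noteq> 0 \<longrightarrow> A Q \<longrightarrow> degree R \<le> degree Q)"
  using assms
proof (induction "degree P" arbitrary: P rule: less_induct)
  case less
  then show ?case by (metis not_le)
qed

text \<open>Integral form of divisibility by a minimal polynomial: pseudo-division leaves a
  remainder of smaller degree that again satisfies \<open>A\<close>, so it vanishes. It serves both
  for annihilators of an endomorphism and for polynomials vanishing at a complex number.\<close>

lemma minimal_poly_dvd:
  fixes R Q :: "int poly"
  assumes "R \<noteq> 0" and ideal: "\<And>P. A P \<Longrightarrow> P \<noteq> 0 \<Longrightarrow> degree R \<le> degree P"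
    and rem: "\<And>a h. A (Polynomial.smult a Q - R * h)"
  shows "\<exists>a h. a \<noteq> 0 \<and> Polynomial.smult a Q = R * h"
proof -
  obtain q r where qr: "pseudo_divmod Q R = (q, r)" by (cases "pseudo_divmod Q R")
  define a where "a = coeff R (degree R) ^ (Suc (degree Q) - degree R)"
  have e: "Polynomial.smult a Q = R * q + r" "r = 0 \<or> degree r < degree R"
    using pseudo_divmod[OF \<open>R \<noteq> 0\<close> qr] by (auto simp: a_def)
  have "r = Polynomial.smult a Q - R * q" using e by simp
  then have "r = 0" using ideal[of r] rem[of a q] e(2) by (metis not_le)
  moreover have "a \<noteq> 0" using \<open>R \<noteq> 0\<close> by (simp add: a_def)
  ultimately show ?thesis using e by auto
qed

context group_endo
begin

text \<open>Conjugation by \<open>t\<close> makes the minimal annihilator \<open>P\<close> divide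
  P(X^k) up to a constant, so its finite set of complex roots is closed under k-th powers; the roots
  are nonzero and hence roots of unity. The minimal polynomial \<open>R\<close> of such a root
  divides \<open>P\<close> and X^n - 1 up to constants, and minimality of \<open>P\<close> provides
  a nonzero element killed by \<open>R\<close>, which is then fixed by the n-th iterate of
  \<open>\<phi>\<close>.\<close>

theorem root_of_unity_fixed_point:
  assumes tf: "torsion_free G (carrier G)" and sp: "rat_spanned G d e"
    and inj: "inj_on \<phi> (carrier G)" and nontriv: "carrier G \<noteq> {\<one>}"
    and t: "t \<in> hom G G" "t ` carrier G = carrier G"
    and conj: "\<And>x. x \<in> carrier G \<Longrightarrow> t (\<phi> x) = (\<phi> ^^ k) (t x)" and k: "2 \<le> k"
  shows "\<exists>n>0. \<exists>y\<in>carrier G. y \<noteq> \<one> \<and> (\<phi> ^^ n) y = y"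
proof -
  define Ann where "Ann P \<longleftrightarrow> (\<forall>x\<in>carrier G. poly_app P x = \<one>)" for P
  obtain P where P: "P \<noteq> 0" "Ann P" and Pmin: "\<And>Q. Q \<noteq> 0 \<Longrightarrow> Ann Q \<Longrightarrow> degree P \<le> degree Q"
    using rat_spanned_annihilator[OF tf sp] ex_min_degree[of Ann] unfolding Ann_def by blast
  have Ann_comb: "Ann (Polynomial.smult a Q - P * h)" if "Ann Q" for a Q h
  proof -
    have "poly_app (Polynomial.smult a Q - P * h) x = \<one>" if x: "x \<in> carrier G" for x
    proof -
      have "Polynomial.smult a Q - P * h = Polynomial.smult a Q + P * Polynomial.smult (-1) h" by simp
      then show ?thesis using x \<open>Ann Q\<close> P unfolding Ann_def
        by (simp only: poly_app_add poly_app_smult poly_app_mult poly_app_closed int_pow_one) simp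
    qed
    then show ?thesis by (simp add: Ann_def)
  qed
  have degP: "degree P > 0"
  proof (rule ccontr)
    assume "\<not> degree P > 0"
    then obtain c where c: "P = [:c:]" using degree_eq_zeroE by blast
    have "x = \<one>" if "x \<in> carrier G" for x
      using int_pow_eq_one_torsion_free[OF tf that, of c] P c that by (auto simp: Ann_def poly_app_const)
    then show False using nontriv one_closed by blast
  qed
  \<comment> \<open>Injectivity would allow a factor X of \<open>P\<close> to be cancelled, against
    minimality; this excludes the root 0, for which the orbit argument would say nothing.\<close>
  have P0: "coeff P 0 \<noteq> 0"
  proof
    assume "coeff P 0 = 0"
    then obtain P' where P': "P = pCons 0 P'" by (metis coeff_pCons_0 pCons_cases)
    have "poly_app P' x = \<one>" if x: "x \<in> carrier G" for x
    proof -
      have "\<phi> (poly_app P' x) = \<phi> \<one>" using P(2) x P' by (simp add: Ann_def poly_app_pCons)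
      then show ?thesis using inj_onD[OF inj] x by simp
    qed
    then have "degree P \<le> degree P'" using Pmin[of P'] P(1) P' by (auto simp: Ann_def)
    then show False using P' P(1) by (auto split: if_splits)
  qed
  have AnnC: "Ann (P \<circ>\<^sub>p monom 1 k)"
    unfolding Ann_def
  proof
    fix x assume "x \<in> carrier G"
    then obtain x' where x': "x' \<in> carrier G" "x = t x'" using t by blast
    interpret K: group_endo G "\<phi> ^^ k" by unfold_locales (rule funpow_phi_hom)
    have "t (poly_app P x') = K.poly_app P (t x')"
      using poly_app_intertwine[OF K.group_endo_axioms t(1) conj x'(1)] .
    moreover have "t \<one> = \<one>" using hom_one[OF t(1) is_group is_group] .
    ultimately have "K.poly_app P x = \<one>" using P(2) x' by (simp add: Ann_def)
    then show "poly_app (P \<circ>\<^sub>p monom 1 k) x = \<one>"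
      using poly_app_pcompose_monom \<open>x \<in> carrier G\<close> by simp
  qed
  obtain a h where ah: "a \<noteq> 0" "Polynomial.smult a (P \<circ>\<^sub>p monom 1 k) = P * h"
    using minimal_poly_dvd[where A = Ann, OF P(1) Pmin Ann_comb[OF AnnC]] by blast
  define cpx :: "int poly \<Rightarrow> complex poly" where "cpx = map_poly of_int"
  have cpx_hom: "cpx (p * q) = cpx p * cpx q" "cpx (p - q) = cpx p - cpx q"
     "cpx (Polynomial.smult c p) = Polynomial.smult (of_int c) (cpx p)" "degree (cpx p) = degree p" for p q c
    by (simp_all add: cpx_def of_int_poly_hom.hom_mult of_int_poly_hom.hom_minus of_int_hom.map_poly_hom_smult)
  define Z where "Z = {z. poly (cpx P) z = 0}"
  have "cpx P \<noteq> 0" using cpx_hom(4)[of P] degP by auto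
  then have finZ: "finite Z" unfolding Z_def by (rule poly_roots_finite)
  have cpx_comp: "poly (cpx (p \<circ>\<^sub>p monom 1 k)) z = poly (cpx p) (z ^ k)" for p z
  proof -
    have "cpx (p \<circ>\<^sub>p monom 1 k) = cpx p \<circ>\<^sub>p monom 1 k"
      unfolding cpx_def by (simp add: of_int_hom.map_poly_pcompose)
    then show ?thesis by (simp add: poly_pcompose poly_monom)
  qed
  have Zk: "z ^ k \<in> Z" if "z \<in> Z" for z
  proof -
    have "poly (cpx (Polynomial.smult a (P \<circ>\<^sub>p monom 1 k))) z = 0"
      using that ah(2) by (simp add: cpx_hom(1) Z_def)
    then show ?thesis using ah(1) by (simp add: cpx_hom(3) cpx_comp Z_def)
  qed
  obtain z where z: "z \<in> Z"
    using fundamental_theorem_of_algebra[of "cpx P"] constant_degree[of "cpx P"] degP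
    unfolding Z_def by (auto simp: cpx_hom(4))
  have z0: "z \<noteq> 0"
  proof
    assume "z = 0"
    then have "coeff (cpx P) 0 = 0" using z by (simp add: Z_def poly_0_coeff_0)
    then show False using P0 by (simp add: cpx_def)
  qed
  have orbit: "z ^ (k ^ i) \<in> Z" for i
  proof (induction i)
    case (Suc i)
    have "z ^ (k ^ Suc i) = (z ^ (k ^ i)) ^ k" by (simp add: power_mult[symmetric] mult.commute)
    then show ?case using Zk[OF Suc] by simp
  qed (simp add: z)
  have "\<not> inj (\<lambda>i. z ^ (k ^ i))"
    using finZ orbit by (meson finite_subset image_subsetI infinite_UNIV_nat finite_imageD)
  then obtain i j where ij: "i < j" "z ^ (k ^ i) = z ^ (k ^ j)"
    by (metis injI linorder_neqE_nat)
  define n where "n = k ^ j - k ^ i"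
  have lt: "k ^ i < k ^ j" using ij(1) k by simp
  have n: "n > 0" using lt by (simp add: n_def)
  have zn: "z ^ n = 1"
  proof -
    have "k ^ i + n = k ^ j" using lt by (simp add: n_def)
    then have "z ^ (k ^ i) * z ^ n = z ^ (k ^ j)" by (metis power_add)
    then have "z ^ (k ^ i) * z ^ n = z ^ (k ^ i) * 1"
      using ij(2) by simp
    then show ?thesis using z0 by simp
  qed
  define Rt where "Rt Q \<longleftrightarrow> poly (cpx Q) z = 0" for Q
  obtain R where R: "R \<noteq> 0" "Rt R" and Rmin: "\<And>Q. Q \<noteq> 0 \<Longrightarrow> Rt Q \<Longrightarrow> degree R \<le> degree Q"
    using ex_min_degree[of Rt P] P(1) z unfolding Rt_def Z_def by blast
  have Rt_comb: "Rt (Polynomial.smult a Q - R * h)" if "Rt Q" for a Q h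
    using that R(2) by (simp add: Rt_def cpx_hom)
  have degR: "degree R > 0"
  proof (rule ccontr)
    assume "\<not> degree R > 0"
    then obtain c where c: "R = [:c:]" using degree_eq_zeroE by blast
    then show False using R by (auto simp: Rt_def cpx_def)
  qed
  have "Rt P" using z by (simp add: Rt_def Z_def)
  obtain b g where bg: "b \<noteq> 0" "Polynomial.smult b P = R * g"
    using minimal_poly_dvd[where A = Rt, OF R(1) Rmin Rt_comb[OF \<open>Rt P\<close>]] by blast
  have Rtn: "Rt (monom 1 n - 1)"
    using zn by (simp add: Rt_def cpx_def of_int_poly_hom.hom_minus poly_monom map_poly_monom)
  obtain b' g' where bg': "b' \<noteq> 0" "Polynomial.smult b' (monom 1 n - 1) = R * g'"
    using minimal_poly_dvd[where A = Rt, OF R(1) Rmin Rt_comb[OF Rtn]] by blast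
  have g0: "g \<noteq> 0" using bg P(1) by auto
  \<comment> \<open>The cofactor \<open>g\<close> has smaller degree than \<open>P\<close> and so
    does not annihilate the group; each of its values is killed by \<open>R\<close>.\<close>
  have "degree P = degree R + degree g" using bg g0 R(1) by (metis degree_mult_eq degree_smult_eq)
  then have "\<not> Ann g" using Pmin[OF g0] degR by auto
  then obtain x where x: "x \<in> carrier G" "poly_app g x \<noteq> \<one>" by (auto simp: Ann_def)
  define y where "y = poly_app g x"
  have y: "y \<in> carrier G" "y \<noteq> \<one>" using x by (auto simp: y_def)
  have "poly_app R y = poly_app (Polynomial.smult b P) x" using x bg by (simp add: y_def poly_app_mult)
  also have "\<dots> = \<one>" using x P(2) by (simp add: poly_app_smult Ann_def)
  finally have "poly_app (R * g') y = \<one>"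
    using y hom_one[OF poly_app_hom is_group is_group] by (simp add: mult.commute[of R] poly_app_mult)
  then have "poly_app (monom 1 n - 1) y [^] b' = \<one>" using y by (simp add: bg'(2)[symmetric] poly_app_smult)
  then have "poly_app (monom 1 n - 1) y = \<one>"
    using int_pow_eq_one_torsion_free[OF tf] y bg'(1) by simp
  moreover have "poly_app (monom 1 n - 1) y = (\<phi> ^^ n) y \<otimes> inv y"
  proof -
    have "monom 1 n - 1 = monom 1 n + [:-1 :: int:]" by (simp add: poly_eq_iff coeff_pCons split: nat.split)
    then show ?thesis using y by (simp only: poly_app_add poly_app_monom poly_app_const) (simp add: int_pow_neg)
  qed
  ultimately have "(\<phi> ^^ n) y = y" using y by (metis inv_equality inv_inv funpow_phi_closed inv_closed)
  then show ?thesis using n y by blast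
qed

end

section \<open>Quotients of a finite rank group by its multiples\<close>

context abelian_grp
begin

text \<open>For prime \<open>p\<close>: linear independence of the classes of the \<open>y i\<close>
  in G/pG over the field with p elements.\<close>

definition pow_indep :: "nat \<Rightarrow> nat \<Rightarrow> (nat \<Rightarrow> 'a) \<Rightarrow> bool" where
  "pow_indep p n y \<longleftrightarrow> (\<forall>i<n. y i \<in> carrier G) \<and>
     (\<forall>c. (\<exists>w\<in>carrier G. lincomb_upto G y c n = w [^] p) \<longrightarrow> (\<forall>i<n. int p dvd c i))"

text \<open>Descent shows that independence modulo \<open>p\<close> implies independence over the
  integers: all coefficients of an integer relation are divisible by \<open>p\<close>,
  torsion-freeness allows dividing by \<open>p\<close>, and the sum of the absolute values
  decreases.\<close>

lemma pow_indep_bound: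
  assumes tf: "torsion_free G (carrier G)" and sp: "rat_spanned G d e" and p: "prime p"
    and ind: "pow_indep p n y"
  shows "n \<le> d"
proof (rule ccontr)
  assume "\<not> n \<le> d"
  have y: "\<forall>i<n. y i \<in> carrier G" using ind by (simp add: pow_indep_def)
  obtain c where c: "\<exists>i<n. c i \<noteq> 0" "lincomb_upto G y c n = \<one>"
    using rat_spanned_dependent[OF sp y] \<open>\<not> n \<le> d\<close> by auto
  have "False" if "\<exists>i<n. c i \<noteq> 0" "lincomb_upto G y c n = \<one>" for c
    using that
  proof (induction "\<Sum>i<n. nat \<bar>c i\<bar>" arbitrary: c rule: less_induct)
    case less
    have "\<one> [^] p = \<one>" by simp
    then have dv: "\<forall>i<n. int p dvd c i" using ind less.prems(2) unfolding pow_indep_def by (metis one_closed)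
    define c' where "c' i = c i div int p" for i
    have cc: "\<forall>i<n. c i = int p * c' i" using dv by (auto simp: c'_def)
    have p1: "p > 1" using p prime_gt_1_nat by blast
    have "lincomb_upto G y c' n [^] int p = lincomb_upto G y (\<lambda>i. int p * c' i) n"
      using lincomb_smult[OF y] by simp
    also have "\<dots> = \<one>" using less.prems(2) lincomb_cong[of n c "\<lambda>i. int p * c' i" y y] cc by simp
    finally have "lincomb_upto G y c' n = \<one>"
      using int_pow_eq_one_torsion_free[OF tf lincomb_closed[OF y]] p1 by force
    moreover have nz: "\<exists>i<n. c' i \<noteq> 0" using less.prems(1) cc by auto
    moreover have "(\<Sum>i<n. nat \<bar>c' i\<bar>) < (\<Sum>i<n. nat \<bar>c i\<bar>)"
    proof (rule sum_strict_mono_ex1)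
      have abs: "nat \<bar>c i\<bar> = p * nat \<bar>c' i\<bar>" if "i < n" for i
        using cc that by (simp add: abs_mult nat_mult_distrib)
      show "\<forall>i\<in>{..<n}. nat \<bar>c' i\<bar> \<le> nat \<bar>c i\<bar>" using abs p1 by auto
      show "\<exists>i\<in>{..<n}. nat \<bar>c' i\<bar> < nat \<bar>c i\<bar>" using nz abs p1 by fastforce
    qed simp
    ultimately show ?case using less.hyps by blast
  qed
  then show False using c by blast
qed

text \<open>A maximal independent family spans G/pG; the representatives are its combinations with
  coefficients 0, ..., p - 1.\<close>

lemma finite_mod_prime:
  assumes tf: "torsion_free G (carrier G)" and sp: "rat_spanned G d e" and p: "prime (p::nat)"
  shows "\<exists>F. finite F \<and> F \<subseteq> carrier G \<and> (\<forall>x\<in>carrier G. \<exists>f\<in>F. \<exists>w\<in>carrier G. x = f \<otimes> w [^] p)"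
proof -
  have p1: "p > 1" using p prime_gt_1_nat by blast
  have "\<exists>y. pow_indep p 0 y" by (simp add: pow_indep_def)
  then obtain n where n: "\<exists>y. pow_indep p n y" "\<And>m. \<exists>y. pow_indep p m y \<Longrightarrow> m \<le> n"
    using Nat.ex_has_greatest_nat[of "\<lambda>m. \<exists>y. pow_indep p m y" 0 d] pow_indep_bound[OF tf sp p]
    by blast
  then obtain y where ind: "pow_indep p n y" by blast
  have y: "\<forall>i<n. y i \<in> carrier G" using ind by (simp add: pow_indep_def)
  define F where "F = (\<lambda>k. lincomb_upto G y k n) ` (\<Pi>\<^sub>E i\<in>{..<n}. {0..<int p})"
  have "finite F" unfolding F_def by (intro finite_imageI finite_PiE) auto
  moreover have "F \<subseteq> carrier G" using lincomb_closed[OF y] by (auto simp: F_def)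
  moreover have "\<exists>f\<in>F. \<exists>w\<in>carrier G. x = f \<otimes> w [^] p" if x: "x \<in> carrier G" for x
  proof -
    have red: "\<exists>f\<in>F. \<exists>w\<in>carrier G. lincomb_upto G y k n = f \<otimes> w [^] p" for k
    proof -
      define k1 where "k1 = restrict (\<lambda>i. k i mod int p) {..<n}"
      define k2 where "k2 i = k i div int p" for i
      have "lincomb_upto G y k n = lincomb_upto G y (\<lambda>i. k1 i + int p * k2 i) n"
        by (intro lincomb_cong) (auto simp: k1_def k2_def)
      also have "\<dots> = lincomb_upto G y k1 n \<otimes> lincomb_upto G y k2 n [^] p"
        using y by (simp add: lincomb_add lincomb_smult int_pow_int)
      finally have eq: "lincomb_upto G y k n = lincomb_upto G y k1 n \<otimes> lincomb_upto G y k2 n [^] p" .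
      have "k1 \<in> (\<Pi>\<^sub>E i\<in>{..<n}. {0..<int p})" using p1 by (simp add: k1_def)
      then have "lincomb_upto G y k1 n \<in> F" by (auto simp: F_def)
      then show ?thesis using eq lincomb_closed[OF y, of k2] by blast
    qed
    define y' where "y' = y(n := x)"
    have y': "\<forall>i<Suc n. y' i \<in> carrier G" using y x by (auto simp: y'_def)
    have "\<not> pow_indep p (Suc n) y'" using n(2) by (metis not_less_eq_eq order_refl)
    then obtain c w where c: "w \<in> carrier G" "lincomb_upto G y' c (Suc n) = w [^] p" "\<exists>i<Suc n. \<not> int p dvd c i"
      using y' unfolding pow_indep_def by blast
    have eq: "lincomb_upto G y c n \<otimes> x [^] c n = w [^] p"
      using c(2) lincomb_cong[of n c c y y'] by (simp add: y'_def)
    define L where "L = lincomb_upto G y c n"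
    have L: "L \<in> carrier G" using lincomb_closed[OF y] by (simp add: L_def)
    \<comment> \<open>If \<open>p\<close> divided the coefficient of \<open>x\<close>, that term
      could be absorbed into the p-fold multiple on the right, leaving a relation among the
      \<open>y i\<close> alone.\<close>
    have ndvd: "\<not> int p dvd c n"
    proof
      assume "int p dvd c n"
      then obtain q where q: "c n = int p * q" by (elim dvdE)
      have "L = w [^] p \<otimes> inv (x [^] c n)" using eq c(1) x L by (simp add: L_def[symmetric] inv_solve_right)
      also have "\<dots> = (w \<otimes> x [^] (- q)) [^] p"
        using c(1) x q by (simp add: int_pow_int[symmetric] int_pow_distrib int_pow_pow int_pow_neg[symmetric] mult.commute)
      finally have "\<forall>i<n. int p dvd c i"
        using ind c(1) x unfolding pow_indep_def L_def by (meson int_pow_closed m_closed)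
      then show False using c(3) \<open>int p dvd c n\<close> less_Suc_eq by auto
    qed
    then have "coprime (c n) (int p)" using p by (simp add: prime_imp_coprime coprime_commute)
    then obtain u v where uv: "u * c n + v * int p = 1"
      using bezout_int[of "c n" "int p"] by auto
    have "x = x [^] (u * c n + v * int p)" using uv x by simp
    also have "\<dots> = (x [^] c n) [^] u \<otimes> (x [^] v) [^] p"
      using x by (simp add: int_pow_mult int_pow_pow mult.commute int_pow_int[symmetric])
    also have "x [^] c n = inv L \<otimes> w [^] p" using eq x L c(1) by (simp add: L_def[symmetric] inv_solve_left)
    also have "(inv L \<otimes> w [^] p) [^] u = L [^] (- u) \<otimes> (w [^] u) [^] p"
      using L c(1) by (simp add: int_pow_distrib int_pow_inv int_pow_neg int_pow_pow int_pow_int[symmetric] mult.commute)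
    also have "L [^] (- u) \<otimes> (w [^] u) [^] p \<otimes> (x [^] v) [^] p = L [^] (- u) \<otimes> (w [^] u \<otimes> x [^] v) [^] p"
      using L c(1) x by (simp add: nat_pow_distrib m_assoc)
    also have "L [^] (- u) = lincomb_upto G y (\<lambda>i. (- u) * c i) n"
      unfolding L_def by (rule lincomb_smult[OF y, symmetric])
    finally have 1: "x = lincomb_upto G y (\<lambda>i. (- u) * c i) n \<otimes> (w [^] u \<otimes> x [^] v) [^] p" .
    obtain f w' where f: "f \<in> F" "w' \<in> carrier G" "lincomb_upto G y (\<lambda>i. (- u) * c i) n = f \<otimes> w' [^] p"
      using red by blast
    have "f \<in> carrier G" using f \<open>F \<subseteq> carrier G\<close> by blast
    then have "x = f \<otimes> (w' \<otimes> (w [^] u \<otimes> x [^] v)) [^] p"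
      using 1 f c(1) x by (simp add: nat_pow_distrib m_assoc)
    then show ?thesis using f c(1) x by blast
  qed
  ultimately show ?thesis by blast
qed

text \<open>One prime factor is split off at a time: x = a + p w and w = b + m' v give x = (a + p b)
  + m v.\<close>

lemma finite_mod_nat:
  assumes tf: "torsion_free G (carrier G)" and sp: "rat_spanned G d e" and m: "0 < (m::nat)"
  shows "\<exists>F. finite F \<and> F \<subseteq> carrier G \<and> (\<forall>x\<in>carrier G. \<exists>f\<in>F. \<exists>w\<in>carrier G. x = f \<otimes> w [^] m)"
  using m
proof (induction m rule: less_induct)
  case (less m)
  show ?case
  proof (cases "m = 1")
    case True
    then show ?thesis by (intro exI[of _ "{\<one>}"]) auto
  next
    case False
    then obtain p where p: "prime p" "p dvd m" using prime_factor_nat by blast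
    then obtain m' where m': "m = p * m'" by (elim dvdE)
    have "0 < m'" using less.prems m' by (cases m') auto
    moreover have "m' < m" using calculation m' prime_gt_1_nat[OF p(1)] by simp
    ultimately obtain F where F: "finite F" "F \<subseteq> carrier G"
      "\<forall>x\<in>carrier G. \<exists>f\<in>F. \<exists>w\<in>carrier G. x = f \<otimes> w [^] m'"
      using less.IH[of m'] by auto
    obtain E where E: "finite E" "E \<subseteq> carrier G" "\<forall>x\<in>carrier G. \<exists>f\<in>E. \<exists>w\<in>carrier G. x = f \<otimes> w [^] p"
      using finite_mod_prime[OF tf sp p(1)] by blast
    have "\<exists>f\<in>(\<lambda>(a, b). a \<otimes> b [^] p) ` (E \<times> F). \<exists>w\<in>carrier G. x = f \<otimes> w [^] m" if x: "x \<in> carrier G" for x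
    proof -
      obtain a w where a: "a \<in> E" "w \<in> carrier G" "x = a \<otimes> w [^] p" using E x by blast
      obtain b v where b: "b \<in> F" "v \<in> carrier G" "w = b \<otimes> v [^] m'" using F a by blast
      have "a \<in> carrier G" "b \<in> carrier G" using a b E F by auto
      then have "x = (a \<otimes> b [^] p) \<otimes> v [^] m"
        using a b m' by (simp add: nat_pow_distrib m_assoc nat_pow_pow mult.commute[of p])
      moreover have "a \<otimes> b [^] p \<in> (\<lambda>(a, b). a \<otimes> b [^] p) ` (E \<times> F)" using a b by force
      ultimately show ?thesis using b(2) by blast
    qed
    moreover have "(\<lambda>(a, b). a \<otimes> b [^] p) ` (E \<times> F) \<subseteq> carrier G"
      using E(2) F(2) by (auto intro!: m_closed nat_pow_closed)
    ultimately show ?thesis using E(1) F(1)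
      by (intro exI[of _ "(\<lambda>(a, b). a \<otimes> b [^] p) ` (E \<times> F)"]) simp
  qed
qed

lemma finite_rcosets_of_cover:
  assumes K: "subgroup K G" and F: "finite F" "F \<subseteq> carrier G"
    and cover: "\<And>x. x \<in> carrier G \<Longrightarrow> \<exists>f\<in>F. \<exists>k\<in>K. x = f \<otimes> k"
  shows "finite (rcosets K)"
proof -
  have "rcosets K \<subseteq> (\<lambda>f. K #> f) ` F"
  proof
    fix c assume "c \<in> rcosets K"
    then obtain x where x: "x \<in> carrier G" "c = K #> x" by (auto simp: RCOSETS_def)
    obtain f k where f: "f \<in> F" "k \<in> K" "x = f \<otimes> k" using cover x by blast
    have "f \<in> carrier G" "k \<in> carrier G" using f F subgroup.mem_carrier[OF K] by auto
    then have "x = k \<otimes> f" using f m_comm by simp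
    then have "K #> x = (K #> k) #> f"
      using coset_mult_assoc[OF subgroup.subset[OF K]] \<open>f \<in> carrier G\<close> \<open>k \<in> carrier G\<close> by simp
    also have "K #> k = K" using coset_join2[OF _ K] f \<open>k \<in> carrier G\<close> by blast
    finally show "c \<in> (\<lambda>f. K #> f) ` F" using x f by blast
  qed
  then show ?thesis using F finite_surj by blast
qed

end

section \<open>Rational vector spaces\<close>

context abelian_grp
begin

lemma nat_pow_inject:
  assumes "torsion_free G (carrier G)" "x \<in> carrier G" "y \<in> carrier G" "0 < (k::nat)" "x [^] k = y [^] k"
  shows "x = y"
proof -
  have "(x \<otimes> inv y) [^] k = x [^] k \<otimes> inv (y [^] k)"
    using assms by (simp add: nat_pow_distrib nat_pow_inv)
  also have "\<dots> = \<one>" using assms by simp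
  finally have "x \<otimes> inv y = \<one>" using assms unfolding torsion_free_def by blast
  then show ?thesis using assms by (metis inv_equality inv_inv inv_closed)
qed

end

locale torsion_free_subgroup = abelian_grp M for M :: "'a monoid" (structure) +
  fixes X :: "'a set"
  assumes subgrp: "subgroup X M" and tf: "torsion_free M (carrier M)"
begin

text \<open>The fraction (1/n) \<otimes> a. Each operation gets a computation rule on such classes,
  which removes the arbitrary choice \<open>qrep\<close> from later arguments.\<close>

definition cl :: "'a \<Rightarrow> nat \<Rightarrow> ('a \<times> nat) set" where
  "cl a n = qrel M X `` {(a, n)}"

lemma X_closed [simp]: "a \<in> X \<Longrightarrow> a \<in> carrier M"
  using subgroup.mem_carrier[OF subgrp] .

lemma X_mult [simp]: "a \<in> X \<Longrightarrow> b \<in> X \<Longrightarrow> a \<otimes> b \<in> X"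
  using subgroup.m_closed[OF subgrp] .

lemma X_one [simp]: "\<one> \<in> X"
  using subgroup.one_closed[OF subgrp] .

lemma X_inv [simp]: "a \<in> X \<Longrightarrow> inv a \<in> X"
  using subgroup.m_inv_closed[OF subgrp] .

lemma X_int_pow [simp]: "a \<in> X \<Longrightarrow> a [^] (k::int) \<in> X"
  using subgroup_int_pow_closed[OF subgrp] .

lemma X_nat_pow [simp]: "a \<in> X \<Longrightarrow> a [^] (k::nat) \<in> X"
  using X_int_pow[of a "int k"] by (simp add: int_pow_int)

text \<open>Torsion-freeness cancels the auxiliary factor \<open>k\<close> of the
  definition.\<close>

lemma qrel_iff:
  "((a, n), (b, m)) \<in> qrel M X \<longleftrightarrow> a \<in> X \<and> b \<in> X \<and> 0 < n \<and> 0 < m \<and> a [^] m = b [^] n"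
proof
  assume "((a, n), (b, m)) \<in> qrel M X"
  then obtain k where k: "a \<in> X" "b \<in> X" "0 < n" "0 < m" "0 < k" "a [^] (m * k) = b [^] (n * k)"
    by (auto simp: qrel_def)
  then have "(a [^] m) [^] k = (b [^] n) [^] k" by (simp add: nat_pow_pow)
  then have "a [^] m = b [^] n" using nat_pow_inject[OF tf, of "a [^] m" "b [^] n" k] k by simp
  then show "a \<in> X \<and> b \<in> X \<and> 0 < n \<and> 0 < m \<and> a [^] m = b [^] n" using k by simp
next
  assume "a \<in> X \<and> b \<in> X \<and> 0 < n \<and> 0 < m \<and> a [^] m = b [^] n"
  then show "((a, n), (b, m)) \<in> qrel M X"
    unfolding qrel_def by (auto intro!: exI[of _ "1::nat"])
qed

lemma equiv_qrel: "equiv (X \<times> {n. 0 < n}) (qrel M X)"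
proof (rule equivI)
  show "qrel M X \<subseteq> (X \<times> {n. 0 < n}) \<times> (X \<times> {n. 0 < n})" by (auto simp: qrel_iff)
  show "refl_on (X \<times> {n. 0 < n}) (qrel M X)" by (auto simp: refl_on_def qrel_iff)
  show "sym (qrel M X)" by (auto simp: sym_def qrel_iff)
  show "trans (qrel M X)"
  proof (rule transI)
    fix x y z assume xy: "(x, y) \<in> qrel M X" and yz: "(y, z) \<in> qrel M X"
    obtain a n b m c l where e: "x = (a, n)" "y = (b, m)" "z = (c, l)"
      by (cases x, cases y, cases z) blast
    have h: "a \<in> X" "b \<in> X" "c \<in> X" "0 < n" "0 < m" "0 < l" "a [^] m = b [^] n" "b [^] l = c [^] m"
      using xy yz by (auto simp: e qrel_iff)
    have "(a [^] l) [^] m = (a [^] m) [^] l" using h(1) by (simp add: nat_pow_pow mult.commute)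
    also have "\<dots> = (b [^] n) [^] l" by (simp only: h(7))
    also have "\<dots> = (b [^] l) [^] n" using h(2) by (simp add: nat_pow_pow mult.commute)
    also have "\<dots> = (c [^] m) [^] n" by (simp only: h(8))
    also have "\<dots> = (c [^] n) [^] m" using h(3) by (simp add: nat_pow_pow mult.commute)
    finally have "a [^] l = c [^] n" using nat_pow_inject[OF tf, of "a [^] l" "c [^] n" m] h by simp
    then show "(x, z) \<in> qrel M X" using h by (simp add: e qrel_iff)
  qed
qed

lemma cl_eq_iff:
  "a \<in> X \<Longrightarrow> b \<in> X \<Longrightarrow> 0 < n \<Longrightarrow> 0 < m \<Longrightarrow> cl a n = cl b m \<longleftrightarrow> a [^] m = b [^] n"
  using eq_equiv_class_iff[OF equiv_qrel, of "(a, n)" "(b, m)"] by (simp add: cl_def qrel_iff)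

lemma cl_eqI:
  "a \<in> X \<Longrightarrow> b \<in> X \<Longrightarrow> 0 < n \<Longrightarrow> 0 < m \<Longrightarrow> a [^] m = b [^] n \<Longrightarrow> cl a n = cl b m"
  using cl_eq_iff by blast

lemma cl_in_QT [simp]: "a \<in> X \<Longrightarrow> 0 < n \<Longrightarrow> cl a n \<in> QT M X"
  by (auto simp: QT_def cl_def intro: quotientI)

lemma QT_cases:
  assumes "v \<in> QT M X"
  obtains a n where "a \<in> X" "0 < n" "v = cl a n"
  using assms by (auto simp: QT_def cl_def elim: quotientE)

lemma qrep_cl:
  assumes "v \<in> QT M X"
  shows "fst (qrep v) \<in> X" "0 < snd (qrep v)" "v = cl (fst (qrep v)) (snd (qrep v))"
proof -
  obtain a n where v: "a \<in> X" "0 < n" "v = cl a n" using assms by (rule QT_cases)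
  then have "(a, n) \<in> v" by (simp add: cl_def qrel_iff)
  then have "qrep v \<in> v" unfolding qrep_def by (rule someI)
  then have r: "((a, n), qrep v) \<in> qrel M X" using v by (simp add: cl_def)
  obtain b m where bm: "qrep v = (b, m)" by (cases "qrep v") blast
  have h: "b \<in> X" "0 < m" "a [^] m = b [^] n" using r by (auto simp: bm qrel_iff)
  show "fst (qrep v) \<in> X" "0 < snd (qrep v)" using h by (auto simp: bm)
  show "v = cl (fst (qrep v)) (snd (qrep v))"
    unfolding bm using h v cl_eqI[of a b n m] by simp
qed

lemma qrep_eq:
  assumes "a \<in> X" "0 < n"
  shows "fst (qrep (cl a n)) [^] n = a [^] snd (qrep (cl a n))"
  using qrep_cl[of "cl a n"] assms cl_eq_iff[of a "fst (qrep (cl a n))" n "snd (qrep (cl a n))"] by simp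

lemma qadd_cl:
  assumes "a \<in> X" "b \<in> X" "0 < n" "0 < m"
  shows "qadd M X (cl a n) (cl b m) = cl (a [^] m \<otimes> b [^] n) (n * m)"
proof -
  obtain a' n' b' m' where r: "qrep (cl a n) = (a', n')" "qrep (cl b m) = (b', m')"
    by (cases "qrep (cl a n)", cases "qrep (cl b m)") blast
  have h: "a' \<in> X" "0 < n'" "b' \<in> X" "0 < m'" "a' [^] n = a [^] n'" "b' [^] m = b [^] m'"
    using qrep_cl[of "cl a n"] qrep_cl[of "cl b m"] qrep_eq assms r by (auto simp: prod_eq_iff) (metis fst_conv snd_conv)+
  have "(a' [^] m') [^] (n * m) = (a' [^] n) [^] (m' * m)"
    using h(1) by (simp add: nat_pow_pow ac_simps)
  also have "\<dots> = (a [^] n') [^] (m' * m)" by (simp only: h(5))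
  also have "\<dots> = (a [^] m) [^] (n' * m')" using assms by (simp add: nat_pow_pow ac_simps)
  finally have 1: "(a' [^] m') [^] (n * m) = (a [^] m) [^] (n' * m')" .
  have "(b' [^] n') [^] (n * m) = (b' [^] m) [^] (n' * n)"
    using h(3) by (simp add: nat_pow_pow ac_simps)
  also have "\<dots> = (b [^] m') [^] (n' * n)" by (simp only: h(6))
  also have "\<dots> = (b [^] n) [^] (n' * m')" using assms by (simp add: nat_pow_pow ac_simps)
  finally have 2: "(b' [^] n') [^] (n * m) = (b [^] n) [^] (n' * m')" .
  have "cl (a' [^] m' \<otimes> b' [^] n') (n' * m') = cl (a [^] m \<otimes> b [^] n) (n * m)"
    using h assms 1 2 by (intro cl_eqI) (simp_all add: nat_pow_distrib)
  then show ?thesis unfolding qadd_def r by (simp add: cl_def)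
qed

lemma qzero_cl: "qzero M X = cl \<one> 1"
  by (simp add: qzero_def cl_def)

lemma cl_one: "0 < n \<Longrightarrow> cl \<one> n = qzero M X"
  unfolding qzero_cl by (intro cl_eqI) auto

lemma cl_eq_qzero: "a \<in> X \<Longrightarrow> 0 < n \<Longrightarrow> cl a n = qzero M X \<longleftrightarrow> a = \<one>"
  unfolding qzero_cl by (subst cl_eq_iff) auto

lemma qlift_cl:
  assumes f: "f \<in> hom (M\<lparr>carrier := X\<rparr>) (M\<lparr>carrier := X\<rparr>)" and a: "a \<in> X" "0 < n"
  shows "qlift M X f (cl a n) = cl (f a) n"
proof -
  obtain a' n' where r: "qrep (cl a n) = (a', n')" by (cases "qrep (cl a n)") blast
  have h: "a' \<in> X" "0 < n'" "a' [^] n = a [^] n'"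
    using qrep_cl[of "cl a n"] qrep_eq[OF a] a r by auto
  interpret XX: group "M\<lparr>carrier := X\<rparr>" using subgroup_imp_group[OF subgrp] .
  have pow: "f (x [^] k) = f x [^] k" if "x \<in> X" for x and k :: nat
    using hom_nat_pow[OF f _ XX.is_group XX.is_group] that
    by (simp add: nat_pow_consistent[symmetric])
  have fX: "f x \<in> X" if "x \<in> X" for x using f that by (auto simp: hom_def)
  have "cl (f a') n' = cl (f a) n"
    using h a fX pow[of a' n] pow[of a n'] by (intro cl_eqI) auto
  then show ?thesis unfolding qlift_def r by (simp add: cl_def)
qed

text \<open>Any fraction representing \<open>r\<close> is allowed, reduced or not, so sums and
  products of scalars can use whatever common denominator is at hand instead of
  \<open>quotient_of\<close>.\<close>

lemma qsmult_cl:
  assumes a: "a \<in> X" "0 < n" and q: "0 < q" and r: "r = of_int p / of_nat q"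
  shows "qsmult M X r (cl a n) = cl (a [^] p) (n * q)"
proof -
  obtain a' n' where rep: "qrep (cl a n) = (a', n')" by (cases "qrep (cl a n)") blast
  have h: "a' \<in> X" "0 < n'" "a' [^] n = a [^] n'"
    using qrep_cl[of "cl a n"] qrep_eq[OF a] a rep by auto
  obtain u w where uw: "quotient_of r = (u, w)" by (cases "quotient_of r") blast
  have w: "0 < w" and rw: "r = of_int u / of_int w"
    using quotient_of_denom_pos[OF uw] quotient_of_div[OF uw] by auto
  have "of_int (u * int q) = (of_int (p * w) :: rat)"
    using rw r w q by (simp add: field_simps)
  then have uq: "u * int q = p * w" by (simp only: of_int_eq_iff)
  have "(a' [^] u) [^] int (n * q) = (a' [^] int n) [^] (u * int q)"
    using h by (simp add: int_pow_pow ac_simps)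
  also have "a' [^] int n = a [^] int n'" using h by (simp add: int_pow_int)
  also have "(a [^] int n') [^] (u * int q) = (a [^] p) [^] (int n' * w)"
    using a uq by (simp add: int_pow_pow ac_simps)
  also have "int n' * w = int (n' * nat w)" using w by simp
  finally have "(a' [^] u) [^] (n * q) = (a [^] p) [^] (n' * nat w)"
    by (simp only: int_pow_int)
  then have "cl (a' [^] u) (n' * nat w) = cl (a [^] p) (n * q)"
    using h a q w by (intro cl_eqI) auto
  then show ?thesis unfolding qsmult_def rep uw by (simp add: cl_def)
qed

lemma rat_fraction: obtains p q where "0 < q" "r = (of_int p / of_nat q :: rat)"
proof -
  obtain u w where uw: "quotient_of r = (u, w)" by (cases "quotient_of r") blast
  have "0 < w" "r = of_int u / of_int w"
    using quotient_of_denom_pos[OF uw] quotient_of_div[OF uw] by auto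
  then show ?thesis using that[of "nat w" u] by simp
qed

lemma qadd_closed: "v \<in> QT M X \<Longrightarrow> w \<in> QT M X \<Longrightarrow> qadd M X v w \<in> QT M X"
  by (elim QT_cases) (simp add: qadd_cl)

lemma qzero_closed: "qzero M X \<in> QT M X"
  by (simp add: qzero_cl)

lemma qsmult_closed: "v \<in> QT M X \<Longrightarrow> qsmult M X r v \<in> QT M X"
  by (elim QT_cases, rule rat_fraction[of r]) (simp add: qsmult_cl)

lemma QTg_simps [simp]:
  "carrier (QTg M X) = QT M X" "\<one>\<^bsub>QTg M X\<^esub> = qzero M X" "v \<otimes>\<^bsub>QTg M X\<^esub> w = qadd M X v w"
  by (simp_all add: QTg_def)

lemma qadd_commute: "v \<in> QT M X \<Longrightarrow> w \<in> QT M X \<Longrightarrow> qadd M X v w = qadd M X w v"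
  by (elim QT_cases) (simp add: qadd_cl m_comm mult.commute)

lemma qadd_assoc:
  assumes "u \<in> QT M X" "v \<in> QT M X" "w \<in> QT M X"
  shows "qadd M X (qadd M X u v) w = qadd M X u (qadd M X v w)"
  using assms by (elim QT_cases) (simp add: qadd_cl nat_pow_distrib nat_pow_pow m_assoc ac_simps)

lemma qadd_zero: "v \<in> QT M X \<Longrightarrow> qadd M X (qzero M X) v = v"
  by (elim QT_cases) (simp add: qzero_cl qadd_cl)

lemma comm_group_QTg: "comm_group (QTg M X)"
proof (rule comm_groupI; unfold QTg_simps)
  fix u assume "u \<in> QT M X"
  then obtain a n where u: "a \<in> X" "0 < n" "u = cl a n" by (rule QT_cases)
  then have "qadd M X (cl (inv a) n) u = qzero M X"
    by (simp add: qadd_cl nat_pow_inv cl_one)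
  then show "\<exists>y\<in>QT M X. qadd M X y u = qzero M X" using u by (intro bexI[of _ "cl (inv a) n"]) auto
qed (simp_all add: qadd_closed qzero_closed qadd_assoc qadd_zero, rule qadd_commute)

lemma QTg_nat_pow:
  assumes "a \<in> X" "0 < n"
  shows "cl a n [^]\<^bsub>QTg M X\<^esub> (k::nat) = cl (a [^] k) n"
proof (induction k)
  case 0
  show ?case using assms by (simp add: cl_one)
next
  case (Suc k)
  have "cl a n [^]\<^bsub>QTg M X\<^esub> Suc k = cl ((a [^] k) [^] n \<otimes> a [^] n) (n * n)"
    using assms Suc by (simp add: qadd_cl)
  also have "\<dots> = cl (a [^] Suc k) n"
    using assms by (intro cl_eqI) (simp_all add: nat_pow_distrib nat_pow_pow ac_simps)
  finally show ?case .
qed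

lemma torsion_free_QTg: "torsion_free (QTg M X) (carrier (QTg M X))"
  unfolding torsion_free_def
proof (intro ballI allI impI)
  fix v :: "('a \<times> nat) set" and k :: nat
  assume v: "v \<in> carrier (QTg M X)" and k: "0 < k \<and> v [^]\<^bsub>QTg M X\<^esub> k = \<one>\<^bsub>QTg M X\<^esub>"
  obtain a n where an: "a \<in> X" "0 < n" "v = cl a n" using v by (auto elim: QT_cases)
  then have "cl (a [^] k) n = qzero M X" using k by (simp add: QTg_nat_pow)
  then have "a [^] k = \<one>" using an by (simp add: cl_eq_qzero)
  then have "a = \<one>" using tf an k unfolding torsion_free_def by auto
  then show "v = \<one>\<^bsub>QTg M X\<^esub>" using an by (simp add: cl_one)
qed

lemma QTg_divide:
  assumes "v \<in> QT M X" "0 < (k::nat)"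
  shows "\<exists>w\<in>QT M X. w [^]\<^bsub>QTg M X\<^esub> k = v"
proof -
  obtain a n where an: "a \<in> X" "0 < n" "v = cl a n" using assms by (auto elim: QT_cases)
  have "cl (a [^] k) (n * k) = cl a n" using an assms by (intro cl_eqI) (simp_all add: nat_pow_pow mult.commute)
  then show ?thesis using an assms by (intro bexI[of _ "cl a (n * k)"]) (simp_all add: QTg_nat_pow)
qed

lemma qsmult_qadd:
  assumes "v \<in> QT M X" "w \<in> QT M X"
  shows "qsmult M X r (qadd M X v w) = qadd M X (qsmult M X r v) (qsmult M X r w)"
proof -
  obtain p q where r: "0 < q" "r = of_int p / of_nat q" by (rule rat_fraction)
  obtain a n b m where e: "a \<in> X" "0 < n" "v = cl a n" "b \<in> X" "0 < m" "w = cl b m"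
    using assms by (elim QT_cases) blast
  have "cl ((a [^] m \<otimes> b [^] n) [^] p) (n * m * q)
      = cl ((a [^] p) [^] (m * q) \<otimes> (b [^] p) [^] (n * q)) (n * q * (m * q))"
    using e r by (intro cl_eqI)
      (simp_all add: int_pow_int[symmetric] int_pow_distrib int_pow_pow ac_simps)
  then show ?thesis using e r(1) by (simp add: qadd_cl qsmult_cl[OF _ _ r])
qed

lemma qsmult_add:
  assumes "v \<in> QT M X"
  shows "qsmult M X (r + s) v = qadd M X (qsmult M X r v) (qsmult M X s v)"
proof -
  obtain p q where r: "0 < q" "r = of_int p / of_nat q" by (rule rat_fraction)
  obtain p' q' where s: "0 < q'" "s = of_int p' / of_nat q'" by (rule rat_fraction)
  have rs: "0 < q * q'" "r + s = of_int (p * int q' + p' * int q) / of_nat (q * q')"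
    using r s by (simp_all add: field_simps)
  obtain a n where e: "a \<in> X" "0 < n" "v = cl a n" using assms by (elim QT_cases)
  have "cl (a [^] (p * int q' + p' * int q)) (n * (q * q'))
      = cl ((a [^] p) [^] (n * q') \<otimes> (a [^] p') [^] (n * q)) (n * q * (n * q'))"
    using e r s by (intro cl_eqI)
      (simp_all add: int_pow_int[symmetric] int_pow_distrib int_pow_pow int_pow_mult[symmetric] algebra_simps)
  then show ?thesis
    unfolding e(3) qsmult_cl[OF e(1,2) r] qsmult_cl[OF e(1,2) s] qsmult_cl[OF e(1,2) rs]
    using e(1,2) r(1) s(1) by (simp add: qadd_cl)
qed

lemma qsmult_mult:
  assumes "v \<in> QT M X"
  shows "qsmult M X (r * s) v = qsmult M X r (qsmult M X s v)"
proof -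
  obtain p q where r: "0 < q" "r = of_int p / of_nat q" by (rule rat_fraction)
  obtain p' q' where s: "0 < q'" "s = of_int p' / of_nat q'" by (rule rat_fraction)
  have rs: "0 < q' * q" "r * s = of_int (p' * p) / of_nat (q' * q)"
    using r(1) s(1) by (simp_all add: r(2) s(2) mult.commute)
  obtain a n where e: "a \<in> X" "0 < n" "v = cl a n" using assms by (elim QT_cases)
  show ?thesis
    unfolding e(3) qsmult_cl[OF e(1,2) s] qsmult_cl[OF e(1,2) rs]
    using e r(1) s(1) by (subst qsmult_cl[OF _ _ r]) (simp_all add: int_pow_pow ac_simps)
qed

lemma qsmult_0: "v \<in> QT M X \<Longrightarrow> qsmult M X 0 v = qzero M X"
  by (elim QT_cases) (simp add: qsmult_cl[of _ _ 1 0 0] cl_one)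

lemma qsmult_zero: "qsmult M X r (qzero M X) = qzero M X"
proof -
  obtain p q where r: "0 < q" "r = of_int p / of_nat q" by (rule rat_fraction)
  have "qsmult M X r (cl \<one> 1) = cl (\<one> [^] p) (1 * q)" by (rule qsmult_cl) (use r in auto)
  then show ?thesis using r by (simp add: qzero_cl[symmetric] cl_one)
qed

lemma qlift_closed:
  assumes f: "f \<in> hom (M\<lparr>carrier := X\<rparr>) (M\<lparr>carrier := X\<rparr>)" and "v \<in> QT M X"
  shows "qlift M X f v \<in> QT M X"
proof -
  obtain a n where e: "a \<in> X" "0 < n" "v = cl a n" using assms by (elim QT_cases)
  have "f a \<in> X" using f e by (auto simp: hom_def)
  then show ?thesis using e by (simp add: qlift_cl[OF f])
qed

lemma hom_int_pow_X:
  assumes f: "f \<in> hom (M\<lparr>carrier := X\<rparr>) (M\<lparr>carrier := X\<rparr>)" and x: "x \<in> X"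
  shows "f (x [^] (k::int)) = f x [^] k"
proof -
  interpret XX: group "M\<lparr>carrier := X\<rparr>" using subgroup_imp_group[OF subgrp] .
  have "f x \<in> X" using f x by (auto simp: hom_def)
  then show ?thesis using hom_int_pow[OF f _ XX.is_group XX.is_group, of x k] x
    by (simp add: int_pow_consistent[OF subgrp, symmetric])
qed

lemma qlift_qadd:
  assumes f: "f \<in> hom (M\<lparr>carrier := X\<rparr>) (M\<lparr>carrier := X\<rparr>)" and "v \<in> QT M X" "w \<in> QT M X"
  shows "qlift M X f (qadd M X v w) = qadd M X (qlift M X f v) (qlift M X f w)"
proof -
  obtain a n b m where e: "a \<in> X" "0 < n" "v = cl a n" "b \<in> X" "0 < m" "w = cl b m"
    using assms by (elim QT_cases) blast
  have fX: "f x \<in> X" if "x \<in> X" for x using f that by (auto simp: hom_def)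
  have fm: "f (x \<otimes> y) = f x \<otimes> f y" if "x \<in> X" "y \<in> X" for x y using f that by (auto simp: hom_def)
  have fp: "f (x [^] k) = f x [^] k" if "x \<in> X" for x and k :: nat
    using hom_int_pow_X[OF f that, of "int k"] by (simp add: int_pow_int)
  show ?thesis using e by (simp add: qadd_cl qlift_cl[OF f] fX fm fp)
qed

lemma qlift_qsmult:
  assumes f: "f \<in> hom (M\<lparr>carrier := X\<rparr>) (M\<lparr>carrier := X\<rparr>)" and "v \<in> QT M X"
  shows "qlift M X f (qsmult M X r v) = qsmult M X r (qlift M X f v)"
proof -
  obtain p q where r: "0 < q" "r = of_int p / of_nat q" by (rule rat_fraction)
  obtain a n where e: "a \<in> X" "0 < n" "v = cl a n" using assms by (elim QT_cases)
  have "f a \<in> X" using f e by (auto simp: hom_def)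
  then show ?thesis using e r(1) by (simp add: qsmult_cl[OF _ _ r] qlift_cl[OF f] hom_int_pow_X[OF f])
qed

lemma qlift_qzero:
  assumes f: "f \<in> hom (M\<lparr>carrier := X\<rparr>) (M\<lparr>carrier := X\<rparr>)"
  shows "qlift M X f (qzero M X) = qzero M X"
  using hom_int_pow_X[OF f, of \<one> 0] by (simp add: qzero_cl qlift_cl[OF f])

lemma qsmult_1: "v \<in> QT M X \<Longrightarrow> qsmult M X 1 v = v"
  by (elim QT_cases) (simp add: qsmult_cl[of _ _ 1 1 1])

lemma qadd_lcomm:
  assumes "u \<in> QT M X" "v \<in> QT M X" "w \<in> QT M X"
  shows "qadd M X u (qadd M X v w) = qadd M X v (qadd M X u w)"
  using comm_monoid.m_lcomm[OF comm_group.axioms(1)[OF comm_group_QTg], of u v w] assms by simp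

text \<open>Coefficients and vectors become functions of a label, so that linear combinations can be
  rearranged pointwise.\<close>

definition qcomb :: "('i \<Rightarrow> ('a \<times> nat) set) \<Rightarrow> ('i \<Rightarrow> rat) \<Rightarrow> 'i list \<Rightarrow> ('a \<times> nat) set" where
  "qcomb g u is = qlincomb M X (map u is) (map g is)"

lemma qcomb_Nil [simp]: "qcomb g u [] = qzero M X"
  by (simp add: qcomb_def qlincomb_def)

lemma qcomb_Cons [simp]: "qcomb g u (i # is) = qadd M X (qsmult M X (u i) (g i)) (qcomb g u is)"
  by (simp add: qcomb_def qlincomb_def)

lemma qcomb_closed: "\<forall>i\<in>set is. g i \<in> QT M X \<Longrightarrow> qcomb g u is \<in> QT M X"
  by (induction "is") (auto simp: qzero_closed qadd_closed qsmult_closed)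

lemma qcomb_add:
  "\<forall>i\<in>set is. g i \<in> QT M X \<Longrightarrow>
    qcomb g (\<lambda>i. u i + w i) is = qadd M X (qcomb g u is) (qcomb g w is)"
proof (induction "is")
  case (Cons i "is")
  then have "g i \<in> QT M X" "qcomb g u is \<in> QT M X" "qcomb g w is \<in> QT M X"
    by (auto intro!: qcomb_closed)
  then show ?case using Cons
    by (simp add: qsmult_add qadd_assoc qadd_closed qsmult_closed qadd_lcomm)
qed (simp add: qadd_zero qzero_closed)

lemma qcomb_smult:
  "\<forall>i\<in>set is. g i \<in> QT M X \<Longrightarrow> qcomb g (\<lambda>i. r * u i) is = qsmult M X r (qcomb g u is)"
  by (induction "is") (simp_all add: qsmult_zero qsmult_qadd qsmult_mult qsmult_closed qcomb_closed)

lemma qcomb_zero: "\<forall>i\<in>set is. g i \<in> QT M X \<Longrightarrow> qcomb g (\<lambda>_. 0) is = qzero M X"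
  by (induction "is") (simp_all add: qsmult_0 qadd_zero qzero_closed)

lemma qcomb_cong: "\<forall>i\<in>set is. g i = h i \<and> u i = w i \<Longrightarrow> qcomb g u is = qcomb h w is"
  by (induction "is") simp_all

lemma qcomb_unit:
  "\<forall>i\<in>set is. g i \<in> QT M X \<Longrightarrow> distinct is \<Longrightarrow> k \<in> set is \<Longrightarrow>
    qcomb g (\<lambda>i. if i = k then 1 else 0) is = g k"
proof (induction "is")
  case (Cons i "is")
  show ?case
  proof (cases "i = k")
    case True
    then have "qcomb g (\<lambda>i. if i = k then 1 else 0) is = qcomb g (\<lambda>_. 0) is"
      using Cons.prems by (intro qcomb_cong) auto
    then show ?thesis using True Cons.prems
      by (simp add: qcomb_zero qsmult_1 qadd_commute[of _ "qzero M X"] qadd_zero qzero_closed)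
  next
    case False
    then show ?thesis using Cons by (simp add: qsmult_0 qadd_zero)
  qed
qed simp

definition q_linear :: "(('a \<times> nat) set \<Rightarrow> ('a \<times> nat) set) \<Rightarrow> bool" where
  "q_linear h \<longleftrightarrow> (\<forall>v\<in>QT M X. h v \<in> QT M X) \<and> h (qzero M X) = qzero M X \<and>
    (\<forall>v\<in>QT M X. \<forall>w\<in>QT M X. h (qadd M X v w) = qadd M X (h v) (h w)) \<and>
    (\<forall>r. \<forall>v\<in>QT M X. h (qsmult M X r v) = qsmult M X r (h v))"

lemma q_linear_qlift:
  "f \<in> hom (M\<lparr>carrier := X\<rparr>) (M\<lparr>carrier := X\<rparr>) \<Longrightarrow> q_linear (qlift M X f)"
  by (simp add: q_linear_def qlift_closed qlift_qzero qlift_qadd qlift_qsmult)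

lemma q_linear_funpow: "q_linear h \<Longrightarrow> q_linear (h ^^ n)"
  by (induction n) (simp_all add: q_linear_def)

lemma q_linear_qsmult: "q_linear h \<Longrightarrow> q_linear (\<lambda>v. qsmult M X r (h v))"
  by (auto simp: q_linear_def qsmult_closed qsmult_zero qsmult_qadd qsmult_mult[symmetric] mult.commute)

lemma q_linear_qcomb:
  "q_linear h \<Longrightarrow> \<forall>i\<in>set is. g i \<in> QT M X \<Longrightarrow> h (qcomb g u is) = qcomb (\<lambda>i. h (g i)) u is"
  by (induction "is") (simp_all add: q_linear_def qsmult_closed qcomb_closed)

lemma qcomb_qcomb:
  assumes "\<forall>i\<in>set is. g i \<in> QT M X"
  shows "\<forall>j\<in>set js. h j = qcomb g (c j) is \<Longrightarrow>
    qcomb h w js = qcomb g (\<lambda>i. \<Sum>j\<leftarrow>js. w j * c j i) is"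
  by (induction js) (simp_all add: qcomb_zero qcomb_add qcomb_smult assms)

text \<open>The numerators of the representatives do it: the fractions formed from their integer
  combinations (\<open>Sp\<close>) contain the spanning list and are closed under addition and
  scalars, hence are everything.\<close>

lemma qlincomb_rat_spanned:
  assumes sp: "qspans M X vs"
  shows "\<exists>d e. rat_spanned (M\<lparr>carrier := X\<rparr>) d e"
proof -
  interpret XX: abelian_grp "M\<lparr>carrier := X\<rparr>"
    using group.group_comm_groupI[OF subgroup_imp_group[OF subgrp]] m_comm
    by (simp add: abelian_grp_def)
  define d where "d = length vs"
  define e where "e j = fst (qrep (vs ! j))" for j
  have vs: "vs ! j \<in> QT M X" if "j < d" for j
    using sp that by (auto simp: qspans_def d_def)
  have e: "e j \<in> X" if "j < d" for j using qrep_cl(1)[OF vs[OF that]] by (simp add: e_def)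
  have eX: "\<forall>j<d. e j \<in> carrier (M\<lparr>carrier := X\<rparr>)" using e by simp
  let ?L = "\<lambda>k. lincomb_upto (M\<lparr>carrier := X\<rparr>) e k d"
  have L: "?L k \<in> X" for k using XX.lincomb_closed[OF eX, of k] by simp
  have Lpow: "?L (\<lambda>j. c * k j) = ?L k [^] c" for c :: int and k
    using XX.lincomb_smult[OF eX, of c k] int_pow_consistent[OF subgrp L] by simp
  have Ladd: "?L (\<lambda>j. k j + l j) = ?L k \<otimes> ?L l" for k l
    using XX.lincomb_add[OF eX, of k l] by simp
  have single: "?L (\<lambda>j. if j = i then 1 else 0) = e i" if "i < d" for i
  proof -
    have "lincomb_upto (M\<lparr>carrier := X\<rparr>) e (\<lambda>j. if j = i then 1 else 0) n = (if i < n then e i else \<one>)"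
      if "n \<le> d" for n
      using that
    proof (induction n)
      case (Suc n)
      then have "e n \<in> X" "i < n \<Longrightarrow> e i \<in> X" using e \<open>i < d\<close> by auto
      moreover have "e n [^]\<^bsub>M\<lparr>carrier := X\<rparr>\<^esub> (1::int) = e n" "e n [^]\<^bsub>M\<lparr>carrier := X\<rparr>\<^esub> (0::int) = \<one>"
        using \<open>e n \<in> X\<close> int_pow_consistent[OF subgrp, of "e n" 1] int_pow_consistent[OF subgrp, of "e n" 0]
        by simp_all
      ultimately show ?case using Suc by (auto simp: less_Suc_eq)
    qed simp
    then show ?thesis using that by simp
  qed
  define Sp where "Sp = {v. \<exists>m k. 0 < m \<and> v = cl (?L k) m}"
  have Sp_vs: "v \<in> Sp" if "v \<in> set vs" for v
  proof -
    obtain j where j: "j < d" "v = vs ! j" using \<open>v \<in> set vs\<close> by (auto simp: in_set_conv_nth d_def)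
    have "v = cl (e j) (snd (qrep v))" "0 < snd (qrep v)"
      using qrep_cl[OF vs[OF j(1)]] by (auto simp: e_def j(2))
    then show ?thesis unfolding Sp_def
      by (intro CollectI exI[of _ "snd (qrep v)"] exI[of _ "\<lambda>i. if i = j then 1 else 0"])
        (simp add: single[OF j(1)])
  qed
  have Sp_add: "qadd M X v w \<in> Sp" if vw: "v \<in> Sp" "w \<in> Sp" for v w
  proof -
    obtain m k m' k' where mk: "0 < m" "v = cl (?L k) m" "0 < m'" "w = cl (?L k') m'"
      using vw unfolding Sp_def by blast
    have "qadd M X v w = cl (?L (\<lambda>j. int m' * k j + int m * k' j)) (m * m')"
      using mk L by (simp add: qadd_cl Ladd Lpow int_pow_int)
    then show ?thesis using mk unfolding Sp_def
      by (intro CollectI exI[of _ "m * m'"] exI[of _ "\<lambda>j. int m' * k j + int m * k' j"]) simp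
  qed
  have Sp_smult: "qsmult M X r v \<in> Sp" if v: "v \<in> Sp" for v r
  proof -
    obtain p q where r: "0 < q" "r = of_int p / of_nat q" by (rule rat_fraction)
    obtain m k where mk: "0 < m" "v = cl (?L k) m" using v unfolding Sp_def by blast
    have "qsmult M X r v = cl (?L (\<lambda>j. p * k j)) (m * q)"
      using mk L r(1) by (simp add: qsmult_cl[OF _ _ r] Lpow)
    then show ?thesis using mk r(1) unfolding Sp_def
      by (intro CollectI exI[of _ "m * q"] exI[of _ "\<lambda>j. p * k j"]) simp
  qed
  have Sp_zero: "qzero M X \<in> Sp"
    using XX.lincomb_zero[of d "\<lambda>_. 0" e] unfolding Sp_def qzero_cl
    by (intro CollectI exI[of _ 1] exI[of _ "\<lambda>_. 0"]) simp
  have Sp_comb: "qlincomb M X cs ws \<in> Sp" if "set ws \<subseteq> Sp" for cs ws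
    using that
  proof (induction cs arbitrary: ws)
    case Nil
    then show ?case using Sp_zero by (simp add: qlincomb_def)
  next
    case (Cons c cs)
    then show ?case using Sp_zero Sp_add Sp_smult by (cases ws) (auto simp: qlincomb_def)
  qed
  have "\<exists>N::nat. 0 < N \<and> (\<exists>k. a [^]\<^bsub>M\<lparr>carrier := X\<rparr>\<^esub> N = ?L k)" if a: "a \<in> X" for a
  proof -
    have "cl a 1 \<in> QT M X" using a by simp
    then obtain cs where "cl a 1 = qlincomb M X cs vs"
      using sp unfolding qspans_def by blast
    then have "cl a 1 \<in> Sp" using Sp_comb[of vs cs] Sp_vs by auto
    then obtain m k where mk: "0 < m" "cl a 1 = cl (?L k) m" unfolding Sp_def by blast
    then have "a [^] m = ?L k" using cl_eq_iff[of a "?L k" 1 m] a L by simp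
    then show ?thesis using mk by (auto simp: nat_pow_consistent[symmetric])
  qed
  then have "rat_spanned (M\<lparr>carrier := X\<rparr>) d e"
    using eX unfolding rat_spanned_def by simp
  then show ?thesis by blast
qed

end

lemma finite_rank_rat_spanned:
  assumes "comm_group M" "subgroup X M" "torsion_free M (carrier M)" "finite_rank M X"
  shows "\<exists>d e. rat_spanned (M\<lparr>carrier := X\<rparr>) d e"
proof -
  interpret torsion_free_subgroup M X
    using assms by (simp add: torsion_free_subgroup_def abelian_grp_def torsion_free_subgroup_axioms_def)
  show ?thesis using assms(4) qlincomb_rat_spanned unfolding finite_rank_def by blast
qed

subsection \<open>The Cayley-Hamilton theorem\<close>

definition mat_op :: "nat \<Rightarrow> rat mat \<Rightarrow> (nat \<Rightarrow> rat) \<Rightarrow> nat \<Rightarrow> rat" where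
  "mat_op n A w i = (if i < n then \<Sum>j<n. A $$ (i, j) * w j else 0)"

text \<open>Horner evaluation of \<open>q\<close> at the matrix \<open>A\<close>, acting on
  coordinate functions; products of polynomials become compositions, which is the module structure
  behind the determinant trick.\<close>

definition poly_op :: "nat \<Rightarrow> rat mat \<Rightarrow> rat poly \<Rightarrow> (nat \<Rightarrow> rat) \<Rightarrow> nat \<Rightarrow> rat" where
  "poly_op n A q w = fold_coeffs (\<lambda>c acc i. c * w i + mat_op n A acc i) q (\<lambda>_. 0)"

lemma mat_op_zero [simp]: "mat_op n A (\<lambda>_. 0) i = 0"
  by (simp add: mat_op_def)

lemma mat_op_add: "mat_op n A (\<lambda>i. u i + w i) i = mat_op n A u i + mat_op n A w i"
  by (simp add: mat_op_def algebra_simps sum.distrib)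

lemma mat_op_smult: "mat_op n A (\<lambda>i. c * w i) i = c * mat_op n A w i"
  by (simp add: mat_op_def sum_distrib_left algebra_simps)

lemma poly_op_0 [simp]: "poly_op n A 0 w i = 0"
  by (simp add: poly_op_def)

lemma poly_op_pCons: "poly_op n A (pCons c q) w i = c * w i + mat_op n A (poly_op n A q w) i"
  by (cases "c = 0 \<and> q = 0") (auto simp: poly_op_def)

lemma poly_op_add: "poly_op n A (p + q) w i = poly_op n A p w i + poly_op n A q w i"
proof (induction p q arbitrary: i rule: poly_induct2)
  case (pCons a p b q)
  have "poly_op n A (p + q) w = (\<lambda>i. poly_op n A p w i + poly_op n A q w i)"
    using pCons by (intro ext)
  then show ?case by (simp add: poly_op_pCons mat_op_add algebra_simps)
qed simp

lemma poly_op_smult: "poly_op n A (Polynomial.smult c p) w i = c * poly_op n A p w i"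
proof (induction p arbitrary: i)
  case (pCons a p)
  have "poly_op n A (Polynomial.smult c p) w = (\<lambda>i. c * poly_op n A p w i)"
    using pCons by (intro ext)
  then show ?case by (simp add: poly_op_pCons mat_op_smult algebra_simps)
qed simp

lemma poly_op_arg_add: "poly_op n A p (\<lambda>i. u i + w i) i = poly_op n A p u i + poly_op n A p w i"
proof (induction p arbitrary: i)
  case (pCons a p)
  have "poly_op n A p (\<lambda>i. u i + w i) = (\<lambda>i. poly_op n A p u i + poly_op n A p w i)"
    using pCons by (intro ext)
  then show ?case by (simp add: poly_op_pCons mat_op_add algebra_simps)
qed simp

lemma poly_op_arg_zero: "poly_op n A p (\<lambda>_. 0) i = 0"
proof (induction p arbitrary: i)
  case (pCons a p)
  have "poly_op n A p (\<lambda>_. 0) = (\<lambda>_. 0)" using pCons by (intro ext)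
  then show ?case by (simp add: poly_op_pCons)
qed simp

lemma poly_op_mult: "poly_op n A (p * q) w i = poly_op n A p (poly_op n A q w) i"
proof (induction p arbitrary: i)
  case (pCons a p)
  have "poly_op n A (p * q) w = poly_op n A p (poly_op n A q w)"
    using pCons by (intro ext)
  then show ?case by (simp add: poly_op_pCons poly_op_add poly_op_smult)
qed simp

lemma poly_op_sum: "poly_op n A (\<Sum>k\<in>K. p k) w i = (\<Sum>k\<in>K. poly_op n A (p k) w i)"
  by (induction K rule: infinite_finite_induct) (simp_all add: poly_op_add)

lemma poly_op_arg_sum:
  "poly_op n A p (\<lambda>i. \<Sum>k\<in>K. w k i) i = (\<Sum>k\<in>K. poly_op n A p (w k) i)"
  by (induction K rule: infinite_finite_induct) (simp_all add: poly_op_arg_add poly_op_arg_zero)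

lemma poly_op_monom: "poly_op n A (monom c k) w i = c * (mat_op n A ^^ k) w i"
proof (induction k arbitrary: i)
  case 0
  have "poly_op n A 0 w = (\<lambda>_. 0)" by (intro ext) simp
  then show ?case by (simp add: monom_0 poly_op_pCons)
next
  case (Suc k)
  have "poly_op n A (monom c k) w = (\<lambda>i. c * (mat_op n A ^^ k) w i)"
    using Suc by (intro ext)
  then show ?case by (simp add: monom_Suc poly_op_pCons mat_op_smult)
qed

definition unit_fun :: "nat \<Rightarrow> nat \<Rightarrow> rat" where
  "unit_fun k i = (if i = k then 1 else 0)"

text \<open>Determinant trick: the tuple of unit functions is annihilated by the characteristic matrix,
  hence, multiplying by the adjugate, by its determinant.\<close>

lemma cayley_hamilton_unit:
  assumes A: "A \<in> carrier_mat n n" and k: "k < n"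
  shows "poly_op n A (char_poly A) (unit_fun k) i = 0"
proof -
  define B where "B = char_poly_matrix A"
  define D where "D = adj_mat B"
  have B: "B \<in> carrier_mat n n" using A by (simp add: B_def)
  have D: "D \<in> carrier_mat n n" "B * D = char_poly A \<cdot>\<^sub>m 1\<^sub>m n"
    using adj_mat[OF B] by (simp_all add: D_def char_poly_def B_def)
  have Bentry: "B $$ (j, l) = (if j = l then [:0, 1:] else 0) + [:- A $$ (j, l):]" if "j < n" "l < n" for j l
    using A that by (simp add: B_def char_poly_matrix_def)
  have c0: "poly_op n A 0 w = (\<lambda>_. 0)" for w by (intro ext) simp
  \<comment> \<open>Column \<open>l\<close> of the characteristic matrix applied to the unit
    functions: the variable sends the \<open>l\<close>-th unit function to column \<open>l\<close>
    of \<open>A\<close>, and the constant entries subtract exactly this column.\<close>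
  have kill: "(\<lambda>i. \<Sum>j<n. poly_op n A (B $$ (j, l)) (unit_fun j) i) = (\<lambda>_. 0)" if l: "l < n" for l
  proof
    fix i
    have X: "poly_op n A [:0, 1:] w i = mat_op n A w i" for w
    proof -
      have "poly_op n A [:1:] w = w" by (intro ext) (simp add: poly_op_pCons c0)
      then show ?thesis by (simp add: poly_op_pCons[of n A 0 "[:1:]"])
    qed
    have c: "poly_op n A [:c:] w i = c * w i" for c w by (simp add: poly_op_pCons c0)
    have "(\<Sum>j<n. poly_op n A (B $$ (j, l)) (unit_fun j) i)
        = (\<Sum>j<n. (if j = l then mat_op n A (unit_fun j) i else 0) - A $$ (j, l) * unit_fun j i)"
      using l by (intro sum.cong) (auto simp: Bentry poly_op_add X c c0)
    also have "\<dots> = mat_op n A (unit_fun l) i - (\<Sum>j<n. A $$ (j, l) * unit_fun j i)"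
      using l by (simp add: sum_subtractf)
    also have "(\<Sum>j<n. A $$ (j, l) * unit_fun j i) = (if i < n then A $$ (i, l) else 0)"
      by (simp add: unit_fun_def if_distrib cong: if_cong)
    also have "mat_op n A (unit_fun l) i = (if i < n then A $$ (i, l) else 0)"
      using l by (simp add: mat_op_def unit_fun_def if_distrib cong: if_cong)
    finally show "(\<Sum>j<n. poly_op n A (B $$ (j, l)) (unit_fun j) i) = 0" by simp
  qed
  have prod: "(\<Sum>l<n. B $$ (j, l) * D $$ (l, k)) = (if j = k then char_poly A else 0)" if j: "j < n" for j
  proof -
    have "(B * D) $$ (j, k) = (\<Sum>l<n. B $$ (j, l) * D $$ (l, k))"
      using B D(1) j k by (simp add: scalar_prod_def atLeast0LessThan)
    moreover have "(B * D) $$ (j, k) = (if j = k then char_poly A else 0)"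
      using D(2) j k by simp
    ultimately show ?thesis by simp
  qed
  have "poly_op n A (char_poly A) (unit_fun k) i
      = (\<Sum>j<n. poly_op n A (if j = k then char_poly A else 0) (unit_fun j) i)"
    using k by (simp add: if_distrib[of "\<lambda>p. poly_op n A p _ i"] cong: if_cong)
  also have "\<dots> = (\<Sum>j<n. \<Sum>l<n. poly_op n A (D $$ (l, k)) (poly_op n A (B $$ (j, l)) (unit_fun j)) i)"
    by (intro sum.cong) (simp_all add: prod[symmetric] poly_op_sum mult.commute[of "B $$ _"] poly_op_mult)
  also have "\<dots> = (\<Sum>l<n. poly_op n A (D $$ (l, k)) (\<lambda>i. \<Sum>j<n. poly_op n A (B $$ (j, l)) (unit_fun j) i) i)"
    by (subst sum.swap) (simp add: poly_op_arg_sum)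
  also have "\<dots> = 0" using kill by (simp add: poly_op_arg_zero)
  finally show ?thesis .
qed

context torsion_free_subgroup
begin

text \<open>Cayley-Hamilton for the characteristic polynomial X^\<delta> - \<nu>/\<mu>: \<mu> times
  the \<delta>-th iterate is multiplication by \<nu>, first on coordinate functions, then on the
  spanning list \<open>vs\<close>, and by linearity on the class of \<open>x\<close>.\<close>

lemma qcharpoly_monomial:
  assumes f: "f \<in> hom (M\<lparr>carrier := X\<rparr>) (M\<lparr>carrier := X\<rparr>)"
    and cp: "qcharpoly M X (qlift M X f) p"
    and p: "Polynomial.smult (of_nat \<mu>) p = monom (of_nat \<mu>) \<delta> - [:of_nat \<nu>:]"
    and \<mu>: "0 < \<mu>" and x: "x \<in> X"
  shows "(f ^^ \<delta>) x [^] \<mu> = x [^] \<nu>"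
proof -
  obtain vs A where vs: "qspans M X vs" and A: "A \<in> carrier_mat (length vs) (length vs)"
    and cols: "\<forall>j<length vs. qlift M X f (vs ! j) = qlincomb M X (list_of_vec (col A j)) vs"
    and chp: "char_poly A = p"
    using cp unfolding qcharpoly_def by blast
  define n where "n = length vs"
  have An: "A \<in> carrier_mat n n" using A by (simp add: n_def)
  define L where "L w = qcomb (\<lambda>j. vs ! j) w [0..<n]" for w
  have mem: "\<forall>i\<in>set [0..<n]. vs ! i \<in> QT M X" using vs by (auto simp: qspans_def n_def)
  define h where "h = qlift M X f"
  have h: "q_linear h" unfolding h_def using q_linear_qlift[OF f] .
  have Lw: "qlincomb M X (map w [0..<n]) vs = L w" for w
    unfolding L_def qcomb_def n_def by (simp add: map_nth)
  have hv: "h (vs ! j) = L (\<lambda>i. A $$ (i, j))" if "j < n" for j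
  proof -
    have "list_of_vec (col A j) = map (\<lambda>i. A $$ (i, j)) [0..<n]"
      using An that by (intro nth_equalityI) (auto simp: list_of_vec_index)
    then show ?thesis using cols that Lw[of "\<lambda>i. A $$ (i, j)"] by (simp add: h_def n_def)
  qed
  have hL: "h (L w) = L (mat_op n A w)" for w
  proof -
    have "h (L w) = qcomb (\<lambda>j. h (vs ! j)) w [0..<n]"
      unfolding L_def using q_linear_qcomb[OF h mem] .
    also have "\<dots> = qcomb (\<lambda>j. vs ! j) (\<lambda>i. \<Sum>j\<leftarrow>[0..<n]. w j * A $$ (i, j)) [0..<n]"
      using hv by (intro qcomb_qcomb[OF mem]) (auto simp: L_def)
    also have "\<dots> = L (mat_op n A w)"
      unfolding L_def
      by (intro qcomb_cong) (auto simp: mat_op_def interv_sum_list_conv_sum_set_nat atLeast0LessThan mult.commute)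
    finally show ?thesis .
  qed
  have hLn: "(h ^^ m) (L w) = L ((mat_op n A ^^ m) w)" for m w
    by (induction m) (simp_all add: hL)
  have Lsm: "L (\<lambda>i. r * w i) = qsmult M X r (L w)" for r w
    unfolding L_def using qcomb_smult[OF mem] .
  have basis: "qsmult M X (of_nat \<mu>) ((h ^^ \<delta>) (vs ! k)) = qsmult M X (of_nat \<nu>) (vs ! k)" if k: "k < n" for k
  proof -
    have Lk: "L (unit_fun k) = vs ! k"
      unfolding L_def unit_fun_def using qcomb_unit[OF mem] k by simp
    have "of_nat \<mu> * (mat_op n A ^^ \<delta>) (unit_fun k) i = of_nat \<nu> * unit_fun k i" for i
    proof -
      have "monom (of_nat \<mu>) \<delta> = Polynomial.smult (of_nat \<mu>) p + monom (of_nat \<nu>) 0"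
        using p by (simp add: monom_0)
      then have "poly_op n A (monom (of_nat \<mu>) \<delta>) (unit_fun k) i = poly_op n A (monom (of_nat \<nu>) 0) (unit_fun k) i"
        using cayley_hamilton_unit[OF An k, of i] chp by (simp add: poly_op_add poly_op_smult)
      then show ?thesis by (simp add: poly_op_monom)
    qed
    then have "L (\<lambda>i. of_nat \<mu> * (mat_op n A ^^ \<delta>) (unit_fun k) i) = L (\<lambda>i. of_nat \<nu> * unit_fun k i)"
      by presburger
    then show ?thesis by (simp add: Lsm hLn[symmetric] Lk)
  qed
  have "cl x 1 \<in> QT M X" using x by simp
  then obtain cs where cs: "length cs = n" "cl x 1 = qlincomb M X cs vs"
    using vs unfolding qspans_def n_def by blast
  then have xL: "cl x 1 = L (\<lambda>i. cs ! i)" using Lw[of "\<lambda>i. cs ! i"] map_nth[of cs] by simp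
  have lin1: "q_linear (\<lambda>v. qsmult M X (of_nat \<mu>) ((h ^^ \<delta>) v))"
    using q_linear_qsmult[OF q_linear_funpow[OF h]] .
  have "q_linear (\<lambda>v. v)" by (simp add: q_linear_def)
  then have lin2: "q_linear (\<lambda>v. qsmult M X (of_nat \<nu>) v)" by (rule q_linear_qsmult)
  have "qsmult M X (of_nat \<mu>) ((h ^^ \<delta>) (L (\<lambda>i. cs ! i))) = qsmult M X (of_nat \<nu>) (L (\<lambda>i. cs ! i))"
    unfolding L_def q_linear_qcomb[OF lin1 mem] q_linear_qcomb[OF lin2 mem]
    using basis by (intro qcomb_cong) auto
  then have eq: "qsmult M X (of_nat \<mu>) ((h ^^ \<delta>) (cl x 1)) = qsmult M X (of_nat \<nu>) (cl x 1)"
    by (simp only: xL)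
  have fX: "(f ^^ m) x \<in> X" for m using f x by (induction m) (auto simp: hom_def)
  have hx: "(h ^^ m) (cl x 1) = cl ((f ^^ m) x) 1" for m
    using fX by (induction m) (simp_all add: h_def qlift_cl[OF f])
  have sm: "qsmult M X (of_nat k) (cl y 1) = cl (y [^] k) 1" if "y \<in> X" for k y
    using qsmult_cl[of y 1 1 "of_nat k" "int k"] that by (simp add: int_pow_int)
  show ?thesis using eq fX x by (simp only: hx sm) (simp add: cl_eq_iff)
qed

end

section \<open>Algebraic actions and their completions\<close>

locale alg_action =
  fixes M :: "'a monoid" and G :: "'g monoid" and S :: "'g set" and A :: "'a set"
    and sig :: "'g \<Rightarrow> 'a \<Rightarrow> 'a"
  assumes standing: "standing M G S A sig"
begin

sublocale M: abelian_grp M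
  using standing by (simp add: standing_def abelian_grp_def)

sublocale G: group G
  using standing by (simp add: standing_def)

abbreviation \<C> :: "'a set set" where "\<C> \<equiv> constr S A sig"

lemma standing_parts:
  "S \<subseteq> carrier G" "\<one>\<^bsub>G\<^esub> \<in> S" "\<forall>s\<in>S. \<forall>t\<in>S. s \<otimes>\<^bsub>G\<^esub> t \<in> S" "subgroup A M"
  "\<forall>g\<in>carrier G. sig g \<in> iso M M" "\<forall>x\<in>carrier M. sig \<one>\<^bsub>G\<^esub> x = x"
  "\<forall>g\<in>carrier G. \<forall>h\<in>carrier G. \<forall>x\<in>carrier M. sig (g \<otimes>\<^bsub>G\<^esub> h) x = sig g (sig h x)"
  "\<forall>s\<in>S. sig s ` A \<subseteq> A" "generate G S = carrier G"
  "generate M (\<Union>g\<in>carrier G. sig g ` A) = carrier M"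
  "\<forall>s\<in>S. finite (rcosets\<^bsub>M\<lparr>carrier := A\<rparr>\<^esub> (sig s ` A))"
  "\<forall>C\<in>constr S A sig. \<forall>g\<in>carrier G. (\<forall>c\<in>C. sig g c = c) \<longrightarrow> g = \<one>\<^bsub>G\<^esub>"
  using standing unfolding standing_def by simp_all

lemma S_closed [simp]: "s \<in> S \<Longrightarrow> s \<in> carrier G"
  and S_one [simp]: "\<one>\<^bsub>G\<^esub> \<in> S"
  and S_mult: "s \<in> S \<Longrightarrow> t \<in> S \<Longrightarrow> s \<otimes>\<^bsub>G\<^esub> t \<in> S"
  and A_subgroup: "subgroup A M"
  and sig_S: "s \<in> S \<Longrightarrow> a \<in> A \<Longrightarrow> sig s a \<in> A"
  and gen_S: "generate G S = carrier G"
  and gen_A: "generate M (\<Union>g\<in>carrier G. sig g ` A) = carrier M"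
  and FI: "s \<in> S \<Longrightarrow> finite (rcosets\<^bsub>M\<lparr>carrier := A\<rparr>\<^esub> (sig s ` A))"
  and sig_iso: "g \<in> carrier G \<Longrightarrow> sig g \<in> iso M M"
  and sig_one [simp]: "x \<in> carrier M \<Longrightarrow> sig \<one>\<^bsub>G\<^esub> x = x"
  and sig_mult: "g \<in> carrier G \<Longrightarrow> h \<in> carrier G \<Longrightarrow> x \<in> carrier M \<Longrightarrow> sig (g \<otimes>\<^bsub>G\<^esub> h) x = sig g (sig h x)"
  using standing_parts(1-11) by (auto simp: image_subset_iff)

lemma JF: "C \<in> \<C> \<Longrightarrow> g \<in> carrier G \<Longrightarrow> (\<And>c. c \<in> C \<Longrightarrow> sig g c = c) \<Longrightarrow> g = \<one>\<^bsub>G\<^esub>"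
  using standing_parts(12) by simp

lemma sig_hom: "g \<in> carrier G \<Longrightarrow> sig g \<in> hom M M"
  using sig_iso by (auto simp: iso_def)

lemma sig_closed [simp]: "g \<in> carrier G \<Longrightarrow> x \<in> carrier M \<Longrightarrow> sig g x \<in> carrier M"
  using sig_hom by (auto simp: hom_def)

lemma sig_add: "g \<in> carrier G \<Longrightarrow> x \<in> carrier M \<Longrightarrow> y \<in> carrier M \<Longrightarrow> sig g (x \<otimes>\<^bsub>M\<^esub> y) = sig g x \<otimes>\<^bsub>M\<^esub> sig g y"
  using sig_hom by (auto simp: hom_def)

lemma sig_zero [simp]: "g \<in> carrier G \<Longrightarrow> sig g \<one>\<^bsub>M\<^esub> = \<one>\<^bsub>M\<^esub>"
  using hom_one[OF sig_hom M.is_group M.is_group] .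

lemma sig_nat_pow: "g \<in> carrier G \<Longrightarrow> x \<in> carrier M \<Longrightarrow> sig g (x [^]\<^bsub>M\<^esub> (n::nat)) = sig g x [^]\<^bsub>M\<^esub> n"
  using hom_nat_pow[OF sig_hom _ M.is_group M.is_group] .

lemma sig_int_pow: "g \<in> carrier G \<Longrightarrow> x \<in> carrier M \<Longrightarrow> sig g (x [^]\<^bsub>M\<^esub> (n::int)) = sig g x [^]\<^bsub>M\<^esub> n"
  using hom_int_pow[OF sig_hom _ M.is_group M.is_group] .

lemma sig_inv: "g \<in> carrier G \<Longrightarrow> x \<in> carrier M \<Longrightarrow> sig g (inv\<^bsub>M\<^esub> x) = inv\<^bsub>M\<^esub> (sig g x)"
  using sig_int_pow[of g x "-1"] by (simp add: M.int_pow_neg)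

lemma sig_inv_sig [simp]:
  "g \<in> carrier G \<Longrightarrow> x \<in> carrier M \<Longrightarrow> sig (inv\<^bsub>G\<^esub> g) (sig g x) = x"
  "g \<in> carrier G \<Longrightarrow> x \<in> carrier M \<Longrightarrow> sig g (sig (inv\<^bsub>G\<^esub> g) x) = x"
  by (simp_all add: sig_mult[symmetric])

lemma sig_inject: "g \<in> carrier G \<Longrightarrow> x \<in> carrier M \<Longrightarrow> y \<in> carrier M \<Longrightarrow> sig g x = sig g y \<Longrightarrow> x = y"
  by (metis sig_inv_sig(1))

lemma A_closed [simp]: "a \<in> A \<Longrightarrow> a \<in> carrier M"
  using subgroup.mem_carrier[OF A_subgroup] .

lemma A_mult [simp]: "a \<in> A \<Longrightarrow> b \<in> A \<Longrightarrow> a \<otimes>\<^bsub>M\<^esub> b \<in> A"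
  using subgroup.m_closed[OF A_subgroup] .

lemma A_one [simp]: "\<one>\<^bsub>M\<^esub> \<in> A"
  using subgroup.one_closed[OF A_subgroup] .

lemma A_inv [simp]: "a \<in> A \<Longrightarrow> inv\<^bsub>M\<^esub> a \<in> A"
  using subgroup.m_inv_closed[OF A_subgroup] .

lemma A_int_pow [simp]: "a \<in> A \<Longrightarrow> a [^]\<^bsub>M\<^esub> (k::int) \<in> A"
  using M.subgroup_int_pow_closed[OF A_subgroup] .

lemma A_nat_pow [simp]: "a \<in> A \<Longrightarrow> a [^]\<^bsub>M\<^esub> (k::nat) \<in> A"
  using A_int_pow[of a "int k"] by (simp add: int_pow_int)

subsection \<open>Constructible subgroups\<close>

lemma constr_subgroup_subset: "C \<in> \<C> \<Longrightarrow> subgroup C M \<and> C \<subseteq> A"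
proof (induction rule: constr.induct)
  case constr_top
  show ?case using A_subgroup by simp
next
  case (constr_img C s)
  have "subgroup (sig s ` C) M"
    using subgroup.subgroup_is_group constr_img group_hom.subgroup_img_is_subgroup[of M M "sig s" C]
      sig_hom[of s] M.is_group by (simp add: group_hom_def group_hom_axioms_def)
  then show ?case using constr_img sig_S by auto
next
  case (constr_pre C s)
  then interpret C: subgroup C M by simp
  have "subgroup {a \<in> A. sig s a \<in> C} M"
    using constr_pre by (intro M.subgroupI) (auto simp: sig_inv sig_add intro!: exI[of _ "\<one>\<^bsub>M\<^esub>"])
  then show ?case by auto
qed

lemma constr_subgroup: "C \<in> \<C> \<Longrightarrow> subgroup C M"
  using constr_subgroup_subset by blast

lemma constr_subset: "C \<in> \<C> \<Longrightarrow> C \<subseteq> A"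
  using constr_subgroup_subset by blast

text \<open>An image meets \<open>D\<close> in the image of C intersected with the preimage of D; a
  preimage meets \<open>D\<close> in the preimage of C intersected with the image of D, by
  injectivity. Both intersect the smaller \<open>C\<close> with another constructible set, hence the
  induction for arbitrary \<open>D\<close>.\<close>

lemma constr_Int: "C \<in> \<C> \<Longrightarrow> D \<in> \<C> \<Longrightarrow> C \<inter> D \<in> \<C>"
proof (induction arbitrary: D rule: constr.induct)
  case constr_top
  then show ?case using constr_subset[of D] by (simp add: Int_absorb1)
next
  case (constr_img C s)
  have "sig s ` C \<inter> D = sig s ` (C \<inter> {a \<in> A. sig s a \<in> D})"
    using constr_subset[OF constr_img.hyps(1)] by auto
  then show ?case using constr_img by (simp add: constr.intros)
next
  case (constr_pre C s)
  have eq: "{a \<in> A. sig s a \<in> C} \<inter> D = {a \<in> A. sig s a \<in> C \<inter> sig s ` D}"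
    using constr_subset[OF constr_pre.prems] constr_pre.hyps sig_inject[OF S_closed[OF constr_pre.hyps(2)]]
    by auto (metis A_closed subsetD)
  have "C \<inter> sig s ` D \<in> \<C>" using constr_pre by (simp add: constr.constr_img)
  then show ?case unfolding eq by (rule constr.constr_pre) (rule constr_pre.hyps(2))
qed

lemma constr_finite_lower:
  "finite F \<Longrightarrow> F \<subseteq> \<C> \<Longrightarrow> \<exists>C\<in>\<C>. \<forall>D\<in>F. C \<subseteq> D"
proof (induction F rule: finite_induct)
  case empty
  then show ?case using constr_top by blast
next
  case (insert D F)
  then obtain C where "C \<in> \<C>" "\<forall>D\<in>F. C \<subseteq> D" by auto
  then show ?case using constr_Int[of C D] insert.prems by (intro bexI[of _ "C \<inter> D"]) auto
qed

lemma constr_finite_index: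
  "C \<in> \<C> \<Longrightarrow> \<exists>F. finite F \<and> F \<subseteq> A \<and> (\<forall>a\<in>A. \<exists>f\<in>F. \<exists>c\<in>C. a = f \<otimes>\<^bsub>M\<^esub> c)"
proof (induction rule: constr.induct)
  case constr_top
  show ?case by (intro exI[of _ "{\<one>\<^bsub>M\<^esub>}"]) auto
next
  case (constr_img C s)
  then obtain F where F: "finite F" "F \<subseteq> A" "\<forall>a\<in>A. \<exists>f\<in>F. \<exists>c\<in>C. a = f \<otimes>\<^bsub>M\<^esub> c" by blast
  let ?MA = "M\<lparr>carrier := A\<rparr>"
  define E where "E = (\<lambda>K. SOME x. x \<in> K) ` (rcosets\<^bsub>?MA\<^esub> (sig s ` A))"
  have E: "finite E" using FI[OF constr_img.hyps(2)] by (simp add: E_def)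
  have coset: "\<exists>e\<in>E. e \<in> A \<and> (\<exists>b\<in>A. a = e \<otimes>\<^bsub>M\<^esub> sig s b)" if a: "a \<in> A" for a
  proof -
    define K where "K = (sig s ` A) #>\<^bsub>?MA\<^esub> a"
    have KE: "(SOME x. x \<in> K) \<in> E" using a by (auto simp: E_def K_def RCOSETS_def)
    have "a = sig s \<one>\<^bsub>M\<^esub> \<otimes>\<^bsub>M\<^esub> a" using a constr_img.hyps by simp
    then have "a \<in> K" unfolding K_def r_coset_def using A_one by force
    then have "(SOME x. x \<in> K) \<in> K" by (rule someI)
    then obtain b where b: "b \<in> A" "(SOME x. x \<in> K) = sig s b \<otimes>\<^bsub>M\<^esub> a"
      by (auto simp: K_def r_coset_def)
    have sb: "sig s b \<in> A" using b constr_img.hyps sig_S by blast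
    have "a = (SOME x. x \<in> K) \<otimes>\<^bsub>M\<^esub> sig s (inv\<^bsub>M\<^esub> b)"
      unfolding b(2) using a b(1) sb constr_img.hyps
      by (simp add: sig_inv M.m_comm[of "sig s b" a] M.m_assoc)
    then show ?thesis using KE b sb a by (metis A_inv A_mult)
  qed
  define F' where "F' = ((\<lambda>(e, f). e \<otimes>\<^bsub>M\<^esub> sig s f) ` (E \<times> F)) \<inter> A"
  have "\<exists>f\<in>F'. \<exists>c\<in>sig s ` C. a = f \<otimes>\<^bsub>M\<^esub> c" if a: "a \<in> A" for a
  proof -
    obtain e b where e: "e \<in> E" "e \<in> A" "b \<in> A" "a = e \<otimes>\<^bsub>M\<^esub> sig s b" using coset[OF a] by blast
    obtain f c where f: "f \<in> F" "c \<in> C" "b = f \<otimes>\<^bsub>M\<^esub> c" using F e by blast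
    have cl: "f \<in> A" "c \<in> A" using f F constr_subset[OF constr_img.hyps(1)] by auto
    have "a = (e \<otimes>\<^bsub>M\<^esub> sig s f) \<otimes>\<^bsub>M\<^esub> sig s c"
      using e f cl constr_img.hyps by (simp add: sig_add M.m_assoc)
    moreover have "e \<otimes>\<^bsub>M\<^esub> sig s f \<in> F'"
      using e f cl constr_img.hyps sig_S by (force simp: F'_def)
    ultimately show ?thesis using f by blast
  qed
  then show ?case using E F by (intro exI[of _ F']) (auto simp: F'_def)
next
  case (constr_pre C s)
  then obtain F where F: "finite F" "F \<subseteq> A" "\<forall>a\<in>A. \<exists>f\<in>F. \<exists>c\<in>C. a = f \<otimes>\<^bsub>M\<^esub> c" by blast
  interpret C: subgroup C M using constr_subgroup constr_pre by blast
  define P where "P f a \<longleftrightarrow> a \<in> A \<and> (\<exists>c\<in>C. sig s a = f \<otimes>\<^bsub>M\<^esub> c)" for f a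
  define F' where "F' = (\<lambda>f. SOME a. P f a) ` {f \<in> F. \<exists>a. P f a}"
  have "\<exists>f\<in>F'. \<exists>c\<in>{a \<in> A. sig s a \<in> C}. a = f \<otimes>\<^bsub>M\<^esub> c" if a: "a \<in> A" for a
  proof -
    obtain f c where f: "f \<in> F" "c \<in> C" "sig s a = f \<otimes>\<^bsub>M\<^esub> c"
      using F sig_S[OF constr_pre.hyps(2) a] by blast
    then have Pa: "P f a" using a by (auto simp: P_def)
    define b where "b = (SOME a. P f a)"
    have "P f b" unfolding b_def using Pa by (rule someI)
    then obtain c' where b: "b \<in> A" "c' \<in> C" "sig s b = f \<otimes>\<^bsub>M\<^esub> c'" by (auto simp: P_def)
    have fA: "f \<in> carrier M" using f F by auto
    have "sig s (inv\<^bsub>M\<^esub> b \<otimes>\<^bsub>M\<^esub> a) = inv\<^bsub>M\<^esub> (f \<otimes>\<^bsub>M\<^esub> c') \<otimes>\<^bsub>M\<^esub> (f \<otimes>\<^bsub>M\<^esub> c)"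
      using a b f constr_pre.hyps by (simp add: sig_add sig_inv)
    also have "\<dots> = inv\<^bsub>M\<^esub> c' \<otimes>\<^bsub>M\<^esub> c"
      using fA f b C.mem_carrier by (simp add: M.inv_mult M.m_comm[of "inv\<^bsub>M\<^esub> f"] M.m_assoc M.mult_inv_cancel)
    finally have "inv\<^bsub>M\<^esub> b \<otimes>\<^bsub>M\<^esub> a \<in> {a \<in> A. sig s a \<in> C}" using a b f by simp
    moreover have "a = b \<otimes>\<^bsub>M\<^esub> (inv\<^bsub>M\<^esub> b \<otimes>\<^bsub>M\<^esub> a)" using a b by (simp add: M.mult_inv_cancel)
    moreover have "b \<in> F'" using f Pa by (auto simp: F'_def b_def)
    ultimately show ?thesis by blast
  qed
  moreover have "F' \<subseteq> A"
  proof -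
    have "Eps (P f) \<in> A" if "P f a" for f a
      using someI[of "P f" a, OF that] unfolding P_def[of f "Eps (P f)"] by blast
    then show ?thesis by (auto simp: F'_def)
  qed
  ultimately show ?case using F by (intro exI[of _ F']) (auto simp: F'_def)
qed

text \<open>Among the multiples 0, ..., |F| of \<open>a\<close> two lie in the same coset, so a
  positive multiple at most |F| lies in \<open>C\<close>; the factorial makes the exponent the same
  for all \<open>a\<close>.\<close>

lemma constr_exponent:
  assumes C: "C \<in> \<C>"
  shows "\<exists>n::nat. 0 < n \<and> (\<forall>a\<in>A. a [^]\<^bsub>M\<^esub> n \<in> C)"
proof -
  interpret C: subgroup C M using constr_subgroup C by blast
  obtain F where F: "finite F" "F \<subseteq> A" "\<forall>a\<in>A. \<exists>f\<in>F. \<exists>c\<in>C. a = f \<otimes>\<^bsub>M\<^esub> c"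
    using constr_finite_index[OF C] by blast
  have "a [^]\<^bsub>M\<^esub> (fact (card F) :: nat) \<in> C" if a: "a \<in> A" for a
  proof -
    have "\<forall>i. \<exists>f\<in>F. \<exists>c\<in>C. a [^]\<^bsub>M\<^esub> (i::nat) = f \<otimes>\<^bsub>M\<^esub> c" using F a by auto
    then obtain f where f: "\<And>i::nat. f i \<in> F" "\<And>i. \<exists>c\<in>C. a [^]\<^bsub>M\<^esub> i = f i \<otimes>\<^bsub>M\<^esub> c" by metis
    have "\<not> inj_on f {..card F}"
    proof
      assume "inj_on f {..card F}"
      then have "card {..card F} \<le> card F" using F f by (intro card_inj_on_le) auto
      then show False by simp
    qed
    then obtain i j where ij: "i < j" "j \<le> card F" "f i = f j"
      by (metis atMost_iff inj_onI linorder_neqE_nat)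
    obtain c c' where c: "c \<in> C" "a [^]\<^bsub>M\<^esub> i = f i \<otimes>\<^bsub>M\<^esub> c" "c' \<in> C" "a [^]\<^bsub>M\<^esub> j = f i \<otimes>\<^bsub>M\<^esub> c'"
      using f(2)[of i] f(2)[of j] ij by auto
    have fi: "f i \<in> carrier M" using f(1)[of i] F(2) by auto
    have "a [^]\<^bsub>M\<^esub> i \<otimes>\<^bsub>M\<^esub> a [^]\<^bsub>M\<^esub> (j - i) = a [^]\<^bsub>M\<^esub> j"
      using a ij by (simp add: M.nat_pow_mult)
    then have "f i \<otimes>\<^bsub>M\<^esub> (c \<otimes>\<^bsub>M\<^esub> a [^]\<^bsub>M\<^esub> (j - i)) = f i \<otimes>\<^bsub>M\<^esub> c'"
      using c fi a C.mem_carrier by (simp add: M.m_assoc)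
    then have "c \<otimes>\<^bsub>M\<^esub> a [^]\<^bsub>M\<^esub> (j - i) = c'"
      using c fi a C.mem_carrier by simp
    then have "a [^]\<^bsub>M\<^esub> (j - i) = inv\<^bsub>M\<^esub> c \<otimes>\<^bsub>M\<^esub> c'"
      using c a C.mem_carrier by (metis A_closed A_nat_pow M.mult_inv_cancel(2))
    then have ji: "a [^]\<^bsub>M\<^esub> (j - i) \<in> C" using c by simp
    have "(j - i) dvd fact (card F)" using ij by (intro dvd_fact) auto
    then obtain q where "fact (card F) = (j - i) * q" by (elim dvdE)
    then have "a [^]\<^bsub>M\<^esub> (fact (card F) :: nat) = (a [^]\<^bsub>M\<^esub> (j - i)) [^]\<^bsub>M\<^esub> q"
      using a by (simp add: M.nat_pow_pow)
    moreover have "x [^]\<^bsub>M\<^esub> q \<in> C" if "x \<in> C" for x using that by (induction q) auto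
    ultimately show ?thesis using ji by simp
  qed
  then show ?thesis by (intro exI[of _ "fact (card F)"]) simp
qed

text \<open>Continuity of \<open>sig g\<close> at 0 for every \<open>g\<close> of the group:
  preimages serve for generators in \<open>S\<close>, images for their inverses, and products
  compose.\<close>

lemma constr_pullback:
  assumes "g \<in> carrier G" "C \<in> \<C>"
  shows "\<exists>C'\<in>\<C>. \<forall>x\<in>C'. sig g x \<in> C"
proof -
  have g: "g \<in> generate G S" using assms gen_S by simp
  show ?thesis using g assms(2)
  proof (induction arbitrary: C rule: generate.induct)
    case one
    then show ?case using constr_subset[of C] by (intro bexI[of _ C]) auto
  next
    case (incl s)
    then show ?case by (intro bexI[of _ "{a \<in> A. sig s a \<in> C}"]) (auto intro: constr_pre)
  next
    case (inv s)
    have "sig (inv\<^bsub>G\<^esub> s) x \<in> C" if "x \<in> sig s ` C" for x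
      using that inv constr_subset[of C] by auto
    then show ?case using inv by (intro bexI[of _ "sig s ` C"]) (auto intro: constr_img)
  next
    case (eng g1 g2)
    have g: "g1 \<in> carrier G" "g2 \<in> carrier G" using eng gen_S by auto
    obtain C1 where C1: "C1 \<in> \<C>" "\<forall>x\<in>C1. sig g1 x \<in> C" using eng by blast
    obtain C2 where C2: "C2 \<in> \<C>" "\<forall>x\<in>C2. sig g2 x \<in> C1" using eng C1 by blast
    have "sig (g1 \<otimes>\<^bsub>G\<^esub> g2) x \<in> C" if "x \<in> C2" for x
      using that C1 C2 g constr_subset[OF C2(1)] by (subst sig_mult) auto
    then show ?case using C2 by blast
  qed
qed

text \<open>M/A is a torsion group: an element \<open>sig g a\<close> lies in \<open>A\<close> once
  \<open>a\<close> lies in a pullback of \<open>A\<close> under \<open>g\<close>, and a multiple of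
  \<open>a\<close> does.\<close>

lemma multiple_in_A:
  assumes "z \<in> carrier M"
  shows "\<exists>n::nat. 0 < n \<and> z [^]\<^bsub>M\<^esub> n \<in> A"
proof -
  have base: "\<exists>n::nat. 0 < n \<and> z [^]\<^bsub>M\<^esub> n \<in> A" if z: "z \<in> (\<Union>g\<in>carrier G. sig g ` A)" for z
  proof -
    obtain g a where ga: "g \<in> carrier G" "a \<in> A" "z = sig g a" using z by blast
    obtain C where C: "C \<in> \<C>" "\<forall>x\<in>C. sig g x \<in> A" using constr_pullback[OF ga(1) constr_top] by blast
    obtain n :: nat where n: "0 < n" "\<forall>a\<in>A. a [^]\<^bsub>M\<^esub> n \<in> C" using constr_exponent[OF C(1)] by blast
    have "z [^]\<^bsub>M\<^esub> n = sig g (a [^]\<^bsub>M\<^esub> n)" using ga by (simp add: sig_nat_pow)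
    then show ?thesis using n C ga by auto
  qed
  have "z \<in> generate M (\<Union>g\<in>carrier G. sig g ` A)" using assms gen_A by simp
  then have "z \<in> carrier M \<and> (\<exists>n::nat. 0 < n \<and> z [^]\<^bsub>M\<^esub> n \<in> A)"
  proof (induction rule: generate.induct)
    case one
    then show ?case by (auto intro: exI[of _ 1])
  next
    case (incl h)
    then show ?case using base[of h] by auto
  next
    case (inv h)
    then have "h \<in> carrier M" by auto
    moreover obtain n :: nat where "0 < n" "h [^]\<^bsub>M\<^esub> n \<in> A" using base[of h] inv by auto
    ultimately show ?case by (auto simp: M.nat_pow_inv intro!: exI[of _ n])
  next
    case (eng x y)
    then obtain n m :: nat where nm: "x \<in> carrier M" "y \<in> carrier M" "0 < n" "0 < m" "x [^]\<^bsub>M\<^esub> n \<in> A" "y [^]\<^bsub>M\<^esub> m \<in> A"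
      by blast
    have "(x \<otimes>\<^bsub>M\<^esub> y) [^]\<^bsub>M\<^esub> (n * m) = (x [^]\<^bsub>M\<^esub> n) [^]\<^bsub>M\<^esub> m \<otimes>\<^bsub>M\<^esub> (y [^]\<^bsub>M\<^esub> m) [^]\<^bsub>M\<^esub> n"
      using nm by (simp add: M.nat_pow_distrib M.nat_pow_pow mult.commute)
    then have "(x \<otimes>\<^bsub>M\<^esub> y) [^]\<^bsub>M\<^esub> (n * m) \<in> A" using nm A_mult A_nat_pow by simp
    then show ?case using nm by (auto intro!: exI[of _ "n * m"])
  qed
  then show ?thesis by blast
qed

subsection \<open>The completion\<close>

abbreviation \<A> :: "('a set \<Rightarrow> 'a set) set" where "\<A> \<equiv> Abar M S A sig"
abbreviation \<T> :: "('a set \<Rightarrow> 'a set) topology" where "\<T> \<equiv> Abar_top M S A sig"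
abbreviation \<iota> :: "'a \<Rightarrow> 'a set \<Rightarrow> 'a set" where "\<iota> \<equiv> iota M S A sig"

lemma mem_lcoset:
  assumes "subgroup C M" "a \<in> carrier M" "x \<in> carrier M"
  shows "x \<in> a <#\<^bsub>M\<^esub> C \<longleftrightarrow> inv\<^bsub>M\<^esub> a \<otimes>\<^bsub>M\<^esub> x \<in> C"
proof
  assume "x \<in> a <#\<^bsub>M\<^esub> C"
  then obtain c where "c \<in> C" "x = a \<otimes>\<^bsub>M\<^esub> c" by (auto simp: l_coset_def)
  then show "inv\<^bsub>M\<^esub> a \<otimes>\<^bsub>M\<^esub> x \<in> C"
    using assms subgroup.mem_carrier[OF assms(1)] by (simp add: M.mult_inv_cancel)
next
  assume "inv\<^bsub>M\<^esub> a \<otimes>\<^bsub>M\<^esub> x \<in> C"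
  then show "x \<in> a <#\<^bsub>M\<^esub> C"
    unfolding l_coset_def using assms by (auto intro!: bexI[of _ "inv\<^bsub>M\<^esub> a \<otimes>\<^bsub>M\<^esub> x"] simp: M.mult_inv_cancel)
qed

lemma lcoset_eq_iff:
  assumes C: "subgroup C M" and a: "a \<in> carrier M" and b: "b \<in> carrier M"
  shows "a <#\<^bsub>M\<^esub> C = b <#\<^bsub>M\<^esub> C \<longleftrightarrow> inv\<^bsub>M\<^esub> a \<otimes>\<^bsub>M\<^esub> b \<in> C"
proof -
  have bb: "b \<in> b <#\<^bsub>M\<^esub> C" using mem_lcoset[OF C b b] subgroup.one_closed[OF C] b by simp
  show ?thesis
    using M.l_repr_independence[OF _ a C, of b] mem_lcoset[OF C a b] bb by metis
qed

lemma lcoset_closed: "C \<in> \<C> \<Longrightarrow> a \<in> A \<Longrightarrow> a <#\<^bsub>M\<^esub> C \<subseteq> A"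
  using constr_subset[of C] by (auto simp: l_coset_def)

lemma self_in_lcoset: "C \<in> \<C> \<Longrightarrow> a \<in> carrier M \<Longrightarrow> a \<in> a <#\<^bsub>M\<^esub> C"
  using mem_lcoset[OF constr_subgroup] subgroup.one_closed[OF constr_subgroup] by simp

lemma Abar_coset:
  assumes "x \<in> \<A>" "C \<in> \<C>" "a \<in> x C"
  shows "a \<in> A" "x C = a <#\<^bsub>M\<^esub> C"
proof -
  obtain b where b: "b \<in> A" "x C = b <#\<^bsub>M\<^esub> C" using assms by (auto simp: Abar_def)
  then show a: "a \<in> A" using assms lcoset_closed by auto
  show "x C = a <#\<^bsub>M\<^esub> C"
    using b a assms lcoset_eq_iff[OF constr_subgroup[OF assms(2)], of b a]
      mem_lcoset[OF constr_subgroup[OF assms(2)], of b a] by simp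
qed

lemma Abar_ex:
  assumes "x \<in> \<A>" "C \<in> \<C>"
  shows "\<exists>a\<in>A. a \<in> x C"
proof -
  obtain b where "b \<in> A" "x C = b <#\<^bsub>M\<^esub> C" using assms by (auto simp: Abar_def)
  then show ?thesis using self_in_lcoset assms by auto
qed

lemma Abar_mono: "x \<in> \<A> \<Longrightarrow> C \<in> \<C> \<Longrightarrow> D \<in> \<C> \<Longrightarrow> D \<subseteq> C \<Longrightarrow> x D \<subseteq> x C"
  by (auto simp: Abar_def)

lemma Abar_eq_mono:
  assumes "x \<in> \<A>" "y \<in> \<A>" "C \<in> \<C>" "D \<in> \<C>" "D \<subseteq> C" "x D = y D"
  shows "x C = y C"
proof -
  obtain a where "a \<in> x D" using Abar_ex[OF assms(1,4)] by blast
  then have "a \<in> x C" "a \<in> y C" using assms Abar_mono by blast+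
  then show ?thesis using Abar_coset(2) assms by metis
qed

lemma Abar_ext:
  assumes "x \<in> \<A>" "y \<in> \<A>" "\<And>C. C \<in> \<C> \<Longrightarrow> x C = y C"
  shows "x = y"
proof
  fix C show "x C = y C" using assms by (cases "C \<in> \<C>") (auto simp: Abar_def)
qed

lemma iota_apply: "C \<in> \<C> \<Longrightarrow> \<iota> a C = a <#\<^bsub>M\<^esub> C"
  by (simp add: iota_def)

lemma iota_in_Abar [simp]: "a \<in> A \<Longrightarrow> \<iota> a \<in> \<A>"
  by (auto simp: Abar_def iota_def l_coset_def)

lemma iota_eq_iff_mem:
  assumes "x \<in> \<A>" "C \<in> \<C>" "a \<in> A"
  shows "\<iota> a C = x C \<longleftrightarrow> a \<in> x C"
  using assms Abar_coset self_in_lcoset[of C a] by (auto simp: iota_apply)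

lemma iota_eq_iff:
  assumes "C \<in> \<C>" "a \<in> A" "b \<in> A"
  shows "\<iota> a C = \<iota> b C \<longleftrightarrow> inv\<^bsub>M\<^esub> a \<otimes>\<^bsub>M\<^esub> b \<in> C"
  using assms lcoset_eq_iff[OF constr_subgroup] by (simp add: iota_apply)

lemma topspace_Abar: "topspace \<T> = \<A>"
proof -
  have "x \<in> \<Union>{{x \<in> \<A>. x C = c} | C c. C \<in> \<C>}" if "x \<in> \<A>" for x
    using that constr_top[of A S sig] by (intro UnionI[of "{y \<in> \<A>. y A = x A}"]) blast+
  then show ?thesis unfolding Abar_top_def by auto
qed

lemma openin_cylinder: "C \<in> \<C> \<Longrightarrow> openin \<T> {y \<in> \<A>. y C = c}"
  unfolding Abar_top_def by (rule topology_generated_by_Basis) blast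

text \<open>A single constructible subgroup describes a neighbourhood because constructible
  subgroups are closed under finite intersections.\<close>

lemma openin_Abar_iff:
  "openin \<T> U \<longleftrightarrow> U \<subseteq> \<A> \<and> (\<forall>x\<in>U. \<exists>C\<in>\<C>. \<forall>y\<in>\<A>. y C = x C \<longrightarrow> y \<in> U)"
proof
  assume U: "openin \<T> U"
  then have "generate_topology_on {{x \<in> \<A>. x C = c} | C c. C \<in> \<C>} U"
    unfolding Abar_top_def by (rule openin_topology_generated_by)
  then have "\<forall>x\<in>U. x \<in> \<A> \<and> (\<exists>C\<in>\<C>. \<forall>y\<in>\<A>. y C = x C \<longrightarrow> y \<in> U)"
  proof (induction rule: generate_topology_on.induct)
    case (Int a b)
    show ?case
    proof
      fix x assume x: "x \<in> a \<inter> b"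
      obtain C where C: "x \<in> \<A>" "C \<in> \<C>" "\<forall>y\<in>\<A>. y C = x C \<longrightarrow> y \<in> a" using Int x by blast
      obtain D where D: "D \<in> \<C>" "\<forall>y\<in>\<A>. y D = x D \<longrightarrow> y \<in> b" using Int x by blast
      have "y \<in> a \<inter> b" if "y \<in> \<A>" "y (C \<inter> D) = x (C \<inter> D)" for y
        using C D that Abar_eq_mono[OF that(1) C(1), of C "C \<inter> D"]
          Abar_eq_mono[OF that(1) C(1), of D "C \<inter> D"] constr_Int by auto
      then show "x \<in> \<A> \<and> (\<exists>C\<in>\<C>. \<forall>y\<in>\<A>. y C = x C \<longrightarrow> y \<in> a \<inter> b)"
        using constr_Int[OF C(2) D(1)] C(1) by blast
    qed
  next
    case (UN K)
    show ?case
    proof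
      fix x assume "x \<in> \<Union>K"
      then obtain k where k: "k \<in> K" "x \<in> k" by blast
      then obtain C where "x \<in> \<A>" "C \<in> \<C>" "\<forall>y\<in>\<A>. y C = x C \<longrightarrow> y \<in> k" using UN.IH[OF k(1)] by blast
      then show "x \<in> \<A> \<and> (\<exists>C\<in>\<C>. \<forall>y\<in>\<A>. y C = x C \<longrightarrow> y \<in> \<Union>K)" using k by blast
    qed
  next
    case (Basis s)
    then obtain C c where Cc: "C \<in> \<C>" "s = {x \<in> \<A>. x C = c}" by blast
    then show ?case by auto
  qed simp
  then show "U \<subseteq> \<A> \<and> (\<forall>x\<in>U. \<exists>C\<in>\<C>. \<forall>y\<in>\<A>. y C = x C \<longrightarrow> y \<in> U)" by blast
next
  assume U: "U \<subseteq> \<A> \<and> (\<forall>x\<in>U. \<exists>C\<in>\<C>. \<forall>y\<in>\<A>. y C = x C \<longrightarrow> y \<in> U)"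
  show "openin \<T> U"
  proof (subst openin_subopen, intro ballI)
    fix x assume x: "x \<in> U"
    then obtain C where C: "C \<in> \<C>" "\<forall>y\<in>\<A>. y C = x C \<longrightarrow> y \<in> U" using U by blast
    then show "\<exists>V. openin \<T> V \<and> x \<in> V \<and> V \<subseteq> U"
      using U x openin_cylinder[OF C(1), of "x C"] by (intro exI[of _ "{y \<in> \<A>. y C = x C}"]) auto
  qed
qed

lemma Hausdorff_Abar: "Hausdorff_space \<T>"
  unfolding Hausdorff_space_def topspace_Abar
proof (intro allI impI)
  fix x y assume xy: "x \<in> \<A> \<and> y \<in> \<A> \<and> x \<noteq> y"
  then obtain C where C: "C \<in> \<C>" "x C \<noteq> y C" using Abar_ext by blast
  show "\<exists>U V. openin \<T> U \<and> openin \<T> V \<and> x \<in> U \<and> y \<in> V \<and> disjnt U V"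
    using xy C openin_cylinder[OF C(1)]
    by (intro exI[of _ "{z \<in> \<A>. z C = x C}"] exI[of _ "{z \<in> \<A>. z C = y C}"]) (auto simp: disjnt_def)
qed

text \<open>Tychonoff for the finite coset spaces \<open>K C\<close>. Each compatibility condition
  involves two coordinates only, so the completion is closed in the product. Indices outside the
  constructible family carry a one-point space with value {}, as in \<open>Abar\<close>.\<close>

lemma compact_Abar: "compact_space \<T>"
proof -
  define K where "K C = (if C \<in> \<C> then (\<lambda>a. a <#\<^bsub>M\<^esub> C) ` A else {{}})" for C
  define P where "P = product_topology (\<lambda>C. discrete_topology (K C)) UNIV"
  have finK: "finite (K C)" for C
  proof (cases "C \<in> \<C>")
    case True
    obtain F where F: "finite F" "F \<subseteq> A" "\<forall>a\<in>A. \<exists>f\<in>F. \<exists>c\<in>C. a = f \<otimes>\<^bsub>M\<^esub> c"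
      using constr_finite_index[OF True] by blast
    have "K C \<subseteq> (\<lambda>a. a <#\<^bsub>M\<^esub> C) ` F"
    proof
      fix k assume "k \<in> K C"
      then obtain a where a: "a \<in> A" "k = a <#\<^bsub>M\<^esub> C" using True by (auto simp: K_def)
      obtain f c where f: "f \<in> F" "c \<in> C" "a = f \<otimes>\<^bsub>M\<^esub> c" using F a by blast
      have "f <#\<^bsub>M\<^esub> C = a <#\<^bsub>M\<^esub> C"
      proof -
        have "f \<in> A" "c \<in> A" using f F(2) constr_subset[OF True] by auto
        then show ?thesis
          using f a(1) lcoset_eq_iff[OF constr_subgroup[OF True], of f a] by (simp add: M.mult_inv_cancel)
      qed
      then show "k \<in> (\<lambda>a. a <#\<^bsub>M\<^esub> C) ` F" using a f by blast
    qed
    then show ?thesis using finite_surj[OF F(1)] by simp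
  qed (simp add: K_def)
  have compP: "compact_space P"
    unfolding P_def compact_space_product_topology
    by (intro disjI2 ballI) (simp add: compact_space_discrete_topology finK)
  have topP: "topspace P = {x. \<forall>C. x C \<in> K C}"
    by (auto simp: P_def PiE_UNIV_domain)
  have AP: "\<A> \<subseteq> topspace P" by (auto simp: topP K_def Abar_def)
  have cyl: "openin P {x \<in> topspace P. x C \<in> Q}" for C Q
  proof -
    have "continuous_map P (discrete_topology (K C)) (\<lambda>x. x C)"
      unfolding P_def using continuous_map_product_projection[of C UNIV "\<lambda>C. discrete_topology (K C)"] by simp
    then have "openin P {x \<in> topspace P. x C \<in> Q \<inter> K C}"
      by (rule openin_continuous_map_preimage) simp
    moreover have "{x \<in> topspace P. x C \<in> Q \<inter> K C} = {x \<in> topspace P. x C \<in> Q}" by (auto simp: topP)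
    ultimately show ?thesis by simp
  qed
  have "closedin P \<A>"
    unfolding closedin_def
  proof (intro conjI)
    show "openin P (topspace P - \<A>)"
    proof (subst openin_subopen, intro ballI)
      fix x assume x: "x \<in> topspace P - \<A>"
      then have xK: "x C \<in> K C" for C by (simp add: topP)
      have 1: "\<exists>a\<in>A. x C = a <#\<^bsub>M\<^esub> C" if "C \<in> \<C>" for C using xK[of C] that by (auto simp: K_def)
      have 2: "x C = {}" if "C \<notin> \<C>" for C using xK[of C] that by (simp add: K_def)
      obtain C D where CD: "C \<in> \<C>" "D \<in> \<C>" "D \<subseteq> C" "\<not> x D \<subseteq> x C"
        using x 1 2 by (simp add: Abar_def) blast
      define V where "V = {y \<in> topspace P. y D \<in> {x D}} \<inter> {y \<in> topspace P. y C \<in> {x C}}"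
      have "openin P V" unfolding V_def by (intro openin_Int cyl)
      moreover have "x \<in> V" using x by (simp add: V_def)
      moreover have "V \<subseteq> topspace P - \<A>"
      proof
        fix y assume y: "y \<in> V"
        then have "\<not> y D \<subseteq> y C" using CD by (simp add: V_def)
        then have "y \<notin> \<A>" using Abar_mono CD by blast
        then show "y \<in> topspace P - \<A>" using y by (simp add: V_def)
      qed
      ultimately show "\<exists>V. openin P V \<and> x \<in> V \<and> V \<subseteq> topspace P - \<A>" by blast
    qed
  qed (rule AP)
  then have "compactin P \<A>" using compP closedin_compact_space by blast
  then have comp: "compact_space (subtopology P \<A>)" by (simp add: compact_space_subtopology)
  have ts: "topspace (subtopology P \<A>) = \<A>" using AP by auto
  \<comment> \<open>Compactness is transported along the identity, from the product topology to the
    topology generated by the cylinders.\<close>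
  have "continuous_map (subtopology P \<A>) \<T> (\<lambda>x. x)"
    unfolding continuous_map_def ts topspace_Abar
  proof (intro conjI allI impI)
    fix U assume U: "openin \<T> U"
    have "openin (subtopology P \<A>) U"
    proof (subst openin_subopen, intro ballI)
      fix x assume x: "x \<in> U"
      then obtain C where C: "x \<in> \<A>" "C \<in> \<C>" "\<forall>y\<in>\<A>. y C = x C \<longrightarrow> y \<in> U"
        using U unfolding openin_Abar_iff by blast
      have "openin (subtopology P \<A>) ({y \<in> topspace P. y C \<in> {x C}} \<inter> \<A>)"
        by (rule openin_subtopology_Int[OF cyl])
      then show "\<exists>V. openin (subtopology P \<A>) V \<and> x \<in> V \<and> V \<subseteq> U"
        using C AP by (intro exI[of _ "{y \<in> topspace P. y C \<in> {x C}} \<inter> \<A>"]) auto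
    qed
    moreover have "{x \<in> \<A>. x \<in> U} = U" using U unfolding openin_Abar_iff by blast
    ultimately show "openin (subtopology P \<A>) {x \<in> \<A>. x \<in> U}" by simp
  qed simp
  from image_compactin[OF comp[unfolded compact_space_def] this]
  have "compactin \<T> \<A>" unfolding ts by simp
  then show ?thesis by (simp add: compact_space_def topspace_Abar)
qed

text \<open>Finitely many neighbourhoods of constancy cover the completion, and a constructible
  subgroup inside all of theirs works at every point.\<close>

lemma uniformly_locally_constant:
  assumes loc: "\<And>x. x \<in> \<A> \<Longrightarrow> \<exists>C\<in>\<C>. \<forall>y\<in>\<A>. y C = x C \<longrightarrow> h y = h x"
  shows "\<exists>C\<in>\<C>. \<forall>x\<in>\<A>. \<forall>y\<in>\<A>. x C = y C \<longrightarrow> h x = h y"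
proof -
  obtain N where N: "\<And>x. x \<in> \<A> \<Longrightarrow> N x \<in> \<C> \<and> (\<forall>y\<in>\<A>. y (N x) = x (N x) \<longrightarrow> h y = h x)"
    using loc by metis
  define U where "U x = {y \<in> \<A>. y (N x) = x (N x)}" for x
  have "\<forall>u\<in>U ` \<A>. openin \<T> u" using N openin_cylinder by (auto simp: U_def)
  moreover have "topspace \<T> \<subseteq> \<Union>(U ` \<A>)" by (auto simp: topspace_Abar U_def)
  ultimately obtain F where F: "finite F" "F \<subseteq> U ` \<A>" "topspace \<T> \<subseteq> \<Union>F"
    using compact_Abar unfolding compact_space_alt by (elim allE[of _ "U ` \<A>"]) blast
  then obtain X where X: "X \<subseteq> \<A>" "finite X" "F = U ` X" using finite_subset_image[OF F(1,2)] by blast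
  have "finite (N ` X)" "N ` X \<subseteq> \<C>" using X N by auto
  then obtain C where C: "C \<in> \<C>" "\<forall>D\<in>N ` X. C \<subseteq> D" using constr_finite_lower by blast
  have "h x = h y" if xy: "x \<in> \<A>" "y \<in> \<A>" "x C = y C" for x y
  proof -
    obtain z where z: "z \<in> X" "x (N z) = z (N z)"
      using F(3) X(3) xy(1) by (auto simp: topspace_Abar U_def)
    have zA: "z \<in> \<A>" using z X by blast
    have "x (N z) = y (N z)"
      using Abar_eq_mono[OF xy(1,2) _ C(1) _ xy(3)] N[OF zA] C(2) z(1) by blast
    then show ?thesis using N[OF zA] z(2) xy by metis
  qed
  then show ?thesis using C(1) by blast
qed

subsection \<open>The partial action on the completion\<close>

abbreviation "dom_p p \<equiv> pdom M A sig p"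
abbreviation "act_p p \<equiv> pact M sig p"
abbreviation "\<U> p \<equiv> Udom M S A sig p"
abbreviation "\<theta> p \<equiv> theta M S A sig p"

lemma pdom_A: "a \<in> dom_p p \<Longrightarrow> a \<in> A" and pact_A: "a \<in> dom_p p \<Longrightarrow> act_p p a \<in> A"
  by (auto simp: pdom_def)

lemma pact_shift:
  assumes p: "p \<in> sd_carrier M G" and a: "a \<in> carrier M" "b \<in> carrier M"
  shows "act_p p b = act_p p a \<otimes>\<^bsub>M\<^esub> sig (snd p) (inv\<^bsub>M\<^esub> a \<otimes>\<^bsub>M\<^esub> b)"
proof -
  have "b = a \<otimes>\<^bsub>M\<^esub> (inv\<^bsub>M\<^esub> a \<otimes>\<^bsub>M\<^esub> b)" using a by (simp add: M.mult_inv_cancel)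
  then have "sig (snd p) b = sig (snd p) a \<otimes>\<^bsub>M\<^esub> sig (snd p) (inv\<^bsub>M\<^esub> a \<otimes>\<^bsub>M\<^esub> b)"
    using sig_add[of "snd p" a "inv\<^bsub>M\<^esub> a \<otimes>\<^bsub>M\<^esub> b"] p a by (simp add: sd_carrier_def mem_Times_iff)
  then show ?thesis using p a by (simp add: pact_def sd_carrier_def mem_Times_iff M.m_assoc)
qed

lemma Udom_iff:
  "x \<in> \<U> p \<longleftrightarrow> x \<in> \<A> \<and> (\<forall>C\<in>\<C>. \<exists>a\<in>dom_p p. a \<in> x C)"
proof
  assume x: "x \<in> \<U> p"
  then have xA: "x \<in> \<A>" unfolding Udom_def in_closure_of topspace_Abar by blast
  have "\<exists>a\<in>dom_p p. a \<in> x C" if C: "C \<in> \<C>" for C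
  proof -
    have "\<forall>T. x \<in> T \<and> openin \<T> T \<longrightarrow> (\<exists>y. y \<in> \<iota> ` dom_p p \<and> y \<in> T)"
      using x unfolding Udom_def in_closure_of by (rule conjunct2)
    then have "x \<in> {y \<in> \<A>. y C = x C} \<and> openin \<T> {y \<in> \<A>. y C = x C} \<longrightarrow>
        (\<exists>y. y \<in> \<iota> ` dom_p p \<and> y \<in> {y \<in> \<A>. y C = x C})" by (rule spec)
    then obtain y where "y \<in> \<iota> ` dom_p p" "y \<in> {y \<in> \<A>. y C = x C}"
      using openin_cylinder[OF C, of "x C"] xA by auto
    then obtain a where "a \<in> dom_p p" "\<iota> a C = x C" by blast
    then show ?thesis using iota_eq_iff_mem[OF xA C] pdom_A by blast
  qed
  then show "x \<in> \<A> \<and> (\<forall>C\<in>\<C>. \<exists>a\<in>dom_p p. a \<in> x C)" using xA by blast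
next
  assume x: "x \<in> \<A> \<and> (\<forall>C\<in>\<C>. \<exists>a\<in>dom_p p. a \<in> x C)"
  show "x \<in> \<U> p"
    unfolding Udom_def in_closure_of topspace_Abar
  proof (intro conjI allI impI)
    fix T assume T: "x \<in> T \<and> openin \<T> T"
    then have "openin \<T> T" "x \<in> T" by auto
    then obtain C where C: "C \<in> \<C>" "\<forall>y\<in>\<A>. y C = x C \<longrightarrow> y \<in> T"
      using openin_Abar_iff[of T] by meson
    obtain a where a: "a \<in> dom_p p" "a \<in> x C" using x C(1) by blast
    have aA: "a \<in> A" using a pdom_A by blast
    then have "\<iota> a C = x C" using iota_eq_iff_mem[of x C a] x C(1) a by blast
    then have "\<iota> a \<in> T" using C(2) aA by simp
    then show "\<exists>y. y \<in> \<iota> ` dom_p p \<and> y \<in> T" using a by blast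
  qed (use x in blast)
qed

lemma iota_in_Udom: "a \<in> dom_p p \<Longrightarrow> \<iota> a \<in> \<U> p"
  unfolding Udom_iff using pdom_A[of a p] by (auto simp: iota_apply intro!: bexI[of _ a] self_in_lcoset)

text \<open>An explicit candidate for the extension: its value modulo \<open>C\<close> is found by
  moving any point of the domain that agrees with \<open>x\<close> modulo a pullback
  \<open>C'\<close> of \<open>C\<close>. The value \<open>undefined\<close> outside the domain is
  the one prescribed by \<open>theta\<close>.\<close>

definition ext_act :: "'a \<times> 'g \<Rightarrow> ('a set \<Rightarrow> 'a set) \<Rightarrow> 'a set \<Rightarrow> 'a set" where
  "ext_act p x = (if x \<in> \<U> p then
     (\<lambda>C. if C \<in> \<C> then
        act_p p (SOME a. \<exists>C'\<in>\<C>. (\<forall>c\<in>C'. sig (snd p) c \<in> C) \<and> a \<in> dom_p p \<and> a \<in> x C') <#\<^bsub>M\<^esub> C else {})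
     else undefined)"

text \<open>Two admissible approximations of \<open>x\<close> are compared through a third one,
  taken modulo the intersection of the two pullbacks.\<close>

lemma ext_act_eq:
  assumes p: "p \<in> sd_carrier M G" and x: "x \<in> \<U> p" and C: "C \<in> \<C>"
    and C': "C' \<in> \<C>" "\<forall>c\<in>C'. sig (snd p) c \<in> C" and a: "a \<in> dom_p p" "a \<in> x C'"
  shows "ext_act p x C = act_p p a <#\<^bsub>M\<^esub> C"
proof -
  let ?Q = "\<lambda>a. \<exists>C'\<in>\<C>. (\<forall>c\<in>C'. sig (snd p) c \<in> C) \<and> a \<in> dom_p p \<and> a \<in> x C'"
  define b where "b = (SOME a. ?Q a)"
  have "?Q a" using C' a by blast
  then have "?Q b" unfolding b_def by (rule someI)
  then obtain D where D: "D \<in> \<C>" "\<forall>c\<in>D. sig (snd p) c \<in> C" "b \<in> dom_p p" "b \<in> x D" by blast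
  have xA: "x \<in> \<A>" using x by (simp add: Udom_iff)
  obtain d where d: "d \<in> dom_p p" "d \<in> x (C' \<inter> D)"
    using x constr_Int[OF C'(1) D(1)] unfolding Udom_iff by blast
  have dd: "d \<in> x C'" "d \<in> x D"
    using d Abar_mono[OF xA, of C' "C' \<inter> D"] Abar_mono[OF xA, of D "C' \<inter> D"]
      constr_Int[OF C'(1) D(1)] C'(1) D(1) by auto
  have same: "act_p p u <#\<^bsub>M\<^esub> C = act_p p d <#\<^bsub>M\<^esub> C"
    if u: "u \<in> dom_p p" "u \<in> x E" and E: "E \<in> \<C>" "\<forall>c\<in>E. sig (snd p) c \<in> C" "d \<in> x E" for u E
  proof -
    have A: "u \<in> A" "d \<in> A" "act_p p u \<in> A" "act_p p d \<in> A" using u d pdom_A pact_A by auto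
    have "x E = u <#\<^bsub>M\<^esub> E" using Abar_coset(2)[OF xA E(1) u(2)] .
    then have "inv\<^bsub>M\<^esub> u \<otimes>\<^bsub>M\<^esub> d \<in> E"
      using E(3) mem_lcoset[OF constr_subgroup[OF E(1)], of u d] A by simp
    then have k: "sig (snd p) (inv\<^bsub>M\<^esub> u \<otimes>\<^bsub>M\<^esub> d) \<in> C" using E(2) by blast
    have "inv\<^bsub>M\<^esub> (act_p p u) \<otimes>\<^bsub>M\<^esub> act_p p d = sig (snd p) (inv\<^bsub>M\<^esub> u \<otimes>\<^bsub>M\<^esub> d)"
      using pact_shift[OF p, of u d] A k constr_subset[OF C] by (auto simp: M.mult_inv_cancel subset_iff)
    then show ?thesis using lcoset_eq_iff[OF constr_subgroup[OF C], of "act_p p u" "act_p p d"] A k by simp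
  qed
  have "act_p p b <#\<^bsub>M\<^esub> C = act_p p a <#\<^bsub>M\<^esub> C"
    using same[OF D(3,4,1,2) dd(2)] same[OF a C' dd(1)] by simp
  then show ?thesis using x C by (simp add: ext_act_def b_def)
qed

lemma ext_act_point:
  assumes p: "p \<in> sd_carrier M G" and x: "x \<in> \<U> p" and C: "C \<in> \<C>"
  obtains C' a where "C' \<in> \<C>" "\<forall>c\<in>C'. sig (snd p) c \<in> C" "a \<in> dom_p p" "a \<in> x C'"
    "ext_act p x C = act_p p a <#\<^bsub>M\<^esub> C"
proof -
  obtain C' where C': "C' \<in> \<C>" "\<forall>c\<in>C'. sig (snd p) c \<in> C"
    using constr_pullback[of "snd p" C] p C by (auto simp: sd_carrier_def)
  obtain a where a: "a \<in> dom_p p" "a \<in> x C'" using x C' unfolding Udom_iff by blast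
  show ?thesis using that[OF C' a ext_act_eq[OF p x C C' a]] .
qed

lemma ext_act_Abar:
  assumes p: "p \<in> sd_carrier M G" and x: "x \<in> \<U> p"
  shows "ext_act p x \<in> \<A>"
proof -
  have 1: "\<exists>a\<in>A. ext_act p x C = a <#\<^bsub>M\<^esub> C" if "C \<in> \<C>" for C
    using ext_act_point[OF p x that] pact_A by metis
  have 2: "ext_act p x D \<subseteq> ext_act p x C" if CD: "C \<in> \<C>" "D \<in> \<C>" "D \<subseteq> C" for C D
  proof -
    obtain C' a where C': "C' \<in> \<C>" "\<forall>c\<in>C'. sig (snd p) c \<in> D" "a \<in> dom_p p" "a \<in> x C'"
      "ext_act p x D = act_p p a <#\<^bsub>M\<^esub> D"
      by (rule ext_act_point[OF p x CD(2)])
    have "\<forall>c\<in>C'. sig (snd p) c \<in> C" using C'(2) CD(3) by blast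
    then have "ext_act p x C = act_p p a <#\<^bsub>M\<^esub> C" by (rule ext_act_eq[OF p x CD(1) C'(1) _ C'(3,4)])
    then show ?thesis using C'(5) CD(3) by (auto simp: l_coset_def)
  qed
  have 3: "ext_act p x C = {}" if "C \<notin> \<C>" for C using that x by (simp add: ext_act_def)
  show ?thesis unfolding Abar_def using 1 2 3 by blast
qed

lemma ext_act_iota:
  assumes p: "p \<in> sd_carrier M G" and a: "a \<in> dom_p p"
  shows "ext_act p (\<iota> a) = \<iota> (act_p p a)"
proof (rule Abar_ext)
  have x: "\<iota> a \<in> \<U> p" using iota_in_Udom[OF a] .
  show "ext_act p (\<iota> a) \<in> \<A>" using ext_act_Abar[OF p x] .
  show "\<iota> (act_p p a) \<in> \<A>" using pact_A[OF a] by simp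
  fix C assume C: "C \<in> \<C>"
  obtain C' where C': "C' \<in> \<C>" "\<forall>c\<in>C'. sig (snd p) c \<in> C"
    using constr_pullback[of "snd p" C] p C by (auto simp: sd_carrier_def)
  have "a \<in> \<iota> a C'" using self_in_lcoset[OF C'(1)] pdom_A[OF a] by (simp add: iota_apply C'(1))
  then have "ext_act p (\<iota> a) C = act_p p a <#\<^bsub>M\<^esub> C" by (rule ext_act_eq[OF p x C C' a])
  then show "ext_act p (\<iota> a) C = \<iota> (act_p p a) C" using C by (simp add: iota_apply)
qed

lemma continuous_ext_act:
  assumes p: "p \<in> sd_carrier M G"
  shows "continuous_map (subtopology \<T> (\<U> p)) \<T> (ext_act p)"
proof -
  have UA: "\<U> p \<subseteq> \<A>" by (auto simp: Udom_iff)
  have ts: "topspace (subtopology \<T> (\<U> p)) = \<U> p" using UA by (auto simp: topspace_Abar)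
  show ?thesis
    unfolding continuous_map_def ts topspace_Abar
  proof (intro conjI allI impI)
    show "ext_act p \<in> \<U> p \<rightarrow> \<A>" using ext_act_Abar[OF p] by blast
    fix V assume V: "openin \<T> V"
    show "openin (subtopology \<T> (\<U> p)) {x \<in> \<U> p. ext_act p x \<in> V}"
    proof (subst openin_subopen, intro ballI)
      fix x assume x: "x \<in> {x \<in> \<U> p. ext_act p x \<in> V}"
      then have xU: "x \<in> \<U> p" by blast
      obtain C where C: "C \<in> \<C>" "\<forall>y\<in>\<A>. y C = ext_act p x C \<longrightarrow> y \<in> V"
        using V x unfolding openin_Abar_iff by blast
      obtain C' a where C': "C' \<in> \<C>" "\<forall>c\<in>C'. sig (snd p) c \<in> C" "a \<in> dom_p p" "a \<in> x C'"
        "ext_act p x C = act_p p a <#\<^bsub>M\<^esub> C"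
        by (rule ext_act_point[OF p xU C(1)])
      define W where "W = {y \<in> \<A>. y C' = x C'} \<inter> \<U> p"
      have "openin (subtopology \<T> (\<U> p)) W"
        unfolding W_def by (rule openin_subtopology_Int[OF openin_cylinder[OF C'(1)]])
      moreover have "x \<in> W" using xU UA by (auto simp: W_def)
      moreover have "W \<subseteq> {x \<in> \<U> p. ext_act p x \<in> V}"
      proof
        fix y assume y: "y \<in> W"
        then have yU: "y \<in> \<U> p" and "a \<in> y C'" using C'(4) by (auto simp: W_def)
        then have "ext_act p y C = ext_act p x C"
          using ext_act_eq[OF p yU C(1) C'(1,2,3)] C'(5) by simp
        then show "y \<in> {x \<in> \<U> p. ext_act p x \<in> V}" using C(2) ext_act_Abar[OF p yU] yU by blast
      qed
      ultimately show "\<exists>W. openin (subtopology \<T> (\<U> p)) W \<and> x \<in> W \<and> W \<subseteq> {x \<in> \<U> p. ext_act p x \<in> V}"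
        by blast
    qed
  qed
qed

text \<open>Existence of the extension is \<open>ext_act\<close>. Uniqueness holds because
  \<open>Udom\<close> is the closure of the set on which the map is prescribed and the completion is
  Hausdorff.\<close>

lemma theta_eq_ext_act:
  assumes p: "p \<in> sd_carrier M G"
  shows "\<theta> p = ext_act p"
  unfolding theta_def
proof (rule the_equality)
  show "continuous_map (subtopology \<T> (\<U> p)) \<T> (ext_act p) \<and>
      (\<forall>a\<in>dom_p p. ext_act p (\<iota> a) = \<iota> (act_p p a)) \<and> (\<forall>x. x \<notin> \<U> p \<longrightarrow> ext_act p x = undefined)"
    using continuous_ext_act[OF p] ext_act_iota[OF p] by (auto simp: ext_act_def)
next
  fix f assume f: "continuous_map (subtopology \<T> (\<U> p)) \<T> f \<and>
      (\<forall>a\<in>dom_p p. f (\<iota> a) = \<iota> (act_p p a)) \<and> (\<forall>x. x \<notin> \<U> p \<longrightarrow> f x = undefined)"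
  show "f = ext_act p"
  proof
    fix x
    show "f x = ext_act p x"
    proof (cases "x \<in> \<U> p")
      case True
      have sub: "\<iota> ` dom_p p \<subseteq> \<U> p" using iota_in_Udom by blast
      then have "x \<in> subtopology \<T> (\<U> p) closure_of (\<iota> ` dom_p p)"
        using True by (simp add: closure_of_subtopology inf.absorb2 Udom_def[symmetric])
      moreover have "f y = ext_act p y" if "y \<in> \<iota> ` dom_p p" for y
        using that f ext_act_iota[OF p] by auto
      moreover have "continuous_map (subtopology \<T> (\<U> p)) \<T> f" using f by simp
      ultimately show ?thesis
        using forall_in_closure_of_eq[OF _ Hausdorff_Abar _ continuous_ext_act[OF p]] by blast
    next
      case False
      then show ?thesis using f by (simp add: ext_act_def)
    qed
  qed
qed

lemma theta_iota:
  assumes "p \<in> sd_carrier M G" "a \<in> dom_p p"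
  shows "\<theta> p (\<iota> a) = \<iota> (act_p p a)"
  using assms theta_eq_ext_act ext_act_iota by simp

lemma pact_sd_mult:
  assumes "p \<in> sd_carrier M G" "q \<in> sd_carrier M G" "x \<in> carrier M"
  shows "act_p (sd_mult M G sig p q) x = act_p p (act_p q x)"
  using assms by (simp add: pact_def sd_mult_def sd_carrier_def mem_Times_iff sig_mult sig_add M.m_assoc)

text \<open>A point \<open>a\<close> near \<open>y\<close> is moved by \<open>q\<close> near the
  image of \<open>y\<close>, so it lands at a point that differs from some point \<open>b\<close> of
  the domain of \<open>p\<close> by an element of \<open>C0\<close>; the linear part of
  \<open>p\<close> maps \<open>C0\<close> into \<open>A\<close>, so \<open>p\<close> is defined
  there too.\<close>

lemma Udom_sd_mult:
  assumes p: "p \<in> sd_carrier M G" and q: "q \<in> sd_carrier M G"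
    and y: "y \<in> \<U> q" and qy: "\<theta> q y \<in> \<U> p"
  shows "y \<in> \<U> (sd_mult M G sig p q)"
  unfolding Udom_iff
proof (intro conjI ballI)
  show yA: "y \<in> \<A>" using y by (simp add: Udom_iff)
  fix C assume C: "C \<in> \<C>"
  obtain C0 where C0: "C0 \<in> \<C>" "\<forall>c\<in>C0. sig (snd p) c \<in> A"
    using constr_pullback[OF _ constr_top, of "snd p"] p unfolding sd_carrier_def by auto
  obtain C1 where C1: "C1 \<in> \<C>" "\<forall>c\<in>C1. sig (snd q) c \<in> C0"
    using constr_pullback[of "snd q" C0] C0 q by (auto simp: sd_carrier_def)
  have CC: "C \<inter> C1 \<in> \<C>" using constr_Int C C1 by blast
  obtain a where a: "a \<in> dom_p q" "a \<in> y (C \<inter> C1)" using y CC unfolding Udom_iff by blast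
  have a': "a \<in> y C" "a \<in> y C1"
    using a(2) Abar_mono[OF yA C CC] Abar_mono[OF yA C1(1) CC] by auto
  have t: "\<theta> q y C0 = act_p q a <#\<^bsub>M\<^esub> C0"
    using theta_eq_ext_act[OF q] ext_act_eq[OF q y C0(1) C1 a(1) a'(2)] by simp
  obtain b where b: "b \<in> dom_p p" "b \<in> \<theta> q y C0" using qy C0(1) unfolding Udom_iff by blast
  have A: "a \<in> A" "act_p q a \<in> A" "b \<in> A" "act_p p b \<in> A" using a b pdom_A pact_A by auto
  have "inv\<^bsub>M\<^esub> (act_p q a) \<otimes>\<^bsub>M\<^esub> b \<in> C0"
    using b(2) t mem_lcoset[OF constr_subgroup[OF C0(1)]] A by simp
  then have "inv\<^bsub>M\<^esub> (inv\<^bsub>M\<^esub> (act_p q a) \<otimes>\<^bsub>M\<^esub> b) \<in> C0"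
    using subgroup.m_inv_closed[OF constr_subgroup[OF C0(1)]] by blast
  then have "inv\<^bsub>M\<^esub> b \<otimes>\<^bsub>M\<^esub> act_p q a \<in> C0" using A by (simp add: M.inv_mult_group)
  then have "act_p p (act_p q a) \<in> A" using pact_shift[OF p, of b "act_p q a"] A C0(2) by auto
  then have "a \<in> dom_p (sd_mult M G sig p q)"
    using A pact_sd_mult[OF p q] by (simp add: pdom_def)
  then show "\<exists>a\<in>dom_p (sd_mult M G sig p q). a \<in> y C" using a' by blast
qed

end

section \<open>The groupoid cocycle\<close>

definition sd_group :: "'a monoid \<Rightarrow> 'g monoid \<Rightarrow> ('g \<Rightarrow> 'a \<Rightarrow> 'a) \<Rightarrow> ('a \<times> 'g) monoid" where
  "sd_group M G sig = \<lparr>carrier = sd_carrier M G, monoid.mult = sd_mult M G sig, one = (\<one>\<^bsub>M\<^esub>, \<one>\<^bsub>G\<^esub>)\<rparr>"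

context alg_action
begin

lemma sd_group_simps [simp]:
  "carrier (sd_group M G sig) = carrier M \<times> carrier G"
  "p \<otimes>\<^bsub>sd_group M G sig\<^esub> q = (fst p \<otimes>\<^bsub>M\<^esub> sig (snd p) (fst q), snd p \<otimes>\<^bsub>G\<^esub> snd q)"
  "\<one>\<^bsub>sd_group M G sig\<^esub> = (\<one>\<^bsub>M\<^esub>, \<one>\<^bsub>G\<^esub>)"
  by (simp_all add: sd_group_def sd_carrier_def sd_mult_def)

lemma group_sd_group: "group (sd_group M G sig)"
proof (rule groupI)
  fix p assume "p \<in> carrier (sd_group M G sig)"
  then show "\<exists>q\<in>carrier (sd_group M G sig). q \<otimes>\<^bsub>sd_group M G sig\<^esub> p = \<one>\<^bsub>sd_group M G sig\<^esub>"
    by (intro bexI[of _ "(inv\<^bsub>M\<^esub> (sig (inv\<^bsub>G\<^esub> (snd p)) (fst p)), inv\<^bsub>G\<^esub> (snd p))"])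
      (auto simp: mem_Times_iff)
qed (auto simp: M.m_assoc G.m_assoc sig_add sig_mult)

lemma snd_hom_sd_group: "snd \<in> hom (sd_group M G sig) G"
  by (auto simp: hom_def)

lemma gpd_arr_iff: "(p, x) \<in> gpd_arr M G S A sig \<longleftrightarrow> p \<in> sd_carrier M G \<and> x \<in> \<U> p"
  by (simp add: gpd_arr_def)

lemma gpd_mul_closed:
  assumes "e \<in> gpd_arr M G S A sig" "f \<in> gpd_arr M G S A sig" "gpd_src e = gpd_rng M S A sig f"
  shows "gpd_mul M G sig e f \<in> gpd_arr M G S A sig"
proof -
  obtain p x q y where e: "e = (p, x)" "f = (q, y)" by (cases e, cases f) blast
  have h: "p \<in> sd_carrier M G" "q \<in> sd_carrier M G" "x \<in> \<U> p" "y \<in> \<U> q" "x = \<theta> q y"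
    using assms by (auto simp: e gpd_arr_iff gpd_src_def gpd_rng_def)
  then have "y \<in> \<U> (sd_mult M G sig p q)" using Udom_sd_mult by blast
  moreover have "sd_mult M G sig p q \<in> sd_carrier M G"
    using h by (auto simp: sd_mult_def sd_carrier_def)
  ultimately show ?thesis by (simp add: e gpd_mul_def gpd_arr_iff)
qed

lemma topspace_gpd: "topspace (gpd_top M G S A sig) = gpd_arr M G S A sig"
  by (auto simp: gpd_top_def topspace_Abar gpd_arr_def Udom_iff)

lemma gpd_nbhd:
  assumes W: "openin (gpd_top M G S A sig) W" and px: "(p, x) \<in> W"
  shows "\<exists>C\<in>\<C>. \<forall>y\<in>\<U> p. y C = x C \<longrightarrow> (p, y) \<in> W"
proof -
  obtain V where V: "openin (prod_topology (discrete_topology (sd_carrier M G)) \<T>) V"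
    "W = V \<inter> gpd_arr M G S A sig"
    using W unfolding gpd_top_def openin_subtopology by blast
  have "(p, x) \<in> V" using px V(2) by blast
  then obtain U1 U2 where U: "openin \<T> U2" "p \<in> U1" "x \<in> U2" "U1 \<times> U2 \<subseteq> V"
    using V(1) unfolding openin_prod_topology_alt by meson
  obtain C where C: "C \<in> \<C>" "\<forall>y\<in>\<A>. y C = x C \<longrightarrow> y \<in> U2"
    using U(1,3) openin_Abar_iff[of U2] by meson
  have "(p, y) \<in> W" if y: "y \<in> \<U> p" "y C = x C" for y
  proof -
    have "y \<in> U2" using C(2) y by (simp add: Udom_iff)
    then have "(p, y) \<in> V" using U by blast
    moreover have "p \<in> sd_carrier M G" using px V(2) by (simp add: gpd_arr_iff)
    ultimately show ?thesis using V(2) y(1) by (simp add: gpd_arr_iff)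
  qed
  then show ?thesis using C(1) by blast
qed

text \<open>The group component of an arrow is locally constant; pulled back along an isomorphism
  this becomes local constancy of the cocycle.\<close>

lemma openin_gpd_slice: "openin (gpd_top M G S A sig) {e \<in> gpd_arr M G S A sig. fst e = q}"
proof (cases "q \<in> sd_carrier M G")
  case True
  have "openin (prod_topology (discrete_topology (sd_carrier M G)) \<T>) ({q} \<times> \<A>)"
    using True openin_topspace[of \<T>] by (simp add: openin_prod_Times_iff topspace_Abar)
  then have "openin (gpd_top M G S A sig) (({q} \<times> \<A>) \<inter> gpd_arr M G S A sig)"
    unfolding gpd_top_def by (rule openin_subtopology_Int)
  moreover have "({q} \<times> \<A>) \<inter> gpd_arr M G S A sig = {e \<in> gpd_arr M G S A sig. fst e = q}"
    by (auto simp: gpd_arr_def Udom_iff)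
  ultimately show ?thesis by simp
next
  case False
  then have "{e \<in> gpd_arr M G S A sig. fst e = q} = {}" by (auto simp: gpd_arr_def)
  then show ?thesis by (metis openin_empty)
qed

end

text \<open>Compatibility with products is given for arrows of the source groupoid; transferring it
  to the inverse map requires the product of composable arrows to be an arrow again.\<close>

lemma gpd_isomorphic_sym:
  assumes "standing M G S A sig" "standing N H T B tau"
    and iso: "gpd_isomorphic M G S A sig N H T B tau"
  shows "gpd_isomorphic N H T B tau M G S A sig"
proof -
  interpret s: alg_action M G S A sig by (rule alg_action.intro) fact
  interpret t: alg_action N H T B tau by (rule alg_action.intro) fact
  obtain \<Phi> where \<Phi>: "homeomorphic_map (gpd_top M G S A sig) (gpd_top N H T B tau) \<Phi>"
    and comp: "\<And>e f. e \<in> gpd_arr M G S A sig \<Longrightarrow> f \<in> gpd_arr M G S A sig \<Longrightarrow>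
       (gpd_src e = gpd_rng M S A sig f \<longleftrightarrow> gpd_src (\<Phi> e) = gpd_rng N T B tau (\<Phi> f)) \<and>
         (gpd_src e = gpd_rng M S A sig f \<longrightarrow>
            \<Phi> (gpd_mul M G sig e f) = gpd_mul N H tau (\<Phi> e) (\<Phi> f))"
    using iso unfolding gpd_isomorphic_def by blast
  obtain \<Psi> where maps: "homeomorphic_maps (gpd_top M G S A sig) (gpd_top N H T B tau) \<Phi> \<Psi>"
    using \<Phi> homeomorphic_map_maps by blast
  then have \<Psi>: "homeomorphic_map (gpd_top N H T B tau) (gpd_top M G S A sig) \<Psi>"
    using homeomorphic_maps_sym homeomorphic_map_maps by blast
  have inv: "\<Psi> (\<Phi> e) = e" if "e \<in> gpd_arr M G S A sig" for e
    using maps that by (simp add: homeomorphic_maps_def s.topspace_gpd)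
  have inv': "\<Phi> (\<Psi> e) = e" if "e \<in> gpd_arr N H T B tau" for e
    using maps that by (simp add: homeomorphic_maps_def t.topspace_gpd)
  have cl: "\<Psi> e \<in> gpd_arr M G S A sig" if "e \<in> gpd_arr N H T B tau" for e
    using homeomorphic_imp_surjective_map[OF \<Psi>] that by (auto simp: s.topspace_gpd t.topspace_gpd)
  have "(gpd_src e = gpd_rng N T B tau f \<longleftrightarrow> gpd_src (\<Psi> e) = gpd_rng M S A sig (\<Psi> f)) \<and>
         (gpd_src e = gpd_rng N T B tau f \<longrightarrow>
            \<Psi> (gpd_mul N H tau e f) = gpd_mul M G sig (\<Psi> e) (\<Psi> f))"
    if e: "e \<in> gpd_arr N H T B tau" and f: "f \<in> gpd_arr N H T B tau" for e f
  proof -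
    have 1: "gpd_src e = gpd_rng N T B tau f \<longleftrightarrow> gpd_src (\<Psi> e) = gpd_rng M S A sig (\<Psi> f)"
      using comp[OF cl[OF e] cl[OF f]] inv'[OF e] inv'[OF f] by simp
    have "\<Psi> (gpd_mul N H tau e f) = gpd_mul M G sig (\<Psi> e) (\<Psi> f)" if "gpd_src e = gpd_rng N T B tau f"
    proof -
      have c: "gpd_src (\<Psi> e) = gpd_rng M S A sig (\<Psi> f)" using 1 that by simp
      have "\<Phi> (gpd_mul M G sig (\<Psi> e) (\<Psi> f)) = gpd_mul N H tau e f"
        using comp[OF cl[OF e] cl[OF f]] c inv'[OF e] inv'[OF f] by simp
      then show ?thesis using inv[OF s.gpd_mul_closed[OF cl[OF e] cl[OF f] c]] by simp
    qed
    then show ?thesis using 1 by blast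
  qed
  then show ?thesis using \<Psi> unfolding gpd_isomorphic_def by blast
qed

text \<open>The part of a groupoid isomorphism that the rigidity argument uses: the group component of
  the image of an arrow, as a cocycle on the source groupoid.\<close>

locale gpd_cocycle = s: alg_action M G S A sig + t: alg_action N H T B tau
  for M :: "'a monoid" and G :: "'g monoid" and S A sig
    and N :: "'b monoid" and H :: "'h monoid" and T B tau +
  fixes c :: "'a \<times> 'g \<Rightarrow> ('a set \<Rightarrow> 'a set) \<Rightarrow> 'b \<times> 'h"
  assumes c_closed: "p \<in> sd_carrier M G \<Longrightarrow> x \<in> Udom M S A sig p \<Longrightarrow> c p x \<in> carrier N \<times> carrier H"
    and c_mult: "p \<in> sd_carrier M G \<Longrightarrow> q \<in> sd_carrier M G \<Longrightarrow> a \<in> pdom M A sig q \<Longrightarrow>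
      pact M sig q a \<in> pdom M A sig p \<Longrightarrow>
      c (sd_mult M G sig p q) (iota M S A sig a) =
        c p (iota M S A sig (pact M sig q a)) \<otimes>\<^bsub>sd_group N H tau\<^esub> c q (iota M S A sig a)"
    and c_inj: "p \<in> sd_carrier M G \<Longrightarrow> q \<in> sd_carrier M G \<Longrightarrow> a \<in> pdom M A sig p \<Longrightarrow> a \<in> pdom M A sig q \<Longrightarrow>
      c p (iota M S A sig a) = c q (iota M S A sig a) \<Longrightarrow> p = q"
    and c_loc: "p \<in> sd_carrier M G \<Longrightarrow> x \<in> Udom M S A sig p \<Longrightarrow>
      \<exists>C\<in>constr S A sig. \<forall>y\<in>Udom M S A sig p. y C = x C \<longrightarrow> c p y = c p x"
    and tf_M: "torsion_free M (carrier M)" and tf_N: "torsion_free N (carrier N)"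

lemma gpd_cocycle_of_iso:
  assumes "standing M G S A sig" "standing N H T B tau"
    and "torsion_free M (carrier M)" "torsion_free N (carrier N)"
    and iso: "gpd_isomorphic M G S A sig N H T B tau"
  shows "\<exists>c. gpd_cocycle M G S A sig N H T B tau c"
proof -
  interpret s: alg_action M G S A sig by (rule alg_action.intro) fact
  interpret t: alg_action N H T B tau by (rule alg_action.intro) fact
  obtain \<Phi> where \<Phi>: "homeomorphic_map (gpd_top M G S A sig) (gpd_top N H T B tau) \<Phi>"
    and comp: "\<And>e f. e \<in> gpd_arr M G S A sig \<Longrightarrow> f \<in> gpd_arr M G S A sig \<Longrightarrow>
       (gpd_src e = gpd_rng M S A sig f \<longleftrightarrow> gpd_src (\<Phi> e) = gpd_rng N T B tau (\<Phi> f)) \<and>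
         (gpd_src e = gpd_rng M S A sig f \<longrightarrow>
            \<Phi> (gpd_mul M G sig e f) = gpd_mul N H tau (\<Phi> e) (\<Phi> f))"
    using iso unfolding gpd_isomorphic_def by blast
  have inj: "inj_on \<Phi> (gpd_arr M G S A sig)"
    using homeomorphic_imp_injective_map[OF \<Phi>] by (simp add: s.topspace_gpd)
  have cl: "\<Phi> e \<in> gpd_arr N H T B tau" if "e \<in> gpd_arr M G S A sig" for e
    using homeomorphic_imp_surjective_map[OF \<Phi>] that by (auto simp: s.topspace_gpd t.topspace_gpd)
  have cont: "continuous_map (gpd_top M G S A sig) (gpd_top N H T B tau) \<Phi>"
    using homeomorphic_imp_continuous_map[OF \<Phi>] .
  define c where "c p x = fst (\<Phi> (p, x))" for p x
  have arr: "(p, s.\<iota> a) \<in> gpd_arr M G S A sig" if "p \<in> sd_carrier M G" "a \<in> s.dom_p p" for p a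
    using that s.iota_in_Udom by (simp add: s.gpd_arr_iff)
  have "gpd_cocycle M G S A sig N H T B tau c"
  proof unfold_locales
    fix p x assume "p \<in> sd_carrier M G" "x \<in> s.\<U> p"
    then have "(p, x) \<in> gpd_arr M G S A sig" by (simp add: s.gpd_arr_iff)
    then have "\<Phi> (p, x) \<in> gpd_arr N H T B tau" by (rule cl)
    then show "c p x \<in> carrier N \<times> carrier H"
      by (auto simp: c_def gpd_arr_def sd_carrier_def)
  next
    fix p q a assume h: "p \<in> sd_carrier M G" "q \<in> sd_carrier M G" "a \<in> s.dom_p q" "s.act_p q a \<in> s.dom_p p"
    have "gpd_src (p, s.\<iota> (s.act_p q a)) = gpd_rng M S A sig (q, s.\<iota> a)"
      using s.theta_iota[OF h(2,3)] by (simp add: gpd_src_def gpd_rng_def)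
    then have "\<Phi> (gpd_mul M G sig (p, s.\<iota> (s.act_p q a)) (q, s.\<iota> a))
        = gpd_mul N H tau (\<Phi> (p, s.\<iota> (s.act_p q a))) (\<Phi> (q, s.\<iota> a))"
      using comp[OF arr[OF h(1,4)] arr[OF h(2,3)]] by blast
    then show "c (sd_mult M G sig p q) (s.\<iota> a)
        = c p (s.\<iota> (s.act_p q a)) \<otimes>\<^bsub>sd_group N H tau\<^esub> c q (s.\<iota> a)"
      by (simp add: c_def gpd_mul_def sd_mult_def sd_group_def)
  next
    fix p q a assume h: "p \<in> sd_carrier M G" "q \<in> sd_carrier M G" "a \<in> s.dom_p p" "a \<in> s.dom_p q"
      and eq: "c p (s.\<iota> a) = c q (s.\<iota> a)"
    \<comment> \<open>The unit arrow at \<open>a\<close> composes with both arrows, so their images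
      have the same source; with equal group components as well, the images coincide.\<close>
    define u where "u = ((\<one>\<^bsub>M\<^esub>, \<one>\<^bsub>G\<^esub>), s.\<iota> a)"
    have a: "a \<in> A" using h s.pdom_A by blast
    then have ua: "a \<in> s.dom_p (\<one>\<^bsub>M\<^esub>, \<one>\<^bsub>G\<^esub>)" "s.act_p (\<one>\<^bsub>M\<^esub>, \<one>\<^bsub>G\<^esub>) a = a"
      by (simp_all add: pdom_def pact_def)
    have u: "u \<in> gpd_arr M G S A sig" unfolding u_def using ua by (intro arr) (auto simp: sd_carrier_def)
    have "gpd_rng M S A sig u = s.\<iota> a"
      using s.theta_iota[of "(\<one>\<^bsub>M\<^esub>, \<one>\<^bsub>G\<^esub>)" a] ua by (simp add: gpd_rng_def u_def sd_carrier_def)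
    then have "gpd_src (\<Phi> (p, s.\<iota> a)) = gpd_rng N T B tau (\<Phi> u)"
        "gpd_src (\<Phi> (q, s.\<iota> a)) = gpd_rng N T B tau (\<Phi> u)"
      using comp[OF arr[OF h(1,3)] u] comp[OF arr[OF h(2,4)] u] by (simp_all add: gpd_src_def)
    then have "\<Phi> (p, s.\<iota> a) = \<Phi> (q, s.\<iota> a)" using eq by (simp add: gpd_src_def c_def prod_eq_iff)
    then show "p = q" using inj_onD[OF inj _ arr[OF h(1,3)] arr[OF h(2,4)]] by simp
  next
    fix p x assume px: "p \<in> sd_carrier M G" "x \<in> s.\<U> p"
    define W where "W = {e \<in> gpd_arr M G S A sig. \<Phi> e \<in> {e \<in> gpd_arr N H T B tau. fst e = c p x}}"
    have "openin (gpd_top M G S A sig) W"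
      unfolding W_def s.topspace_gpd[symmetric]
      using openin_continuous_map_preimage[OF cont t.openin_gpd_slice] .
    moreover have "(p, x) \<in> W" using px cl by (auto simp: W_def s.gpd_arr_iff c_def)
    ultimately obtain C where "C \<in> s.\<C>" "\<forall>y\<in>s.\<U> p. y C = x C \<longrightarrow> (p, y) \<in> W"
      using s.gpd_nbhd by blast
    then show "\<exists>C\<in>s.\<C>. \<forall>y\<in>s.\<U> p. y C = x C \<longrightarrow> c p y = c p x"
      by (intro bexI[of _ C]) (auto simp: W_def c_def)
  qed fact+
  then show ?thesis by blast
qed

section \<open>The cocycle on translations and at the base point 0\<close>

context gpd_cocycle
begin

sublocale P: group "sd_group N H tau"
  using t.group_sd_group .

abbreviation P :: "('b \<times> 'h) monoid" where "P \<equiv> sd_group N H tau"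

definition cA :: "'a \<Rightarrow> 'a \<Rightarrow> 'b \<times> 'h" where
  "cA a x = c (a, \<one>\<^bsub>G\<^esub>) (s.\<iota> x)"

text \<open>Linear maps fix 0, so these arrows belong to the isotropy group there and the cocycle is
  multiplicative on them.\<close>

definition K :: "'g \<Rightarrow> 'b \<times> 'h" where
  "K g = c (\<one>\<^bsub>M\<^esub>, g) (s.\<iota> \<one>\<^bsub>M\<^esub>)"

definition e :: "'a \<Rightarrow> 'b \<times> 'h" where
  "e a = cA a \<one>\<^bsub>M\<^esub>"

lemma transl_dom: "a \<in> A \<Longrightarrow> x \<in> A \<Longrightarrow> x \<in> s.dom_p (a, \<one>\<^bsub>G\<^esub>)"
  and transl_act: "x \<in> A \<Longrightarrow> s.act_p (a, \<one>\<^bsub>G\<^esub>) x = a \<otimes>\<^bsub>M\<^esub> x"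
  by (simp_all add: pdom_def pact_def)

lemma transl_sd: "a \<in> A \<Longrightarrow> (a, \<one>\<^bsub>G\<^esub>) \<in> sd_carrier M G"
  by (simp add: sd_carrier_def)

lemma lin_dom: "g \<in> carrier G \<Longrightarrow> x \<in> A \<Longrightarrow> sig g x \<in> A \<Longrightarrow> x \<in> s.dom_p (\<one>\<^bsub>M\<^esub>, g)"
  and lin_act: "g \<in> carrier G \<Longrightarrow> x \<in> A \<Longrightarrow> s.act_p (\<one>\<^bsub>M\<^esub>, g) x = sig g x"
  and lin_sd: "g \<in> carrier G \<Longrightarrow> (\<one>\<^bsub>M\<^esub>, g) \<in> sd_carrier M G"
  by (simp_all add: pdom_def pact_def sd_carrier_def)

lemma c_iota_closed: "p \<in> sd_carrier M G \<Longrightarrow> a \<in> s.dom_p p \<Longrightarrow> c p (s.\<iota> a) \<in> carrier P"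
  using c_closed s.iota_in_Udom by simp

lemma cA_closed: "a \<in> A \<Longrightarrow> x \<in> A \<Longrightarrow> cA a x \<in> carrier P"
  unfolding cA_def by (rule c_iota_closed[OF transl_sd transl_dom])

lemma e_closed: "a \<in> A \<Longrightarrow> e a \<in> carrier P"
  unfolding e_def by (simp add: cA_closed del: t.sd_group_simps)

lemma K_closed: "g \<in> carrier G \<Longrightarrow> K g \<in> carrier P"
  unfolding K_def by (rule c_iota_closed[OF lin_sd lin_dom]) simp_all

text \<open>The cocycle identity for two successive translations; what separates it from additivity
  is the shift of the base point from \<open>x\<close> to b + x.\<close>

lemma cA_add:
  assumes "a \<in> A" "b \<in> A" "x \<in> A"
  shows "cA (a \<otimes>\<^bsub>M\<^esub> b) x = cA a (b \<otimes>\<^bsub>M\<^esub> x) \<otimes>\<^bsub>P\<^esub> cA b x"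
  using c_mult[OF transl_sd transl_sd, of a b x] assms
  by (simp add: transl_dom transl_act cA_def sd_mult_def del: t.sd_group_simps)

lemma K_mult: "g \<in> carrier G \<Longrightarrow> h \<in> carrier G \<Longrightarrow> K (g \<otimes>\<^bsub>G\<^esub> h) = K g \<otimes>\<^bsub>P\<^esub> K h"
  using c_mult[OF lin_sd lin_sd, of g h "\<one>\<^bsub>M\<^esub>"]
  by (simp add: lin_dom lin_act K_def sd_mult_def del: t.sd_group_simps)

text \<open>The translation by 0 has an idempotent value, hence one; \<open>c_inj\<close> at the
  base point 0 then identifies \<open>a\<close> with 0.\<close>

lemma e_eq_one:
  assumes "a \<in> A" "e a = \<one>\<^bsub>P\<^esub>"
  shows "a = \<one>\<^bsub>M\<^esub>"
proof -
  have "cA \<one>\<^bsub>M\<^esub> \<one>\<^bsub>M\<^esub> = cA \<one>\<^bsub>M\<^esub> \<one>\<^bsub>M\<^esub> \<otimes>\<^bsub>P\<^esub> cA \<one>\<^bsub>M\<^esub> \<one>\<^bsub>M\<^esub>"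
    using cA_add[of "\<one>\<^bsub>M\<^esub>" "\<one>\<^bsub>M\<^esub>" "\<one>\<^bsub>M\<^esub>"] by (simp del: t.sd_group_simps)
  then have "e \<one>\<^bsub>M\<^esub> = \<one>\<^bsub>P\<^esub>"
    using P.r_cancel_one'[of "cA \<one>\<^bsub>M\<^esub> \<one>\<^bsub>M\<^esub>" "cA \<one>\<^bsub>M\<^esub> \<one>\<^bsub>M\<^esub>"] cA_closed[of "\<one>\<^bsub>M\<^esub>" "\<one>\<^bsub>M\<^esub>"]
    by (simp add: e_def del: t.sd_group_simps)
  then show ?thesis
    using c_inj[OF transl_sd transl_sd, of a "\<one>\<^bsub>M\<^esub>" "\<one>\<^bsub>M\<^esub>"] assms transl_dom
    by (simp add: e_def cA_def del: t.sd_group_simps)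
qed

text \<open>Translations whose cocycle sees the base point only modulo \<open>C\<close>. Since this
  set is a subgroup, it contains a finitely generated group as soon as it contains the
  generators.\<close>

definition stab :: "'a set \<Rightarrow> 'a set" where
  "stab C = {a \<in> A. \<forall>x\<in>A. \<forall>y\<in>A. inv\<^bsub>M\<^esub> x \<otimes>\<^bsub>M\<^esub> y \<in> C \<longrightarrow> cA a x = cA a y}"

lemma stab_A: "a \<in> stab C \<Longrightarrow> a \<in> A"
  by (simp add: stab_def)

lemma stabD: "a \<in> stab C \<Longrightarrow> x \<in> A \<Longrightarrow> y \<in> A \<Longrightarrow> inv\<^bsub>M\<^esub> x \<otimes>\<^bsub>M\<^esub> y \<in> C \<Longrightarrow> cA a x = cA a y"
  by (simp add: stab_def)

lemma stab_mono: "D \<subseteq> C \<Longrightarrow> stab C \<subseteq> stab D"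
  by (auto simp: stab_def)

text \<open>Translation by an element of \<open>A\<close> is defined on the whole completion, so
  compactness makes its local constancy uniform.\<close>

lemma ex_stab:
  assumes a: "a \<in> A"
  shows "\<exists>C\<in>s.\<C>. a \<in> stab C"
proof -
  have U: "s.\<U> (a, \<one>\<^bsub>G\<^esub>) = s.\<A>"
    using s.Abar_ex transl_dom[OF a] by (auto simp: s.Udom_iff) blast
  have "\<exists>C\<in>s.\<C>. \<forall>x\<in>s.\<A>. \<forall>y\<in>s.\<A>. x C = y C \<longrightarrow> c (a, \<one>\<^bsub>G\<^esub>) x = c (a, \<one>\<^bsub>G\<^esub>) y"
    using c_loc[OF transl_sd[OF a]] unfolding U by (rule s.uniformly_locally_constant)
  then obtain C where C: "C \<in> s.\<C>" "\<forall>x\<in>s.\<A>. \<forall>y\<in>s.\<A>. x C = y C \<longrightarrow> c (a, \<one>\<^bsub>G\<^esub>) x = c (a, \<one>\<^bsub>G\<^esub>) y"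
    by blast
  have "a \<in> stab C"
    using a C s.iota_eq_iff[OF C(1)] by (auto simp: stab_def cA_def)
  then show ?thesis using C(1) by blast
qed

lemma ex_stab_finite:
  assumes "finite F" "F \<subseteq> A"
  shows "\<exists>C\<in>s.\<C>. F \<subseteq> stab C"
  using assms
proof (induction F rule: finite_induct)
  case empty
  then show ?case using constr_top by blast
next
  case (insert a F)
  then obtain C D where CD: "C \<in> s.\<C>" "F \<subseteq> stab C" "D \<in> s.\<C>" "a \<in> stab D" using ex_stab[of a] by auto
  then have "insert a F \<subseteq> stab (C \<inter> D)"
    using stab_mono[of "C \<inter> D" C] stab_mono[of "C \<inter> D" D] by auto
  then show ?case using s.constr_Int[OF CD(1,3)] by blast
qed

text \<open>Translating \<open>x\<close> and \<open>y\<close> by the same element keeps their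
  difference in \<open>C\<close>, so the cocycle identity carries the condition over to sums and
  inverses.\<close>

lemma stab_subgroup:
  shows "subgroup (stab C) M"
proof (rule s.M.subgroupI)
  show "stab C \<subseteq> carrier M" using stab_A by auto
  have one: "\<one>\<^bsub>M\<^esub> \<in> stab C"
  proof -
    have "cA \<one>\<^bsub>M\<^esub> x = \<one>\<^bsub>P\<^esub>" if "x \<in> A" for x
      using cA_add[of "\<one>\<^bsub>M\<^esub>" "\<one>\<^bsub>M\<^esub>" x] that P.r_cancel_one'[of "cA \<one>\<^bsub>M\<^esub> x" "cA \<one>\<^bsub>M\<^esub> x"] cA_closed[of "\<one>\<^bsub>M\<^esub>" x]
      by (simp del: t.sd_group_simps)
    then show ?thesis by (simp add: stab_def)
  qed
  then show "stab C \<noteq> {}" by blast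
  show "a \<otimes>\<^bsub>M\<^esub> b \<in> stab C" if a: "a \<in> stab C" and b: "b \<in> stab C" for a b
  proof -
    have A: "a \<in> A" "b \<in> A" using a b stab_A by auto
    have "cA (a \<otimes>\<^bsub>M\<^esub> b) x = cA (a \<otimes>\<^bsub>M\<^esub> b) y" if xy: "x \<in> A" "y \<in> A" "inv\<^bsub>M\<^esub> x \<otimes>\<^bsub>M\<^esub> y \<in> C" for x y
    proof -
      have "inv\<^bsub>M\<^esub> (b \<otimes>\<^bsub>M\<^esub> x) \<otimes>\<^bsub>M\<^esub> (b \<otimes>\<^bsub>M\<^esub> y) = inv\<^bsub>M\<^esub> x \<otimes>\<^bsub>M\<^esub> y"
        using A xy by (simp add: s.M.inv_mult_group s.M.m_assoc s.M.mult_inv_cancel)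
      then have "cA a (b \<otimes>\<^bsub>M\<^esub> x) = cA a (b \<otimes>\<^bsub>M\<^esub> y)" using stabD[OF a] A xy by simp
      then show ?thesis using stabD[OF b] A xy by (simp add: cA_add del: t.sd_group_simps)
    qed
    then show ?thesis using A by (simp add: stab_def)
  qed
  show "inv\<^bsub>M\<^esub> a \<in> stab C" if a: "a \<in> stab C" for a
  proof -
    have A: "a \<in> A" using a stab_A by auto
    have eq: "cA (inv\<^bsub>M\<^esub> a) x = inv\<^bsub>P\<^esub> (cA a (inv\<^bsub>M\<^esub> a \<otimes>\<^bsub>M\<^esub> x))" if x: "x \<in> A" for x
    proof -
      have "cA \<one>\<^bsub>M\<^esub> x = \<one>\<^bsub>P\<^esub>"
        using cA_add[of "\<one>\<^bsub>M\<^esub>" "\<one>\<^bsub>M\<^esub>" x] x P.r_cancel_one'[of "cA \<one>\<^bsub>M\<^esub> x" "cA \<one>\<^bsub>M\<^esub> x"] cA_closed[of "\<one>\<^bsub>M\<^esub>" x]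
        by (simp del: t.sd_group_simps)
      then have "cA a (inv\<^bsub>M\<^esub> a \<otimes>\<^bsub>M\<^esub> x) \<otimes>\<^bsub>P\<^esub> cA (inv\<^bsub>M\<^esub> a) x = \<one>\<^bsub>P\<^esub>"
        using cA_add[of a "inv\<^bsub>M\<^esub> a" x] A x by (simp del: t.sd_group_simps)
      then have "cA (inv\<^bsub>M\<^esub> a) x \<otimes>\<^bsub>P\<^esub> cA a (inv\<^bsub>M\<^esub> a \<otimes>\<^bsub>M\<^esub> x) = \<one>\<^bsub>P\<^esub>"
        using P.inv_comm cA_closed A x by (simp del: t.sd_group_simps)
      then show ?thesis using P.inv_equality cA_closed A x by (metis s.A_inv s.A_mult)
    qed
    have "cA (inv\<^bsub>M\<^esub> a) x = cA (inv\<^bsub>M\<^esub> a) y" if xy: "x \<in> A" "y \<in> A" "inv\<^bsub>M\<^esub> x \<otimes>\<^bsub>M\<^esub> y \<in> C" for x y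
    proof -
      have "inv\<^bsub>M\<^esub> (inv\<^bsub>M\<^esub> a \<otimes>\<^bsub>M\<^esub> x) \<otimes>\<^bsub>M\<^esub> (inv\<^bsub>M\<^esub> a \<otimes>\<^bsub>M\<^esub> y) = inv\<^bsub>M\<^esub> x \<otimes>\<^bsub>M\<^esub> y"
        using A xy by (simp add: s.M.inv_mult_group s.M.m_assoc s.M.mult_inv_cancel)
      then have "cA a (inv\<^bsub>M\<^esub> a \<otimes>\<^bsub>M\<^esub> x) = cA a (inv\<^bsub>M\<^esub> a \<otimes>\<^bsub>M\<^esub> y)" using stabD[OF a] A xy by simp
      then show ?thesis using eq xy by simp
    qed
    then show ?thesis using A by (simp add: stab_def)
  qed
qed

end

section \<open>The rational embedding\<close>

lemma (in abelian_grp) torsion_free_subgroup_carrier: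
  "torsion_free G (carrier G) \<Longrightarrow> torsion_free_subgroup G (carrier G)"
  by (intro torsion_free_subgroup.intro torsion_free_subgroup_axioms.intro abelian_grp_axioms subgroup_self)

text \<open>Passage to rational vector spaces of a map that is additive only after taking multiples.\<close>

locale virtual_hom = M: abelian_grp M + N: abelian_grp N
  for M :: "'a monoid" and N :: "'b monoid" +
  fixes E :: "'a set" and f :: "'a \<Rightarrow> 'b"
  assumes tf_M: "torsion_free M (carrier M)" and tf_N: "torsion_free N (carrier N)"
    and E_closed: "z \<in> E \<Longrightarrow> z \<in> carrier M" and f_closed: "z \<in> E \<Longrightarrow> f z \<in> carrier N"
    and E_pow: "z \<in> E \<Longrightarrow> z [^]\<^bsub>M\<^esub> (k::nat) \<in> E"
    and f_pow: "z \<in> E \<Longrightarrow> f (z [^]\<^bsub>M\<^esub> (k::nat)) = f z [^]\<^bsub>N\<^esub> k"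
    and f_add: "z \<in> carrier M \<Longrightarrow> w \<in> carrier M \<Longrightarrow> \<exists>n::nat. 0 < n \<and> z [^]\<^bsub>M\<^esub> n \<in> E \<and> w [^]\<^bsub>M\<^esub> n \<in> E \<and>
      (z \<otimes>\<^bsub>M\<^esub> w) [^]\<^bsub>M\<^esub> n \<in> E \<and> f ((z \<otimes>\<^bsub>M\<^esub> w) [^]\<^bsub>M\<^esub> n) = f (z [^]\<^bsub>M\<^esub> n) \<otimes>\<^bsub>N\<^esub> f (w [^]\<^bsub>M\<^esub> n)"
    and f_inj: "z \<in> E \<Longrightarrow> f z = \<one>\<^bsub>N\<^esub> \<Longrightarrow> z = \<one>\<^bsub>M\<^esub>"
begin

sublocale QM: torsion_free_subgroup M "carrier M"
  using M.torsion_free_subgroup_carrier[OF tf_M] .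

sublocale QN: torsion_free_subgroup N "carrier N"
  using N.torsion_free_subgroup_carrier[OF tf_N] .

text \<open>The value at the fraction z/m: a multiple n z lies in \<open>E\<close>, and its image
  under \<open>f\<close> is divided by n m.\<close>

definition bmap :: "('a \<times> nat) set \<Rightarrow> ('b \<times> nat) set" where
  "bmap v = (let z = fst (qrep v); n = (SOME n::nat. 0 < n \<and> z [^]\<^bsub>M\<^esub> n \<in> E)
     in QN.cl (f (z [^]\<^bsub>M\<^esub> n)) (n * snd (qrep v)))"

lemma multiple_in_E: "z \<in> carrier M \<Longrightarrow> \<exists>n::nat. 0 < n \<and> z [^]\<^bsub>M\<^esub> n \<in> E"
  using f_add[of z z] by blast

text \<open>Two choices of representative and multiplier have a common multiple inside
  \<open>E\<close>, on which \<open>f\<close> is compatible with multiples.\<close>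

lemma bmap_cl:
  assumes z: "z \<in> carrier M" and m: "0 < m" and n: "0 < n" and zn: "z [^]\<^bsub>M\<^esub> n \<in> E"
  shows "bmap (QM.cl z m) = QN.cl (f (z [^]\<^bsub>M\<^esub> n)) (n * m)"
proof -
  define v where "v = QM.cl z m"
  have v: "v \<in> QT M (carrier M)" using z m by (simp add: v_def)
  define z' m' where "z' = fst (qrep v)" and "m' = snd (qrep v)"
  have r: "z' \<in> carrier M" "0 < m'" "v = QM.cl z' m'"
    using QM.qrep_cl[OF v] by (auto simp: z'_def m'_def)
  define n' where "n' = (SOME n::nat. 0 < n \<and> z' [^]\<^bsub>M\<^esub> n \<in> E)"
  have n': "0 < n' \<and> z' [^]\<^bsub>M\<^esub> n' \<in> E"
    unfolding n'_def using multiple_in_E[OF r(1)] by (rule someI_ex)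
  have zz: "z [^]\<^bsub>M\<^esub> m' = z' [^]\<^bsub>M\<^esub> m"
    using QM.cl_eq_iff[OF z r(1) m r(2)] r(3) by (simp add: v_def)
  have "f (z' [^]\<^bsub>M\<^esub> n') [^]\<^bsub>N\<^esub> (n * m) = f ((z' [^]\<^bsub>M\<^esub> n') [^]\<^bsub>M\<^esub> (n * m))"
    using f_pow n' by simp
  also have "(z' [^]\<^bsub>M\<^esub> n') [^]\<^bsub>M\<^esub> (n * m) = (z' [^]\<^bsub>M\<^esub> m) [^]\<^bsub>M\<^esub> (n * n')"
    using r(1) by (simp add: M.nat_pow_pow ac_simps)
  also have "\<dots> = (z [^]\<^bsub>M\<^esub> m') [^]\<^bsub>M\<^esub> (n * n')" by (simp only: zz)
  also have "\<dots> = (z [^]\<^bsub>M\<^esub> n) [^]\<^bsub>M\<^esub> (n' * m')" using z by (simp add: M.nat_pow_pow ac_simps)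
  also have "f \<dots> = f (z [^]\<^bsub>M\<^esub> n) [^]\<^bsub>N\<^esub> (n' * m')" using f_pow[OF zn] .
  finally have "QN.cl (f (z' [^]\<^bsub>M\<^esub> n')) (n' * m') = QN.cl (f (z [^]\<^bsub>M\<^esub> n)) (n * m)"
    using n' zn n m r(2) f_closed by (intro QN.cl_eqI) auto
  then show ?thesis by (simp add: bmap_def v_def[symmetric] z'_def[symmetric] m'_def[symmetric] n'_def[symmetric] Let_def)
qed

lemma bmap_closed: "v \<in> QT M (carrier M) \<Longrightarrow> bmap v \<in> QT N (carrier N)"
proof (elim QM.QT_cases)
  fix z m assume z: "z \<in> carrier M" "0 < m" "v = QM.cl z m"
  obtain n :: nat where n: "0 < n" "z [^]\<^bsub>M\<^esub> n \<in> E" using multiple_in_E[OF z(1)] by blast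
  then show "bmap v \<in> QT N (carrier N)"
    using bmap_cl[OF z(1,2) n] z f_closed[OF n(2)] by simp
qed

lemma bmap_hom: "bmap \<in> hom (QTg M (carrier M)) (QTg N (carrier N))"
proof (rule homI)
  show "bmap v \<in> carrier (QTg N (carrier N))" if "v \<in> carrier (QTg M (carrier M))" for v
    using that bmap_closed by simp
next
  fix v w assume "v \<in> carrier (QTg M (carrier M))" "w \<in> carrier (QTg M (carrier M))"
  then obtain z m y l where z: "z \<in> carrier M" "0 < m" "v = QM.cl z m" and y: "y \<in> carrier M" "0 < l" "w = QM.cl y l"
    by (auto elim!: QM.QT_cases)
  \<comment> \<open>The common denominator m l reduces addition to the numerators, for which
    \<open>f_add\<close> supplies one multiplier.\<close>
  define z' y' where "z' = z [^]\<^bsub>M\<^esub> l" and "y' = y [^]\<^bsub>M\<^esub> m"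
  have c: "z' \<in> carrier M" "y' \<in> carrier M" "0 < m * l" using z y by (auto simp: z'_def y'_def)
  have v: "v = QM.cl z' (m * l)" and w: "w = QM.cl y' (m * l)"
    unfolding z(3) y(3) using z y by (intro QM.cl_eqI; simp add: z'_def y'_def M.nat_pow_pow mult.commute)+
  have vw: "qadd M (carrier M) v w = QM.cl (z' \<otimes>\<^bsub>M\<^esub> y') (m * l)"
    using z y by (simp add: QM.qadd_cl z'_def y'_def)
  obtain n :: nat where n: "0 < n" "z' [^]\<^bsub>M\<^esub> n \<in> E" "y' [^]\<^bsub>M\<^esub> n \<in> E" "(z' \<otimes>\<^bsub>M\<^esub> y') [^]\<^bsub>M\<^esub> n \<in> E"
    "f ((z' \<otimes>\<^bsub>M\<^esub> y') [^]\<^bsub>M\<^esub> n) = f (z' [^]\<^bsub>M\<^esub> n) \<otimes>\<^bsub>N\<^esub> f (y' [^]\<^bsub>M\<^esub> n)"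
    using f_add[OF c(1,2)] by blast
  define k where "k = n * (m * l)"
  have k: "0 < k" using n c by (simp add: k_def)
  have "bmap (qadd M (carrier M) v w) = QN.cl (f (z' [^]\<^bsub>M\<^esub> n) \<otimes>\<^bsub>N\<^esub> f (y' [^]\<^bsub>M\<^esub> n)) k"
    unfolding vw using bmap_cl[OF _ c(3) n(1,4)] c n(5) by (simp add: k_def)
  also have "\<dots> = qadd N (carrier N) (QN.cl (f (z' [^]\<^bsub>M\<^esub> n)) k) (QN.cl (f (y' [^]\<^bsub>M\<^esub> n)) k)"
    using f_closed n k QN.qadd_cl[of "f (z' [^]\<^bsub>M\<^esub> n)" "f (y' [^]\<^bsub>M\<^esub> n)" k k]
    by (simp, intro QN.cl_eqI) (simp_all add: N.nat_pow_distrib N.nat_pow_pow)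
  also have "\<dots> = qadd N (carrier N) (bmap v) (bmap w)"
    unfolding v w using bmap_cl[OF c(1,3) n(1,2)] bmap_cl[OF c(2,3) n(1,3)] by (simp add: k_def)
  finally show "bmap (v \<otimes>\<^bsub>QTg M (carrier M)\<^esub> w) = bmap v \<otimes>\<^bsub>QTg N (carrier N)\<^esub> bmap w" by simp
qed

lemma bmap_inj: "inj_on bmap (carrier (QTg M (carrier M)))"
proof -
  interpret h: group_hom "QTg M (carrier M)" "QTg N (carrier N)" bmap
    using QM.comm_group_QTg QN.comm_group_QTg bmap_hom
    by (simp add: group_hom_def group_hom_axioms_def comm_group.axioms(2))
  have "v = qzero M (carrier M)" if v: "v \<in> QT M (carrier M)" "bmap v = qzero N (carrier N)" for v
  proof -
    obtain z m where z: "z \<in> carrier M" "0 < m" "v = QM.cl z m" using v(1) by (rule QM.QT_cases)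
    obtain n :: nat where n: "0 < n" "z [^]\<^bsub>M\<^esub> n \<in> E" using multiple_in_E[OF z(1)] by blast
    have "QN.cl (f (z [^]\<^bsub>M\<^esub> n)) (n * m) = qzero N (carrier N)"
      using v(2) bmap_cl[OF z(1,2) n] z(3) by simp
    then have "f (z [^]\<^bsub>M\<^esub> n) = \<one>\<^bsub>N\<^esub>" using QN.cl_eq_qzero f_closed[OF n(2)] n z by simp
    then have "z [^]\<^bsub>M\<^esub> n = \<one>\<^bsub>M\<^esub>" using f_inj n by blast
    then have "z = \<one>\<^bsub>M\<^esub>" using tf_M z n unfolding torsion_free_def by blast
    then show ?thesis using z QM.cl_one by simp
  qed
  then show ?thesis unfolding h.inj_on_one_iff by simp
qed

end

context alg_action
begin

lemma qt_act_cl: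
  assumes "torsion_free M (carrier M)" "g \<in> carrier G" "z \<in> carrier M" "0 < m"
  shows "qt_act M sig g (torsion_free_subgroup.cl M (carrier M) z m)
    = torsion_free_subgroup.cl M (carrier M) (sig g z) m"
proof -
  interpret Q: torsion_free_subgroup M "carrier M"
    using M.torsion_free_subgroup_carrier[OF assms(1)] .
  show ?thesis using assms sig_hom by (simp add: qt_act_def Q.qlift_cl)
qed

lemma qt_act_closed:
  assumes "torsion_free M (carrier M)" "g \<in> carrier G" "v \<in> QT M (carrier M)"
  shows "qt_act M sig g v \<in> QT M (carrier M)"
proof -
  interpret Q: torsion_free_subgroup M "carrier M"
    using M.torsion_free_subgroup_carrier[OF assms(1)] .
  show ?thesis using assms(3) by (rule Q.QT_cases) (use assms in \<open>simp add: qt_act_cl\<close>)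
qed

lemma qt_act_mult:
  assumes "torsion_free M (carrier M)" "g \<in> carrier G" "h \<in> carrier G" "v \<in> QT M (carrier M)"
  shows "qt_act M sig (g \<otimes>\<^bsub>G\<^esub> h) v = qt_act M sig g (qt_act M sig h v)"
proof -
  interpret Q: torsion_free_subgroup M "carrier M"
    using M.torsion_free_subgroup_carrier[OF assms(1)] .
  show ?thesis using assms(4) by (rule Q.QT_cases) (use assms in \<open>simp add: qt_act_cl sig_mult\<close>)
qed

lemma qt_act_one:
  assumes "torsion_free M (carrier M)" "v \<in> QT M (carrier M)"
  shows "qt_act M sig \<one>\<^bsub>G\<^esub> v = v"
proof -
  interpret Q: torsion_free_subgroup M "carrier M"
    using M.torsion_free_subgroup_carrier[OF assms(1)] .
  show ?thesis using assms(2) by (rule Q.QT_cases) (use assms in \<open>simp add: qt_act_cl\<close>)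
qed

end

section \<open>The local homomorphism and its linear part\<close>

context gpd_cocycle
begin

declare t.sd_group_simps [simp del]

text \<open>An element of \<open>C\<close> is an invisible shift of base point for translations in
  \<open>stab C\<close>; on the intersection the cocycle identity therefore becomes additivity of
  \<open>e\<close>.\<close>

definition Dom :: "'a set \<Rightarrow> 'a set" where
  "Dom C = stab C \<inter> C"

lemma Dom_subgroup: "C \<in> s.\<C> \<Longrightarrow> subgroup (Dom C) M"
  unfolding Dom_def using stab_subgroup s.constr_subgroup
  by (metis s.M.subgroups_Inter_pair)

lemma Dom_A: "a \<in> Dom C \<Longrightarrow> a \<in> A"
  using stab_A by (auto simp: Dom_def)

lemma Dom_int_pow: "C \<in> s.\<C> \<Longrightarrow> a \<in> Dom C \<Longrightarrow> a [^]\<^bsub>M\<^esub> (k::int) \<in> Dom C"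
  using s.M.subgroup_int_pow_closed[OF Dom_subgroup] .

lemma Dom_nat_pow: "C \<in> s.\<C> \<Longrightarrow> a \<in> Dom C \<Longrightarrow> a [^]\<^bsub>M\<^esub> (k::nat) \<in> Dom C"
  using Dom_int_pow[of C a "int k"] by (simp add: int_pow_int)

lemma Dom_mult: "C \<in> s.\<C> \<Longrightarrow> a \<in> Dom C \<Longrightarrow> b \<in> Dom C \<Longrightarrow> a \<otimes>\<^bsub>M\<^esub> b \<in> Dom C"
  using subgroup.m_closed[OF Dom_subgroup] .

lemma e_mult:
  assumes C: "C \<in> s.\<C>" and a: "a \<in> Dom C" and b: "b \<in> Dom C"
  shows "e (a \<otimes>\<^bsub>M\<^esub> b) = e a \<otimes>\<^bsub>P\<^esub> e b"
proof -
  have A: "a \<in> A" "b \<in> A" using a b Dom_A by auto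
  have "inv\<^bsub>M\<^esub> b \<otimes>\<^bsub>M\<^esub> \<one>\<^bsub>M\<^esub> \<in> C"
    using b A subgroup.m_inv_closed[OF s.constr_subgroup[OF C]] by (simp add: Dom_def)
  then have "cA a b = cA a \<one>\<^bsub>M\<^esub>" using stabD[of a C b "\<one>\<^bsub>M\<^esub>"] a A by (simp add: Dom_def)
  then show ?thesis using cA_add[of a b "\<one>\<^bsub>M\<^esub>"] A by (simp add: e_def)
qed

lemma e_int_pow:
  assumes C: "C \<in> s.\<C>" and a: "a \<in> Dom C"
  shows "e (a [^]\<^bsub>M\<^esub> (k::int)) = e a [^]\<^bsub>P\<^esub> k"
proof -
  have h: "e \<in> hom (M\<lparr>carrier := Dom C\<rparr>) P"
    using e_mult[OF C] e_closed Dom_A by (auto simp: hom_def)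
  have g: "group (M\<lparr>carrier := Dom C\<rparr>)" using s.M.subgroup_imp_group[OF Dom_subgroup[OF C]] .
  show ?thesis using hom_int_pow[OF h _ g P.is_group, of a k] a s.M.int_pow_consistent[OF Dom_subgroup[OF C] a]
    by simp
qed

lemma e_nat_pow: "C \<in> s.\<C> \<Longrightarrow> a \<in> Dom C \<Longrightarrow> e (a [^]\<^bsub>M\<^esub> (k::nat)) = e a [^]\<^bsub>P\<^esub> k"
  using e_int_pow[of C a "int k"] by (simp add: int_pow_int)

definition \<pi> :: "'a \<Rightarrow> 'h" where
  "\<pi> a = snd (e a)"

lemma snd_hom: "snd \<in> hom P H"
  using t.snd_hom_sd_group .

lemma snd_mult: "p \<in> carrier P \<Longrightarrow> q \<in> carrier P \<Longrightarrow> snd (p \<otimes>\<^bsub>P\<^esub> q) = snd p \<otimes>\<^bsub>H\<^esub> snd q"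
  using snd_hom by (simp add: hom_def)

lemma snd_closed: "p \<in> carrier P \<Longrightarrow> snd p \<in> carrier H"
  using snd_hom by (auto simp: hom_def)

lemma snd_inv: "p \<in> carrier P \<Longrightarrow> snd (inv\<^bsub>P\<^esub> p) = inv\<^bsub>H\<^esub> (snd p)"
  using group_hom.hom_inv[of P H snd p] P.is_group t.G.is_group snd_hom
  by (simp add: group_hom_def group_hom_axioms_def)

lemma pi_closed: "a \<in> A \<Longrightarrow> \<pi> a \<in> carrier H"
  unfolding \<pi>_def using e_closed snd_closed by blast

lemma pi_mult:
  "C \<in> s.\<C> \<Longrightarrow> a \<in> Dom C \<Longrightarrow> b \<in> Dom C \<Longrightarrow> \<pi> (a \<otimes>\<^bsub>M\<^esub> b) = \<pi> a \<otimes>\<^bsub>H\<^esub> \<pi> b"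
  using e_mult snd_mult e_closed Dom_A by (simp add: \<pi>_def)

lemma pi_int_pow:
  "C \<in> s.\<C> \<Longrightarrow> a \<in> Dom C \<Longrightarrow> \<pi> (a [^]\<^bsub>M\<^esub> (k::int)) = \<pi> a [^]\<^bsub>H\<^esub> k"
  using e_int_pow[of C a k] hom_int_pow[OF snd_hom e_closed[OF Dom_A] P.is_group t.G.is_group]
  by (simp add: \<pi>_def)

lemma pi_nat_pow:
  "C \<in> s.\<C> \<Longrightarrow> a \<in> Dom C \<Longrightarrow> \<pi> (a [^]\<^bsub>M\<^esub> (k::nat)) = \<pi> a [^]\<^bsub>H\<^esub> k"
  using pi_int_pow[of C a "int k"] by (simp add: int_pow_int)

definition tmap :: "'g \<Rightarrow> 'h" where
  "tmap g = snd (K g)"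

lemma tmap_hom: "tmap \<in> hom G H"
  using K_closed K_mult snd_closed snd_mult by (auto simp: hom_def tmap_def)

lemma tmap_closed: "g \<in> carrier G \<Longrightarrow> tmap g \<in> carrier H"
  using tmap_hom by (auto simp: hom_def)

lemma tmap_mult: "g \<in> carrier G \<Longrightarrow> h \<in> carrier G \<Longrightarrow> tmap (g \<otimes>\<^bsub>G\<^esub> h) = tmap g \<otimes>\<^bsub>H\<^esub> tmap h"
  using tmap_hom by (auto simp: hom_def)

text \<open>The arrow from 0 to \<open>sig g a\<close> with linear part \<open>g\<close> factors in
  two ways: translate by \<open>a\<close> and apply \<open>g\<close>, or apply \<open>g\<close>,
  which fixes 0, and translate by \<open>sig g a\<close>. By local constancy the factor of
  \<open>g\<close> at a point \<open>a\<close> near 0 is \<open>K g\<close> as well.\<close>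

lemma e_sig_near:
  assumes g: "g \<in> S"
  shows "\<exists>C\<in>s.\<C>. \<forall>a\<in>C. e (sig g a) = K g \<otimes>\<^bsub>P\<^esub> e a \<otimes>\<^bsub>P\<^esub> inv\<^bsub>P\<^esub> (K g)"
proof -
  have gG: "g \<in> carrier G" using g by simp
  have d1: "\<one>\<^bsub>M\<^esub> \<in> s.dom_p (\<one>\<^bsub>M\<^esub>, g)" using lin_dom[OF gG] gG by simp
  obtain C where C: "C \<in> s.\<C>" "\<forall>y\<in>s.\<U> (\<one>\<^bsub>M\<^esub>, g). y C = s.\<iota> \<one>\<^bsub>M\<^esub> C \<longrightarrow> c (\<one>\<^bsub>M\<^esub>, g) y = K g"
    using c_loc[OF lin_sd[OF gG] s.iota_in_Udom[OF d1]] unfolding K_def by blast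
  have "e (sig g a) = K g \<otimes>\<^bsub>P\<^esub> e a \<otimes>\<^bsub>P\<^esub> inv\<^bsub>P\<^esub> (K g)" if a: "a \<in> C" for a
  proof -
    have A: "a \<in> A" "sig g a \<in> A" using a s.constr_subset[OF C(1)] s.sig_S[OF g] by auto
    have da: "a \<in> s.dom_p (\<one>\<^bsub>M\<^esub>, g)" using lin_dom[OF gG A] .
    have "s.\<iota> \<one>\<^bsub>M\<^esub> C = s.\<iota> a C" using s.iota_eq_iff[OF C(1), of "\<one>\<^bsub>M\<^esub>" a] A a by simp
    then have ca: "c (\<one>\<^bsub>M\<^esub>, g) (s.\<iota> a) = K g" using C(2) s.iota_in_Udom[OF da] by simp
    have "c (sd_mult M G sig (\<one>\<^bsub>M\<^esub>, g) (a, \<one>\<^bsub>G\<^esub>)) (s.\<iota> \<one>\<^bsub>M\<^esub>) = K g \<otimes>\<^bsub>P\<^esub> e a"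
      using c_mult[OF lin_sd[OF gG] transl_sd[OF A(1)], of "\<one>\<^bsub>M\<^esub>"] A da ca
      by (simp add: transl_dom transl_act e_def cA_def)
    moreover have "c (sd_mult M G sig (sig g a, \<one>\<^bsub>G\<^esub>) (\<one>\<^bsub>M\<^esub>, g)) (s.\<iota> \<one>\<^bsub>M\<^esub>) = e (sig g a) \<otimes>\<^bsub>P\<^esub> K g"
      using c_mult[OF transl_sd[OF A(2)] lin_sd[OF gG] d1] A gG
      by (simp add: transl_dom lin_act e_def cA_def K_def)
    moreover have "sd_mult M G sig (\<one>\<^bsub>M\<^esub>, g) (a, \<one>\<^bsub>G\<^esub>) = sd_mult M G sig (sig g a, \<one>\<^bsub>G\<^esub>) (\<one>\<^bsub>M\<^esub>, g)"
      using A gG by (simp add: sd_mult_def)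
    ultimately have "K g \<otimes>\<^bsub>P\<^esub> e a = e (sig g a) \<otimes>\<^bsub>P\<^esub> K g" by simp
    then show ?thesis using K_closed[OF gG] e_closed[OF A(1)] e_closed[OF A(2)] by (simp add: P.m_assoc)
  qed
  then show ?thesis using C(1) by blast
qed

lemma pi_sig_near:
  assumes g: "g \<in> S"
  shows "\<exists>C\<in>s.\<C>. \<forall>a\<in>C. \<pi> (sig g a) = tmap g \<otimes>\<^bsub>H\<^esub> \<pi> a \<otimes>\<^bsub>H\<^esub> inv\<^bsub>H\<^esub> (tmap g)"
proof -
  obtain C where C: "C \<in> s.\<C>" "\<forall>a\<in>C. e (sig g a) = K g \<otimes>\<^bsub>P\<^esub> e a \<otimes>\<^bsub>P\<^esub> inv\<^bsub>P\<^esub> (K g)"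
    using e_sig_near[OF g] by blast
  have gG: "g \<in> carrier G" using g by simp
  have "\<pi> (sig g a) = tmap g \<otimes>\<^bsub>H\<^esub> \<pi> a \<otimes>\<^bsub>H\<^esub> inv\<^bsub>H\<^esub> (tmap g)" if "a \<in> C" for a
  proof -
    have "a \<in> A" using that s.constr_subset[OF C(1)] by blast
    then show ?thesis using C(2) that K_closed[OF gG] e_closed[of a]
      by (simp add: \<pi>_def tmap_def snd_mult snd_inv)
  qed
  then show ?thesis using C(1) by blast
qed

text \<open>Shrinking \<open>C\<close> only enlarges \<open>stab C\<close>, so \<open>F\<close>
  stays inside it, and the uniform exponent of A/C moves the multiples into
  \<open>C\<close>.\<close>

lemma ex_Dom_pow:
  assumes F: "finite F" "F \<subseteq> A" and C0: "C0 \<in> s.\<C>"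
  shows "\<exists>C\<in>s.\<C>. C \<subseteq> C0 \<and> F \<subseteq> stab C \<and> (\<exists>n::nat. 0 < n \<and> (\<forall>a\<in>F. a [^]\<^bsub>M\<^esub> n \<in> Dom C))"
proof -
  obtain C1 where C1: "C1 \<in> s.\<C>" "F \<subseteq> stab C1" using ex_stab_finite[OF F] by blast
  define C where "C = C1 \<inter> C0"
  have C: "C \<in> s.\<C>" using s.constr_Int C1 C0 by (simp add: C_def)
  have FC: "F \<subseteq> stab C" using C1(2) stab_mono[of C C1] by (auto simp: C_def)
  obtain n :: nat where n: "0 < n" "\<forall>a\<in>A. a [^]\<^bsub>M\<^esub> n \<in> C" using s.constr_exponent[OF C] by blast
  have "a [^]\<^bsub>M\<^esub> n \<in> Dom C" if "a \<in> F" for a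
    using that n FC F s.M.subgroup_int_pow_closed[OF stab_subgroup, of a C "int n"]
    by (auto simp: Dom_def int_pow_int)
  then show ?thesis using C FC n(1) by (intro bexI[of _ C]) (auto simp: C_def)
qed

text \<open>The elements that \<open>e\<close> sends to translations. The witness \<open>C\<close>
  varies with the element, so sums are controlled only after passing to a common multiple.\<close>

definition E :: "'a set" where
  "E = {z. \<exists>C\<in>s.\<C>. z \<in> Dom C \<and> \<pi> z = \<one>\<^bsub>H\<^esub>}"

lemma E_A: "z \<in> E \<Longrightarrow> z \<in> A"
  using Dom_A by (auto simp: E_def)

lemma E_nat_pow: "z \<in> E \<Longrightarrow> z [^]\<^bsub>M\<^esub> (k::nat) \<in> E"
  using Dom_nat_pow pi_nat_pow by (fastforce simp: E_def)

lemma fst_e_mult: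
  assumes C: "C \<in> s.\<C>" "a \<in> Dom C" "b \<in> Dom C" "\<pi> a = \<one>\<^bsub>H\<^esub>"
  shows "fst (e (a \<otimes>\<^bsub>M\<^esub> b)) = fst (e a) \<otimes>\<^bsub>N\<^esub> fst (e b)"
proof -
  have "e b \<in> carrier N \<times> carrier H" using e_closed[OF Dom_A[OF C(3)]] by (simp add: t.sd_group_simps)
  then show ?thesis using e_mult[OF C(1-3)] C(4) by (simp add: t.sd_group_simps \<pi>_def mem_Times_iff)
qed

lemma fst_e_nat_pow:
  assumes z: "z \<in> E"
  shows "fst (e (z [^]\<^bsub>M\<^esub> (k::nat))) = fst (e z) [^]\<^bsub>N\<^esub> k"
proof (induction k)
  case 0
  obtain C where C: "C \<in> s.\<C>" "z \<in> Dom C" using z by (auto simp: E_def)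
  show ?case using e_nat_pow[OF C, of 0] by (simp add: t.sd_group_simps)
next
  case (Suc k)
  obtain C where C: "C \<in> s.\<C>" "z \<in> Dom C" using z by (auto simp: E_def)
  have "\<pi> (z [^]\<^bsub>M\<^esub> k) = \<one>\<^bsub>H\<^esub>" using E_nat_pow[OF z, of k] by (auto simp: E_def)
  then show ?case using fst_e_mult[OF C(1) Dom_nat_pow[OF C] C(2)] Suc by simp
qed

definition virtually_translation :: bool where
  "virtually_translation \<longleftrightarrow> (\<forall>a\<in>A. \<exists>n::nat. 0 < n \<and> a [^]\<^bsub>M\<^esub> n \<in> E)"

lemma E_if_torsion:
  assumes C: "C \<in> s.\<C>" "a [^]\<^bsub>M\<^esub> (n::nat) \<in> Dom C" and a: "a \<in> carrier M" "0 < n"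
    and m: "0 < (m::nat)" "\<pi> (a [^]\<^bsub>M\<^esub> n) [^]\<^bsub>H\<^esub> m = \<one>\<^bsub>H\<^esub>"
  shows "\<exists>k::nat. 0 < k \<and> a [^]\<^bsub>M\<^esub> k \<in> E"
proof -
  have "\<pi> ((a [^]\<^bsub>M\<^esub> n) [^]\<^bsub>M\<^esub> m) = \<one>\<^bsub>H\<^esub>" using pi_nat_pow[OF C] m by simp
  then have "(a [^]\<^bsub>M\<^esub> n) [^]\<^bsub>M\<^esub> m \<in> E" using Dom_nat_pow[OF C] C(1) by (auto simp: E_def)
  then show ?thesis using a m by (intro exI[of _ "n * m"]) (simp add: s.M.nat_pow_pow)
qed

end

locale gpd_cocycle_vt = gpd_cocycle +
  assumes vt: virtually_translation
begin

lemma virtual_hom_e: "virtual_hom M N E (\<lambda>z. fst (e z))"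
proof unfold_locales
  fix z assume z: "z \<in> E"
  show "z \<in> carrier M" using E_A[OF z] by simp
  show "fst (e z) \<in> carrier N" using e_closed[OF E_A[OF z]] by (auto simp: t.sd_group_simps)
  show "z [^]\<^bsub>M\<^esub> k \<in> E" for k :: nat using E_nat_pow[OF z] .
  show "fst (e (z [^]\<^bsub>M\<^esub> k)) = fst (e z) [^]\<^bsub>N\<^esub> k" for k :: nat using fst_e_nat_pow[OF z] .
  show "z = \<one>\<^bsub>M\<^esub>" if "fst (e z) = \<one>\<^bsub>N\<^esub>"
  proof -
    have "snd (e z) = \<one>\<^bsub>H\<^esub>" using z by (auto simp: E_def \<pi>_def)
    then have "e z = \<one>\<^bsub>P\<^esub>" using that by (simp add: t.sd_group_simps prod_eq_iff)
    then show ?thesis using e_eq_one E_A[OF z] by blast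
  qed
next
  fix z w assume zw: "z \<in> carrier M" "w \<in> carrier M"
  have ex: "\<exists>n::nat. 0 < n \<and> z [^]\<^bsub>M\<^esub> n \<in> E" if z: "z \<in> carrier M" for z
  proof -
    obtain n :: nat where n: "0 < n" "z [^]\<^bsub>M\<^esub> n \<in> A" using s.multiple_in_A[OF z] by blast
    obtain m :: nat where "0 < m" "(z [^]\<^bsub>M\<^esub> n) [^]\<^bsub>M\<^esub> m \<in> E" using vt n unfolding virtually_translation_def by blast
    then show ?thesis using n z by (intro exI[of _ "n * m"]) (simp add: s.M.nat_pow_pow)
  qed
  obtain n :: nat where n: "0 < n" "z [^]\<^bsub>M\<^esub> n \<in> E" using ex[OF zw(1)] by blast
  obtain m :: nat where m: "0 < m" "w [^]\<^bsub>M\<^esub> m \<in> E" using ex[OF zw(2)] by blast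
  define z' w' where "z' = (z [^]\<^bsub>M\<^esub> n) [^]\<^bsub>M\<^esub> m" and "w' = (w [^]\<^bsub>M\<^esub> m) [^]\<^bsub>M\<^esub> n"
  have E: "z' \<in> E" "w' \<in> E" using E_nat_pow n m by (auto simp: z'_def w'_def)
  then obtain C C' where C: "C \<in> s.\<C>" "z' \<in> Dom C" "C' \<in> s.\<C>" "w' \<in> Dom C'" by (auto simp: E_def)
  \<comment> \<open>\<open>z'\<close> and \<open>w'\<close> come with different constructible
    subgroups; a further multiple brings both into one \<open>Dom D\<close>, where \<open>e\<close>
    is additive.\<close>
  obtain D k where D: "D \<in> s.\<C>" "0 < (k::nat)" "\<forall>a\<in>{z', w'}. a [^]\<^bsub>M\<^esub> k \<in> Dom D"
    using ex_Dom_pow[of "{z', w'}" A] E E_A constr_top[of A S sig] by blast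
  define l where "l = n * m * k"
  have zl: "z [^]\<^bsub>M\<^esub> l = z' [^]\<^bsub>M\<^esub> k" "w [^]\<^bsub>M\<^esub> l = w' [^]\<^bsub>M\<^esub> k"
    using zw by (simp_all add: z'_def w'_def l_def s.M.nat_pow_pow ac_simps)
  have inE: "z [^]\<^bsub>M\<^esub> l \<in> E" "w [^]\<^bsub>M\<^esub> l \<in> E" using E_nat_pow E by (simp_all add: zl)
  have inD: "z [^]\<^bsub>M\<^esub> l \<in> Dom D" "w [^]\<^bsub>M\<^esub> l \<in> Dom D" using D by (simp_all add: zl)
  have eq: "(z \<otimes>\<^bsub>M\<^esub> w) [^]\<^bsub>M\<^esub> l = z [^]\<^bsub>M\<^esub> l \<otimes>\<^bsub>M\<^esub> w [^]\<^bsub>M\<^esub> l" using zw by (simp add: s.M.nat_pow_distrib)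
  have pi1: "\<pi> (z [^]\<^bsub>M\<^esub> l) = \<one>\<^bsub>H\<^esub>" "\<pi> (w [^]\<^bsub>M\<^esub> l) = \<one>\<^bsub>H\<^esub>" using inE by (auto simp: E_def)
  have "(z \<otimes>\<^bsub>M\<^esub> w) [^]\<^bsub>M\<^esub> l \<in> E"
    unfolding eq E_def using D(1) Dom_mult[OF D(1) inD] pi_mult[OF D(1) inD] pi1 by auto
  moreover have "fst (e ((z \<otimes>\<^bsub>M\<^esub> w) [^]\<^bsub>M\<^esub> l)) = fst (e (z [^]\<^bsub>M\<^esub> l)) \<otimes>\<^bsub>N\<^esub> fst (e (w [^]\<^bsub>M\<^esub> l))"
    unfolding eq using fst_e_mult[OF D(1) inD pi1(1)] .
  moreover have "0 < l" using n m D by (simp add: l_def)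
  ultimately show "\<exists>n::nat. 0 < n \<and> z [^]\<^bsub>M\<^esub> n \<in> E \<and> w [^]\<^bsub>M\<^esub> n \<in> E \<and> (z \<otimes>\<^bsub>M\<^esub> w) [^]\<^bsub>M\<^esub> n \<in> E \<and>
      fst (e ((z \<otimes>\<^bsub>M\<^esub> w) [^]\<^bsub>M\<^esub> n)) = fst (e (z [^]\<^bsub>M\<^esub> n)) \<otimes>\<^bsub>N\<^esub> fst (e (w [^]\<^bsub>M\<^esub> n))"
    using inE by blast
qed (rule tf_M, rule tf_N)

sublocale V: virtual_hom M N E "\<lambda>z. fst (e z)"
  by (rule virtual_hom_e)

text \<open>A multiple \<open>x\<close> of the numerator lies close enough to 0 for \<open>e\<close>
  to turn \<open>sig g\<close> into conjugation by \<open>K g\<close>. Conjugating a translation in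
  the semidirect product applies the linear part of \<open>K g\<close> to it, because
  \<open>N\<close> is commutative.\<close>

lemma bmap_equivariant_S:
  assumes g: "g \<in> S" and v: "v \<in> QT M (carrier M)"
  shows "V.bmap (qt_act M sig g v) = qt_act N tau (tmap g) (V.bmap v)"
proof -
  have gG: "g \<in> carrier G" using g by simp
  obtain z m where z: "z \<in> carrier M" "0 < m" "v = V.QM.cl z m" using v by (rule V.QM.QT_cases)
  obtain n :: nat where n: "0 < n" "z [^]\<^bsub>M\<^esub> n \<in> E" using V.multiple_in_E[OF z(1)] by blast
  obtain Cg where Cg: "Cg \<in> s.\<C>" "\<forall>a\<in>Cg. e (sig g a) = K g \<otimes>\<^bsub>P\<^esub> e a \<otimes>\<^bsub>P\<^esub> inv\<^bsub>P\<^esub> (K g)"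
    using e_sig_near[OF g] by blast
  have zA: "z [^]\<^bsub>M\<^esub> n \<in> A" using n E_A by blast
  define y where "y = z [^]\<^bsub>M\<^esub> n"
  have yA: "y \<in> A" "sig g y \<in> A" using zA s.sig_S[OF g] by (auto simp: y_def)
  obtain D k where D: "D \<in> s.\<C>" "D \<subseteq> Cg" "0 < (k::nat)" "\<forall>a\<in>{y, sig g y}. a [^]\<^bsub>M\<^esub> k \<in> Dom D"
    using ex_Dom_pow[of "{y, sig g y}" Cg] yA Cg(1) by blast
  define x where "x = y [^]\<^bsub>M\<^esub> k"
  have x: "x \<in> E" "x \<in> A" "x \<in> Dom D" using n E_nat_pow D yA by (auto simp: x_def y_def)
  have sx: "sig g x = sig g y [^]\<^bsub>M\<^esub> k" using yA gG by (simp add: x_def s.sig_nat_pow)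
  then have sxD: "sig g x \<in> Dom D" using D by simp
  have "x \<in> Cg" using x D by (auto simp: Dom_def)
  then have conj: "e (sig g x) = K g \<otimes>\<^bsub>P\<^esub> e x \<otimes>\<^bsub>P\<^esub> inv\<^bsub>P\<^esub> (K g)" using Cg by blast
  have sn: "snd (e x) = \<one>\<^bsub>H\<^esub>" using x by (auto simp: E_def \<pi>_def)
  have Kg: "K g \<in> carrier N \<times> carrier H" "e x \<in> carrier N \<times> carrier H"
    using K_closed[OF gG] e_closed[OF x(2)] by (auto simp: t.sd_group_simps)
  define w where "w = tau (tmap g) (fst (e x))"
  have w: "w \<in> carrier N" using Kg by (auto simp: w_def tmap_def mem_Times_iff)
  have Kw: "K g \<otimes>\<^bsub>P\<^esub> e x = (w, \<one>\<^bsub>H\<^esub>) \<otimes>\<^bsub>P\<^esub> K g"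
    using Kg sn w by (simp add: t.sd_group_simps tmap_def w_def mem_Times_iff t.M.m_comm)
  have "(w, \<one>\<^bsub>H\<^esub>) \<in> carrier P" using w by (simp add: t.sd_group_simps)
  then have ew: "e (sig g x) = (w, \<one>\<^bsub>H\<^esub>)"
    using conj K_closed[OF gG] unfolding Kw by (simp add: P.m_assoc)
  have sxE: "sig g x \<in> E" using sxD D(1) ew by (auto simp: E_def \<pi>_def)
  have xz: "x = z [^]\<^bsub>M\<^esub> (n * k)" using z by (simp add: x_def y_def s.M.nat_pow_pow)
  have sz: "sig g x = sig g z [^]\<^bsub>M\<^esub> (n * k)" using z gG by (simp add: xz s.sig_nat_pow)
  have nk: "0 < n * k" using n D by simp
  have 1: "V.bmap v = V.QN.cl (fst (e x)) (n * k * m)"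
    unfolding z(3) using V.bmap_cl[OF z(1,2) nk] x(1) xz by simp
  have 2: "V.bmap (qt_act M sig g v) = V.QN.cl w (n * k * m)"
    unfolding z(3) s.qt_act_cl[OF tf_M gG z(1,2)]
    using V.bmap_cl[OF s.sig_closed[OF gG z(1)] z(2) nk] sxE sz ew by simp
  show ?thesis unfolding 1 2
    using t.qt_act_cl[OF tf_N tmap_closed[OF gG], of "fst (e x)" "n * k * m"] Kg nk z(2)
    by (simp add: w_def mem_Times_iff)
qed

lemma bmap_equivariant:
  assumes g: "g \<in> carrier G" and v: "v \<in> QT M (carrier M)"
  shows "V.bmap (qt_act M sig g v) = qt_act N tau (tmap g) (V.bmap v)"
proof -
  have "g \<in> generate G S" using g s.gen_S by simp
  then show ?thesis using v
  proof (induction arbitrary: v rule: generate.induct)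
    case one
    have "tmap \<one>\<^bsub>G\<^esub> = \<one>\<^bsub>H\<^esub>" using hom_one[OF tmap_hom s.G.is_group t.G.is_group] .
    then show ?case using one s.qt_act_one[OF tf_M] t.qt_act_one[OF tf_N] V.bmap_closed by simp
  next
    case (incl g)
    then show ?case using bmap_equivariant_S by blast
  next
    case (inv g)
    have gG: "g \<in> carrier G" "inv\<^bsub>G\<^esub> g \<in> carrier G" using inv by auto
    define u where "u = qt_act M sig (inv\<^bsub>G\<^esub> g) v"
    have u: "u \<in> QT M (carrier M)" using s.qt_act_closed[OF tf_M gG(2)] inv by (simp add: u_def)
    have "qt_act M sig g u = v"
      using s.qt_act_mult[OF tf_M gG inv.prems] s.qt_act_one[OF tf_M inv.prems] gG by (simp add: u_def)
    then have "V.bmap v = qt_act N tau (tmap g) (V.bmap u)" using bmap_equivariant_S[OF inv.hyps u] by simp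
    moreover have "tmap (inv\<^bsub>G\<^esub> g) \<otimes>\<^bsub>H\<^esub> tmap g = \<one>\<^bsub>H\<^esub>"
      using tmap_mult[OF gG(2,1)] hom_one[OF tmap_hom s.G.is_group t.G.is_group] gG by simp
    ultimately have "qt_act N tau (tmap (inv\<^bsub>G\<^esub> g)) (V.bmap v) = V.bmap u"
      using t.qt_act_mult[OF tf_N tmap_closed[OF gG(2)] tmap_closed[OF gG(1)] V.bmap_closed[OF u]]
        t.qt_act_one[OF tf_N V.bmap_closed[OF u]] by simp
    then show ?case by (simp add: u_def)
  next
    case (eng g h)
    have gh: "g \<in> carrier G" "h \<in> carrier G" using eng s.gen_S by auto
    show ?case
      using eng gh s.qt_act_mult[OF tf_M gh] s.qt_act_closed[OF tf_M gh(2)] tmap_mult[OF gh]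
        t.qt_act_mult[OF tf_N tmap_closed[OF gh(1)] tmap_closed[OF gh(2)] V.bmap_closed] by simp
  qed
qed

text \<open>By equivariance and injectivity of \<open>bmap\<close>, an element of the kernel fixes
  \<open>A\<close> pointwise, so (JF) applies with C = A.\<close>

lemma tmap_inj: "inj_on tmap (carrier G)"
proof -
  interpret h: group_hom G H tmap
    using tmap_hom s.G.is_group t.G.is_group by (simp add: group_hom_def group_hom_axioms_def)
  have "g = \<one>\<^bsub>G\<^esub>" if g: "g \<in> carrier G" "tmap g = \<one>\<^bsub>H\<^esub>" for g
  proof (rule s.JF[OF constr_top g(1)])
    fix a assume a: "a \<in> A"
    have v: "V.QM.cl a 1 \<in> QT M (carrier M)" using a by simp
    have "V.bmap (qt_act M sig g (V.QM.cl a 1)) = V.bmap (V.QM.cl a 1)"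
      using bmap_equivariant[OF g(1) v] g(2) t.qt_act_one[OF tf_N V.bmap_closed[OF v]] by simp
    then have "qt_act M sig g (V.QM.cl a 1) = V.QM.cl a 1"
      using inj_onD[OF V.bmap_inj] v s.qt_act_closed[OF tf_M g(1) v] by simp
    then have "V.QM.cl (sig g a) 1 = V.QM.cl a 1" using s.qt_act_cl[OF tf_M g(1), of a 1] a by simp
    then show "sig g a = a" using V.QM.cl_eq_iff[of "sig g a" a 1 1] a g by simp
  qed
  then show ?thesis unfolding h.inj_on_one_iff by blast
qed

lemma rational_embedding:
  "act_emb G (QTg M (carrier M)) (qt_act M sig) H (QTg N (carrier N)) (qt_act N tau) tmap V.bmap"
  unfolding act_emb_def using tmap_hom tmap_inj V.bmap_hom V.bmap_inj bmap_equivariant by simp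

end

section \<open>Vanishing of the linear part\<close>

context alg_action
begin

text \<open>(JF) with C = A, applied to the quotient of the two elements.\<close>

lemma faithful:
  assumes "g \<in> carrier G" "h \<in> carrier G" "\<And>x. x \<in> carrier M \<Longrightarrow> sig g x = sig h x"
  shows "g = h"
proof -
  have "inv\<^bsub>G\<^esub> h \<otimes>\<^bsub>G\<^esub> g = \<one>\<^bsub>G\<^esub>"
    using assms by (intro JF[OF constr_top]) (auto simp: sig_mult)
  then show ?thesis using assms by (metis G.inv_closed G.inv_equality G.inv_inv)
qed

lemma sig_pow:
  assumes "g \<in> carrier G" "x \<in> carrier M"
  shows "sig (g [^]\<^bsub>G\<^esub> (n::nat)) x = (sig g ^^ n) x"
proof (induction n)
  case (Suc n)
  have "g [^]\<^bsub>G\<^esub> Suc n = g \<otimes>\<^bsub>G\<^esub> g [^]\<^bsub>G\<^esub> n" using G.nat_pow_Suc2[OF assms(1)] .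
  then show ?case using Suc assms by (simp add: sig_mult)
qed (use assms in simp)

lemma S_pow: "g \<in> S \<Longrightarrow> g [^]\<^bsub>G\<^esub> (n::nat) \<in> S"
  by (induction n) (auto intro: S_mult)

lemma fixed_point_trivial:
  assumes F: "cond_F M G sig" and g: "g \<in> carrier G" and y: "y \<in> carrier M" "sig g y = y" "y \<noteq> \<one>\<^bsub>M\<^esub>"
  shows "g = \<one>\<^bsub>G\<^esub>"
proof (rule ccontr)
  assume "g \<noteq> \<one>\<^bsub>G\<^esub>"
  then have "inj_on (\<lambda>b. b \<otimes>\<^bsub>M\<^esub> inv\<^bsub>M\<^esub> (sig g b)) (carrier M)" using F g by (simp add: cond_F_def)
  then have "y = \<one>\<^bsub>M\<^esub>" by (rule inj_onD) (use y g in auto)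
  then show False using y by blast
qed

text \<open>\<open>sig t\<close> conjugates the automorphism \<open>sig \<alpha>\<close> to its k-th
  power, so some power of \<alpha> fixes a nonzero element, and (F) makes that power trivial. For
  trivial \<open>M\<close>, faithfulness gives \<alpha> = 1.\<close>

lemma finite_order_of_conj_pow:
  assumes tf: "torsion_free M (carrier M)" and fr: "finite_rank M (carrier M)" and F: "cond_F M G sig"
    and \<alpha>: "\<alpha> \<in> carrier G" and t: "t \<in> carrier G"
    and conj: "t \<otimes>\<^bsub>G\<^esub> \<alpha> \<otimes>\<^bsub>G\<^esub> inv\<^bsub>G\<^esub> t = \<alpha> [^]\<^bsub>G\<^esub> (k::nat)" and k: "2 \<le> k"
  shows "\<exists>n::nat. 0 < n \<and> \<alpha> [^]\<^bsub>G\<^esub> n = \<one>\<^bsub>G\<^esub>"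
proof (cases "carrier M = {\<one>\<^bsub>M\<^esub>}")
  case True
  then have "\<alpha> = \<one>\<^bsub>G\<^esub>" using \<alpha> by (intro faithful) auto
  then show ?thesis by (intro exI[of _ 1]) simp
next
  case False
  interpret E: group_endo M "sig \<alpha>" by unfold_locales (rule sig_hom[OF \<alpha>])
  obtain d e where sp: "rat_spanned M d e"
    using finite_rank_rat_spanned[OF M.comm_group_axioms M.subgroup_self tf fr] by auto
  have inj: "inj_on (sig \<alpha>) (carrier M)" using sig_inject[OF \<alpha>] by (auto simp: inj_on_def)
  have surj: "sig t ` carrier M = carrier M"
    using t sig_iso[OF t] by (auto simp: iso_def bij_betw_def)
  have tw: "sig t (sig \<alpha> x) = (sig \<alpha> ^^ k) (sig t x)" if x: "x \<in> carrier M" for x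
  proof -
    have "t \<otimes>\<^bsub>G\<^esub> \<alpha> = \<alpha> [^]\<^bsub>G\<^esub> k \<otimes>\<^bsub>G\<^esub> t"
      using conj \<alpha> t by (metis G.inv_closed G.inv_solve_right' G.m_closed G.nat_pow_closed)
    then have "sig (t \<otimes>\<^bsub>G\<^esub> \<alpha>) x = sig (\<alpha> [^]\<^bsub>G\<^esub> k \<otimes>\<^bsub>G\<^esub> t) x" by simp
    then show ?thesis using x \<alpha> t by (simp add: sig_mult sig_pow)
  qed
  obtain n y where n: "n > 0" "y \<in> carrier M" "y \<noteq> \<one>\<^bsub>M\<^esub>" "(sig \<alpha> ^^ n) y = y"
    using E.root_of_unity_fixed_point[OF tf sp inj False sig_hom[OF t] surj tw k] by blast
  have "\<alpha> [^]\<^bsub>G\<^esub> n = \<one>\<^bsub>G\<^esub>"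
    using fixed_point_trivial[OF F _ n(2) _ n(3), of "\<alpha> [^]\<^bsub>G\<^esub> n"] n \<alpha> by (simp add: sig_pow)
  then show ?thesis using n(1) by blast
qed

end

context gpd_cocycle
begin

section \<open>Multiples of elements become translations\<close>

lemma E_inv: "z \<in> E \<Longrightarrow> inv\<^bsub>M\<^esub> z \<in> E"
proof -
  assume "z \<in> E"
  then obtain C where C: "C \<in> s.\<C>" "z \<in> Dom C" "\<pi> z = \<one>\<^bsub>H\<^esub>" by (auto simp: E_def)
  have "inv\<^bsub>M\<^esub> z = z [^]\<^bsub>M\<^esub> (-1::int)" using Dom_A[OF C(2)] by (simp add: s.M.int_pow_neg)
  then show ?thesis using Dom_int_pow[OF C(1,2), of "-1"] pi_int_pow[OF C(1,2), of "-1"] C(1,3)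
    by (auto simp: E_def)
qed

lemma near_conj:
  assumes g: "g \<in> S" and a: "a \<in> A" and F: "finite F" "F \<subseteq> A"
  obtains C n where "C \<in> s.\<C>" "0 < (n::nat)" "a [^]\<^bsub>M\<^esub> n \<in> Dom C" "\<forall>b\<in>F. b [^]\<^bsub>M\<^esub> n \<in> Dom C"
    "\<pi> (sig g (a [^]\<^bsub>M\<^esub> n)) = tmap g \<otimes>\<^bsub>H\<^esub> \<pi> (a [^]\<^bsub>M\<^esub> n) \<otimes>\<^bsub>H\<^esub> inv\<^bsub>H\<^esub> (tmap g)"
proof -
  obtain Cg where Cg: "Cg \<in> s.\<C>"
    "\<forall>a\<in>Cg. \<pi> (sig g a) = tmap g \<otimes>\<^bsub>H\<^esub> \<pi> a \<otimes>\<^bsub>H\<^esub> inv\<^bsub>H\<^esub> (tmap g)"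
    using pi_sig_near[OF g] by blast
  obtain C n where C: "C \<in> s.\<C>" "C \<subseteq> Cg" "0 < (n::nat)" "\<forall>b\<in>insert a F. b [^]\<^bsub>M\<^esub> n \<in> Dom C"
    using ex_Dom_pow[of "insert a F" Cg] Cg(1) a F by blast
  have "a [^]\<^bsub>M\<^esub> n \<in> Cg" using C by (auto simp: Dom_def)
  then show ?thesis using that[OF C(1,3)] C(4) Cg(2) by blast
qed

text \<open>Near 0 a scalar element makes \<open>tmap g\<close> conjugate \<open>\<pi> a\<close> to
  its \<kappa>-th power; what remains, torsion of such elements of \<open>H\<close>, is isolated as
  the assumption \<open>tor\<close>.\<close>

lemma vt_scalar_torsion:
  assumes sc: "scalar_elt M S A sig g \<kappa>" and a: "a \<in> A"
    and tor: "\<And>\<alpha>. \<alpha> \<in> carrier H \<Longrightarrow> tmap g \<otimes>\<^bsub>H\<^esub> \<alpha> \<otimes>\<^bsub>H\<^esub> inv\<^bsub>H\<^esub> (tmap g) = \<alpha> [^]\<^bsub>H\<^esub> \<kappa> \<Longrightarrow>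
      \<exists>n::nat. 0 < n \<and> \<alpha> [^]\<^bsub>H\<^esub> n = \<one>\<^bsub>H\<^esub>"
  shows "\<exists>n::nat. 0 < n \<and> a [^]\<^bsub>M\<^esub> n \<in> E"
proof -
  have g: "g \<in> S" and ga: "\<And>a. a \<in> A \<Longrightarrow> sig g a = a [^]\<^bsub>M\<^esub> \<kappa>" using sc by (auto simp: scalar_elt_def)
  obtain C n where C: "C \<in> s.\<C>" "0 < (n::nat)" "a [^]\<^bsub>M\<^esub> n \<in> Dom C"
    "\<pi> (sig g (a [^]\<^bsub>M\<^esub> n)) = tmap g \<otimes>\<^bsub>H\<^esub> \<pi> (a [^]\<^bsub>M\<^esub> n) \<otimes>\<^bsub>H\<^esub> inv\<^bsub>H\<^esub> (tmap g)"
    using near_conj[OF g a, of "{}"] by auto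
  have "tmap g \<otimes>\<^bsub>H\<^esub> \<pi> (a [^]\<^bsub>M\<^esub> n) \<otimes>\<^bsub>H\<^esub> inv\<^bsub>H\<^esub> (tmap g) = \<pi> (a [^]\<^bsub>M\<^esub> n) [^]\<^bsub>H\<^esub> \<kappa>"
    using C(4) ga[of "a [^]\<^bsub>M\<^esub> n"] pi_int_pow[OF C(1,3), of \<kappa>] a by simp
  then obtain m :: nat where "0 < m" "\<pi> (a [^]\<^bsub>M\<^esub> n) [^]\<^bsub>H\<^esub> m = \<one>\<^bsub>H\<^esub>"
    using tor[OF pi_closed[of "a [^]\<^bsub>M\<^esub> n"]] a by auto
  then show ?thesis using E_if_torsion[OF C(1,3) _ C(2)] a by auto
qed

lemma vt_i2: "cond_i2 M S A sig H \<Longrightarrow> virtually_translation"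
  unfolding virtually_translation_def
proof
  fix a assume i2: "cond_i2 M S A sig H" and a: "a \<in> A"
  obtain g \<kappa> where g: "scalar_elt M S A sig g \<kappa>"
    and tor: "\<forall>\<alpha>\<in>carrier H. (\<exists>\<beta>\<in>carrier H. \<beta> \<otimes>\<^bsub>H\<^esub> \<alpha> \<otimes>\<^bsub>H\<^esub> inv\<^bsub>H\<^esub> \<beta> = \<alpha> [^]\<^bsub>H\<^esub> \<kappa>) \<longrightarrow>
        (\<exists>n::nat. 0 < n \<and> \<alpha> [^]\<^bsub>H\<^esub> n = \<one>\<^bsub>H\<^esub>)"
    using i2 unfolding cond_i2_def by blast
  have "g \<in> carrier G" using g by (simp add: scalar_elt_def)
  then show "\<exists>n::nat. 0 < n \<and> a [^]\<^bsub>M\<^esub> n \<in> E"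
    using vt_scalar_torsion[OF g a] tor tmap_closed by blast
qed

text \<open>Replacing \<open>t\<close> by its square replaces \<kappa> by the natural number
  \<kappa>^2, which is at least 2 as the spectral argument requires, except for \<kappa> =
  -1.\<close>

lemma vt_III: "cond_III M S A sig N H tau \<Longrightarrow> virtually_translation"
  unfolding virtually_translation_def
proof
  fix a assume III: "cond_III M S A sig N H tau" and a: "a \<in> A"
  obtain g \<kappa> where g: "scalar_elt M S A sig g \<kappa>" and fr: "finite_rank N (carrier N)" and F: "cond_F N H tau"
    using III by (auto simp: cond_III_def)
  have gS: "g \<in> S" "g \<in> carrier G" and \<kappa>: "\<kappa> \<noteq> 0" "\<kappa> \<noteq> 1"
    and ga: "\<And>a. a \<in> A \<Longrightarrow> sig g a = a [^]\<^bsub>M\<^esub> \<kappa>"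
    using g by (auto simp: scalar_elt_def)
  define t where "t = tmap g"
  have t: "t \<in> carrier H" using tmap_closed gS by (simp add: t_def)
  have "\<exists>n::nat. 0 < n \<and> \<alpha> [^]\<^bsub>H\<^esub> n = \<one>\<^bsub>H\<^esub>"
    if \<alpha>: "\<alpha> \<in> carrier H" and conj: "t \<otimes>\<^bsub>H\<^esub> \<alpha> \<otimes>\<^bsub>H\<^esub> inv\<^bsub>H\<^esub> t = \<alpha> [^]\<^bsub>H\<^esub> \<kappa>" for \<alpha>
  proof (cases "\<kappa> = -1")
    \<comment> \<open>Here g^2 = 1, hence t^2 = 1, and every sum of b and \<open>tau t b\<close> is
      fixed by \<open>t\<close>. By (F) either t = 1 or \<open>tau t\<close> is -1; in both cases
      \<open>t\<close> commutes with \<alpha>, which is therefore its own inverse.\<close>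
    case True
    have "g \<otimes>\<^bsub>G\<^esub> g = \<one>\<^bsub>G\<^esub>"
      using gS ga True by (intro s.JF[OF constr_top]) (auto simp: s.sig_mult s.sig_int_pow s.M.int_pow_neg)
    then have tt: "t \<otimes>\<^bsub>H\<^esub> t = \<one>\<^bsub>H\<^esub>"
      using tmap_mult[OF gS(2) gS(2)] hom_one[OF tmap_hom s.G.is_group t.G.is_group] by (simp add: t_def)
    have "t \<otimes>\<^bsub>H\<^esub> \<alpha> = \<alpha> \<otimes>\<^bsub>H\<^esub> t"
    proof (cases "t = \<one>\<^bsub>H\<^esub>")
      case True
      then show ?thesis using \<alpha> by simp
    next
      case False
      have neg: "tau t b = inv\<^bsub>N\<^esub> b" if b: "b \<in> carrier N" for b
      proof -
        have "tau t (b \<otimes>\<^bsub>N\<^esub> tau t b) = b \<otimes>\<^bsub>N\<^esub> tau t b"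
          using b t tt t.sig_mult[OF t t b] by (simp add: t.sig_add t.M.m_comm)
        then have "b \<otimes>\<^bsub>N\<^esub> tau t b = \<one>\<^bsub>N\<^esub>"
          using t.fixed_point_trivial[OF F t, of "b \<otimes>\<^bsub>N\<^esub> tau t b"] False b t by auto
        then have "tau t b \<otimes>\<^bsub>N\<^esub> b = \<one>\<^bsub>N\<^esub>" using t.M.m_comm[of "tau t b" b] b t by simp
        then show ?thesis using t.M.inv_equality[of "tau t b" b] b t by simp
      qed
      show ?thesis
        using t \<alpha> by (intro t.faithful) (auto simp: t.sig_mult neg t.sig_inv)
    qed
    then have "\<alpha> = inv\<^bsub>H\<^esub> \<alpha>"
      using conj True \<alpha> t by (simp add: t.G.m_assoc t.G.int_pow_neg)
    then have "\<alpha> \<otimes>\<^bsub>H\<^esub> \<alpha> = \<one>\<^bsub>H\<^esub>" using \<alpha> by (metis t.G.r_inv)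
    then show ?thesis using \<alpha> by (intro exI[of _ 2]) (simp add: numeral_2_eq_2)
  next
    case False
    define k where "k = nat (\<kappa> * \<kappa>)"
    have "2 \<le> \<bar>\<kappa>\<bar>" using \<kappa> False by linarith
    then have "2 * 2 \<le> \<bar>\<kappa>\<bar> * \<bar>\<kappa>\<bar>" by (intro mult_mono) auto
    then have k: "2 \<le> k" "int k = \<kappa> * \<kappa>" by (auto simp: k_def abs_mult[symmetric])
    have "(t \<otimes>\<^bsub>H\<^esub> t) \<otimes>\<^bsub>H\<^esub> \<alpha> \<otimes>\<^bsub>H\<^esub> inv\<^bsub>H\<^esub> (t \<otimes>\<^bsub>H\<^esub> t) = t \<otimes>\<^bsub>H\<^esub> (t \<otimes>\<^bsub>H\<^esub> \<alpha> \<otimes>\<^bsub>H\<^esub> inv\<^bsub>H\<^esub> t) \<otimes>\<^bsub>H\<^esub> inv\<^bsub>H\<^esub> t"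
      using t \<alpha> by (simp add: t.G.m_assoc t.G.inv_mult_group)
    also have "\<dots> = (\<alpha> [^]\<^bsub>H\<^esub> \<kappa>) [^]\<^bsub>H\<^esub> \<kappa>"
      unfolding conj using t.G.conj_int_pow[OF t \<alpha>, of \<kappa>] conj by simp
    also have "\<dots> = \<alpha> [^]\<^bsub>H\<^esub> k" using \<alpha> k(2) by (simp add: t.G.int_pow_pow int_pow_int[symmetric])
    finally show ?thesis
      using t.finite_order_of_conj_pow[OF tf_N fr F \<alpha> t.G.m_closed[OF t t] _ k(1)] by blast
  qed
  then show "\<exists>n::nat. 0 < n \<and> a [^]\<^bsub>M\<^esub> n \<in> E"
    using vt_scalar_torsion[OF g a] unfolding t_def by blast
qed

text \<open>Since id - \<open>sig g\<close> is injective on \<open>X\<close>, some multiple m a is a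
  difference y - sig g y. For a multiple \<open>u\<close> of \<open>y\<close> near 0,
  \<open>\<pi> u\<close> commutes with its conjugate by \<open>tmap g\<close>, because u and sig g u
  commute; hence it commutes with \<open>tmap g\<close>, and the two linear parts cancel in the
  difference.\<close>

lemma vt_i1:
  assumes X: "subgroup X M" "X \<subseteq> A" "finite_rank M X" and i1: "cond_i1 M S sig H X" and a: "a \<in> X"
  shows "\<exists>n::nat. 0 < n \<and> a [^]\<^bsub>M\<^esub> n \<in> E"
proof -
  obtain g where g: "g \<in> S" "sig g ` X \<subseteq> X" "inj_on (\<lambda>a. a \<otimes>\<^bsub>M\<^esub> inv\<^bsub>M\<^esub> (sig g a)) X"
    and two: "two_gen_free_or_abelian H"
    using i1 by (auto simp: cond_i1_def)
  have gG: "g \<in> carrier G" using g by simp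
  define \<phi> where "\<phi> a = a \<otimes>\<^bsub>M\<^esub> inv\<^bsub>M\<^esub> (sig g a)" for a
  interpret X: subgroup X M by (rule X(1))
  let ?X = "M\<lparr>carrier := X\<rparr>"
  have XA: "x \<in> A" if "x \<in> X" for x using that X(2) by blast
  interpret XG: group_endo ?X \<phi>
  proof (intro group_endo.intro abelian_grp.intro group_endo_axioms.intro)
    show "comm_group ?X"
      using group.group_comm_groupI[OF s.M.subgroup_imp_group[OF X(1)]] s.M.m_comm by simp
    show "\<phi> \<in> hom ?X ?X"
    proof (rule homI)
      fix x assume "x \<in> carrier ?X"
      then show "\<phi> x \<in> carrier ?X" using g(2) by (auto simp: \<phi>_def)
    next
      fix x y assume "x \<in> carrier ?X" "y \<in> carrier ?X"
      then show "\<phi> (x \<otimes>\<^bsub>?X\<^esub> y) = \<phi> x \<otimes>\<^bsub>?X\<^esub> \<phi> y"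
        using gG by (simp add: \<phi>_def s.sig_add s.M.inv_mult s.M.m_ac)
    qed
  qed
  have tfX: "torsion_free ?X (carrier ?X)"
    using tf_M by (auto simp: torsion_free_def s.M.nat_pow_consistent[symmetric])
  obtain d e where sp: "rat_spanned ?X d e"
    using finite_rank_rat_spanned[OF s.M.comm_group_axioms X(1) tf_M X(3)] by blast
  have "inj_on \<phi> (carrier ?X)" using g(3) by (simp add: \<phi>_def[abs_def])
  then obtain m :: int where m: "m \<noteq> 0" "\<forall>x\<in>X. \<exists>y\<in>X. x [^]\<^bsub>?X\<^esub> m = \<phi> y"
    using XG.inj_cokernel_bounded[OF tfX sp] by auto
  then obtain y where y: "y \<in> X" "a [^]\<^bsub>M\<^esub> m = \<phi> y"
    using a s.M.int_pow_consistent[OF X(1) a] by auto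
  have yA: "y \<in> A" "sig g y \<in> A" using y XA s.sig_S[OF g(1)] by auto
  obtain C n where C: "C \<in> s.\<C>" "0 < (n::nat)" "y [^]\<^bsub>M\<^esub> n \<in> Dom C" "sig g y [^]\<^bsub>M\<^esub> n \<in> Dom C"
    and conj: "\<pi> (sig g (y [^]\<^bsub>M\<^esub> n)) = tmap g \<otimes>\<^bsub>H\<^esub> \<pi> (y [^]\<^bsub>M\<^esub> n) \<otimes>\<^bsub>H\<^esub> inv\<^bsub>H\<^esub> (tmap g)"
    using near_conj[OF g(1) yA(1), of "{sig g y}"] yA by auto
  define u where "u = y [^]\<^bsub>M\<^esub> n"
  have su: "sig g u = sig g y [^]\<^bsub>M\<^esub> n" using yA gG by (simp add: u_def s.sig_nat_pow)
  have uD: "u \<in> Dom C" "sig g u \<in> Dom C" using C by (simp_all add: u_def su[unfolded u_def])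
  have uA: "u \<in> A" "sig g u \<in> A" using uD Dom_A by auto
  have t: "tmap g \<in> carrier H" using tmap_closed gG by blast
  have pu: "\<pi> u \<in> carrier H" using pi_closed uA by blast
  have conj': "\<pi> (sig g u) = tmap g \<otimes>\<^bsub>H\<^esub> \<pi> u \<otimes>\<^bsub>H\<^esub> inv\<^bsub>H\<^esub> (tmap g)" using conj by (simp add: u_def)
  have "\<pi> u \<otimes>\<^bsub>H\<^esub> \<pi> (sig g u) = \<pi> (sig g u) \<otimes>\<^bsub>H\<^esub> \<pi> u"
    using pi_mult[OF C(1) uD] pi_mult[OF C(1) uD(2,1)] s.M.m_comm[of u "sig g u"] uA by simp
  then have "\<pi> u \<otimes>\<^bsub>H\<^esub> tmap g = tmap g \<otimes>\<^bsub>H\<^esub> \<pi> u"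
    using commute_with_conj_two_gen[OF t.G.is_group two pu t] conj' by simp
  then have same: "\<pi> (sig g u) = \<pi> u"
    unfolding conj' using t pu by (metis t.G.inv_solve_right' t.G.m_closed)
  have inv_su: "inv\<^bsub>M\<^esub> (sig g u) = sig g u [^]\<^bsub>M\<^esub> (-1::int)" using uA by (simp add: s.M.int_pow_neg)
  have isD: "inv\<^bsub>M\<^esub> (sig g u) \<in> Dom C" unfolding inv_su using Dom_int_pow[OF C(1) uD(2)] .
  have "\<pi> (u \<otimes>\<^bsub>M\<^esub> inv\<^bsub>M\<^esub> (sig g u)) = \<pi> u \<otimes>\<^bsub>H\<^esub> inv\<^bsub>H\<^esub> (\<pi> u)"
    using pi_mult[OF C(1) uD(1) isD] pi_int_pow[OF C(1) uD(2), of "-1"] same pu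
    by (simp add: inv_su t.G.int_pow_neg)
  then have "u \<otimes>\<^bsub>M\<^esub> inv\<^bsub>M\<^esub> (sig g u) \<in> E"
    using pu Dom_mult[OF C(1) uD(1) isD] C(1) by (auto simp: E_def)
  moreover have "u \<otimes>\<^bsub>M\<^esub> inv\<^bsub>M\<^esub> (sig g u) = (a [^]\<^bsub>M\<^esub> m) [^]\<^bsub>M\<^esub> n"
    using yA by (simp add: y(2) \<phi>_def su u_def[symmetric] s.M.nat_pow_distrib s.M.nat_pow_inv)
  ultimately have amn: "(a [^]\<^bsub>M\<^esub> m) [^]\<^bsub>M\<^esub> n \<in> E" by simp
  have aM: "a \<in> carrier M" using a by simp
  have "a [^]\<^bsub>M\<^esub> (nat \<bar>m\<bar> * n) \<in> E"
  proof (cases m rule: int_cases2)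
    case (nonneg k)
    then show ?thesis using amn aM by (simp add: int_pow_int s.M.nat_pow_pow)
  next
    case (nonpos k)
    then have "(a [^]\<^bsub>M\<^esub> m) [^]\<^bsub>M\<^esub> n = inv\<^bsub>M\<^esub> (a [^]\<^bsub>M\<^esub> (k * n))"
      using aM by (simp add: s.M.int_pow_neg_int s.M.nat_pow_inv s.M.nat_pow_pow)
    then have "inv\<^bsub>M\<^esub> (inv\<^bsub>M\<^esub> (a [^]\<^bsub>M\<^esub> (k * n))) \<in> E" using E_inv[OF amn] by simp
    then show ?thesis using nonpos aM by simp
  qed
  then show ?thesis using m(1) C(2) by (intro exI[of _ "nat \<bar>m\<bar> * n"]) simp
qed

lemma vt_I_seq:
  assumes "incr_fr_seq M A An" "cond_I_seq M S A sig H An"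
  shows "virtually_translation"
proof (cases "cond_i2 M S A sig H")
  case True
  then show ?thesis by (rule vt_i2)
next
  case False
  then have i1: "\<And>n. cond_i1 M S sig H (An n)" using assms(2) by (simp add: cond_I_seq_def)
  have An: "subgroup (An n) M" "finite_rank M (An n)" "An n \<subseteq> A" for n
    using assms(1) by (auto simp: incr_fr_seq_def)
  have U: "(\<Union>n. An n) = A" using assms(1) by (simp add: incr_fr_seq_def)
  show ?thesis unfolding virtually_translation_def
  proof
    fix a assume "a \<in> A"
    then obtain n where "a \<in> An n" using U by blast
    then show "\<exists>n::nat. 0 < n \<and> a [^]\<^bsub>M\<^esub> n \<in> E" using vt_i1[OF An(1,3,2) i1] by blast
  qed
qed

text \<open>Some multiple n a goes to a translation \<open>y\<close>. As \<open>e a\<close> commutes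
  with its own power, its linear part fixes \<open>y\<close>, so by (F) it is trivial or y = 0; the
  latter forces a = 0.\<close>

lemma translation_if_F:
  assumes F: "cond_F N H tau" and vt: virtually_translation and C: "C \<in> s.\<C>" and a: "a \<in> Dom C"
  shows "a \<in> E"
proof -
  have aA: "a \<in> A" using Dom_A a by blast
  have "\<pi> a = \<one>\<^bsub>H\<^esub>"
  proof (rule ccontr)
    assume nt: "\<pi> a \<noteq> \<one>\<^bsub>H\<^esub>"
    obtain n :: nat where n: "0 < n" "a [^]\<^bsub>M\<^esub> n \<in> E" using vt aA unfolding virtually_translation_def by blast
    define y where "y = fst (e (a [^]\<^bsub>M\<^esub> n))"
    have "snd (e (a [^]\<^bsub>M\<^esub> n)) = \<one>\<^bsub>H\<^esub>" using n(2) by (auto simp: E_def \<pi>_def)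
    then have ey: "e (a [^]\<^bsub>M\<^esub> n) = (y, \<one>\<^bsub>H\<^esub>)" by (simp add: y_def prod_eq_iff)
    have ea: "e a \<in> carrier P" using e_closed aA by blast
    then have ea': "fst (e a) \<in> carrier N" "snd (e a) \<in> carrier H" by (auto simp: t.sd_group_simps)
    have y: "y \<in> carrier N" using e_closed[of "a [^]\<^bsub>M\<^esub> n"] aA by (auto simp: y_def t.sd_group_simps)
    have "e (a [^]\<^bsub>M\<^esub> n) = e a [^]\<^bsub>P\<^esub> n" using e_nat_pow[OF C a] .
    then have "e a \<otimes>\<^bsub>P\<^esub> (y, \<one>\<^bsub>H\<^esub>) = (y, \<one>\<^bsub>H\<^esub>) \<otimes>\<^bsub>P\<^esub> e a"
      using ey P.nat_pow_Suc2[OF ea, of n] by simp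
    then have "fst (e a) \<otimes>\<^bsub>N\<^esub> tau (\<pi> a) y = fst (e a) \<otimes>\<^bsub>N\<^esub> y"
      using y ea' by (simp add: t.sd_group_simps \<pi>_def t.M.m_comm)
    then have "tau (\<pi> a) y = y" using y ea' by (simp add: \<pi>_def)
    then have "y = \<one>\<^bsub>N\<^esub>" using t.fixed_point_trivial[OF F pi_closed[OF aA] y] nt by blast
    then have "e (a [^]\<^bsub>M\<^esub> n) = \<one>\<^bsub>P\<^esub>" using ey by (simp add: t.sd_group_simps)
    then have "a [^]\<^bsub>M\<^esub> n = \<one>\<^bsub>M\<^esub>" using e_eq_one aA by simp
    then have a1: "a = \<one>\<^bsub>M\<^esub>" using tf_M aA n(1) unfolding torsion_free_def by auto
    have "e \<one>\<^bsub>M\<^esub> = \<one>\<^bsub>P\<^esub>" using e_nat_pow[OF C a, of 0] by simp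
    then show False using nt a1 by (simp add: \<pi>_def t.sd_group_simps)
  qed
  then show ?thesis using C a by (auto simp: E_def)
qed

text \<open>On \<open>X\<close> one has \<mu> sig g' = \<nu> with g' the \<delta>-th power of
  \<open>g\<close>, so near 0 conjugation by \<open>t\<close> takes the \<mu>-th power of
  \<open>\<pi> a\<close> to its \<nu>-th power. For an element of exact order \<open>l\<close> these
  powers must have the same order, which is impossible when \<mu>, \<nu> are coprime and one of them
  shares a factor with \<open>l\<close>.\<close>

lemma avoid_torsion_order:
  assumes X: "subgroup X M" "X \<subseteq> A" and inv: "\<forall>g\<in>S. sig g ` Y \<subseteq> Y" and YX: "Y \<subseteq> X"
    and ii1: "cond_ii1 M G S sig H X" and C: "C \<in> s.\<C>" and YC: "Y \<subseteq> stab C" and l: "1 < (l::nat)"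
  shows "\<exists>C'\<in>s.\<C>. \<forall>a\<in>Y \<inter> C \<inter> C'.
    \<not> (\<pi> a [^]\<^bsub>H\<^esub> l = \<one>\<^bsub>H\<^esub> \<and> (\<forall>k. 0 < k \<and> k < l \<longrightarrow> \<pi> a [^]\<^bsub>H\<^esub> k \<noteq> \<one>\<^bsub>H\<^esub>))"
proof (cases "is_torsion_order H l")
  case False
  have "\<not> (\<pi> a [^]\<^bsub>H\<^esub> l = \<one>\<^bsub>H\<^esub> \<and> (\<forall>k. 0 < k \<and> k < l \<longrightarrow> \<pi> a [^]\<^bsub>H\<^esub> k \<noteq> \<one>\<^bsub>H\<^esub>))" if "a \<in> A" for a
    using False pi_closed[OF that] l unfolding is_torsion_order_def by auto
  moreover have "a \<in> A" if "a \<in> Y" for a using that YX X(2) by blast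
  ultimately show ?thesis using C by blast
next
  case True
  obtain g \<mu> \<nu> \<delta> p where g: "g \<in> S" and \<mu>: "0 < \<mu>" and cop: "coprime \<mu> \<nu>"
    and gX: "sig g ` X \<subseteq> X" and cp: "qcharpoly M X (qlift M X (sig g)) p"
    and p: "Polynomial.smult (of_nat \<mu>) p = monom (of_nat \<mu>) \<delta> - [:of_nat \<nu>:]"
    and gcd: "1 < gcd l \<mu> \<or> 1 < gcd l \<nu>"
    using ii1 l True unfolding cond_ii1_def by blast
  have gG: "g \<in> carrier G" using g by simp
  interpret TX: torsion_free_subgroup M X
    by (intro torsion_free_subgroup.intro torsion_free_subgroup_axioms.intro s.M.abelian_grp_axioms X(1) tf_M)
  have ghom: "sig g \<in> hom (M\<lparr>carrier := X\<rparr>) (M\<lparr>carrier := X\<rparr>)"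
    using gX gG by (auto simp: hom_def s.sig_add)
  define g' where "g' = g [^]\<^bsub>G\<^esub> \<delta>"
  have g': "g' \<in> S" "g' \<in> carrier G" using s.S_pow[OF g] gG by (auto simp: g'_def)
  have mn: "sig g' x [^]\<^bsub>M\<^esub> \<mu> = x [^]\<^bsub>M\<^esub> \<nu>" if "x \<in> X" for x
    using TX.qcharpoly_monomial[OF ghom cp p \<mu> that] s.sig_pow[OF gG, of x \<delta>] that by (simp add: g'_def)
  obtain Cg where Cg: "Cg \<in> s.\<C>"
    "\<forall>a\<in>Cg. \<pi> (sig g' a) = tmap g' \<otimes>\<^bsub>H\<^esub> \<pi> a \<otimes>\<^bsub>H\<^esub> inv\<^bsub>H\<^esub> (tmap g')"
    using pi_sig_near[OF g'(1)] by blast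
  \<comment> \<open>Small enough for the conjugation formula and for \<open>sig g' a\<close> to
    remain in \<open>C\<close>; invariance of \<open>Y\<close> then puts both \<open>a\<close> and
    \<open>sig g' a\<close> into \<open>Dom C\<close>.\<close>
  define C' where "C' = Cg \<inter> {a \<in> A. sig g' a \<in> C}"
  have C': "C' \<in> s.\<C>" unfolding C'_def using s.constr_Int Cg(1) constr_pre[OF C g'(1)] by blast
  have "\<not> (\<pi> a [^]\<^bsub>H\<^esub> l = \<one>\<^bsub>H\<^esub> \<and> (\<forall>k. 0 < k \<and> k < l \<longrightarrow> \<pi> a [^]\<^bsub>H\<^esub> k \<noteq> \<one>\<^bsub>H\<^esub>))"
    if a: "a \<in> Y \<inter> C \<inter> C'" for a
  proof
    assume ord: "\<pi> a [^]\<^bsub>H\<^esub> l = \<one>\<^bsub>H\<^esub> \<and> (\<forall>k. 0 < k \<and> k < l \<longrightarrow> \<pi> a [^]\<^bsub>H\<^esub> k \<noteq> \<one>\<^bsub>H\<^esub>)"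
    have aX: "a \<in> X" "a \<in> A" using a YX X(2) by auto
    have aD: "a \<in> Dom C" using a YC by (auto simp: Dom_def)
    have gaD: "sig g' a \<in> Dom C" using a YC inv g'(1) by (auto simp: Dom_def C'_def)
    define \<alpha> t where "\<alpha> = \<pi> a" and "t = tmap g'"
    have \<alpha>: "\<alpha> \<in> carrier H" and t: "t \<in> carrier H"
      using pi_closed aX tmap_closed g' by (auto simp: \<alpha>_def t_def)
    have dvd: "l dvd k" if "\<alpha> [^]\<^bsub>H\<^esub> k = \<one>\<^bsub>H\<^esub>" for k :: nat
    proof -
      have al: "\<alpha> [^]\<^bsub>H\<^esub> l = \<one>\<^bsub>H\<^esub>" using ord by (simp add: \<alpha>_def)
      have eq: "\<alpha> [^]\<^bsub>H\<^esub> k = (\<alpha> [^]\<^bsub>H\<^esub> l) [^]\<^bsub>H\<^esub> (k div l) \<otimes>\<^bsub>H\<^esub> \<alpha> [^]\<^bsub>H\<^esub> (k mod l)"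
        using \<alpha> by (simp add: t.G.nat_pow_pow t.G.nat_pow_mult)
      have "\<alpha> [^]\<^bsub>H\<^esub> (k mod l) = \<one>\<^bsub>H\<^esub>" using eq that \<alpha> unfolding al by simp
      then have "\<not> 0 < k mod l" using ord l by (auto simp: \<alpha>_def)
      then show ?thesis by (simp add: dvd_eq_mod_eq_0)
    qed
    have one: "\<alpha> [^]\<^bsub>H\<^esub> k = \<one>\<^bsub>H\<^esub>" if lk: "l dvd k" for k :: nat
    proof -
      obtain q where "k = l * q" using lk by (elim dvdE)
      then have "\<alpha> [^]\<^bsub>H\<^esub> k = (\<alpha> [^]\<^bsub>H\<^esub> l) [^]\<^bsub>H\<^esub> q" using \<alpha> by (simp add: t.G.nat_pow_pow)
      then show ?thesis using ord by (simp add: \<alpha>_def)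
    qed
    have pc: "\<pi> (sig g' a) = t \<otimes>\<^bsub>H\<^esub> \<alpha> \<otimes>\<^bsub>H\<^esub> inv\<^bsub>H\<^esub> t" using Cg(2) a by (simp add: C'_def \<alpha>_def t_def)
    have key: "t \<otimes>\<^bsub>H\<^esub> \<alpha> [^]\<^bsub>H\<^esub> (\<mu> * j) \<otimes>\<^bsub>H\<^esub> inv\<^bsub>H\<^esub> t = \<alpha> [^]\<^bsub>H\<^esub> (\<nu> * j)" for j :: nat
    proof -
      have "t \<otimes>\<^bsub>H\<^esub> \<alpha> [^]\<^bsub>H\<^esub> (\<mu> * j) \<otimes>\<^bsub>H\<^esub> inv\<^bsub>H\<^esub> t = ((t \<otimes>\<^bsub>H\<^esub> \<alpha> \<otimes>\<^bsub>H\<^esub> inv\<^bsub>H\<^esub> t) [^]\<^bsub>H\<^esub> \<mu>) [^]\<^bsub>H\<^esub> j"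
        using t.G.conj_int_pow[OF t \<alpha>, of "int (\<mu> * j)"] t \<alpha> by (simp only: int_pow_int) (simp add: t.G.nat_pow_pow)
      also have "(t \<otimes>\<^bsub>H\<^esub> \<alpha> \<otimes>\<^bsub>H\<^esub> inv\<^bsub>H\<^esub> t) [^]\<^bsub>H\<^esub> \<mu> = \<pi> (sig g' a [^]\<^bsub>M\<^esub> \<mu>)"
        using pi_nat_pow[OF C gaD] pc by simp
      also have "\<dots> = \<alpha> [^]\<^bsub>H\<^esub> \<nu>" using mn[OF aX(1)] pi_nat_pow[OF C aD] by (simp add: \<alpha>_def)
      finally show ?thesis using \<alpha> by (simp add: t.G.nat_pow_pow)
    qed
    have lmul: "l dvd x * (l div gcd l x)" for x
      by (metis dvd_div_mult dvd_triv_left gcd_dvd1 gcd_dvd2 mult.commute)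
    have gcd_cancel: "gcd l x dvd y" if "l dvd y * (l div gcd l x)" for x y
    proof -
      have "gcd l x * (l div gcd l x) dvd y * (l div gcd l x)" using that by simp
      moreover have "l div gcd l x \<noteq> 0" using l by (simp add: dvd_div_eq_0_iff)
      ultimately show ?thesis
        using nat_mult_dvd_cancel_disj[of "l div gcd l x" "gcd l x" y] by (metis mult.commute)
    qed
    from gcd show False
    proof
      assume g1: "1 < gcd l \<mu>"
      \<comment> \<open>The least positive exponent for which the power \<mu> j of \<alpha> is
        trivial. Conjugation makes the power \<nu> j trivial too, so \<open>l\<close> divides \<nu>
        j and gcd(l, \<mu>) divides \<nu>.\<close>
      define j where "j = l div gcd l \<mu>"
      have "\<alpha> [^]\<^bsub>H\<^esub> (\<mu> * j) = \<one>\<^bsub>H\<^esub>" using one lmul by (simp add: j_def)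
      then have "\<alpha> [^]\<^bsub>H\<^esub> (\<nu> * j) = \<one>\<^bsub>H\<^esub>" using key[of j] t by simp
      then have "gcd l \<mu> dvd \<nu>" using gcd_cancel dvd by (simp add: j_def)
      then have "gcd l \<mu> dvd 1" using cop by (meson coprime_common_divisor gcd_dvd2)
      then show False using g1 by simp
    next
      assume g1: "1 < gcd l \<nu>"
      define j where "j = l div gcd l \<nu>"
      have "\<alpha> [^]\<^bsub>H\<^esub> (\<nu> * j) = \<one>\<^bsub>H\<^esub>" using one lmul by (simp add: j_def)
      then have "\<alpha> [^]\<^bsub>H\<^esub> (\<mu> * j) = \<one>\<^bsub>H\<^esub>"
        using key[of j] t.G.conj_eq_one[OF t, of "\<alpha> [^]\<^bsub>H\<^esub> (\<mu> * j)"] \<alpha> by simp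
      then have "gcd l \<nu> dvd \<mu>" using gcd_cancel dvd by (simp add: j_def)
      then have "gcd l \<nu> dvd 1" using cop by (meson coprime_common_divisor gcd_dvd2)
      then show False using g1 by simp
    qed
  qed
  then show ?thesis using C' by blast
qed

text \<open>Finitely many generators have a common multiple \<open>R\<close> going to translations,
  so near 0 the linear parts have order dividing \<open>R\<close>. Only the orders 2, ..., R must be
  excluded, each by its own constructible subgroup, and these finitely many have a common lower
  bound.\<close>

lemma translation_if_ii1:
  assumes An: "incr_fr_seq M A An" and ii1: "\<forall>n. cond_ii1 M G S sig H (An n)"
    and vt: virtually_translation and F: "finite F" "F \<subseteq> A" and inv: "\<forall>g\<in>S. sig g ` generate M F \<subseteq> generate M F"
  shows "\<exists>C\<in>s.\<C>. generate M F \<inter> C \<subseteq> E"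
proof -
  define Y where "Y = generate M F"
  have FM: "F \<subseteq> carrier M" using F(2) by auto
  have sub: "subgroup (An n) M" "An n \<subseteq> An (Suc n)" for n using An by (auto simp: incr_fr_seq_def)
  have U: "(\<Union>n. An n) = A" using An by (simp add: incr_fr_seq_def)
  have mono: "An n \<subseteq> An m" if "n \<le> m" for n m using lift_Suc_mono_le[of An] sub(2) that by blast
  have "\<exists>n. F \<subseteq> An n"
    using F
  proof (induction F rule: finite_induct)
    case (insert x F)
    then obtain n m where "F \<subseteq> An n" "x \<in> An m" using U by blast
    then have "insert x F \<subseteq> An (max n m)" using mono[of n "max n m"] mono[of m "max n m"] by auto
    then show ?case by blast
  qed simp
  then obtain n0 where n0: "F \<subseteq> An n0" by blast
  define X where "X = An n0"
  have X: "subgroup X M" "X \<subseteq> A" using sub U by (auto simp: X_def)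
  have YX: "Y \<subseteq> X" unfolding Y_def X_def by (rule s.M.generate_subgroup_incl[OF n0 sub(1)])
  obtain C where C: "C \<in> s.\<C>" "F \<subseteq> stab C" using ex_stab_finite[OF F] by blast
  have YC: "Y \<subseteq> stab C" unfolding Y_def by (rule s.M.generate_subgroup_incl[OF C(2) stab_subgroup])
  have "\<exists>L::nat. 0 < L \<and> (\<forall>f\<in>F. f [^]\<^bsub>M\<^esub> L \<in> E)"
    using F
  proof (induction F rule: finite_induct)
    case empty
    show ?case by (intro exI[of _ 1]) simp
  next
    case (insert x F)
    then obtain L :: nat where L: "0 < L" "\<forall>f\<in>F. f [^]\<^bsub>M\<^esub> L \<in> E" by auto
    obtain n :: nat where n: "0 < n" "x [^]\<^bsub>M\<^esub> n \<in> E" using vt insert.prems unfolding virtually_translation_def by blast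
    have "f [^]\<^bsub>M\<^esub> (L * n) \<in> E" if f: "f \<in> insert x F" for f
    proof -
      have "f \<in> carrier M" using f insert.prems by auto
      then have "f [^]\<^bsub>M\<^esub> (L * n) = (f [^]\<^bsub>M\<^esub> L) [^]\<^bsub>M\<^esub> n" "f [^]\<^bsub>M\<^esub> (L * n) = (f [^]\<^bsub>M\<^esub> n) [^]\<^bsub>M\<^esub> L"
        by (simp_all add: s.M.nat_pow_pow mult.commute)
      then show ?thesis using f L n E_nat_pow by (metis insertE)
    qed
    then show ?case using L n by (intro exI[of _ "L * n"]) simp
  qed
  then obtain L :: nat where L: "0 < L" "\<forall>f\<in>F. f [^]\<^bsub>M\<^esub> L \<in> E" by blast
  obtain k :: nat where k: "0 < k" "\<forall>a\<in>A. a [^]\<^bsub>M\<^esub> k \<in> C" using s.constr_exponent[OF C(1)] by blast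
  \<comment> \<open>\<open>L\<close> turns the generators into translations and \<open>k\<close>
    moves them into \<open>C\<close>; the product does both for all of \<open>Y\<close>.\<close>
  define R where "R = L * k"
  have R: "0 < R" using L k by (simp add: R_def)
  have pw: "f [^]\<^bsub>M\<^esub> R \<in> Dom C \<and> \<pi> (f [^]\<^bsub>M\<^esub> R) = \<one>\<^bsub>H\<^esub>" if f: "f \<in> Y" for f
    using f unfolding Y_def
  proof (induction rule: generate.induct)
    case one
    have "\<one>\<^bsub>M\<^esub> \<in> Dom C" using subgroup.one_closed[OF Dom_subgroup[OF C(1)]] .
    then show ?case using pi_nat_pow[OF C(1), of "\<one>\<^bsub>M\<^esub>" 0] by simp
  next
    case (incl f)
    then have fM: "f \<in> carrier M" "f \<in> A" using F(2) by auto
    have "f [^]\<^bsub>M\<^esub> R = (f [^]\<^bsub>M\<^esub> L) [^]\<^bsub>M\<^esub> k" using fM by (simp add: R_def s.M.nat_pow_pow)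
    then have "f [^]\<^bsub>M\<^esub> R \<in> E" "f [^]\<^bsub>M\<^esub> R \<in> C" using incl L k fM E_nat_pow by auto
    moreover have "f [^]\<^bsub>M\<^esub> R \<in> stab C"
      using s.M.subgroup_int_pow_closed[OF stab_subgroup, of f C "int R"] C(2) incl by (auto simp: int_pow_int)
    ultimately show ?case by (auto simp: Dom_def E_def)
  next
    case (inv f)
    then have fM: "f \<in> carrier M" "f \<in> A" using F(2) by auto
    have "f [^]\<^bsub>M\<^esub> R = (f [^]\<^bsub>M\<^esub> L) [^]\<^bsub>M\<^esub> k" using fM by (simp add: R_def s.M.nat_pow_pow)
    then have "f [^]\<^bsub>M\<^esub> R \<in> E" "f [^]\<^bsub>M\<^esub> R \<in> C" using inv L k fM E_nat_pow by auto
    moreover have "f [^]\<^bsub>M\<^esub> R \<in> stab C"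
      using s.M.subgroup_int_pow_closed[OF stab_subgroup, of f C "int R"] C(2) inv by (auto simp: int_pow_int)
    ultimately have D: "f [^]\<^bsub>M\<^esub> R \<in> Dom C" "\<pi> (f [^]\<^bsub>M\<^esub> R) = \<one>\<^bsub>H\<^esub>" by (auto simp: Dom_def E_def)
    have "(inv\<^bsub>M\<^esub> f) [^]\<^bsub>M\<^esub> R = (f [^]\<^bsub>M\<^esub> R) [^]\<^bsub>M\<^esub> (-1::int)"
      using fM by (simp add: s.M.nat_pow_inv s.M.int_pow_neg)
    then show ?case using Dom_int_pow[OF C(1) D(1), of "-1"] pi_int_pow[OF C(1) D(1), of "-1"] D(2) by simp
  next
    case (eng f h)
    then have fh: "f \<in> carrier M" "h \<in> carrier M" using s.M.generate_in_carrier[OF FM] by auto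
    have "(f \<otimes>\<^bsub>M\<^esub> h) [^]\<^bsub>M\<^esub> R = f [^]\<^bsub>M\<^esub> R \<otimes>\<^bsub>M\<^esub> h [^]\<^bsub>M\<^esub> R" using fh by (simp add: s.M.nat_pow_distrib)
    then show ?case using eng Dom_mult[OF C(1)] pi_mult[OF C(1)] by simp
  qed
  define bad where "bad l a \<longleftrightarrow> \<pi> a [^]\<^bsub>H\<^esub> l = \<one>\<^bsub>H\<^esub> \<and> (\<forall>k. 0 < k \<and> k < l \<longrightarrow> \<pi> a [^]\<^bsub>H\<^esub> k \<noteq> \<one>\<^bsub>H\<^esub>)" for l :: nat and a
  have "cond_ii1 M G S sig H X" using ii1 by (simp add: X_def)
  then have ex: "\<exists>C'\<in>s.\<C>. \<forall>a\<in>Y \<inter> C \<inter> C'. \<not> bad l a" if "1 < l" for l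
    unfolding bad_def by (rule avoid_torsion_order[OF X inv[folded Y_def] YX _ C(1) YC that])
  define D where "D l = (SOME C'. C' \<in> s.\<C> \<and> (\<forall>a\<in>Y \<inter> C \<inter> C'. \<not> bad l a))" for l
  have D: "D l \<in> s.\<C> \<and> (\<forall>a\<in>Y \<inter> C \<inter> D l. \<not> bad l a)" if "1 < l" for l
    unfolding D_def by (rule someI_ex) (rule ex[OF that, unfolded Bex_def])
  have "finite (insert C (D ` {2..R}))" "insert C (D ` {2..R}) \<subseteq> s.\<C>" using C(1) D by auto
  then obtain C' where C': "C' \<in> s.\<C>" "\<forall>B\<in>insert C (D ` {2..R}). C' \<subseteq> B"
    using s.constr_finite_lower[of "insert C (D ` {2..R})"] by blast
  have "a \<in> E" if a: "a \<in> Y \<inter> C'" for a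
  proof -
    have aC: "a \<in> C" using a C'(2) by blast
    then have aD: "a \<in> Dom C" using a YC by (auto simp: Dom_def)
    have ex: "0 < R \<and> \<pi> a [^]\<^bsub>H\<^esub> R = \<one>\<^bsub>H\<^esub>" using R pw[of a] pi_nat_pow[OF C(1) aD] a by simp
    define l where "l = (LEAST l::nat. 0 < l \<and> \<pi> a [^]\<^bsub>H\<^esub> l = \<one>\<^bsub>H\<^esub>)"
    have l: "0 < l \<and> \<pi> a [^]\<^bsub>H\<^esub> l = \<one>\<^bsub>H\<^esub>" unfolding l_def by (rule LeastI[of _ R]) (rule ex)
    have lR: "l \<le> R" unfolding l_def by (rule Least_le) (rule ex)
    have min: "\<not> (0 < k \<and> \<pi> a [^]\<^bsub>H\<^esub> k = \<one>\<^bsub>H\<^esub>)" if "k < l" for k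
      using not_less_Least[of k] that unfolding l_def by blast
    have bad: "bad l a" using l min by (auto simp: bad_def)
    have "l = 1"
    proof (rule ccontr)
      assume "l \<noteq> 1"
      then have l2: "1 < l" "l \<in> {2..R}" using l lR by auto
      then have "a \<in> D l" using a C'(2) by blast
      then show False using D[OF l2(1)] bad a aC by blast
    qed
    then have "\<pi> a = \<one>\<^bsub>H\<^esub>" using l pi_closed[OF Dom_A[OF aD]] by simp
    then show ?thesis using C(1) aD by (auto simp: E_def)
  qed
  then show ?thesis using C'(1) unfolding Y_def by blast
qed

text \<open>(PC) gives one \<open>g\<close> mapping all of \<open>A\<close> into the subgroup
  \<open>C\<close> found for a finitely generated group containing \<open>a\<close>. Invariance of
  that group keeps \<open>sig g a\<close> inside it, and hence in \<open>E\<close>.\<close>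

lemma translation_if_star:
  assumes star: "cond_star M G S A sig N H T B tau"
  shows "virtually_translation \<and> (\<forall>a\<in>A. \<exists>g\<in>S. sig g a \<in> E)"
proof -
  obtain An where An: "incr_fr_seq M A An" and cases: "(cond_I_seq M S A sig H An \<and> cond_II_seq M G S A sig N H tau An) \<or>
         cond_III M S A sig N H tau"
    using star unfolding cond_star_def by blast
  obtain Ak where Ak: "\<forall>k. Ak k \<subseteq> Ak (Suc k) \<and> (\<exists>F. finite F \<and> F \<subseteq> A \<and> Ak k = generate M F) \<and>
              (\<forall>s\<in>S. sig s ` Ak k \<subseteq> Ak k)" "(\<Union>k. Ak k) = A"
    using star unfolding cond_star_def by blast
  have PC: "cond_PC S A sig" using star unfolding cond_star_def by blast
  have vt: virtually_translation using cases vt_I_seq[OF An] vt_III by blast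
  \<comment> \<open>(F) is part of (III) and of the second alternative of (II); the first
    alternative of (II) is (ii_1) along the sequence.\<close>
  have dich: "cond_F N H tau \<or> (\<forall>n. cond_ii1 M G S sig H (An n))"
    using cases by (auto simp: cond_II_seq_def cond_III_def)
  have "\<exists>g\<in>S. sig g a \<in> E" if a: "a \<in> A" for a
  proof -
    obtain k where k: "a \<in> Ak k" using a Ak(2) by blast
    obtain F where F: "finite F" "F \<subseteq> A" "Ak k = generate M F" using Ak(1)[rule_format, of k] by blast
    have inv: "\<forall>g\<in>S. sig g ` generate M F \<subseteq> generate M F" using Ak(1)[rule_format, of k] F(3) by simp
    have "\<exists>C\<in>s.\<C>. generate M F \<inter> C \<subseteq> E"
    proof (cases "cond_F N H tau")
      case True
      obtain C where C: "C \<in> s.\<C>" "F \<subseteq> stab C" using ex_stab_finite[OF F(1,2)] by blast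
      have "generate M F \<subseteq> stab C" by (rule s.M.generate_subgroup_incl[OF C(2) stab_subgroup])
      then have "generate M F \<inter> C \<subseteq> E" using translation_if_F[OF True vt C(1)] by (auto simp: Dom_def)
      then show ?thesis using C(1) by blast
    next
      case False
      then show ?thesis using translation_if_ii1[OF An _ vt F(1,2) inv] dich by blast
    qed
    then obtain C where C: "C \<in> s.\<C>" "generate M F \<inter> C \<subseteq> E" by blast
    obtain g where g: "g \<in> S" "sig g ` A \<subseteq> C" using PC C(1) unfolding cond_PC_def by blast
    have "sig g a \<in> generate M F" using inv g(1) k F(3) by blast
    then show ?thesis using C(2) g a by blast
  qed
  then show ?thesis using vt by blast
qed

end

section \<open>Integrality and the main theorem\<close>

context gpd_cocycle_vt
begin

text \<open>Equivariance recovers the value at \<open>z\<close> from the value at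
  \<open>sig g z\<close> by applying the inverse of \<open>tau (tmap g)\<close>, which preserves
  \<open>N\<close>.\<close>

lemma integral_step:
  assumes g: "g \<in> S" and z: "z \<in> carrier M"
    and y: "y \<in> carrier N" "V.bmap (V.QM.cl (sig g z) 1) = V.QN.cl y 1"
  shows "\<exists>y\<in>carrier N. V.bmap (V.QM.cl z 1) = V.QN.cl y 1"
proof -
  have gG: "g \<in> carrier G" using g by simp
  define t where "t = tmap g"
  have t: "t \<in> carrier H" "inv\<^bsub>H\<^esub> t \<in> carrier H" using tmap_closed[OF gG] by (auto simp: t_def)
  have v: "V.QM.cl z 1 \<in> QT M (carrier M)" using z by simp
  have w: "V.bmap (V.QM.cl z 1) \<in> QT N (carrier N)" using V.bmap_closed[OF v] .
  have "qt_act N tau t (V.bmap (V.QM.cl z 1)) = V.QN.cl y 1"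
    using bmap_equivariant[OF gG v] s.qt_act_cl[OF tf_M gG z, of 1] y(2) by (simp add: t_def)
  then have "V.bmap (V.QM.cl z 1) = qt_act N tau (inv\<^bsub>H\<^esub> t) (V.QN.cl y 1)"
    using t.qt_act_mult[OF tf_N t(2,1) w] t.qt_act_one[OF tf_N w] t(1) by simp
  also have "\<dots> = V.QN.cl (tau (inv\<^bsub>H\<^esub> t) y) 1" using t.qt_act_cl[OF tf_N t(2) y(1), of 1] by simp
  finally show ?thesis using t.sig_closed[OF t(2) y(1)] by blast
qed

text \<open>On \<open>E\<close> the rational map is read off from \<open>e\<close> and is integral.
  Two descents extend this: from \<open>E\<close> to \<open>A\<close> by the assumption
  \<open>tr\<close>, and from \<open>A\<close> to \<open>M\<close> by localization.\<close>

lemma integral_embedding: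
  assumes tr: "\<forall>a\<in>A. \<exists>g\<in>S. sig g a \<in> E" and loc: "localized M G S A sig"
  shows "\<exists>b. act_emb G M sig H N tau tmap b"
proof -
  have inA: "\<exists>y\<in>carrier N. V.bmap (V.QM.cl a 1) = V.QN.cl y 1" if a: "a \<in> A" for a
  proof -
    obtain g where g: "g \<in> S" "sig g a \<in> E" using tr a by blast
    have x: "sig g a \<in> carrier M" using E_A[OF g(2)] by simp
    have "V.bmap (V.QM.cl (sig g a) 1) = V.QN.cl (fst (e (sig g a))) 1"
      using V.bmap_cl[OF x, of 1 1] g(2) x by simp
    then show ?thesis using integral_step[OF g(1) s.A_closed[OF a] V.f_closed[OF g(2)]] by blast
  qed
  have ex: "\<exists>y\<in>carrier N. V.bmap (V.QM.cl z 1) = V.QN.cl y 1" if z: "z \<in> carrier M" for z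
  proof -
    obtain g where g: "g \<in> S" "sig g z \<in> A" using loc z unfolding localized_def by blast
    then obtain y where "y \<in> carrier N" "V.bmap (V.QM.cl (sig g z) 1) = V.QN.cl y 1" using inA by blast
    then show ?thesis using integral_step[OF g(1) z] by blast
  qed
  define b where "b z = (SOME y. y \<in> carrier N \<and> V.bmap (V.QM.cl z 1) = V.QN.cl y 1)" for z
  have b: "b z \<in> carrier N \<and> V.bmap (V.QM.cl z 1) = V.QN.cl (b z) 1" if "z \<in> carrier M" for z
    unfolding b_def by (rule someI_ex) (rule ex[OF that, unfolded Bex_def])
  have clN: "x = y" if "V.QN.cl x 1 = V.QN.cl y 1" "x \<in> carrier N" "y \<in> carrier N" for x y
    using V.QN.cl_eq_iff[of x y 1 1] that by simp
  have clM: "x = y" if "V.QM.cl x 1 = V.QM.cl y 1" "x \<in> carrier M" "y \<in> carrier M" for x y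
    using V.QM.cl_eq_iff[of x y 1 1] that by simp
  have "b \<in> hom M N"
  proof (rule homI)
    show "b z \<in> carrier N" if "z \<in> carrier M" for z using b that by blast
    fix x y assume xy: "x \<in> carrier M" "y \<in> carrier M"
    have "V.QM.cl (x \<otimes>\<^bsub>M\<^esub> y) 1 = qadd M (carrier M) (V.QM.cl x 1) (V.QM.cl y 1)"
      using xy by (simp add: V.QM.qadd_cl)
    then have "V.bmap (V.QM.cl (x \<otimes>\<^bsub>M\<^esub> y) 1) = qadd N (carrier N) (V.bmap (V.QM.cl x 1)) (V.bmap (V.QM.cl y 1))"
      using hom_mult[OF V.bmap_hom, of "V.QM.cl x 1" "V.QM.cl y 1"] xy by simp
    also have "\<dots> = V.QN.cl (b x \<otimes>\<^bsub>N\<^esub> b y) 1" using b[OF xy(1)] b[OF xy(2)] by (simp add: V.QN.qadd_cl)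
    finally show "b (x \<otimes>\<^bsub>M\<^esub> y) = b x \<otimes>\<^bsub>N\<^esub> b y"
      using b[of "x \<otimes>\<^bsub>M\<^esub> y"] b[OF xy(1)] b[OF xy(2)] xy by (intro clN) auto
  qed
  moreover have "inj_on b (carrier M)"
  proof (rule inj_onI)
    fix x y assume xy: "x \<in> carrier M" "y \<in> carrier M" "b x = b y"
    then have "V.bmap (V.QM.cl x 1) = V.bmap (V.QM.cl y 1)" using b by metis
    then have "V.QM.cl x 1 = V.QM.cl y 1" using inj_onD[OF V.bmap_inj] xy by simp
    then show "x = y" using clM xy by blast
  qed
  moreover have "b (sig g x) = tau (tmap g) (b x)" if gx: "g \<in> carrier G" "x \<in> carrier M" for g x
  proof -
    have v: "V.QM.cl x 1 \<in> QT M (carrier M)" using gx by simp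
    have "V.bmap (V.QM.cl (sig g x) 1) = qt_act N tau (tmap g) (V.QN.cl (b x) 1)"
      using bmap_equivariant[OF gx(1) v] s.qt_act_cl[OF tf_M gx, of 1] b[OF gx(2)] by simp
    also have "\<dots> = V.QN.cl (tau (tmap g) (b x)) 1"
      using t.qt_act_cl[OF tf_N tmap_closed[OF gx(1)], of "b x" 1] b[OF gx(2)] by simp
    finally show ?thesis
      using b[of "sig g x"] b[OF gx(2)] gx tmap_closed[OF gx(1)] by (intro clN) auto
  qed
  ultimately show ?thesis unfolding act_emb_def using tmap_hom tmap_inj by blast
qed

end

lemma rational_embedding_of_I:
  assumes "standing M G S A sig" "standing N H T B tau"
    and "torsion_free M (carrier M)" "torsion_free N (carrier N)"
    and "gpd_isomorphic M G S A sig N H T B tau" and I: "cond_I M S A sig H"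
  shows "\<exists>t b. act_emb G (QTg M (carrier M)) (qt_act M sig) H (QTg N (carrier N)) (qt_act N tau) t b"
proof -
  obtain c where "gpd_cocycle M G S A sig N H T B tau c" using gpd_cocycle_of_iso assms by blast
  then interpret gpd_cocycle M G S A sig N H T B tau c .
  have virtually_translation using I vt_I_seq unfolding cond_I_def by blast
  then interpret gpd_cocycle_vt M G S A sig N H T B tau c by unfold_locales
  show ?thesis using rational_embedding by blast
qed

text \<open>The two embeddings are produced with the same \<open>t\<close>, because strictness of
  the integral one is later obtained from the rational one through (SF).\<close>

lemma embeddings_of_star:
  assumes "standing M G S A sig" "standing N H T B tau"
    and "torsion_free M (carrier M)" "torsion_free N (carrier N)"
    and "gpd_isomorphic M G S A sig N H T B tau" and star: "cond_star M G S A sig N H T B tau"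
  shows "\<exists>t b b'. act_emb G (QTg M (carrier M)) (qt_act M sig) H (QTg N (carrier N)) (qt_act N tau) t b \<and>
    act_emb G M sig H N tau t b'"
proof -
  obtain c where "gpd_cocycle M G S A sig N H T B tau c" using gpd_cocycle_of_iso assms by blast
  then interpret gpd_cocycle M G S A sig N H T B tau c .
  have "virtually_translation" using translation_if_star[OF star] by blast
  then interpret gpd_cocycle_vt M G S A sig N H T B tau c by unfold_locales
  have "localized M G S A sig" using star by (simp add: cond_star_def)
  then show ?thesis using rational_embedding integral_embedding translation_if_star[OF star] by blast
qed

subsection \<open>Finite rank\<close>

lemma rat_spanned_QTg:
  assumes "comm_group M" "torsion_free M (carrier M)" "finite_rank M (carrier M)"
  shows "\<exists>d e. rat_spanned (QTg M (carrier M)) d e"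
proof -
  interpret M: abelian_grp M by (rule abelian_grp.intro) fact
  interpret Q: torsion_free_subgroup M "carrier M" using M.torsion_free_subgroup_carrier[OF assms(2)] .
  interpret QG: abelian_grp "QTg M (carrier M)" by (rule abelian_grp.intro) (rule Q.comm_group_QTg)
  obtain d e where sp: "rat_spanned M d e"
    using finite_rank_rat_spanned[OF assms(1) M.subgroup_self assms(2,3)] by auto
  have eM: "e j \<in> carrier M" if "j < d" for j using sp that by (simp add: rat_spanned_def)
  have ihom: "(\<lambda>a. Q.cl a 1) \<in> hom M (QTg M (carrier M))"
    by (auto simp: hom_def Q.qadd_cl)
  have lin: "Q.cl (lincomb_upto M e k n) 1 = lincomb_upto (QTg M (carrier M)) (\<lambda>j. Q.cl (e j) 1) k n"
    if "n \<le> d" for k n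
    using that
  proof (induction n)
    case 0
    then show ?case by (simp add: Q.cl_one)
  next
    case (Suc n)
    have c: "lincomb_upto M e k n \<in> carrier M" "e n \<in> carrier M"
      using M.lincomb_closed[of n e k] eM Suc.prems by auto
    show ?case
      using hom_mult[OF ihom c(1), of "e n [^]\<^bsub>M\<^esub> k n"] c Suc
        hom_int_pow[OF ihom c(2) M.is_group QG.is_group, of "k n"] by simp
  qed
  have "\<exists>N::nat. 0 < N \<and> (\<exists>k. v [^]\<^bsub>QTg M (carrier M)\<^esub> N = lincomb_upto (QTg M (carrier M)) (\<lambda>j. Q.cl (e j) 1) k d)"
    if v: "v \<in> QT M (carrier M)" for v
  proof -
    obtain a n where a: "a \<in> carrier M" "0 < n" "v = Q.cl a n" using v by (rule Q.QT_cases)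
    obtain N k where N: "0 < (N::nat)" "a [^]\<^bsub>M\<^esub> N = lincomb_upto M e k d"
      using sp a unfolding rat_spanned_def by blast
    have "v [^]\<^bsub>QTg M (carrier M)\<^esub> (N * n) = Q.cl (a [^]\<^bsub>M\<^esub> (N * n)) n" using a by (simp add: Q.QTg_nat_pow)
    also have "\<dots> = Q.cl (a [^]\<^bsub>M\<^esub> N) 1" using a by (intro Q.cl_eqI) (simp_all add: M.nat_pow_pow)
    finally show ?thesis using N lin[of d k] a(2) by (intro exI[of _ "N * n"]) auto
  qed
  then show ?thesis using eM unfolding rat_spanned_def
    by (intro exI[of _ d] exI[of _ "\<lambda>j. Q.cl (e j) 1"]) simp
qed

text \<open>The composite of the two injections has cokernel of bounded exponent \<open>m\<close>,
  and the space in the middle is divisible: dividing by \<open>m\<close> there turns a preimage of m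
  v into a preimage of \<open>v\<close>.\<close>

lemma full_of_mutual:
  assumes M: "comm_group M" "torsion_free M (carrier M)" "finite_rank M (carrier M)"
    and N: "comm_group N" "torsion_free N (carrier N)"
    and b: "b \<in> hom (QTg M (carrier M)) (QTg N (carrier N))" "inj_on b (QT M (carrier M))"
    and b': "b' \<in> hom (QTg N (carrier N)) (QTg M (carrier M))" "inj_on b' (QT N (carrier N))"
  shows "b' ` QT N (carrier N) = QT M (carrier M)"
proof -
  interpret M: abelian_grp M by (rule abelian_grp.intro) (rule M(1))
  interpret QM: torsion_free_subgroup M "carrier M" using M.torsion_free_subgroup_carrier[OF M(2)] .
  interpret N: abelian_grp N by (rule abelian_grp.intro) (rule N(1))
  interpret QN: torsion_free_subgroup N "carrier N" using N.torsion_free_subgroup_carrier[OF N(2)] .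
  interpret GN: abelian_grp "QTg N (carrier N)" by (rule abelian_grp.intro) (rule QN.comm_group_QTg)
  have hom: "(\<lambda>v. b' (b v)) \<in> hom (QTg M (carrier M)) (QTg M (carrier M))"
    using hom_compose[OF b(1) b'(1)] by (simp add: comp_def)
  interpret E: group_endo "QTg M (carrier M)" "\<lambda>v. b' (b v)"
    by (intro group_endo.intro abelian_grp.intro group_endo_axioms.intro QM.comm_group_QTg hom)
  have bc: "b v \<in> QT N (carrier N)" if "v \<in> QT M (carrier M)" for v using b(1) that by (auto simp: hom_def)
  have bc': "b' v \<in> QT M (carrier M)" if "v \<in> QT N (carrier N)" for v using b'(1) that by (auto simp: hom_def)
  have inj: "inj_on (\<lambda>v. b' (b v)) (carrier (QTg M (carrier M)))"
    using b(2) b'(2) bc by (auto simp: inj_on_def)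
  obtain d e where sp: "rat_spanned (QTg M (carrier M)) d e" using rat_spanned_QTg[OF M] by blast
  obtain m :: int where m: "m \<noteq> 0" "\<forall>x\<in>carrier (QTg M (carrier M)). \<exists>y\<in>carrier (QTg M (carrier M)).
      x [^]\<^bsub>QTg M (carrier M)\<^esub> m = b' (b y)"
    using E.inj_cokernel_bounded[OF QM.torsion_free_QTg sp inj] by blast
  have "v \<in> b' ` QT N (carrier N)" if v: "v \<in> QT M (carrier M)" for v
  proof -
    obtain y where y: "y \<in> QT M (carrier M)" "v [^]\<^bsub>QTg M (carrier M)\<^esub> m = b' (b y)" using m(2) v by auto
    obtain u where u: "u \<in> QT N (carrier N)" "u [^]\<^bsub>QTg N (carrier N)\<^esub> nat \<bar>m\<bar> = b y"
      using QN.QTg_divide[OF bc[OF y(1)], of "nat \<bar>m\<bar>"] m(1) by auto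
    \<comment> \<open>\<open>m\<close> may be negative while division was by its absolute value; the
      sign is put on the quotient.\<close>
    define w where "w = u [^]\<^bsub>QTg N (carrier N)\<^esub> (sgn m)"
    have w: "w \<in> QT N (carrier N)" using GN.int_pow_closed[of u "sgn m"] u by (simp add: w_def)
    have "w [^]\<^bsub>QTg N (carrier N)\<^esub> m = u [^]\<^bsub>QTg N (carrier N)\<^esub> (sgn m * m)"
      using GN.int_pow_pow[of u "sgn m" m] u by (simp add: w_def)
    also have "sgn m * m = int (nat \<bar>m\<bar>)" by (simp add: sgn_if)
    finally have "w [^]\<^bsub>QTg N (carrier N)\<^esub> m = b y" using u(2) by (simp only: int_pow_int)
    then have "b' w [^]\<^bsub>QTg M (carrier M)\<^esub> m = b' (b y)"
      using hom_int_pow[OF b'(1), of w m] w GN.is_group E.is_group by simp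
    then have e: "b' w [^]\<^bsub>QTg M (carrier M)\<^esub> m = v [^]\<^bsub>QTg M (carrier M)\<^esub> m" using y by simp
    let ?q = "v \<otimes>\<^bsub>QTg M (carrier M)\<^esub> inv\<^bsub>QTg M (carrier M)\<^esub> (b' w)"
    have cl: "v \<in> carrier (QTg M (carrier M))" "b' w \<in> carrier (QTg M (carrier M))" using v bc'[OF w] by auto
    then have "?q [^]\<^bsub>QTg M (carrier M)\<^esub> m = \<one>\<^bsub>QTg M (carrier M)\<^esub>"
      using e E.int_pow_distrib[of v "inv\<^bsub>QTg M (carrier M)\<^esub> (b' w)" m] E.int_pow_inv[of "b' w" m]
        E.r_inv[of "v [^]\<^bsub>QTg M (carrier M)\<^esub> m"] by (simp del: QM.QTg_simps)
    then have "?q = \<one>\<^bsub>QTg M (carrier M)\<^esub>"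
      using E.int_pow_eq_one_torsion_free[OF QM.torsion_free_QTg] cl m(1) by (simp del: QM.QTg_simps)
    then have "v = b' w" using cl E.inv_equality[of v "inv\<^bsub>QTg M (carrier M)\<^esub> (b' w)"] by (simp del: QM.QTg_simps)
    then show ?thesis using w by blast
  qed
  then show ?thesis using bc' by blast
qed

text \<open>The image of \<open>b\<close> contains that of the composite with \<open>b'\<close>,
  hence m N for some nonzero m, and a torsion-free group of finite rank is finite modulo its
  multiples.\<close>

lemma finite_index_of_mutual:
  fixes M :: "'a monoid" and N :: "'b monoid"
  assumes M: "comm_group M" and N: "comm_group N" "torsion_free N (carrier N)" "finite_rank N (carrier N)"
    and b: "b \<in> hom M N" "inj_on b (carrier M)" and b': "b' \<in> hom N M" "inj_on b' (carrier N)"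
  shows "finite (rcosets\<^bsub>N\<^esub> (b ` carrier M))"
proof -
  interpret M: abelian_grp M by (rule abelian_grp.intro) (rule M(1))
  interpret N: abelian_grp N by (rule abelian_grp.intro) (rule N(1))
  have hom: "(\<lambda>v. b (b' v)) \<in> hom N N" using hom_compose[OF b'(1) b(1)] by (simp add: comp_def)
  interpret E: group_endo N "\<lambda>v. b (b' v)"
    by (intro group_endo.intro N.abelian_grp_axioms group_endo_axioms.intro hom)
  have bc: "b v \<in> carrier N" if "v \<in> carrier M" for v using b(1) that by (auto simp: hom_def)
  have bc': "b' v \<in> carrier M" if "v \<in> carrier N" for v using b'(1) that by (auto simp: hom_def)
  have inj: "inj_on (\<lambda>v. b (b' v)) (carrier N)" using b(2) b'(2) bc' by (auto simp: inj_on_def)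
  obtain d e where sp: "rat_spanned N d e"
    using finite_rank_rat_spanned[OF N(1) N.subgroup_self N(2,3)] by auto
  obtain m :: int where m: "m \<noteq> 0" "\<forall>x\<in>carrier N. \<exists>y\<in>carrier N. x [^]\<^bsub>N\<^esub> m = b (b' y)"
    using E.inj_cokernel_bounded[OF N(2) sp inj] by blast
  have K: "subgroup (b ` carrier M) N"
    using group_hom.subgroup_img_is_subgroup[of M N b "carrier M"] b(1) M.is_group N.is_group M.subgroup_self
    by (simp add: group_hom_def group_hom_axioms_def)
  have pw: "x [^]\<^bsub>N\<^esub> (nat \<bar>m\<bar>) \<in> b ` carrier M" if x: "x \<in> carrier N" for x
  proof -
    have "x [^]\<^bsub>N\<^esub> m \<in> b ` carrier M" using m(2) x bc' by auto
    then have "(x [^]\<^bsub>N\<^esub> m) [^]\<^bsub>N\<^esub> (sgn m) \<in> b ` carrier M" using N.subgroup_int_pow_closed[OF K] by blast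
    moreover have "(x [^]\<^bsub>N\<^esub> m) [^]\<^bsub>N\<^esub> (sgn m) = x [^]\<^bsub>N\<^esub> (m * sgn m)" using x by (simp add: N.int_pow_pow)
    moreover have "m * sgn m = int (nat \<bar>m\<bar>)" by (simp add: sgn_if)
    ultimately show ?thesis by (simp only: int_pow_int)
  qed
  have "0 < nat \<bar>m\<bar>" using m by simp
  then obtain F where F: "finite F" "F \<subseteq> carrier N"
    "\<forall>x\<in>carrier N. \<exists>f\<in>F. \<exists>w\<in>carrier N. x = f \<otimes>\<^bsub>N\<^esub> w [^]\<^bsub>N\<^esub> (nat \<bar>m\<bar>)"
    using N.finite_mod_nat[OF N(2) sp, of "nat \<bar>m\<bar>"] by auto
  show ?thesis
  proof (rule N.finite_rcosets_of_cover[OF K F(1,2)])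
    fix x assume "x \<in> carrier N"
    then show "\<exists>f\<in>F. \<exists>k\<in>b ` carrier M. x = f \<otimes>\<^bsub>N\<^esub> k" using F(3) pw by blast
  qed
qed

text \<open>The composite of \<open>b\<close> and \<open>b'\<close> is an automorphism of the
  rational space that intertwines the actions of \<open>g\<close> and \<open>t' (t g)\<close>, so
  (SF) identifies the two elements.\<close>

lemma strict_of_SF:
  assumes SF: "cond_SF M G sig"
    and full: "b' ` QT N (carrier N) = QT M (carrier M)" "b ` QT M (carrier M) = QT N (carrier N)"
    and b: "act_emb G (QTg M (carrier M)) (qt_act M sig) H (QTg N (carrier N)) (qt_act N tau) t b"
    and b': "act_emb H (QTg N (carrier N)) (qt_act N tau) G (QTg M (carrier M)) (qt_act M sig) t' b'"
    and g: "g \<in> carrier G"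
  shows "t' (t g) = g"
proof -
  have car: "carrier (QTg M (carrier M)) = QT M (carrier M)" "carrier (QTg N (carrier N)) = QT N (carrier N)"
    by (simp_all add: QTg_def)
  have h: "t \<in> hom G H" "b \<in> hom (QTg M (carrier M)) (QTg N (carrier N))" "inj_on b (QT M (carrier M))"
    "t' \<in> hom H G" "b' \<in> hom (QTg N (carrier N)) (QTg M (carrier M))" "inj_on b' (QT N (carrier N))"
    using b b' by (auto simp: act_emb_def car)
  have eq: "b (qt_act M sig g v) = qt_act N tau (t g) (b v)" if "v \<in> QT M (carrier M)" for v
    using b g that by (simp add: act_emb_def car)
  have tg: "t g \<in> carrier H" using h g by (auto simp: hom_def)
  have eq': "b' (qt_act N tau (t g) v) = qt_act M sig (t' (t g)) (b' v)" if "v \<in> QT N (carrier N)" for v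
    using b' tg that by (simp add: act_emb_def car)
  have "(\<lambda>v. b' (b v)) \<in> hom (QTg M (carrier M)) (QTg M (carrier M))"
    using hom_compose[OF h(2,5)] by (simp add: comp_def)
  moreover have "bij_betw (\<lambda>v. b' (b v)) (QT M (carrier M)) (QT M (carrier M))"
    using bij_betw_trans[of b "QT M (carrier M)" "QT N (carrier N)" b' "QT M (carrier M)"] full h(3,6)
    by (simp add: bij_betw_def comp_def)
  ultimately have iso: "(\<lambda>v. b' (b v)) \<in> iso (QTg M (carrier M)) (QTg M (carrier M))"
    by (simp add: iso_def car)
  have "t' (t g) \<in> carrier G" using h tg by (auto simp: hom_def)
  moreover have "\<forall>v\<in>QT M (carrier M). qt_act M sig (t' (t g)) (b' (b v)) = b' (b (qt_act M sig g v))"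
  proof
    fix v assume v: "v \<in> QT M (carrier M)"
    then have "b v \<in> QT N (carrier N)" using full(2) by blast
    then show "qt_act M sig (t' (t g)) (b' (b v)) = b' (b (qt_act M sig g v))"
      using eq[OF v] eq' by simp
  qed
  ultimately show ?thesis using SF g iso unfolding cond_SF_def by blast
qed

theorem theorem3p30:
  fixes M :: "'a monoid" and G :: "'g monoid" and S :: "'g set" and A :: "'a set"
    and sig :: "'g \<Rightarrow> 'a \<Rightarrow> 'a"
    and N :: "'b monoid" and H :: "'h monoid" and T :: "'h set" and B :: "'b set"
    and tau :: "'h \<Rightarrow> 'b \<Rightarrow> 'b"
  assumes st_sig: "standing M G S A sig"
    and st_tau: "standing N H T B tau"
    and tf_sig: "torsion_free M (carrier M)"
    and tf_tau: "torsion_free N (carrier N)"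
  defines "QA \<equiv> QTg M (carrier M)" and "QB \<equiv> QTg N (carrier N)"
    and "I_s \<equiv> cond_I M S A sig H \<and> cond_I N T B tau G"
    and "star_s \<equiv> cond_star M G S A sig N H T B tau \<and> cond_star N H T B tau M G S A sig"
    and "iso_gpd \<equiv> gpd_isomorphic M G S A sig N H T B tau"
  shows
   \<comment> \<open>(i)\<close>
   "(I_s \<and> iso_gpd \<longrightarrow>
       (\<exists>t b. act_emb G QA (qt_act M sig) H QB (qt_act N tau) t b) \<and>
       (\<exists>t b. act_emb H QB (qt_act N tau) G QA (qt_act M sig) t b)) \<and>
    \<comment> \<open>(ii)\<close>
    (star_s \<and> iso_gpd \<longrightarrow>
       (\<exists>t b. act_emb G M sig H N tau t b) \<and>
       (\<exists>t b. act_emb H N tau G M sig t b)) \<and>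
    \<comment> \<open>finite rank\<close>
    (finite_rank M (carrier M) \<and> finite_rank N (carrier N) \<longrightarrow>
      (I_s \<and> iso_gpd \<longrightarrow>
         (\<exists>t b. act_emb G QA (qt_act M sig) H QB (qt_act N tau) t b \<and> emb_full QA QB b) \<and>
         (\<exists>t b. act_emb H QB (qt_act N tau) G QA (qt_act M sig) t b \<and> emb_full QB QA b)) \<and>
      (star_s \<and> iso_gpd \<longrightarrow>
         (\<exists>t b. act_emb G M sig H N tau t b \<and> emb_finite_index M N b) \<and>
         (\<exists>t b. act_emb H N tau G M sig t b \<and> emb_finite_index N M b))) \<and>
    \<comment> \<open>finite rank and (SF)\<close>
    (finite_rank M (carrier M) \<and> finite_rank N (carrier N) \<and> cond_SF M G sig \<and> cond_SF N H tau \<longrightarrow>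
      (I_s \<and> iso_gpd \<longrightarrow>
         (\<exists>t b. act_emb G QA (qt_act M sig) H QB (qt_act N tau) t b \<and> emb_full QA QB b \<and>
                emb_strict G H t)) \<and>
      (star_s \<and> iso_gpd \<longrightarrow>
         (\<exists>t b. act_emb G M sig H N tau t b \<and> emb_finite_index M N b \<and> emb_strict G H t) \<and>
         (\<exists>t b. act_emb H N tau G M sig t b \<and> emb_finite_index N M b \<and> emb_strict H G t)))"
proof -
  interpret s: alg_action M G S A sig by (rule alg_action.intro) (rule st_sig)
  interpret t: alg_action N H T B tau by (rule alg_action.intro) (rule st_tau)
  have MN: "comm_group M" "comm_group N" by (rule s.M.comm_group_axioms, rule t.M.comm_group_axioms)
  have sym: "gpd_isomorphic N H T B tau M G S A sig" if iso_gpd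
    using gpd_isomorphic_sym[OF st_sig st_tau] that by (simp add: iso_gpd_def)
  have I1: "\<exists>t b. act_emb G QA (qt_act M sig) H QB (qt_act N tau) t b" if "I_s \<and> iso_gpd"
    using rational_embedding_of_I[OF st_sig st_tau tf_sig tf_tau] that
    by (simp add: I_s_def iso_gpd_def QA_def QB_def)
  have I2: "\<exists>t b. act_emb H QB (qt_act N tau) G QA (qt_act M sig) t b" if "I_s \<and> iso_gpd"
    using rational_embedding_of_I[OF st_tau st_sig tf_tau tf_sig] that sym
    by (simp add: I_s_def QA_def QB_def)
  have S1: "\<exists>t b b'. act_emb G QA (qt_act M sig) H QB (qt_act N tau) t b \<and> act_emb G M sig H N tau t b'"
    if "star_s \<and> iso_gpd"
    using embeddings_of_star[OF st_sig st_tau tf_sig tf_tau] that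
    by (simp add: star_s_def iso_gpd_def QA_def QB_def)
  have S2: "\<exists>t b b'. act_emb H QB (qt_act N tau) G QA (qt_act M sig) t b \<and> act_emb H N tau G M sig t b'"
    if "star_s \<and> iso_gpd"
    using embeddings_of_star[OF st_tau st_sig tf_tau tf_sig] that sym
    by (simp add: star_s_def QA_def QB_def)
  have car: "carrier QA = QT M (carrier M)" "carrier QB = QT N (carrier N)"
    by (simp_all add: QA_def QB_def QTg_def)
  have full: "emb_full QA QB b \<and> emb_full QB QA b'"
    if fr: "finite_rank M (carrier M)" "finite_rank N (carrier N)"
      and b: "act_emb G QA (qt_act M sig) H QB (qt_act N tau) t b"
      and b': "act_emb H QB (qt_act N tau) G QA (qt_act M sig) t' b'" for t b t' b'
  proof -
    have h: "b \<in> hom QA QB" "inj_on b (QT M (carrier M))" "b' \<in> hom QB QA" "inj_on b' (QT N (carrier N))"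
      using b b' by (auto simp: act_emb_def car)
    have "b' ` QT N (carrier N) = QT M (carrier M)"
      using full_of_mutual[OF MN(1) tf_sig fr(1) MN(2) tf_tau] h by (simp add: QA_def QB_def)
    moreover have "b ` QT M (carrier M) = QT N (carrier N)"
      using full_of_mutual[OF MN(2) tf_tau fr(2) MN(1) tf_sig] h by (simp add: QA_def QB_def)
    ultimately show ?thesis by (simp add: emb_full_def car)
  qed
  have fin: "emb_finite_index M N b \<and> emb_finite_index N M b'"
    if fr: "finite_rank M (carrier M)" "finite_rank N (carrier N)"
      and b: "act_emb G M sig H N tau t b" and b': "act_emb H N tau G M sig t' b'" for t b t' b'
  proof -
    have h: "b \<in> hom M N" "inj_on b (carrier M)" "b' \<in> hom N M" "inj_on b' (carrier N)"
      using b b' by (auto simp: act_emb_def)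
    show ?thesis unfolding emb_finite_index_def
      using finite_index_of_mutual[OF MN(1) MN(2) tf_tau fr(2) h]
        finite_index_of_mutual[OF MN(2) MN(1) tf_sig fr(1) h(3,4,1,2)] by blast
  qed
  have strict: "emb_strict G H t \<and> emb_strict H G t'"
    if fr: "finite_rank M (carrier M)" "finite_rank N (carrier N)"
      and SF: "cond_SF M G sig" "cond_SF N H tau"
      and b: "act_emb G QA (qt_act M sig) H QB (qt_act N tau) t b"
      and b': "act_emb H QB (qt_act N tau) G QA (qt_act M sig) t' b'" for t b t' b'
  proof -
    have fl: "b' ` QT N (carrier N) = QT M (carrier M)" "b ` QT M (carrier M) = QT N (carrier N)"
      using full[OF fr b b'] by (auto simp: emb_full_def car)
    \<comment> \<open>(SF) for each of the two actions makes \<open>t\<close> and \<open>t'\<close>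
      mutually inverse, so both are onto.\<close>
    have "t' (t g) = g" if "g \<in> carrier G" for g
      using strict_of_SF[OF SF(1) fl _ _ that] b b'
      by (simp add: QA_def QB_def)
    moreover have "t (t' g) = g" if "g \<in> carrier H" for g
      using strict_of_SF[OF SF(2) fl(2,1) _ _ that] b b'
      by (simp add: QA_def QB_def)
    moreover have "t \<in> carrier G \<rightarrow> carrier H" "t' \<in> carrier H \<rightarrow> carrier G"
      using b b' by (auto simp: act_emb_def hom_def)
    ultimately show ?thesis unfolding emb_strict_def by (auto simp: image_iff Pi_iff) metis+
  qed
  show ?thesis
  proof (intro conjI impI)
    assume h: "I_s \<and> iso_gpd"
    show "\<exists>t b. act_emb G QA (qt_act M sig) H QB (qt_act N tau) t b" using I1[OF h] .
    show "\<exists>t b. act_emb H QB (qt_act N tau) G QA (qt_act M sig) t b" using I2[OF h] .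
  next
    assume h: "star_s \<and> iso_gpd"
    show "\<exists>t b. act_emb G M sig H N tau t b" using S1[OF h] by blast
    show "\<exists>t b. act_emb H N tau G M sig t b" using S2[OF h] by blast
  next
    assume fr: "finite_rank M (carrier M) \<and> finite_rank N (carrier N)" and h: "I_s \<and> iso_gpd"
    obtain t b t' b' where b: "act_emb G QA (qt_act M sig) H QB (qt_act N tau) t b"
      and b': "act_emb H QB (qt_act N tau) G QA (qt_act M sig) t' b'" using I1[OF h] I2[OF h] by blast
    have f: "emb_full QA QB b \<and> emb_full QB QA b'" using full[OF _ _ b b'] fr by blast
    show "\<exists>t b. act_emb G QA (qt_act M sig) H QB (qt_act N tau) t b \<and> emb_full QA QB b" using b f by blast
    show "\<exists>t b. act_emb H QB (qt_act N tau) G QA (qt_act M sig) t b \<and> emb_full QB QA b" using b' f by blast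
  next
    assume fr: "finite_rank M (carrier M) \<and> finite_rank N (carrier N)" and h: "star_s \<and> iso_gpd"
    obtain t b t' b' where b: "act_emb G M sig H N tau t b" and b': "act_emb H N tau G M sig t' b'"
      using S1[OF h] S2[OF h] by blast
    have f: "emb_finite_index M N b \<and> emb_finite_index N M b'" using fin[OF _ _ b b'] fr by blast
    show "\<exists>t b. act_emb G M sig H N tau t b \<and> emb_finite_index M N b" using b f by blast
    show "\<exists>t b. act_emb H N tau G M sig t b \<and> emb_finite_index N M b" using b' f by blast
  next
    assume fr: "finite_rank M (carrier M) \<and> finite_rank N (carrier N) \<and> cond_SF M G sig \<and> cond_SF N H tau"
      and h: "I_s \<and> iso_gpd"
    obtain t b t' b' where b: "act_emb G QA (qt_act M sig) H QB (qt_act N tau) t b"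
      and b': "act_emb H QB (qt_act N tau) G QA (qt_act M sig) t' b'" using I1[OF h] I2[OF h] by blast
    have "emb_full QA QB b" "emb_strict G H t"
      using full[OF _ _ b b'] strict[OF _ _ _ _ b b'] fr by blast+
    then show "\<exists>t b. act_emb G QA (qt_act M sig) H QB (qt_act N tau) t b \<and> emb_full QA QB b \<and> emb_strict G H t"
      using b by blast
  next
    assume fr: "finite_rank M (carrier M) \<and> finite_rank N (carrier N) \<and> cond_SF M G sig \<and> cond_SF N H tau"
      and h: "star_s \<and> iso_gpd"
    obtain t b c t' b' c' where b: "act_emb G QA (qt_act M sig) H QB (qt_act N tau) t b"
      and b': "act_emb H QB (qt_act N tau) G QA (qt_act M sig) t' b'"
      and c: "act_emb G M sig H N tau t c" and c': "act_emb H N tau G M sig t' c'"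
      using S1[OF h] S2[OF h] by blast
    have f: "emb_finite_index M N c \<and> emb_finite_index N M c'" "emb_strict G H t \<and> emb_strict H G t'"
      using fin[OF _ _ c c'] strict[OF _ _ _ _ b b'] fr by blast+
    show "\<exists>t b. act_emb G M sig H N tau t b \<and> emb_finite_index M N b \<and> emb_strict G H t" using c f by blast
    show "\<exists>t b. act_emb H N tau G M sig t b \<and> emb_finite_index N M b \<and> emb_strict H G t" using c' f by blast
  qed
qed

end
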